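(* Let $p>2$ and $1<q\le p$, and let $\mathscr{D}$ be an admissible operator of spectral growth order $p$. Assume that $\mathbb{E}[\epsilon_{11}^4]<\infty$ and that the measurement locations $U_{ij}$, $i=1,\dots,n$, $j=1,\dots,r_i$, are independent copies of $U\sim\mathrm{Unif}(\mathbb{S}^2)$. Let $C_\eta=R_\eta-\mu_\eta\otimes\mu_\eta$ be the covariance estimator, where $$\mu_\eta=\operatorname*{arg\,min}_{g\in\mathcal{H}_p}\ \frac{4\pi}{n}\sum_{i=1}^n\frac1{r_i}\sum_{j=1}^{r_i}(W_{ij}-g(U_{ij}))^2+\eta\,\|\mathscr{D}g\|^2_{L^2(\mathbb{S}^2)},$$ $$R_\eta=\operatorname*{arg\,min}_{g\in\mathbb{H}_p}\ \frac{(4\pi)^2}{n}\sum_{i=1}^n\frac1{r_i(r_i-1)}\sum_{1\le j\ne k\le r_i}(W_{ij}W_{ik}-g(U_{ij},U_{ik}))^2+\eta\,\|(\mathscr{D}\otimes\mathscr{D})g\|^2_{L^2(\mathbb{S}^2\times\mathbb{S}^2)}.$$ If $\eta\asymp(nr/\log n)^{-p/(p+1)}$, then $$\lim_{D\to\infty}\limsup_{n\to\infty}\sup_{\mathbb{P}_X\in\Pi_2(p,q)}\mathbb{P}\left(\|C_\eta-C\|^2_{L^2(\mathbb{S}^2\times\mathbb{S}^2)}>D\left(\Big(\frac{\log n}{nr}\Big)^{p/(p+1)}+n^{-1}\right)\right)=0.$$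
   Context: $\mathbb{S}^2$ is the unit sphere of $\mathbb{R}^3$ with surface measure (total mass $4\pi$), and $\{Y_{\ell,m}\}_{\ell\in\mathbb{N},-\ell\le m\le\ell}$ is a standard real orthonormal basis of spherical harmonics of $L^2(\mathbb{S}^2)$. $(f_1\otimes f_2)(u,v)=f_1(u)f_2(v)$. For $s\ge0$, $\mathcal{H}_s=\{f\in L^2(\mathbb{S}^2):\|f\|_{\mathcal{H}_s}^2=\sum_{\ell\ge0}(1+\ell(\ell+1))^s\sum_{m=-\ell}^{\ell}\langle f,Y_{\ell,m}\rangle_{L^2(\mathbb S^2)}^2<\infty\}$ and $\mathbb{H}_s=\mathcal{H}_s\otimes\mathcal{H}_s\subset L^2(\mathbb{S}^2\times\mathbb{S}^2)$ is the Hilbert tensor product, with norm $\|g\|_{\mathbb{H}_s}^2=\sum_{\ell,\ell'}(1+\ell(\ell+1))^s(1+\ell'(\ell'+1))^s\sum_{m,m'}\langle g,Y_{\ell,m}\otimes Y_{\ell',m'}\rangle_{L^2(\mathbb{S}^2\times\mathbb{S}^2)}^2$. For $s>1$ elements of these spaces are identified with their continuous representatives. An admissible operator $\mathscr{D}$ of spectral growth order $p$ is a linear operator $\mathscr{D}f=\sum_{\ell}D_\ell\sum_{m}\langle f,Y_{\ell,m}\rangle_{L^2(\mathbb S^2)}Y_{\ell,m}$ with non-zero real $D_\ell$ satisfying $C_1(1+\ell)^p\le|D_\ell|\le C_2(1+\ell)^p$ for all $\ell\in\mathbb{N}$ and some constants $C_1,C_2>0$, viewed as an operator $\mathcal{H}_p\to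 L^2(\mathbb{S}^2)$; $\mathscr{D}\otimes\mathscr{D}:\mathbb{H}_p\to L^2(\mathbb{S}^2\times\mathbb{S}^2)$ is the continuous linear operator with $(\mathscr{D}\otimes\mathscr{D})(f_1\otimes f_2)=(\mathscr{D}f_1)\otimes(\mathscr{D}f_2)$. Model: $X=\{X(u),u\in\mathbb{S}^2\}$ is a second-order process that is a random element of $\mathcal{H}_q$, with law $\mathbb{P}_X$, mean $\mu(u)=\mathbb{E}[X(u)]$, second-order moment function $R(u,v)=\mathbb{E}[X(u)X(v)]$ and covariance $C(u,v)=R(u,v)-\mu(u)\mu(v)$. $X_1,\dots,X_n$ are i.i.d. copies of $X$, and one observes $$W_{ij}=X_i(U_{ij})+\epsilon_{ij},\qquad i=1,\dots,n,\ j=1,\dots,r_i,$$ with $\epsilon_{ij}$ i.i.d. of mean $0$ and variance $0<\sigma^2<\infty$; the $X_i$'s, the locations $U_{ij}$ and the errors $\epsilon_{ij}$ are mutually independent. The integers $r_i\ge2$ may depend on $n$, and $r=\big(\frac1n\sum_{i=1}^n\frac1{r_i}\big)^{-1}$ is their harmonic mean. $\Pi_2(p,q)$ (for fixed constants $L,K_1,K_2>0$) is the collection of laws $\mathbb{P}_X$ of $\mathcal{H}_q$-valued processes $X$ with $\mathbb{E}\|X\|^4_{\mathcal{H}_q}\le L$, $\|R\|^2_{\mathbb{H}_p}\le K_1$ and $\|\mu\|^2_{\mathcal{H}_p}\le K_2$. The notation $\eta\asymp a_n$ means that $\eta=\eta_n$ satisfies $c\,a_n\le\eta_n\le c'a_n$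 for constants $0<c\le c'<\infty$. *)

theory Defs
  imports
    "HOL-Probability.Probability"
    "HOL-Computational_Algebra.Polynomial"
begin

section \<open>The unit sphere, its surface measure and real spherical harmonics\<close>

abbreviation S2 :: "(real^3) set" where
  "S2 \<equiv> sphere 0 1"

text \<open>Surface measure is the cone measure: the area of \<open>A\<close> is three times the volume of the part
  of the unit ball lying over \<open>A\<close>; the total mass is \<open>4 * pi\<close>.  Note \<open>sgn x = x /\<^sub>R norm x\<close>.\<close>

definition surface :: "(real^3) measure" where
  "surface = scale_measure 3
     (distr (restrict_space lborel (ball 0 1 - {0})) (restrict_space borel S2) sgn)"

definition unif_sphere :: "(real^3) measure" where
  "unif_sphere = uniform_measure surface S2"

text \<open>Rodrigues' formula for the Legendre polynomials.\<close>

definition legendre :: "nat \<Rightarrow> real poly" where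
  "legendre l = smult (1 / (2 ^ l * fact l)) ((pderiv ^^ l) ([:-1, 0, 1:] ^ l))"

text \<open>With \<open>u = (sin \<theta> cos \<phi>, sin \<theta> sin \<phi>, cos \<theta>)\<close> and \<open>k = \<bar>m\<bar>\<close>, the associated Legendre function
  \<open>sin\<^sup>k \<theta> \<cdot> P\<^sub>l\<^sup>(\<^sup>k\<^sup>)(cos \<theta>)\<close> times \<open>cos (k \<phi>)\<close> or \<open>sin (k \<phi>)\<close> is \<open>P\<^sub>l\<^sup>(\<^sup>k\<^sup>)(u\<^sub>3)\<close> times the real or
  imaginary part of \<open>(u\<^sub>1 + \<i> u\<^sub>2)\<^sup>k\<close>.  The Condon--Shortley sign is omitted.\<close>

definition sph_harm :: "nat \<Rightarrow> int \<Rightarrow> real^3 \<Rightarrow> real" where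
  "sph_harm l m u =
     (let k = nat \<bar>m\<bar>; z = Complex (u $ 1) (u $ 2) ^ k in
      sqrt ((2 * real l + 1) / (4 * pi) * fact (l - k) / fact (l + k))
      * poly ((pderiv ^^ k) (legendre l)) (u $ 3)
      * (if m = 0 then 1 else if m > 0 then sqrt 2 * Re z else sqrt 2 * Im z))"


section \<open>Square integrable functions\<close>

definition L2 :: "'a measure \<Rightarrow> ('a \<Rightarrow> real) set" where
  "L2 M = {f \<in> borel_measurable M. integrable M (\<lambda>x. (f x)\<^sup>2)}"

definition L2_inner :: "'a measure \<Rightarrow> ('a \<Rightarrow> real) \<Rightarrow> ('a \<Rightarrow> real) \<Rightarrow> real" where
  "L2_inner M f g = (LINT x|M. f x * g x)"

definition L2_normsq :: "'a measure \<Rightarrow> ('a \<Rightarrow> real) \<Rightarrow> real" where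
  "L2_normsq M f = L2_inner M f f"

definition tensor :: "('a \<Rightarrow> real) \<Rightarrow> ('b \<Rightarrow> real) \<Rightarrow> 'a \<times> 'b \<Rightarrow> real" where
  "tensor f g = (\<lambda>(u, v). f u * g v)"

abbreviation surface2 :: "((real^3) \<times> (real^3)) measure" where
  "surface2 \<equiv> surface \<Otimes>\<^sub>M surface"


section \<open>Sobolev spaces on the sphere and their tensor squares\<close>

definition sobolev_weight :: "real \<Rightarrow> nat \<Rightarrow> real" where
  "sobolev_weight s l = (1 + real l * (real l + 1)) powr s"

definition sobolev_normsq :: "real \<Rightarrow> (real^3 \<Rightarrow> real) \<Rightarrow> ennreal" where
  "sobolev_normsq s f = (\<Sum>l. ennreal (sobolev_weight s l *
     (\<Sum>m\<in>{-int l..int l}. (L2_inner surface f (sph_harm l m))\<^sup>2)))"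

definition sobolev2_normsq :: "real \<Rightarrow> ((real^3) \<times> (real^3) \<Rightarrow> real) \<Rightarrow> ennreal" where
  "sobolev2_normsq s g = (\<Sum>l. \<Sum>l'. ennreal (sobolev_weight s l * sobolev_weight s l' *
     (\<Sum>m\<in>{-int l..int l}. \<Sum>m'\<in>{-int l'..int l'}.
        (L2_inner surface2 g (tensor (sph_harm l m) (sph_harm l' m')))\<^sup>2)))"

text \<open>The spaces are only meant for \<open>s > 1\<close>, where every class has a unique continuous
  representative; an element is that representative, extended by \<open>0\<close> off the sphere so that it is
  determined as a function on the ambient type.\<close>

definition sobolev :: "real \<Rightarrow> (real^3 \<Rightarrow> real) set" where
  "sobolev s = {f \<in> L2 surface. continuous_on S2 f \<and> (\<forall>u. u \<notin> S2 \<longrightarrow> f u = 0) \<and>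
                  sobolev_normsq s f < \<infinity>}"

definition sobolev2 :: "real \<Rightarrow> ((real^3) \<times> (real^3) \<Rightarrow> real) set" where
  "sobolev2 s = {g \<in> L2 surface2. continuous_on (S2 \<times> S2) g \<and>
                   (\<forall>x. x \<notin> S2 \<times> S2 \<longrightarrow> g x = 0) \<and> sobolev2_normsq s g < \<infinity>}"

definition sobolev_dist :: "real \<Rightarrow> (real^3 \<Rightarrow> real) \<Rightarrow> (real^3 \<Rightarrow> real) \<Rightarrow> real" where
  "sobolev_dist s f g = sqrt (enn2real (sobolev_normsq s (\<lambda>u. f u - g u)))"

text \<open>The Borel \<open>\<sigma>\<close>-algebra of the Hilbert space \<open>sobolev s\<close>.\<close>

definition sobolev_borel :: "real \<Rightarrow> (real^3 \<Rightarrow> real) measure" where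
  "sobolev_borel s = sigma (sobolev s)
     {A. openin (Metric_space.mtopology (sobolev s) (sobolev_dist s)) A}"


section \<open>Admissible operators\<close>

text \<open>Operators take values in \<open>L\<^sup>2\<close>, so they are determined only up to null sets.\<close>

definition admissible_operator ::
    "real \<Rightarrow> ((real^3 \<Rightarrow> real) \<Rightarrow> (real^3 \<Rightarrow> real)) \<Rightarrow> bool" where
  "admissible_operator p T \<longleftrightarrow>
     (\<exists>d :: nat \<Rightarrow> real.
        (\<forall>l. d l \<noteq> 0) \<and>
        (\<exists>C1>0. \<exists>C2>0. \<forall>l. C1 * (1 + real l) powr p \<le> \<bar>d l\<bar> \<and> \<bar>d l\<bar> \<le> C2 * (1 + real l) powr p) \<and>
        (\<forall>f\<in>sobolev p. T f \<in> L2 surface \<and>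
           (\<lambda>N. L2_normsq surface (\<lambda>u. T f u -
                  (\<Sum>l\<le>N. d l * (\<Sum>m\<in>{-int l..int l}.
                      L2_inner surface f (sph_harm l m) * sph_harm l m u))))
             \<longlonglongrightarrow> 0))"

definition tensor_square_operator ::
    "real \<Rightarrow> ((real^3 \<Rightarrow> real) \<Rightarrow> (real^3 \<Rightarrow> real)) \<Rightarrow>
     (((real^3) \<times> (real^3) \<Rightarrow> real) \<Rightarrow> ((real^3) \<times> (real^3) \<Rightarrow> real)) \<Rightarrow> bool" where
  "tensor_square_operator p T T2 \<longleftrightarrow>
     (\<forall>g\<in>sobolev2 p. T2 g \<in> L2 surface2) \<and>
     (\<forall>g\<in>sobolev2 p. \<forall>h\<in>sobolev2 p. \<forall>a b :: real.
        AE x in surface2. T2 (\<lambda>y. a * g y + b * h y) x = a * T2 g x + b * T2 h x) \<and>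
     (\<exists>B\<ge>0. \<forall>g\<in>sobolev2 p.
        ennreal (L2_normsq surface2 (T2 g)) \<le> ennreal B * sobolev2_normsq p g) \<and>
     (\<forall>f1\<in>sobolev p. \<forall>f2\<in>sobolev p.
        AE x in surface2. T2 (tensor f1 f2) x = tensor (T f1) (T f2) x)"


section \<open>Laws of the process\<close>

definition mean_fun :: "(real^3 \<Rightarrow> real) measure \<Rightarrow> real^3 \<Rightarrow> real" where
  "mean_fun P u = (LINT x|P. x u)"

definition second_moment_fun :: "(real^3 \<Rightarrow> real) measure \<Rightarrow> (real^3) \<times> (real^3) \<Rightarrow> real" where
  "second_moment_fun P = (\<lambda>(u, v). LINT x|P. x u * x v)"

definition cov_fun :: "(real^3 \<Rightarrow> real) measure \<Rightarrow> (real^3) \<times> (real^3) \<Rightarrow> real" where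
  "cov_fun P = (\<lambda>y. second_moment_fun P y - tensor (mean_fun P) (mean_fun P) y)"

definition Pi2 :: "real \<Rightarrow> real \<Rightarrow> real \<Rightarrow> real \<Rightarrow> real \<Rightarrow> (real^3 \<Rightarrow> real) measure set" where
  "Pi2 L K1 K2 p q = {P. prob_space P \<and> sets P = sets (sobolev_borel q) \<and>
     (\<integral>\<^sup>+x. (sobolev_normsq q x)\<^sup>2 \<partial>P) \<le> ennreal L \<and>
     second_moment_fun P \<in> sobolev2 p \<and> sobolev2_normsq p (second_moment_fun P) \<le> ennreal K1 \<and>
     mean_fun P \<in> sobolev p \<and> sobolev_normsq p (mean_fun P) \<le> ennreal K2}"


section \<open>The sampling model\<close>

text \<open>Indices start at \<open>0\<close>: curve \<open>i < n\<close> is observed at locations \<open>j < r i\<close>.\<close>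

definition obs_index :: "nat \<Rightarrow> (nat \<Rightarrow> nat) \<Rightarrow> (nat \<times> nat) set" where
  "obs_index n r = (SIGMA i:{..<n}. {..<r i})"

type_synonym sample =
  "(nat \<Rightarrow> real^3 \<Rightarrow> real) \<times> (nat \<times> nat \<Rightarrow> real^3) \<times> (nat \<times> nat \<Rightarrow> real)"

text \<open>The joint law of the curves (i.i.d. from \<open>P\<close>), the locations (i.i.d. uniform) and the errors
  (i.i.d. from \<open>\<nu>\<close>), all mutually independent.\<close>

definition sample_space ::
    "nat \<Rightarrow> (nat \<Rightarrow> nat) \<Rightarrow> (real^3 \<Rightarrow> real) measure \<Rightarrow> real measure \<Rightarrow> sample measure" where
  "sample_space n r P \<nu> =
     (\<Pi>\<^sub>M i\<in>{..<n}. P) \<Otimes>\<^sub>M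
     ((\<Pi>\<^sub>M ij\<in>obs_index n r. unif_sphere) \<Otimes>\<^sub>M (\<Pi>\<^sub>M ij\<in>obs_index n r. \<nu>))"

definition location :: "sample \<Rightarrow> nat \<Rightarrow> nat \<Rightarrow> real^3" where
  "location = (\<lambda>(X, U, E) i j. U (i, j))"

definition observation :: "sample \<Rightarrow> nat \<Rightarrow> nat \<Rightarrow> real" where
  "observation = (\<lambda>(X, U, E) i j. X i (U (i, j)) + E (i, j))"

definition harmonic_mean :: "nat \<Rightarrow> (nat \<Rightarrow> nat) \<Rightarrow> real" where
  "harmonic_mean n r = inverse (1 / real n * (\<Sum>i<n. 1 / real (r i)))"


section \<open>The penalised estimators\<close>

definition mean_estimator ::
    "real \<Rightarrow> ((real^3 \<Rightarrow> real) \<Rightarrow> (real^3 \<Rightarrow> real)) \<Rightarrow> real \<Rightarrow> nat \<Rightarrow> (nat \<Rightarrow> nat) \<Rightarrow>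
     sample \<Rightarrow> real^3 \<Rightarrow> real" where
  "mean_estimator p T \<eta> n r \<omega> = arg_min
     (\<lambda>g. 4 * pi / real n *
            (\<Sum>i<n. 1 / real (r i) *
               (\<Sum>j<r i. (observation \<omega> i j - g (location \<omega> i j))\<^sup>2))
          + \<eta> * L2_normsq surface (T g))
     (\<lambda>g. g \<in> sobolev p)"

definition second_moment_estimator ::
    "real \<Rightarrow> (((real^3) \<times> (real^3) \<Rightarrow> real) \<Rightarrow> ((real^3) \<times> (real^3) \<Rightarrow> real)) \<Rightarrow> real \<Rightarrow> nat \<Rightarrow>
     (nat \<Rightarrow> nat) \<Rightarrow> sample \<Rightarrow> (real^3) \<times> (real^3) \<Rightarrow> real" where
  "second_moment_estimator p T2 \<eta> n r \<omega> = arg_min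
     (\<lambda>g. (4 * pi)\<^sup>2 / real n *
            (\<Sum>i<n. 1 / (real (r i) * (real (r i) - 1)) *
               (\<Sum>(j, k)\<in>{(j, k). j < r i \<and> k < r i \<and> j \<noteq> k}.
                  (observation \<omega> i j * observation \<omega> i k
                     - g (location \<omega> i j, location \<omega> i k))\<^sup>2))
          + \<eta> * L2_normsq surface2 (T2 g))
     (\<lambda>g. g \<in> sobolev2 p)"

definition cov_estimator ::
    "real \<Rightarrow> ((real^3 \<Rightarrow> real) \<Rightarrow> (real^3 \<Rightarrow> real)) \<Rightarrow>
     (((real^3) \<times> (real^3) \<Rightarrow> real) \<Rightarrow> ((real^3) \<times> (real^3) \<Rightarrow> real)) \<Rightarrow> real \<Rightarrow> nat \<Rightarrow>
     (nat \<Rightarrow> nat) \<Rightarrow> sample \<Rightarrow> (real^3) \<times> (real^3) \<Rightarrow> real" where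
  "cov_estimator p T T2 \<eta> n r \<omega> = (\<lambda>y. second_moment_estimator p T2 \<eta> n r \<omega> y
     - tensor (mean_estimator p T \<eta> n r \<omega>) (mean_estimator p T \<eta> n r \<omega>) y)"

end

theory Submission
  imports Defs "HOL-Real_Asymp.Real_Asymp"
begin

text \<open>Both estimators are penalised least squares fits in a reproducing-kernel space of continuous
functions, so one argument serves the mean and the second moment function.

Let \<open>e k\<close> be an orthonormal basis and \<open>J g = (\<Sum>k. \<rho> k * (coef g k)\<^sup>2)\<close> the penalty; the eigenvalues
grow fast enough for point evaluation to be continuous. Put \<open>A k = 1 + \<eta> * \<rho> k\<close>. Comparing the
criterion at the minimiser \<open>g\<close> with its value at the target \<open>f0\<close> gives, for \<open>d = g - f0\<close>,
\<open>\<parallel>d\<parallel>\<^sub>n\<^sup>2 + \<eta> J g \<le> \<eta> J f0 + 2 E\<close>, where \<open>\<parallel>d\<parallel>\<^sub>n\<close> is the empirical norm and \<open>E\<close> the empirical inner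
product of \<open>d\<close> with the residuals. By Cauchy-Schwarz in the weights \<open>A k\<close>, the term \<open>E\<close> is controlled
by the sum of the squared empirical coefficients of the residuals divided by \<open>A k\<close>, and the
distance between \<open>\<parallel>d\<parallel>\<^sub>n\<^sup>2\<close> and \<open>\<parallel>d\<parallel>\<^sup>2\<close> by a weighted Hilbert-Schmidt norm of the empirical Gram matrix
minus the identity. When the latter is small, lemma \<open>oracle_inequality\<close> bounds \<open>\<parallel>d\<parallel>\<^sup>2\<close> without any
reference to probability.

Both quantities have small expectation (\<open>noise_expectation\<close>, \<open>gram_expectation\<close>), and
Markov's inequality turns this into \<open>risk_bound\<close>. Conditionally on the curves, observations at
disjoint sets of locations are independent, so a variance only sees the pairs of design points that
share a location; these contribute a factor of order \<open>1 / (n r)\<close>, multiplied by the effective dimension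
\<open>(\<Sum>k. (e k x)\<^sup>2 / A k)\<close>. The conditional mean of the noise is an average of \<open>n\<close> independent curves and
contributes the term \<open>1 / n\<close>.

On the sphere, the addition theorem evaluates the effective dimension. With penalty eigenvalues of
order \<open>(1 + l) powr (2 * p)\<close> it is \<open>O(s)\<close> for the mean and \<open>O(s * ln s)\<close> for the
second moment, where \<open>s = \<eta> powr (- 1 / p)\<close>; the logarithm counts lattice points below a hyperbola and is
the origin of the logarithm in the rate. The stated choice of \<open>\<eta>\<close> balances
the variance \<open>s * ln s / (n r)\<close> against the bias \<open>\<eta>\<close>. All constants depend on the law of the process only
through the bounds defining the class, hence the uniformity. Finally
\<open>C\<^sub>\<eta> - C = (R\<^sub>\<eta> - R) - (\<mu>\<^sub>\<eta> \<otimes> \<mu>\<^sub>\<eta> - \<mu> \<otimes> \<mu>)\<close> transfers the two risk bounds to the covariance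
(\<open>covariance_error\<close>).

The facts on the sphere are derived from the definitions: the Legendre equation yields
orthogonality and the addition theorem, rotation invariance of the surface measure yields the moments of the
height function, and the Stone-Weierstrass theorem yields completeness.\<close>

section \<open>Expansions in orthonormal systems and their reproducing-kernel spaces\<close>

lemma summable_of_ennreal_bound:
  fixes f :: "nat \<Rightarrow> real"
  assumes "\<And>k. 0 \<le> f k" "(\<Sum>k. ennreal (f k)) \<le> ennreal V" "0 \<le> V"
  shows "summable f" "suminf f \<le> V"
proof -
  have "(\<Sum>k. ennreal (f k)) \<noteq> top"
    using assms(2) by (metis ennreal_less_top infinity_ennreal_def neq_top_trans ennreal_neq_top)
  then show s: "summable f" using summable_suminf_not_top[of f] assms(1) by auto
  have "ennreal (suminf f) = (\<Sum>k. ennreal (f k))"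
    by (rule suminf_ennreal_eq[symmetric]) (use assms(1) s in \<open>auto simp: summable_sums\<close>)
  then have "ennreal (suminf f) \<le> ennreal V" using assms(2) by simp
  then show "suminf f \<le> V" using assms(3) by (simp add: ennreal_le_iff)
qed

lemma ennreal_suminf_of_summable:
  fixes f :: "nat \<Rightarrow> real"
  assumes "\<And>k. 0 \<le> f k" "summable f"
  shows "(\<Sum>k. ennreal (f k)) = ennreal (suminf f)"
  by (rule suminf_ennreal_eq) (use assms in \<open>auto simp: summable_sums\<close>)

lemma suminf_Cauchy_Schwarz:
  fixes a b A :: "nat \<Rightarrow> real"
  assumes A: "\<And>k. 0 < A k" and sa: "summable (\<lambda>k. A k * (a k)\<^sup>2)" and sb: "summable (\<lambda>k. (b k)\<^sup>2 / A k)"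
  shows "summable (\<lambda>k. \<bar>a k * b k\<bar>)"
    and "(\<Sum>k. a k * b k)\<^sup>2 \<le> (\<Sum>k. A k * (a k)\<^sup>2) * (\<Sum>k. (b k)\<^sup>2 / A k)"
proof -
  have e1: "(sqrt (A k) * a k)\<^sup>2 = A k * (a k)\<^sup>2" "(b k / sqrt (A k))\<^sup>2 = (b k)\<^sup>2 / A k"
    "(sqrt (A k) * a k) * (b k / sqrt (A k)) = a k * b k" for k
    using A[of k] by (auto simp: power_mult_distrib power_divide less_imp_le)
  have "\<bar>a k * b k\<bar> \<le> A k * (a k)\<^sup>2 + (b k)\<^sup>2 / A k" for k
  proof -
    have "\<bar>x * y\<bar> \<le> x\<^sup>2 + y\<^sup>2" for x y :: real
      using sum_squares_bound[of "\<bar>x\<bar>" "\<bar>y\<bar>"] mult_nonneg_nonneg[of "\<bar>x\<bar>" "\<bar>y\<bar>"]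
      unfolding abs_mult power2_abs by linarith
    from this[of "sqrt (A k) * a k" "b k / sqrt (A k)"] show ?thesis unfolding e1 .
  qed
  then show s: "summable (\<lambda>k. \<bar>a k * b k\<bar>)"
    by (intro summable_comparison_test'[OF summable_add[OF sa sb], of 0]) auto
  have p: "(\<Sum>k<n. a k * b k)\<^sup>2 \<le> (\<Sum>k. A k * (a k)\<^sup>2) * (\<Sum>k. (b k)\<^sup>2 / A k)" for n
  proof -
    have "(\<Sum>k<n. a k * b k)\<^sup>2 \<le> (\<Sum>k<n. A k * (a k)\<^sup>2) * (\<Sum>k<n. (b k)\<^sup>2 / A k)"
      using Cauchy_Schwarz_ineq_sum[of "\<lambda>k. sqrt (A k) * a k" "\<lambda>k. b k / sqrt (A k)" "{..<n}"]
      unfolding e1 .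
    also have "\<dots> \<le> (\<Sum>k. A k * (a k)\<^sup>2) * (\<Sum>k. (b k)\<^sup>2 / A k)"
      using A sa sb by (intro mult_mono sum_le_suminf sum_nonneg suminf_nonneg) (auto simp: less_imp_le)
    finally show ?thesis .
  qed
  have "(\<lambda>n. (\<Sum>k<n. a k * b k)\<^sup>2) \<longlonglongrightarrow> (\<Sum>k. a k * b k)\<^sup>2"
    using summable_rabs_cancel[OF s] by (intro tendsto_power summable_LIMSEQ)
  then show "(\<Sum>k. a k * b k)\<^sup>2 \<le> (\<Sum>k. A k * (a k)\<^sup>2) * (\<Sum>k. (b k)\<^sup>2 / A k)"
    by (rule LIMSEQ_le_const2) (use p in auto)
qed

text \<open>Completeness is required only for continuous functions: it says that a continuous function is
determined pointwise by its coefficients, which is how it enters the proofs.\<close>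

locale orthonormal_system =
  fixes M :: "'x::topological_space measure" and S :: "'x set" and e :: "nat \<Rightarrow> 'x \<Rightarrow> real"
  assumes fin: "finite_measure M" and space_M: "space M = S" and compact_S: "compact S"
    and meas: "\<And>f :: 'x \<Rightarrow> real. continuous_on S f \<Longrightarrow> f \<in> borel_measurable M"
    and cont_e: "\<And>k. continuous_on S (e k)"
    and orth: "\<And>j k. L2_inner M (e j) (e k) = (if j = k then 1 else 0)"
    and complete: "\<And>f x. continuous_on S f \<Longrightarrow> (\<And>k. L2_inner M f (e k) = 0) \<Longrightarrow> x \<in> S \<Longrightarrow> f x = 0"
begin

abbreviation coef :: "('x \<Rightarrow> real) \<Rightarrow> nat \<Rightarrow> real" where "coef f k \<equiv> L2_inner M f (e k)"

lemma bounded_cont: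
  assumes "continuous_on S f" obtains C where "C \<ge> 0" "\<And>x. x \<in> S \<Longrightarrow> \<bar>f x :: real\<bar> \<le> C"
proof -
  have "bounded (f ` S)" using compact_continuous_image[OF assms compact_S] compact_imp_bounded by blast
  then obtain C where "\<And>x. x \<in> S \<Longrightarrow> \<bar>f x\<bar> \<le> C" by (auto simp: bounded_iff)
  then show ?thesis by (intro that[of "max C 0"]) (auto simp: le_max_iff_disj)
qed

lemma integrable_cont:
  assumes "continuous_on S f" shows "integrable M (f :: 'x \<Rightarrow> real)"
proof -
  obtain C where "\<And>x. x \<in> S \<Longrightarrow> \<bar>f x\<bar> \<le> C" using bounded_cont[OF assms] by blast
  then show ?thesis
    by (intro finite_measure.integrable_const_bound[OF fin, of _ C] meas assms AE_I2) (auto simp: space_M)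
qed

lemma inner_lin:
  assumes "continuous_on S f" "continuous_on S g" "continuous_on S h"
  shows "L2_inner M (\<lambda>x. a * f x + b * g x) h = a * L2_inner M f h + b * L2_inner M g h"
proof -
  have "integrable M (\<lambda>x. f x * h x)" "integrable M (\<lambda>x. g x * h x)"
    using assms by (auto intro!: integrable_cont continuous_intros)
  then show ?thesis unfolding L2_inner_def by (simp add: algebra_simps)
qed

lemma inner_diff:
  assumes "continuous_on S f" "continuous_on S g" "continuous_on S h"
  shows "L2_inner M (\<lambda>x. f x - g x) h = L2_inner M f h - L2_inner M g h"
  using inner_lin[OF assms, of 1 "-1"] by simp

lemma inner_sum:
  assumes "continuous_on S h"
  shows "L2_inner M (\<lambda>x. \<Sum>k\<in>K. c k * e k x) h = (\<Sum>k\<in>K. c k * L2_inner M (e k) h)"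
proof -
  have "integrable M (\<lambda>x. c k * (e k x * h x))" for k
    using assms cont_e by (auto intro!: integrable_cont continuous_intros)
  then show ?thesis unfolding L2_inner_def by (simp add: sum_distrib_right mult.assoc)
qed

lemma inner_cong: "(\<And>x. x \<in> S \<Longrightarrow> f x = f' x) \<Longrightarrow> L2_inner M f h = L2_inner M f' h"
  unfolding L2_inner_def by (intro Bochner_Integration.integral_cong) (auto simp: space_M)

text \<open>The measure is finite, so uniform convergence may be exchanged with integration.\<close>

lemma inner_uniform_limit:
  assumes "\<And>n. continuous_on S (F n)" "uniform_limit S F f sequentially" "continuous_on S g"
  shows "(\<lambda>n. L2_inner M (F n) g) \<longlonglongrightarrow> L2_inner M f g"
proof -
  have cf: "continuous_on S f" using uniform_limit_theorem[OF _ assms(2)] assms(1) by auto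
  obtain C where C: "C \<ge> 0" "\<And>x. x \<in> S \<Longrightarrow> \<bar>g x\<bar> \<le> C" using bounded_cont[OF assms(3)] by blast
  show ?thesis
  proof (rule LIMSEQ_I)
    fix r :: real assume r: "r > 0"
    define m where "m = measure M S"
    have m: "m \<ge> 0" unfolding m_def by simp
    define d where "d = r / (C * m + 1)"
    have d: "d > 0" using r C m unfolding d_def by (auto intro!: divide_pos_pos add_nonneg_pos)
    have dm: "d * C * m < r"
    proof -
      have "d * (C * m + 1) = r" using C m unfolding d_def
        by (simp add: add_nonneg_eq_0_iff)
      then show ?thesis using d by (simp add: algebra_simps)
    qed
    obtain N where N: "\<And>n x. n \<ge> N \<Longrightarrow> x \<in> S \<Longrightarrow> dist (F n x) (f x) < d"
      using uniform_limitD[OF assms(2) d] unfolding eventually_sequentially by blast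
    have "norm (L2_inner M (F n) g - L2_inner M f g) < r" if "n \<ge> N" for n
    proof -
      have c: "continuous_on S (\<lambda>x. (F n x - f x) * g x)"
        by (intro continuous_intros assms cf)
      have "L2_inner M (F n) g - L2_inner M f g = (LINT x|M. (F n x - f x) * g x)"
        using inner_diff[OF assms(1) cf assms(3), of n] unfolding L2_inner_def by simp
      also have "norm \<dots> \<le> (LINT x|M. norm ((F n x - f x) * g x))" by (rule integral_norm_bound)
      also have "\<dots> \<le> (LINT x|M. d * C)"
      proof (rule integral_mono)
        show "integrable M (\<lambda>x. norm ((F n x - f x) * g x))" by (intro integrable_norm integrable_cont c)
        show "integrable M (\<lambda>x. d * C)" by (simp add: finite_measure.integrable_const[OF fin])
        fix x assume x: "x \<in> space M"
        show "norm ((F n x - f x) * g x) \<le> d * C" unfolding norm_mult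
          using N[OF that, of x] C(2)[of x] x d C(1) by (intro mult_mono) (auto simp: space_M dist_real_def)
      qed
      also have "\<dots> = d * C * m" using fin by (simp add: m_def space_M mult.commute)
      finally show ?thesis using dm by linarith
    qed
    then show "\<exists>no. \<forall>n\<ge>no. norm (L2_inner M (F n) g - L2_inner M f g) < r" by blast
  qed
qed

end

text \<open>The kernel condition is the bound \<open>K(x, x) \<le> B\<close> on the diagonal of the reproducing kernel
\<open>K(x, y) = (\<Sum>k. e k x * e k y / \<rho> k)\<close>. It makes point evaluation continuous for the norm \<open>J\<close>.\<close>

locale kernel_space = orthonormal_system M S e
  for M :: "'x::topological_space measure" and S e +
  fixes \<rho> :: "nat \<Rightarrow> real" and \<rho>0 B :: real
  assumes \<rho>0: "0 < \<rho>0" "\<And>k. \<rho>0 \<le> \<rho> k" and B: "0 \<le> B"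
    and kernel: "\<And>x. x \<in> S \<Longrightarrow> (\<Sum>k. ennreal ((e k x)\<^sup>2 / \<rho> k)) \<le> ennreal B"
begin

text \<open>Functions are set to zero off \<open>S\<close>, so that an element is determined as a function on the whole type.\<close>

definition Hs :: "('x \<Rightarrow> real) set" where
  "Hs = {f. continuous_on S f \<and> (\<forall>x. x \<notin> S \<longrightarrow> f x = 0) \<and> summable (\<lambda>k. \<rho> k * (coef f k)\<^sup>2)}"

definition J :: "('x \<Rightarrow> real) \<Rightarrow> real" where "J f = (\<Sum>k. \<rho> k * (coef f k)\<^sup>2)"

lemma \<rho>_pos: "0 < \<rho> k" using \<rho>0(1) \<rho>0(2)[of k] by linarith

lemma kernel_summable: "x \<in> S \<Longrightarrow> summable (\<lambda>k. (e k x)\<^sup>2 / \<rho> k)"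
  and kernel_le: "x \<in> S \<Longrightarrow> (\<Sum>k. (e k x)\<^sup>2 / \<rho> k) \<le> B"
  using summable_of_ennreal_bound[OF _ kernel B, of x] \<rho>_pos by (simp_all add: less_imp_le)

lemma series_bound:
  assumes "summable (\<lambda>k. \<rho> k * (c k)\<^sup>2)" "x \<in> S"
  shows "summable (\<lambda>k. \<bar>c k * e k x\<bar>)" "(\<Sum>k. c k * e k x)\<^sup>2 \<le> B * (\<Sum>k. \<rho> k * (c k)\<^sup>2)"
proof -
  note cs = suminf_Cauchy_Schwarz[OF \<rho>_pos assms(1) kernel_summable[OF assms(2)]]
  show "summable (\<lambda>k. \<bar>c k * e k x\<bar>)" by (rule cs)
  have "0 \<le> (\<Sum>k. \<rho> k * (c k)\<^sup>2)" using assms \<rho>_pos by (intro suminf_nonneg) (auto simp: less_imp_le)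
  then show "(\<Sum>k. c k * e k x)\<^sup>2 \<le> B * (\<Sum>k. \<rho> k * (c k)\<^sup>2)"
    using order_trans[OF cs(2) mult_left_mono[OF kernel_le[OF assms(2)]]] by (simp add: mult.commute)
qed

text \<open>Cauchy-Schwarz against the kernel bounds the tail of the series by the tail of
\<open>(\<Sum>k. \<rho> k * (c k)\<^sup>2)\<close>, uniformly in \<open>x\<close>.\<close>

lemma uniform_series:
  assumes s: "summable (\<lambda>k. \<rho> k * (c k)\<^sup>2)"
  shows "uniform_limit S (\<lambda>n x. \<Sum>k<n. c k * e k x) (\<lambda>x. \<Sum>k. c k * e k x) sequentially"
proof (rule uniform_limitI)
  fix \<epsilon> :: real assume e: "\<epsilon> > 0"
  define q where "q n = (\<Sum>k. \<rho> (k + n) * (c (k + n))\<^sup>2)" for n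
  have q0: "q \<longlonglongrightarrow> 0" unfolding q_def using suminf_exist_split2[OF s] by simp
  have "(\<lambda>n. B * q n) \<longlonglongrightarrow> B * 0" by (intro tendsto_intros q0)
  then have "\<forall>\<^sub>F n in sequentially. B * q n < \<epsilon>\<^sup>2"
    by (rule order_tendstoD) (use e in simp)
  then show "\<forall>\<^sub>F n in sequentially. \<forall>x\<in>S. dist (\<Sum>k<n. c k * e k x) (\<Sum>k. c k * e k x) < \<epsilon>"
  proof eventually_elim
    case (elim n)
    show ?case
    proof
      fix x assume x: "x \<in> S"
      have sn: "summable (\<lambda>k. \<rho> (k + n) * (c (k + n))\<^sup>2)" using s by (rule summable_ignore_initial_segment)
      have kn: "summable (\<lambda>k. (e (k + n) x)\<^sup>2 / \<rho> (k + n))"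
        using kernel_summable[OF x] by (rule summable_ignore_initial_segment)
      have "(\<Sum>k. (e (k + n) x)\<^sup>2 / \<rho> (k + n)) \<le> (\<Sum>k. (e k x)\<^sup>2 / \<rho> k)"
        using suminf_split_initial_segment[OF kernel_summable[OF x], of n] \<rho>_pos
        by (simp add: sum_nonneg less_imp_le)
      then have le: "(\<Sum>k. (e (k + n) x)\<^sup>2 / \<rho> (k + n)) \<le> B" using kernel_le[OF x] by linarith
      have qn: "0 \<le> q n" unfolding q_def using sn \<rho>_pos by (intro suminf_nonneg) (auto simp: less_imp_le)
      have "(\<Sum>k. c k * e k x) - (\<Sum>k<n. c k * e k x) = (\<Sum>k. c (k + n) * e (k + n) x)"
        using suminf_split_initial_segment[OF summable_rabs_cancel[OF series_bound(1)[OF s x]], of n] by simp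
      moreover have "(\<Sum>k. c (k + n) * e (k + n) x)\<^sup>2 \<le> q n * (\<Sum>k. (e (k + n) x)\<^sup>2 / \<rho> (k + n))"
        unfolding q_def by (rule suminf_Cauchy_Schwarz(2)[OF _ sn kn]) (rule \<rho>_pos)
      moreover have "\<dots> \<le> q n * B" by (rule mult_left_mono[OF le qn])
      ultimately have "((\<Sum>k. c k * e k x) - (\<Sum>k<n. c k * e k x))\<^sup>2 < \<epsilon>\<^sup>2" using elim
        by (simp add: mult.commute)
      then show "dist (\<Sum>k<n. c k * e k x) (\<Sum>k. c k * e k x) < \<epsilon>"
        using e by (metis abs_le_square_iff abs_of_pos dist_commute dist_real_def not_le)
    qed
  qed
qed

lemma continuous_partial: "continuous_on S (\<lambda>x. \<Sum>k<n. c k * e k x)"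
  by (intro continuous_intros cont_e)

lemma coef_series:
  assumes s: "summable (\<lambda>k. \<rho> k * (c k)\<^sup>2)"
  shows "continuous_on S (\<lambda>x. \<Sum>k. c k * e k x)" "coef (\<lambda>x. \<Sum>k. c k * e k x) j = c j"
proof -
  note u = uniform_series[OF s]
  show "continuous_on S (\<lambda>x. \<Sum>k. c k * e k x)"
    by (rule uniform_limit_theorem[OF _ u]) (auto intro!: always_eventually continuous_partial)
  have "(\<lambda>n. coef (\<lambda>x. \<Sum>k<n. c k * e k x) j) \<longlonglongrightarrow> coef (\<lambda>x. \<Sum>k. c k * e k x) j"
    by (rule inner_uniform_limit[OF continuous_partial u cont_e])
  moreover have "(\<lambda>n. coef (\<lambda>x. \<Sum>k<n. c k * e k x) j) \<longlonglongrightarrow> c j"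
  proof (rule tendsto_eventually, rule eventually_sequentiallyI[of "Suc j"])
    fix n assume "Suc j \<le> n"
    then show "coef (\<lambda>x. \<Sum>k<n. c k * e k x) j = c j"
      by (subst inner_sum[OF cont_e]) (simp add: orth if_distrib cong: if_cong)
  qed
  ultimately show "coef (\<lambda>x. \<Sum>k. c k * e k x) j = c j" by (rule LIMSEQ_unique)
qed

text \<open>This is the completeness of the space: admissible coefficients sum uniformly to a continuous function,
whose coefficients are recovered by integrating term by term.\<close>

lemma synthesis:
  assumes s: "summable (\<lambda>k. \<rho> k * (c k)\<^sup>2)"
  obtains f where "f \<in> Hs" "\<And>k. coef f k = c k"
proof -
  define f where "f x = (if x \<in> S then \<Sum>k. c k * e k x else 0)" for x
  have c: "coef f j = c j" for j
    using coef_series(2)[OF s, of j] inner_cong[of f "\<lambda>x. \<Sum>k. c k * e k x"] by (simp add: f_def)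
  have "continuous_on S f" using coef_series(1)[OF s] by (rule continuous_on_eq) (simp add: f_def)
  then have "f \<in> Hs" using s by (auto simp: Hs_def c f_def)
  with c that show thesis by blast
qed

lemma HsD: "f \<in> Hs \<Longrightarrow> continuous_on S f" "f \<in> Hs \<Longrightarrow> x \<notin> S \<Longrightarrow> f x = 0"
  "f \<in> Hs \<Longrightarrow> summable (\<lambda>k. \<rho> k * (coef f k)\<^sup>2)"
  by (auto simp: Hs_def)

text \<open>The function and the sum of its series are continuous with the same coefficients, so they
agree everywhere by completeness of the system.\<close>

lemma expansion:
  assumes f: "f \<in> Hs" and x: "x \<in> S"
  shows "f x = (\<Sum>k. coef f k * e k x)"
proof -
  note s = HsD(3)[OF f] note cs = coef_series[OF s]
  have "f x - (\<Sum>k. coef f k * e k x) = 0"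
    by (rule complete[OF _ _ x])
      (auto intro!: continuous_intros HsD(1)[OF f] cs(1) simp: inner_diff[OF HsD(1)[OF f] cs(1) cont_e] cs(2))
  then show ?thesis by simp
qed

lemma expansion_sums:
  assumes f: "f \<in> Hs" and x: "x \<in> S"
  shows "(\<lambda>k. coef f k * e k x) sums f x"
  using expansion[OF assms] series_bound(1)[OF HsD(3)[OF f] x] summable_rabs_cancel summable_sums by metis

lemma point_bound: "f \<in> Hs \<Longrightarrow> x \<in> S \<Longrightarrow> (f x)\<^sup>2 \<le> B * J f"
  using series_bound(2)[OF HsD(3)] expansion unfolding J_def by metis

lemma J_nonneg: "f \<in> Hs \<Longrightarrow> 0 \<le> J f"
  unfolding J_def using HsD(3) \<rho>_pos by (intro suminf_nonneg) (auto simp: less_imp_le)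

lemma parseval:
  assumes f: "f \<in> Hs" shows "(\<lambda>k. (coef f k)\<^sup>2) sums L2_normsq M f"
proof -
  note s = HsD(3)[OF f]
  have u: "uniform_limit S (\<lambda>n x. \<Sum>k<n. coef f k * e k x) f sequentially"
    using uniform_series[OF s] by (rule uniform_limit_cong'[THEN iffD1, rotated -1]) (auto simp: expansion[OF f])
  have "(\<lambda>n. L2_inner M (\<lambda>x. \<Sum>k<n. coef f k * e k x) f) \<longlonglongrightarrow> L2_inner M f f"
    by (rule inner_uniform_limit[OF continuous_partial u HsD(1)[OF f]])
  moreover have "L2_inner M (\<lambda>x. \<Sum>k<n. coef f k * e k x) f = (\<Sum>k<n. (coef f k)\<^sup>2)" for n
    by (subst inner_sum[OF HsD(1)[OF f]]) (simp add: power2_eq_square L2_inner_def mult.commute)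
  ultimately show ?thesis by (simp add: sums_def L2_normsq_def)
qed

lemma Hs_lin:
  assumes f: "f \<in> Hs" and g: "g \<in> Hs"
  shows "(\<lambda>x. a * f x + b * g x) \<in> Hs" "coef (\<lambda>x. a * f x + b * g x) k = a * coef f k + b * coef g k"
proof -
  have c: "coef (\<lambda>x. a * f x + b * g x) j = a * coef f j + b * coef g j" for j
    by (rule inner_lin[OF HsD(1)[OF f] HsD(1)[OF g] cont_e])
  show "coef (\<lambda>x. a * f x + b * g x) k = a * coef f k + b * coef g k" by (rule c)
  have "summable (\<lambda>k. \<rho> k * (a * coef f k + b * coef g k)\<^sup>2)"
  proof (rule summable_comparison_test')
    show "summable (\<lambda>k. 2 * a\<^sup>2 * (\<rho> k * (coef f k)\<^sup>2) + 2 * b\<^sup>2 * (\<rho> k * (coef g k)\<^sup>2))"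
      by (intro summable_add summable_mult HsD(3) f g)
    fix k
    have "(a * coef f k + b * coef g k)\<^sup>2 \<le> 2 * (a * coef f k)\<^sup>2 + 2 * (b * coef g k)\<^sup>2"
      using sum_squares_bound[of "a * coef f k" "b * coef g k"] by (simp add: power2_sum)
    from mult_left_mono[OF this less_imp_le[OF \<rho>_pos[of k]]]
    show "norm (\<rho> k * (a * coef f k + b * coef g k)\<^sup>2) \<le> 2 * a\<^sup>2 * (\<rho> k * (coef f k)\<^sup>2) + 2 * b\<^sup>2 * (\<rho> k * (coef g k)\<^sup>2)"
      using \<rho>_pos[of k] by (simp add: algebra_simps power_mult_distrib abs_mult)
  qed
  then show "(\<lambda>x. a * f x + b * g x) \<in> Hs" using f g
    by (auto simp: Hs_def c intro!: continuous_intros)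
qed

lemma Hs_diff:
  assumes f: "f \<in> Hs" and g: "g \<in> Hs"
  shows "(\<lambda>x. f x - g x) \<in> Hs" "coef (\<lambda>x. f x - g x) k = coef f k - coef g k"
  using Hs_lin[OF assms, where a = 1 and b = "-1"] by auto

lemma zero_Hs: "(\<lambda>x. 0) \<in> Hs"
  by (auto simp: Hs_def L2_inner_def)

text \<open>The parallelogram law holds coefficientwise; it makes minimising sequences Cauchy.\<close>

lemma J_parallelogram:
  assumes f: "f \<in> Hs" and g: "g \<in> Hs"
  shows "J (\<lambda>x. f x - g x) + J (\<lambda>x. 1 * f x + 1 * g x) = 2 * J f + 2 * J g"
proof -
  note s = HsD(3)[OF Hs_diff(1)[OF f g]] HsD(3)[OF Hs_lin(1)[OF f g, of 1 1]]
  have "J (\<lambda>x. f x - g x) + J (\<lambda>x. 1 * f x + 1 * g x) =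
    (\<Sum>k. \<rho> k * (coef (\<lambda>x. f x - g x) k)\<^sup>2 + \<rho> k * (coef (\<lambda>x. 1 * f x + 1 * g x) k)\<^sup>2)"
    unfolding J_def by (rule suminf_add[OF s])
  also have "\<dots> = (\<Sum>k. 2 * (\<rho> k * (coef f k)\<^sup>2) + 2 * (\<rho> k * (coef g k)\<^sup>2))"
    unfolding Hs_diff(2)[OF f g] Hs_lin(2)[OF f g]
    by (rule suminf_cong) (simp add: power2_eq_square algebra_simps)
  also have "\<dots> = 2 * J f + 2 * J g" unfolding J_def using HsD(3) f g
    by (simp add: suminf_add[symmetric] suminf_mult summable_mult)
  finally show ?thesis .
qed

lemma J_scale: "f \<in> Hs \<Longrightarrow> J (\<lambda>x. a * f x) = a\<^sup>2 * J f"
  using Hs_lin(2)[of f f a 0] HsD(3)[of f] unfolding J_def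
  by (simp add: power_mult_distrib mult.left_commute[of _ "a\<^sup>2"] suminf_mult)

lemma J_diff_le: "f \<in> Hs \<Longrightarrow> g \<in> Hs \<Longrightarrow> J (\<lambda>x. f x - g x) \<le> 2 * J f + 2 * J g"
  using J_parallelogram[of f g] J_nonneg[OF Hs_lin(1)[of f g 1 1]] by auto

end

section \<open>Penalised least squares: existence and a deterministic oracle inequality\<close>

context kernel_space
begin

text \<open>The criterion is a convex quadratic whose curvature is at least that of the penalty, so by the
parallelogram law any minimising sequence is Cauchy for \<open>J\<close>. Its coefficients converge, \<open>synthesis\<close>
turns them into an element of the space, and evaluation at the finitely many design points is continuous.\<close>

lemma exists_minimiser:
  fixes w y :: "'i \<Rightarrow> real" and x :: "'i \<Rightarrow> 'x" and \<eta> :: real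
  assumes I: "finite I" and w: "\<And>a. a \<in> I \<Longrightarrow> 0 \<le> w a" and x: "\<And>a. a \<in> I \<Longrightarrow> x a \<in> S" and \<eta>: "0 < \<eta>"
  defines "F \<equiv> \<lambda>g. (\<Sum>a\<in>I. w a * (y a - g (x a))\<^sup>2) + \<eta> * J g"
  shows "\<exists>g\<in>Hs. \<forall>h\<in>Hs. F g \<le> F h"
proof -
  define m where "m = Inf (F ` Hs)"
  have F0: "0 \<le> F g" if "g \<in> Hs" for g
    unfolding F_def using w J_nonneg[OF that] \<eta> by (intro add_nonneg_nonneg sum_nonneg) auto
  then have bdd: "bdd_below (F ` Hs)" by (intro bdd_belowI2[of _ 0])
  have m: "m \<le> F g" if "g \<in> Hs" for g unfolding m_def by (rule cINF_lower[OF bdd that])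
  have "\<exists>g\<in>Hs. F g < m + 1 / real (Suc n)" for n
  proof -
    have "\<exists>v\<in>F ` Hs. v < m + 1 / real (Suc n)"
      unfolding m_def using zero_Hs by (intro cInf_lessD) auto
    then show ?thesis by blast
  qed
  then obtain g where g: "\<And>n. g n \<in> Hs" "\<And>n. F (g n) < m + 1 / real (Suc n)" by metis
  have par: "m \<le> (F f + F h) / 2 - \<eta> / 4 * J (\<lambda>x. f x - h x)" if f: "f \<in> Hs" and h: "h \<in> Hs" for f h
  proof -
    define k where "k = (\<lambda>x. 1/2 * f x + 1/2 * h x)"
    have "k = (\<lambda>x. 1/2 * (1 * f x + 1 * h x))" unfolding k_def by auto
    then have Jk: "J k = (2 * J f + 2 * J h - J (\<lambda>x. f x - h x)) / 4"
      using J_scale[OF Hs_lin(1)[OF f h, of 1 1], of "1/2"] J_parallelogram[OF f h] by (simp add: power2_eq_square)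
    have "w a * (y a - k (x a))\<^sup>2 \<le> (w a * (y a - f (x a))\<^sup>2 + w a * (y a - h (x a))\<^sup>2) / 2" if "a \<in> I" for a
    proof -
      have "(y a - k (x a))\<^sup>2 \<le> ((y a - f (x a))\<^sup>2 + (y a - h (x a))\<^sup>2) / 2"
        unfolding k_def using zero_le_power2[of "f (x a) - h (x a)"]
        by (simp add: power2_eq_square field_simps)
      from mult_left_mono[OF this w[OF that]] show ?thesis by (simp add: distrib_left)
    qed
    then have "(\<Sum>a\<in>I. w a * (y a - k (x a))\<^sup>2) \<le>
        (\<Sum>a\<in>I. (w a * (y a - f (x a))\<^sup>2 + w a * (y a - h (x a))\<^sup>2) / 2)" by (rule sum_mono)
    also have "\<dots> = ((\<Sum>a\<in>I. w a * (y a - f (x a))\<^sup>2) + (\<Sum>a\<in>I. w a * (y a - h (x a))\<^sup>2)) / 2"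
      by (simp add: sum.distrib flip: sum_divide_distrib)
    finally have "F k \<le> (F f + F h) / 2 - \<eta> / 4 * J (\<lambda>x. f x - h x)"
      unfolding F_def Jk by (simp add: field_simps)
    moreover have "k \<in> Hs" unfolding k_def by (rule Hs_lin(1)[OF f h])
    ultimately show ?thesis using m[of k] by linarith
  qed
  define K where "K n = 4 / \<eta> * (1 / real (Suc n))" for n :: nat
  have K0: "K \<longlonglongrightarrow> 0"
    unfolding K_def using tendsto_mult_right_zero[OF LIMSEQ_inverse_real_of_nat, of "4/\<eta>"]
    by (simp add: inverse_eq_divide)
  have lin: "q \<le> u" if "v \<le> u" "m \<le> (a + b) / 2 - q" "a < m + u" "b < m + v" for a b q u v :: real
  proof -
    have "a + b < 2 * m + 2 * u" using that by linarith
    moreover have "2 * q \<le> a + b - 2 * m" using that(2) by (simp add: field_simps)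
    ultimately show ?thesis by linarith
  qed
  have K: "J (\<lambda>x. g n x - g i x) \<le> K n" if "n \<le> i" for n i
  proof -
    have "1 / real (Suc i) \<le> 1 / real (Suc n)" using that by (simp add: frac_le)
    then have "\<eta> / 4 * J (\<lambda>x. g n x - g i x) \<le> 1 / real (Suc n)"
      by (rule lin[OF _ par[OF g(1)[of n] g(1)[of i]] g(2)[of n] g(2)[of i]])
    from mult_left_mono[OF this, of "4/\<eta>"] \<eta> show ?thesis by (simp add: K_def)
  qed
  have Kn: "(\<Sum>k<N. \<rho> k * (coef (g n) k - coef (g i) k)\<^sup>2) \<le> K n" if "n \<le> i" for n i N
  proof -
    have "(\<Sum>k<N. \<rho> k * (coef (\<lambda>x. g n x - g i x) k)\<^sup>2) \<le> J (\<lambda>x. g n x - g i x)"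
      unfolding J_def using HsD(3)[OF Hs_diff(1)[OF g(1) g(1)]] \<rho>_pos
      by (intro sum_le_suminf) (auto simp: less_imp_le)
    then show ?thesis using K[OF that] by (simp add: Hs_diff(2)[OF g(1) g(1)])
  qed
  have cauchy: "Cauchy (\<lambda>n. coef (g n) k)" for k
  proof (rule metric_CauchyI)
    fix \<epsilon> :: real assume e: "\<epsilon> > 0"
    have "\<forall>\<^sub>F n in sequentially. K n < \<rho>0 * (\<epsilon> / 2)\<^sup>2"
      by (rule order_tendstoD(2)[OF K0]) (use e \<rho>0 in simp)
    then obtain N where N: "K N < \<rho>0 * (\<epsilon> / 2)\<^sup>2" by (auto simp: eventually_sequentially)
    have "\<bar>coef (g N) k - coef (g i) k\<bar> < \<epsilon> / 2" if "N \<le> i" for i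
    proof -
      have "\<rho>0 * (coef (g N) k - coef (g i) k)\<^sup>2 \<le> \<rho> k * (coef (g N) k - coef (g i) k)\<^sup>2"
        by (rule mult_right_mono[OF \<rho>0(2)]) simp
      also have "\<dots> \<le> (\<Sum>j<Suc k. \<rho> j * (coef (g N) j - coef (g i) j)\<^sup>2)"
        using \<rho>_pos by (intro member_le_sum) (auto simp: less_imp_le)
      also have "\<dots> \<le> K N" by (rule Kn[OF that])
      also note N
      finally have "(coef (g N) k - coef (g i) k)\<^sup>2 < (\<epsilon> / 2)\<^sup>2"
        unfolding mult_less_cancel_left_pos[OF \<rho>0(1)] .
      then show ?thesis using e power2_less_imp_less[of "\<bar>coef (g N) k - coef (g i) k\<bar>" "\<epsilon> / 2"] by simp
    qed
    note close = this
    have "dist (coef (g i) k) (coef (g j) k) < \<epsilon>" if "N \<le> i" "N \<le> j" for i j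
      using close[OF that(1)] close[OF that(2)] unfolding dist_real_def by linarith
    then have "\<forall>i\<ge>N. \<forall>j\<ge>N. dist (coef (g i) k) (coef (g j) k) < \<epsilon>" by blast
    then show "\<exists>N. \<forall>i\<ge>N. \<forall>j\<ge>N. dist (coef (g i) k) (coef (g j) k) < \<epsilon>" by blast
  qed
  define c where "c k = lim (\<lambda>n. coef (g n) k)" for k
  have c: "(\<lambda>n. coef (g n) k) \<longlonglongrightarrow> c k" for k
    unfolding c_def using cauchy by (simp add: Cauchy_convergent_iff convergent_LIMSEQ_iff)
  have part: "(\<Sum>k<N. \<rho> k * (coef (g n) k - c k)\<^sup>2) \<le> K n" for n N
  proof (rule LIMSEQ_le_const2)
    show "(\<lambda>i. \<Sum>k<N. \<rho> k * (coef (g n) k - coef (g i) k)\<^sup>2) \<longlonglongrightarrow> (\<Sum>k<N. \<rho> k * (coef (g n) k - c k)\<^sup>2)"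
      by (intro tendsto_intros c)
    show "\<exists>N'. \<forall>i\<ge>N'. (\<Sum>k<N. \<rho> k * (coef (g n) k - coef (g i) k)\<^sup>2) \<le> K n" using Kn by blast
  qed
  have sd: "summable (\<lambda>k. \<rho> k * (coef (g n) k - c k)\<^sup>2)" for n
  proof (rule bounded_imp_summable[of _ "K n"])
    show "0 \<le> \<rho> k * (coef (g n) k - c k)\<^sup>2" for k using \<rho>_pos[of k] by (simp add: less_imp_le)
    show "(\<Sum>k\<le>N. \<rho> k * (coef (g n) k - c k)\<^sup>2) \<le> K n" for N
      using part[of n "Suc N"] by (simp only: lessThan_Suc_atMost)
  qed
  have "summable (\<lambda>k. \<rho> k * (c k)\<^sup>2)"
  proof -
    obtain h where h: "h \<in> Hs" "\<And>k. coef h k = coef (g 0) k - c k" using synthesis[OF sd[of 0]] by blast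
    show ?thesis using HsD(3)[OF Hs_diff(1)[OF g(1)[of 0] h(1)]] by (simp add: Hs_diff(2)[OF g(1) h(1)] h(2))
  qed
  then obtain f where f: "f \<in> Hs" "\<And>k. coef f k = c k" using synthesis by blast
  have Jd: "J (\<lambda>x. g n x - f x) \<le> K n" for n
    unfolding J_def Hs_diff(2)[OF g(1) f(1)] f(2)
    by (intro suminf_le_const[OF sd]) (rule part)
  have pt: "(\<lambda>n. g n u) \<longlonglongrightarrow> f u" if u: "u \<in> S" for u
  proof -
    have "(\<lambda>n. (g n u - f u)\<^sup>2) \<longlonglongrightarrow> 0"
    proof (rule tendsto_sandwich[OF _ _ tendsto_const])
      show "(\<lambda>n. B * K n) \<longlonglongrightarrow> 0" using tendsto_mult_right_zero[OF K0] by simp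
      show "\<forall>\<^sub>F n in sequentially. (g n u - f u)\<^sup>2 \<le> B * K n"
        using order_trans[OF point_bound[OF Hs_diff(1)[OF g(1) f(1)] u] mult_left_mono[OF Jd B]] by auto
    qed auto
    then have "(\<lambda>n. g n u - f u) \<longlonglongrightarrow> 0" by simp
    then show ?thesis by (simp add: LIM_zero_iff)
  qed
  have "F f \<le> m"
  proof -
    have "(\<Sum>a\<in>I. w a * (y a - f (x a))\<^sup>2) + \<eta> * (\<Sum>k<N. \<rho> k * (coef f k)\<^sup>2) \<le> m" for N
    proof (rule LIMSEQ_le)
      show "(\<lambda>n. (\<Sum>a\<in>I. w a * (y a - g n (x a))\<^sup>2) + \<eta> * (\<Sum>k<N. \<rho> k * (coef (g n) k)\<^sup>2)) \<longlonglongrightarrow>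
         (\<Sum>a\<in>I. w a * (y a - f (x a))\<^sup>2) + \<eta> * (\<Sum>k<N. \<rho> k * (coef f k)\<^sup>2)"
        unfolding f(2) by (intro tendsto_intros c pt x)
      show "(\<lambda>n. m + 1 / real (Suc n)) \<longlonglongrightarrow> m"
        using tendsto_add[OF tendsto_const[of m] LIMSEQ_inverse_real_of_nat] by (simp add: inverse_eq_divide)
      have "(\<Sum>a\<in>I. w a * (y a - g n (x a))\<^sup>2) + \<eta> * (\<Sum>k<N. \<rho> k * (coef (g n) k)\<^sup>2) \<le> m + 1 / real (Suc n)" for n
      proof -
        have "(\<Sum>k<N. \<rho> k * (coef (g n) k)\<^sup>2) \<le> J (g n)"
          unfolding J_def using HsD(3)[OF g(1)] \<rho>_pos by (intro sum_le_suminf) (auto simp: less_imp_le)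
        from mult_left_mono[OF this less_imp_le[OF \<eta>]] show ?thesis using g(2)[of n] unfolding F_def by linarith
      qed
      then show "\<exists>N'. \<forall>n\<ge>N'. (\<Sum>a\<in>I. w a * (y a - g n (x a))\<^sup>2) + \<eta> * (\<Sum>k<N. \<rho> k * (coef (g n) k)\<^sup>2) \<le> m + 1 / real (Suc n)"
        by blast
    qed
    moreover have "(\<lambda>N. (\<Sum>a\<in>I. w a * (y a - f (x a))\<^sup>2) + \<eta> * (\<Sum>k<N. \<rho> k * (coef f k)\<^sup>2)) \<longlonglongrightarrow> F f"
      unfolding F_def J_def by (intro tendsto_intros summable_LIMSEQ HsD(3) f)
    ultimately show ?thesis by (intro LIMSEQ_le_const2) auto
  qed
  then show ?thesis using f(1) order_trans[OF _ m] by blast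
qed

text \<open>The inputs are the weighted size \<open>V\<close> of the noise coefficients and a weighted
Hilbert-Schmidt distance of at most \<open>1 / 4\<close> between the empirical Gram matrix and the identity.
With \<open>A2 = \<parallel>d\<parallel>\<^sup>2 + \<eta> * J d\<close>, Cauchy-Schwarz gives \<open>\<bar>N - \<parallel>d\<parallel>\<^sup>2\<bar> \<le> A2 / 4\<close> for the empirical
squared norm \<open>N\<close> and \<open>E \<le> A2 / 16 + 4 * V\<close>; both multiples of \<open>A2\<close> are absorbed by the left-hand side.\<close>

lemma oracle_inequality:
  fixes w y :: "'i \<Rightarrow> real" and x :: "'i \<Rightarrow> 'x" and \<eta> V :: real
  assumes I: "finite I" and w: "\<And>a. a \<in> I \<Longrightarrow> 0 \<le> w a" and x: "\<And>a. a \<in> I \<Longrightarrow> x a \<in> S" and \<eta>: "0 < \<eta>"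
    and f0: "f0 \<in> Hs" and g: "g \<in> Hs"
    and min: "(\<Sum>a\<in>I. w a * (y a - g (x a))\<^sup>2) + \<eta> * J g \<le> (\<Sum>a\<in>I. w a * (y a - f0 (x a))\<^sup>2) + \<eta> * J f0"
  assumes V: "(\<Sum>k. ennreal ((\<Sum>a\<in>I. w a * ((y a - f0 (x a)) * e k (x a)))\<^sup>2 / (1 + \<eta> * \<rho> k))) \<le> ennreal V" "0 \<le> V"
    and HS: "(\<Sum>k. \<Sum>j. ennreal (((\<Sum>a\<in>I. w a * (e k (x a) * e j (x a))) - (if k = j then 1 else 0))\<^sup>2
        / ((1 + \<eta> * \<rho> k) * (1 + \<eta> * \<rho> j)))) \<le> ennreal (1 / 16)"
  shows "L2_normsq M (\<lambda>x. g x - f0 x) \<le> 64 * V + 16 * \<eta> * J f0"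
proof -
  define d where "d = (\<lambda>x. g x - f0 x)"
  define c where "c = coef d"
  define A where "A k = 1 + \<eta> * \<rho> k" for k
  define \<epsilon> where "\<epsilon> k = (\<Sum>a\<in>I. w a * ((y a - f0 (x a)) * e k (x a)))" for k
  define T where "T k j = (\<Sum>a\<in>I. w a * (e k (x a) * e j (x a))) - (if k = j then 1 else 0)" for k j
  define N where "N = (\<Sum>a\<in>I. w a * (d (x a))\<^sup>2)"
  define D where "D = (\<Sum>k. (c k)\<^sup>2)"
  define E where "E = (\<Sum>a\<in>I. w a * ((y a - f0 (x a)) * d (x a)))"
  have A: "0 < A k" for k unfolding A_def using \<eta> \<rho>_pos[of k] by (simp add: add_pos_pos)
  have d: "d \<in> Hs" unfolding d_def by (rule Hs_diff(1)[OF g f0])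
  have dx: "(\<lambda>k. c k * e k (x a)) sums d (x a)" if "a \<in> I" for a
    unfolding c_def by (rule expansion_sums[OF d x[OF that]])
  have D: "D = L2_normsq M d" "summable (\<lambda>k. (c k)\<^sup>2)"
    unfolding D_def c_def using parseval[OF d] by (auto simp: sums_iff)
  have sJ: "summable (\<lambda>k. \<rho> k * (c k)\<^sup>2)" unfolding c_def by (rule HsD(3)[OF d])
  have Aeq: "A k * (c k)\<^sup>2 = (c k)\<^sup>2 + \<eta> * (\<rho> k * (c k)\<^sup>2)" for k by (simp add: A_def algebra_simps)
  have sA: "summable (\<lambda>k. A k * (c k)\<^sup>2)"
    unfolding Aeq by (intro summable_add D summable_mult sJ)
  define A2 where "A2 = (\<Sum>k. A k * (c k)\<^sup>2)"
  have Jd: "J d = (\<Sum>k. \<rho> k * (c k)\<^sup>2)" by (simp add: J_def c_def)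
  have A2: "A2 = D + \<eta> * J d"
    unfolding A2_def Aeq D_def Jd
    by (simp add: suminf_add[symmetric] suminf_mult D sJ summable_mult)
  have A20: "0 \<le> A2" unfolding A2_def using sA A by (intro suminf_nonneg) (auto simp: less_imp_le)
  have E_sums: "(\<lambda>k. c k * \<epsilon> k) sums E"
  proof -
    have "(\<lambda>k. \<Sum>a\<in>I. w a * ((y a - f0 (x a)) * (c k * e k (x a)))) sums E"
      unfolding E_def by (intro sums_sum sums_mult dx)
    then show ?thesis unfolding \<epsilon>_def sum_distrib_left by (simp add: algebra_simps)
  qed
  \<comment> \<open>Cauchy-Schwarz with the weights \<open>A k\<close> and \<open>1 / A k\<close>\<close>
  have E2: "E\<^sup>2 \<le> A2 * V"
  proof -
    note v = summable_of_ennreal_bound[OF _ V(1)[folded A_def \<epsilon>_def] V(2)]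
    have v: "summable (\<lambda>k. (\<epsilon> k)\<^sup>2 / A k)" "(\<Sum>k. (\<epsilon> k)\<^sup>2 / A k) \<le> V"
      using A by (auto intro!: v simp: less_imp_le)
    have "E\<^sup>2 \<le> A2 * (\<Sum>k. (\<epsilon> k)\<^sup>2 / A k)"
      using suminf_Cauchy_Schwarz(2)[OF A sA v(1)] E_sums unfolding A2_def by (simp add: sums_iff)
    then show ?thesis using mult_left_mono[OF v(2) A20] by linarith
  qed
  \<comment> \<open>\<open>N - D\<close> is the quadratic form of \<open>T\<close> at the coefficients of \<open>d\<close>; applying Cauchy-Schwarz first in the
  column index and then in the row index bounds it by the weighted Hilbert-Schmidt norm\<close>
  have ND: "(N - D)\<^sup>2 \<le> A2 * (A2 * (1 / 16))"
  proof -
    have "(\<Sum>k. ennreal (inverse (A k)) * (\<Sum>j. ennreal ((T k j)\<^sup>2 / A j))) \<le> ennreal (1 / 16)" (is "?L \<le> _")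
    proof -
      have "ennreal (inverse (A k)) * (\<Sum>j. ennreal ((T k j)\<^sup>2 / A j)) = (\<Sum>j. ennreal ((T k j)\<^sup>2 / (A k * A j)))" for k
        using A less_imp_le[OF A] by (simp add: ennreal_suminf_cmult[symmetric] ennreal_mult[symmetric] field_simps)
      then show ?thesis using HS unfolding T_def A_def by simp
    qed
    note L = this
    have fin: "(\<Sum>j. ennreal ((T k j)\<^sup>2 / A j)) \<noteq> top" for k
    proof
      assume t: "(\<Sum>j. ennreal ((T k j)\<^sup>2 / A j)) = top"
      have "ennreal (inverse (A k)) * (\<Sum>j. ennreal ((T k j)\<^sup>2 / A j)) \<le> ?L"
        using sum_le_suminf[of "\<lambda>k. ennreal (inverse (A k)) * (\<Sum>j. ennreal ((T k j)\<^sup>2 / A j))" "{k}"] by simp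
      also have "ennreal (inverse (A k)) * (\<Sum>j. ennreal ((T k j)\<^sup>2 / A j)) = top"
        unfolding t using A[of k] by (simp add: ennreal_mult_top)
      finally show False using L by (simp add: top_unique)
    qed
    have sT: "summable (\<lambda>j. (T k j)\<^sup>2 / A j)" for k
      using fin[of k] A by (intro summable_suminf_not_top) (auto simp: less_imp_le)
    define m where "m k = (\<Sum>j. (T k j)\<^sup>2 / A j)" for k
    have m0: "0 \<le> m k" for k unfolding m_def using A by (intro suminf_nonneg sT) (auto simp: less_imp_le)
    have "ennreal (inverse (A k)) * (\<Sum>j. ennreal ((T k j)\<^sup>2 / A j)) = ennreal (m k / A k)" for k
    proof -
      have "(\<Sum>j. ennreal ((T k j)\<^sup>2 / A j)) = ennreal (m k)"
        unfolding m_def by (rule ennreal_suminf_of_summable[OF _ sT]) (use A in \<open>auto simp: less_imp_le\<close>)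
      then show ?thesis using A[of k] m0[of k] by (simp add: ennreal_mult[symmetric] field_simps)
    qed
    with L have "(\<Sum>k. ennreal (m k / A k)) \<le> ennreal (1 / 16)" by simp
    from summable_of_ennreal_bound[OF _ this]
    have ms: "summable (\<lambda>k. m k / A k)" "(\<Sum>k. m k / A k) \<le> 1 / 16" using A m0 by (auto simp: less_imp_le)
    define h where "h k = (\<Sum>a\<in>I. w a * (d (x a) * e k (x a)))" for k
    have hT: "(\<lambda>j. c j * T k j) sums (h k - c k)" for k
    proof -
      have "(\<lambda>j. (\<Sum>a\<in>I. w a * (e k (x a) * (c j * e j (x a))))) sums (\<Sum>a\<in>I. w a * (e k (x a) * d (x a)))"
        by (intro sums_sum sums_mult dx)
      moreover have "(\<lambda>j. if j = k then c j else 0) sums c k" by (rule sums_single)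
      ultimately have "(\<lambda>j. (\<Sum>a\<in>I. w a * (e k (x a) * (c j * e j (x a)))) - (if j = k then c j else 0)) sums
        ((\<Sum>a\<in>I. w a * (e k (x a) * d (x a))) - c k)" by (rule sums_diff)
      moreover have "(\<Sum>a\<in>I. w a * (e k (x a) * (c j * e j (x a)))) - (if j = k then c j else 0) = c j * T k j" for j
        unfolding T_def by (simp add: sum_distrib_left algebra_simps)
      ultimately show ?thesis unfolding h_def by (simp add: mult.commute)
    qed
    have hb: "(h k - c k)\<^sup>2 \<le> A2 * m k" for k
      using suminf_Cauchy_Schwarz(2)[OF A sA sT[of k]] hT[of k] unfolding A2_def m_def by (simp add: sums_iff)
    have sh: "summable (\<lambda>k. (h k - c k)\<^sup>2 / A k)"
      by (rule summable_comparison_test'[OF summable_mult[OF ms(1), of A2]])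
        (use A hb in \<open>auto simp: divide_right_mono less_imp_le\<close>)
    have "(\<Sum>k. (h k - c k)\<^sup>2 / A k) \<le> (\<Sum>k. A2 * (m k / A k))"
      by (rule suminf_le[OF _ sh summable_mult[OF ms(1)]])
        (use A hb in \<open>auto simp: divide_right_mono less_imp_le\<close>)
    also have "\<dots> = A2 * (\<Sum>k. m k / A k)" by (rule suminf_mult[OF ms(1)])
    also have "\<dots> \<le> A2 * (1 / 16)" by (rule mult_left_mono[OF ms(2) A20])
    finally have b: "(\<Sum>k. (h k - c k)\<^sup>2 / A k) \<le> A2 * (1 / 16)" .
    have "(\<lambda>k. \<Sum>a\<in>I. w a * (d (x a) * (c k * e k (x a)))) sums (\<Sum>a\<in>I. w a * (d (x a) * d (x a)))"
      by (intro sums_sum sums_mult dx)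
    then have "(\<lambda>k. c k * h k) sums N" unfolding N_def h_def sum_distrib_left
      by (simp add: algebra_simps power2_eq_square)
    moreover have "(\<lambda>k. c k * c k) sums D"
      unfolding D_def using D(2) by (simp add: power2_eq_square[symmetric] summable_sums)
    ultimately have "(\<lambda>k. c k * (h k - c k)) sums (N - D)" using sums_diff by (fastforce simp: right_diff_distrib)
    then have "(N - D)\<^sup>2 \<le> A2 * (\<Sum>k. (h k - c k)\<^sup>2 / A k)"
      using suminf_Cauchy_Schwarz(2)[OF A sA sh] unfolding A2_def by (simp add: sums_iff)
    also have "\<dots> \<le> A2 * (A2 * (1 / 16))" by (rule mult_left_mono[OF b A20])
    finally show ?thesis .
  qed
  have "\<bar>N - D\<bar> \<le> A2 / 4"
  proof (rule power2_le_imp_le)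
    show "\<bar>N - D\<bar>\<^sup>2 \<le> (A2 / 4)\<^sup>2" using ND by (simp add: power2_eq_square)
  qed (use A20 in simp)
  then have 1: "N \<ge> D - A2 / 4" by linarith
  \<comment> \<open>expansion of the square in the minimality of \<open>g\<close> compared with \<open>f0\<close>\<close>
  have 2: "N - 2 * E + \<eta> * J g \<le> \<eta> * J f0"
  proof -
    have "(\<Sum>a\<in>I. w a * (y a - g (x a))\<^sup>2) = (\<Sum>a\<in>I. w a * (y a - f0 (x a))\<^sup>2 - 2 * (w a * ((y a - f0 (x a)) * d (x a))) + w a * (d (x a))\<^sup>2)"
      by (rule sum.cong) (auto simp: d_def power2_eq_square algebra_simps)
    also have "\<dots> = (\<Sum>a\<in>I. w a * (y a - f0 (x a))\<^sup>2) - 2 * E + N"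
      unfolding E_def N_def by (simp add: sum.distrib sum_subtractf sum_distrib_left)
    finally show ?thesis using min by linarith
  qed
  have 3: "J d \<le> 2 * J g + 2 * J f0" unfolding d_def by (rule J_diff_le[OF g f0])
  have 4: "E \<le> A2 / 16 + 4 * V"
  proof -
    have "A2 * V \<le> (A2 / 16 + 4 * V)\<^sup>2"
      using zero_le_power2[of "A2 / 16 - 4 * V"] by (simp add: power2_eq_square field_simps)
    then have "E\<^sup>2 \<le> (A2 / 16 + 4 * V)\<^sup>2" using E2 by linarith
    then show ?thesis by (rule power2_le_imp_le) (use A20 V(2) in simp)
  qed
  have 5: "\<eta> * J d \<le> 2 * (\<eta> * J g) + 2 * (\<eta> * J f0)"
    using mult_left_mono[OF 3 less_imp_le[OF \<eta>]] by (simp add: algebra_simps)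
  have "0 \<le> \<eta> * J d" using \<eta> J_nonneg[OF d] by simp
  moreover have "0 \<le> D" unfolding D_def by (rule suminf_nonneg[OF D(2)]) simp
  ultimately have "D \<le> 64 * V + 16 * (\<eta> * J f0)" using 1 2 4 5 A2 by linarith
  then show ?thesis unfolding D(1) d_def by simp
qed

end

section \<open>Legendre polynomials and their addition theorem\<close>

text \<open>The derivative \<open>P\<^sub>l\<^sup>(\<^sup>k\<^sup>)\<close> of the Legendre polynomial, the polynomial factor of the associated Legendre function.\<close>

definition Q :: "nat \<Rightarrow> nat \<Rightarrow> real poly" where "Q l k = (pderiv ^^ k) (legendre l)"

lemma pderiv_Q: "pderiv (Q l k) = Q l (Suc k)" by (simp add: Q_def)

text \<open>With \<open>W = x\<^sup>2 - 1\<close> the powers satisfy \<open>W * (W^l)' = 2 * l * x * W^l\<close>; Leibniz' rule then gives the \<open>n\<close>-th derivative.\<close>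

lemma rodrigues_recurrence:
  defines "W \<equiv> [:-1, 0, 1:] :: real poly"
  defines "y \<equiv> \<lambda>l n. (pderiv ^^ n) (W ^ l)"
  shows "W * y l (Suc n) = smult (2 * real l - 2 * real n) ([:0, 1:] * y l n)
      + smult (real n * (2 * real l - real n + 1)) (y l (n - 1))"
proof (induction n)
  case 0
  have "W * pderiv (W ^ l) = smult (2 * real l) ([:0, 1:] * W ^ l)"
  proof (cases l)
    case (Suc i)
    have "pderiv W = [:0, 2:]" by (simp add: W_def pderiv_pCons)
    then show ?thesis unfolding Suc pderiv_power_Suc
      by (simp add: algebra_simps)
  qed (simp add: pderiv_1)
  then show ?case by (simp add: y_def)
next
  case (Suc n)
  have y: "pderiv (y l i) = y l (Suc i)" for i by (simp add: y_def)
  have yn: "smult (real n * a) (y l (Suc (n - 1))) = smult (real n * a) (y l n)" for a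
    by (cases n) simp_all
  have "pderiv (W * y l (Suc n)) = pderiv (smult (2 * real l - 2 * real n) ([:0, 1:] * y l n)
      + smult (real n * (2 * real l - real n + 1)) (y l (n - 1)))" using Suc by simp
  then have "W * y l (Suc (Suc n)) + y l (Suc n) * [:0, 2:] = smult (2 * real l - 2 * real n) ([:0, 1:] * y l (Suc n) + y l n)
      + smult (real n * (2 * real l - real n + 1)) (y l n)"
    unfolding pderiv_add pderiv_smult pderiv_mult y unfolding yn by (simp add: W_def pderiv_pCons)
  then have *: "poly (W * y l (Suc (Suc n)) + y l (Suc n) * [:0, 2:]) t = poly (smult (2 * real l - 2 * real n) ([:0, 1:] * y l (Suc n) + y l n)
      + smult (real n * (2 * real l - real n + 1)) (y l n)) t" for t by (rule arg_cong)
  show ?case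
  proof (rule poly_eq_poly_eq_iff[THEN iffD1], rule ext)
    fix t
    show "poly (W * y l (Suc (Suc n))) t = poly (smult (2 * real l - 2 * real (Suc n)) ([:0, 1:] * y l (Suc n))
      + smult (real (Suc n) * (2 * real l - real (Suc n) + 1)) (y l (Suc n - 1))) t"
      using *[of t] by (simp add: algebra_simps)
  qed
qed

text \<open>The \<open>k\<close>-fold differentiated Legendre equation. Orthogonality and the addition theorem are both derived from it.\<close>

lemma legendre_ode:
  "(1 - t\<^sup>2) * poly (Q l (Suc (Suc k))) t = 2 * (real k + 1) * t * poly (Q l (Suc k)) t
     - (real l - real k) * (real l + real k + 1) * poly (Q l k) t"
proof -
  define y where "y n = (pderiv ^^ n) ([:-1, 0, 1:] ^ l :: real poly)" for n
  define c :: real where "c = 1 / (2 ^ l * fact l)"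
  have Qy: "Q l k = smult c (y (l + k))" for k
    by (simp add: Q_def y_def c_def legendre_def higher_pderiv_smult funpow_add[symmetric, THEN fun_cong, simplified] add.commute)
  have "poly ([:-1, 0, 1:] * y (Suc (l + k + 1))) t = poly (smult (2 * real l - 2 * real (l + k + 1)) ([:0, 1:] * y (l + k + 1))
      + smult (real (l + k + 1) * (2 * real l - real (l + k + 1) + 1)) (y (l + k + 1 - 1))) t"
    unfolding y_def by (rule arg_cong[OF rodrigues_recurrence])
  then have "(1 - t\<^sup>2) * poly (y (l + Suc (Suc k))) t = 2 * (real k + 1) * t * poly (y (l + Suc k)) t
     - (real l - real k) * (real l + real k + 1) * poly (y (l + k)) t"
    by (simp add: algebra_simps power2_eq_square)
  from arg_cong[OF this, of "\<lambda>z. c * z"] show ?thesis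
    unfolding Qy poly_smult right_diff_distrib by (simp add: algebra_simps)
qed

lemma higher_pderiv_root_power:
  "poly ((pderiv ^^ n) ([:- a, 1:] ^ n * q)) a = fact n * poly q (a :: real)"
proof (induction n arbitrary: q)
  case (Suc n)
  have "pderiv ([:- a, 1:] ^ Suc n * q) = [:- a, 1:] ^ n * (smult (of_nat (Suc n)) q + [:- a, 1:] * pderiv q)"
    unfolding pderiv_mult pderiv_power_Suc by (simp add: pderiv_pCons algebra_simps)
  then show ?case by (simp only: funpow_Suc_right o_apply Suc) simp
qed simp

lemma legendre_at_1: "poly (Q l 0) 1 = 1"
proof -
  have "([:-1, 0, 1:] :: real poly) = [:- 1, 1:] * [:1, 1:]" by simp
  then have "([:-1, 0, 1:] ^ l :: real poly) = [:- 1, 1:] ^ l * [:1, 1:] ^ l" by (simp only: power_mult_distrib)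
  then show ?thesis
    by (simp add: Q_def legendre_def higher_pderiv_smult higher_pderiv_root_power poly_power del: mult_pCons_left)
qed

lemma degree_Q: "degree (Q l k) = l - k" and Q_nz: "k \<le> l \<Longrightarrow> Q l k \<noteq> 0"
proof -
  have d: "degree ((pderiv ^^ n) p) = degree p - n" for n and p :: "real poly"
    by (induction n) (auto simp: degree_pderiv)
  have 1: "degree ([:-1, 0, 1:] ^ l :: real poly) = 2 * l" by (simp add: degree_power_eq)
  have q: "degree (Q l k) = l - k" for k
    by (simp add: Q_def d legendre_def 1)
  then show "degree (Q l k) = l - k" .
  show "Q l k \<noteq> 0" if "k \<le> l"
  proof (cases "k = l")
    case True
    show ?thesis
    proof
      assume "Q l k = 0"
      have "(pderiv ^^ n) p = 0 \<Longrightarrow> p = 0 \<or> degree p < n" for n and p :: "real poly"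
      proof (induction n arbitrary: p)
        case (Suc n)
        have "(pderiv ^^ n) (pderiv p) = 0" using Suc.prems by (simp add: funpow_swap1)
        from Suc.IH[OF this] show ?case by (auto simp: degree_pderiv pderiv_eq_0_iff)
      qed simp
      from this[of l "legendre l"] \<open>Q l k = 0\<close> True q[of 0] legendre_at_1[of l]
      show False by (cases l) (auto simp: Q_def)
    qed
  next
    case False
    then show ?thesis using q[of k] that by fastforce
  qed
qed

lemma Q_beyond: "Q l (Suc l) = 0"
  using degree_Q[of l l] by (simp add: pderiv_Q[symmetric] pderiv_eq_0_iff)

text \<open>The derivative of the partial sum up to \<open>m\<close> collapses, by the differential equation, to a multiple of
\<open>Q l m * Q l (Suc m)\<close>. At \<open>m = l\<close> this vanishes because \<open>Q l (Suc l) = 0\<close>; the sum is thus constant, and at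
\<open>t = 1\<close> only the first term is left.\<close>

lemma legendre_addition:
  "poly (Q l 0) t ^ 2 + (\<Sum>k=1..l. 2 * fact (l - k) / fact (l + k) * (1 - t\<^sup>2) ^ k * poly (Q l k) t ^ 2) = 1"
proof -
  define c :: "nat \<Rightarrow> real" where "c k = 2 * fact (l - k) / fact (l + k)" for k
  define w :: "real poly" where "w = [:1, 0, -1:]"
  define F where "F m = Q l 0 ^ 2 + (\<Sum>k=1..m. smult (c k) (w ^ k * Q l k ^ 2))" for m
  have w: "poly w t = 1 - t\<^sup>2" "pderiv w = [:0, -2:]" for t by (auto simp: w_def power2_eq_square pderiv_pCons)
  have cm: "c (Suc m) * ((real l - real m) * (real l + real m + 1)) = c m" if "m < l" for m
  proof -
    define a b where "a = real l - real m" and "b = real l + real m + 1"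
    have "l - m = Suc (l - Suc m)" using that by simp
    then have f1: "fact (l - m) = a * fact (l - Suc m)" using that by (simp add: of_nat_diff a_def)
    have f2: "fact (l + Suc m) = b * fact (l + m)" by (simp add: b_def)
    have "b \<noteq> 0" by (simp add: b_def)
    then show ?thesis unfolding c_def f1 f2 a_def[symmetric] b_def[symmetric] by (simp add: field_simps)
  qed
  have dF: "m \<le> l \<Longrightarrow> poly (pderiv (F m)) t = c m * (1 - t\<^sup>2) ^ m * poly (Q l m) t * poly (Q l (Suc m)) t" for m t
  proof (induction m)
    case 0
    then show ?case by (simp add: F_def c_def pderiv_power pderiv_Q power2_eq_square pderiv_mult)
  next
    case (Suc m)
    have "poly (pderiv (F (Suc m))) t = poly (pderiv (F m)) t
        + c (Suc m) * ((real m + 1) * (1 - t\<^sup>2) ^ m * (- 2 * t) * poly (Q l (Suc m)) t ^ 2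
            + 2 * (1 - t\<^sup>2) ^ Suc m * poly (Q l (Suc m)) t * poly (Q l (Suc (Suc m))) t)"
      unfolding F_def sum.cl_ivl_Suc
      by (simp add: pderiv_add pderiv_smult pderiv_mult pderiv_power_Suc power2_eq_square pderiv_Q w poly_power
          del: power_Suc) (simp add: algebra_simps w)
    also have "poly (pderiv (F m)) t = c (Suc m) * ((real l - real m) * (real l + real m + 1)) * (1 - t\<^sup>2) ^ m * poly (Q l m) t * poly (Q l (Suc m)) t"
      using Suc cm[of m] by simp
    also have "\<dots> + c (Suc m) * ((real m + 1) * (1 - t\<^sup>2) ^ m * (- 2 * t) * poly (Q l (Suc m)) t ^ 2
            + 2 * (1 - t\<^sup>2) ^ Suc m * poly (Q l (Suc m)) t * poly (Q l (Suc (Suc m))) t)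
       = c (Suc m) * (1 - t\<^sup>2) ^ m * poly (Q l (Suc m)) t * (2 * ((1 - t\<^sup>2) * poly (Q l (Suc (Suc m))) t)
         - (2 * (real m + 1) * t * poly (Q l (Suc m)) t
     - (real l - real m) * (real l + real m + 1) * poly (Q l m) t))"
      by (simp add: algebra_simps power2_eq_square)
    also have "\<dots> = c (Suc m) * (1 - t\<^sup>2) ^ Suc m * poly (Q l (Suc m)) t * poly (Q l (Suc (Suc m))) t"
      unfolding legendre_ode[symmetric] by (simp add: algebra_simps)
    finally show ?case .
  qed
  have "pderiv (F l) = 0"
    by (rule poly_eq_poly_eq_iff[THEN iffD1]) (auto simp: dF Q_beyond)
  then obtain a where a: "F l = [:a:]" using pderiv_iszero by blast
  have F: "poly (F l) t = poly (Q l 0) t ^ 2 + (\<Sum>k=1..l. c k * (1 - t\<^sup>2) ^ k * poly (Q l k) t ^ 2)" for t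
    by (simp add: F_def poly_sum poly_power w mult.assoc)
  have "(\<Sum>k=1..l. c k * (1 - 1\<^sup>2) ^ k * poly (Q l k) 1 ^ 2) = 0" by (intro sum.neutral) auto
  then have "poly (F l) 1 = 1" unfolding F by (simp only: legendre_at_1) simp
  then have "poly (F l) t = 1" using a by simp
  then show ?thesis unfolding F c_def .
qed

lemma sgn_measurable [measurable]: "sgn \<in> restrict_space lborel (ball 0 1 - {0 :: real^3}) \<rightarrow>\<^sub>M restrict_space borel S2"
proof (rule measurable_restrict_space2)
  show "sgn \<in> space (restrict_space lborel (ball 0 1 - {0 :: real^3})) \<rightarrow> S2"
    by (auto simp: space_restrict_space norm_sgn)
  show "sgn \<in> borel_measurable (restrict_space lborel (ball 0 1 - {0 :: real^3}))"
    by (intro measurable_restrict_space1) (simp add: sgn_div_norm[abs_def])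
qed

text \<open>Scaling by a constant is rewritten as a constant density, for which the integration rules are available.\<close>

lemma surface_density:
  "surface = density (distr (restrict_space lborel (ball 0 1 - {0})) (restrict_space borel S2) sgn) (\<lambda>_. ennreal 3)"
  unfolding surface_def by (rule measure_eqI) (auto simp: emeasure_density_const)

lemma space_surface [simp]: "space surface = S2"
  and sets_surface [measurable_cong]: "sets surface = sets (restrict_space borel S2)"
  by (simp_all add: surface_density space_restrict_space)

lemma surface_integral:
  assumes [measurable]: "f \<in> borel_measurable (restrict_space borel S2)"
  shows "(LINT u|surface. f u :: real) = 3 * (LINT x|lborel. indicator (ball 0 1 - {0}) x * f (sgn x))"
proof -
  have "(LINT u|surface. f u) = (LINT u|distr (restrict_space lborel (ball 0 1 - {0})) (restrict_space borel S2) sgn. 3 * f u)"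
    unfolding surface_density by (subst integral_density) auto
  also have "\<dots> = (LINT x|restrict_space lborel (ball 0 1 - {0}). 3 * f (sgn x))"
    by (subst integral_distr) auto
  also have "\<dots> = 3 * (LINT x|lborel. indicator (ball 0 1 - {0}) x * f (sgn x))"
    by (subst integral_restrict_space) (auto simp: mult.left_commute)
  finally show ?thesis .
qed

lemma emeasure_surface: "emeasure surface S2 = ennreal (4 * pi)"
proof -
  have "emeasure surface S2 = 3 * emeasure lborel (ball 0 1 - {0 :: real^3})"
  proof -
    have "sgn -` S2 \<inter> space (restrict_space lborel (ball 0 1 - {0 :: real^3})) = ball 0 1 - {0}"
      by (auto simp: space_restrict_space norm_sgn)
    moreover have "S2 \<in> sets (restrict_space borel S2)"
      using sets.top[of "restrict_space borel S2"] by (simp add: space_restrict_space)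
    ultimately show ?thesis unfolding surface_def emeasure_scale_measure
      by (subst emeasure_distr[OF sgn_measurable]) (simp_all add: emeasure_restrict_space)
  qed
  also have "emeasure lborel (ball 0 1 - {0 :: real^3}) = emeasure lborel (ball 0 1 :: (real^3) set)"
    by (subst emeasure_Diff) (auto simp: emeasure_lborel_ball_finite)
  also have "\<dots> = ennreal (4 / 3 * pi)"
    by (subst emeasure_ball) (auto simp: unit_ball_vol_3)
  also have "3 * ennreal (4 / 3 * pi) = ennreal (4 * pi)"
    by (subst ennreal_numeral[symmetric], subst ennreal_mult[symmetric]) auto
  finally show ?thesis .
qed

lemma finite_surface: "finite_measure surface"
  by (rule finite_measureI) (simp add: emeasure_surface)

lemma integrable_surface:
  fixes f :: "real^3 \<Rightarrow> real"
  assumes "continuous_on S2 f" shows "integrable surface f"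
proof -
  have "bounded (f ` S2)" by (rule compact_imp_bounded[OF compact_continuous_image[OF assms compact_sphere]])
  then obtain C where "\<forall>x\<in>S2. \<bar>f x\<bar> \<le> C" unfolding bounded_iff by auto
  then show ?thesis
    using borel_measurable_continuous_on_restrict[OF assms]
    by (intro finite_measure.integrable_const_bound[OF finite_surface, of _ C] AE_I2)
      (auto cong: measurable_cong_sets simp: sets_surface simp del: mem_sphere_0)
qed

lemma lborel_orthogonal:
  fixes R :: "real^3 \<Rightarrow> real^3"
  assumes R: "orthogonal_transformation R"
  shows "distr lborel borel R = lborel"
proof (rule lborel_eqI[symmetric])
  note iR = orthogonal_transformation_inv[OF R] note bij = orthogonal_transformation_bij[OF R]
  have [measurable]: "R \<in> borel_measurable borel"
    by (intro borel_measurable_continuous_onI linear_continuous_on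
        linear_conv_bounded_linear[THEN iffD1] orthogonal_transformation_linear[OF R])
  fix l u :: "real^3" assume lu: "\<And>b. b \<in> Basis \<Longrightarrow> l \<bullet> b \<le> u \<bullet> b"
  have "R -` box l u = inv R ` box l u" by (rule bij_vimage_eq_inv_image[OF bij])
  then have "emeasure (distr lborel borel R) (box l u) = emeasure lborel (inv R ` box l u)"
    by (subst emeasure_distr) auto
  also have "\<dots> = emeasure lebesgue (inv R ` box l u)"
    by (subst emeasure_completion) (use \<open>R -` box l u = inv R ` box l u\<close> measurable_sets[of R borel borel "box l u"] in auto)
  also have "\<dots> = ennreal (measure lebesgue (inv R ` box l u))"
    using measurable_orthogonal_image[OF iR, of "box l u"] by (intro emeasure_eq_measure2) auto
  also have "\<dots> = ennreal (measure lebesgue (box l u))" by (subst measure_orthogonal_image[OF iR]) auto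
  also have "\<dots> = (\<Prod>b\<in>Basis. (u - l) \<bullet> b)" using lu by (simp add: measure_lborel_box)
  finally show "emeasure (distr lborel borel R) (box l u) = (\<Prod>b\<in>Basis. (u - l) \<bullet> b)" .
qed simp

text \<open>Rotations preserve Lebesgue measure and the unit ball and commute with radial projection.\<close>

lemma surface_rotation:
  fixes f :: "real^3 \<Rightarrow> real"
  assumes R: "orthogonal_transformation R" and f: "continuous_on S2 f"
  shows "(LINT u|surface. f (R u)) = (LINT u|surface. f u)"
proof -
  have lin: "linear R" by (rule orthogonal_transformation_linear[OF R])
  have c: "continuous_on A R" for A
    by (rule linear_continuous_on[OF linear_conv_bounded_linear[THEN iffD1, OF lin]])
  then have [measurable]: "R \<in> borel_measurable borel" by (rule borel_measurable_continuous_onI)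
  have n: "norm (R x) = norm x" for x by (rule orthogonal_transformation_norm[OF R])
  have cR: "continuous_on S2 (\<lambda>u. f (R u))"
    by (rule continuous_on_compose2[OF f c]) (auto simp: n)
  have sR: "sgn (R x) = R (sgn x)" for x by (simp add: sgn_div_norm n linear_cmul[OF lin])
  have R0: "R x = 0 \<longleftrightarrow> x = 0" for x by (metis n norm_eq_zero)
  have g: "(\<lambda>x. indicator (ball 0 1 - {0}) x * f (sgn x)) \<in> borel_measurable borel"
  proof -
    have "(\<lambda>x. f (sgn x)) \<in> borel_measurable (restrict_space lborel (ball 0 1 - {0}))"
      using measurable_compose[OF sgn_measurable borel_measurable_continuous_on_restrict[OF f]] .
    then have "(\<lambda>x. f (sgn x)) \<in> borel_measurable (restrict_space borel (ball 0 1 - {0}))" 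
      by (simp cong: measurable_cong_sets add: sets_restrict_space)
    then show ?thesis by (subst (asm) borel_measurable_restrict_space_iff) auto
  qed
  have "(LINT u|surface. f u) = 3 * (LINT x|distr lborel borel R. indicator (ball 0 1 - {0}) x * f (sgn x))"
    unfolding lborel_orthogonal[OF R] by (rule surface_integral[OF borel_measurable_continuous_on_restrict[OF f]])
  also have "\<dots> = 3 * (LINT x|lborel. indicator (ball 0 1 - {0}) (R x) * f (sgn (R x)))"
    by (subst integral_distr) (use g in auto)
  also have "\<dots> = 3 * (LINT x|lborel. indicator (ball 0 1 - {0}) x * f (R (sgn x)))"
    by (simp add: sR indicator_def R0 n)
  also have "\<dots> = (LINT u|surface. f (R u))"
    by (rule surface_integral[OF borel_measurable_continuous_on_restrict[OF cR], symmetric])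
  finally show ?thesis by simp
qed

text \<open>A continuous function of vanishing square integral vanishes: otherwise its square would be
bounded below on a cone of positive volume.\<close>

lemma surface_positive:
  fixes f :: "real^3 \<Rightarrow> real"
  assumes f: "continuous_on S2 f" and 0: "(LINT u|surface. (f u)\<^sup>2) = 0" and u: "u \<in> S2"
  shows "f u = 0"
proof (rule ccontr)
  assume nz: "f u \<noteq> 0"
  define V where "V = (ball 0 1 - {0}) \<inter> (\<lambda>x. f (sgn x)) -` (- {0})"
  have c: "continuous_on (ball 0 1 - {0}) (\<lambda>x. f (sgn x))"
    by (rule continuous_on_compose2[OF f]) (auto intro!: continuous_intros simp: norm_sgn split: if_splits)
  have V: "open V" unfolding V_def by (rule continuous_open_preimage[OF c]) auto
  have "AE u in surface. (f u)\<^sup>2 = 0"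
    using integrable_surface[of "\<lambda>u. (f u)\<^sup>2"] f 0
    by (subst integral_nonneg_eq_0_iff_AE[symmetric]) (auto intro!: continuous_intros)
  then have "AE x in lborel. x \<in> ball 0 1 - {0} \<longrightarrow> f (sgn x) = 0"
    unfolding surface_density using borel_measurable_continuous_on_restrict[OF f]
    by (subst (asm) AE_density, simp, subst (asm) AE_distr_iff, simp, measurable, subst (asm) AE_restrict_space_iff, auto)
  then have "AE x in lborel. x \<notin> V" by eventually_elim (auto simp: V_def)
  then have "V \<in> null_sets lborel" using V by (subst AE_iff_null_sets) auto
  then have "negligible V" by (simp add: negligible_iff_null_sets null_sets_completionI)
  moreover have "(1/2) *\<^sub>R u \<in> V" using u nz by (auto simp: V_def sgn_scaleR sgn_div_norm)
  ultimately show False using open_not_negligible[OF V] by blast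
qed

section \<open>Surface measure and rotations\<close>

text \<open>The horizontal coordinates as a complex number; rotations about the vertical axis act by multiplication.\<close>

definition zz :: "real^3 \<Rightarrow> complex" where "zz u = Complex (u $ 1) (u $ 2)"

lemma norm3: "(norm (u :: real^3))\<^sup>2 = (u $ 1)\<^sup>2 + (u $ 2)\<^sup>2 + (u $ 3)\<^sup>2"
  by (simp add: norm_vec_def L2_set_def sum_3)

lemma zz_sphere: "u \<in> S2 \<Longrightarrow> (Re (zz u))\<^sup>2 + (Im (zz u))\<^sup>2 = 1 - (u $ 3)\<^sup>2"
  using norm3[of u] by (simp add: zz_def)

lemma continuous_zz [continuous_intros]: "continuous_on A zz"
  unfolding zz_def complex_eq_iff Complex_eq by (intro continuous_intros)

lemma continuous_poly3 [continuous_intros]: "continuous_on A (\<lambda>u :: real^3. poly p (u $ 3))"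
  by (intro continuous_intros)

lemma vector3_orthogonal:
  assumes "linear R" "\<And>u. (R u $ 1)\<^sup>2 + (R u $ 2)\<^sup>2 + (R u $ 3)\<^sup>2 = (u $ 1)\<^sup>2 + (u $ 2)\<^sup>2 + (u $ 3)\<^sup>2"
  shows "orthogonal_transformation (R :: real^3 \<Rightarrow> real^3)"
proof -
  have "norm (R u) = norm u" for u
    using assms(2)[of u] unfolding norm3[symmetric] by (simp add: power2_eq_iff_nonneg)
  then show ?thesis using assms(1) by (simp add: orthogonal_transformation)
qed

text \<open>The rotation by the angle \<open>pi / k\<close> about the vertical axis changes the sign of \<open>zz u ^ k\<close> and preserves the height.\<close>

lemma integral_azimuthal:
  assumes "1 \<le> k"
  shows "(LINT u|surface. poly p (u $ 3) * Re (zz u ^ k)) = 0"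
    and "(LINT u|surface. poly p (u $ 3) * Im (zz u ^ k)) = 0"
proof -
  define a where "a = cis (pi / real k)"
  define R :: "real^3 \<Rightarrow> real^3" where "R u = vector [Re (a * zz u), Im (a * zz u), u $ 3]" for u
  have lin: "linear R"
    by (rule linearI) (auto simp: R_def zz_def vec_eq_iff forall_3 algebra_simps)
  have "cmod a = 1" by (simp add: a_def)
  then have "(Re (a * zz u))\<^sup>2 + (Im (a * zz u))\<^sup>2 = (u $ 1)\<^sup>2 + (u $ 2)\<^sup>2" for u
    unfolding cmod_power2[symmetric] norm_mult by (simp add: cmod_power2 zz_def)
  then have R: "orthogonal_transformation R"
    by (intro vector3_orthogonal lin) (simp add: R_def)
  have zR: "zz (R u) = a * zz u" for u by (simp add: R_def zz_def complex_eq_iff)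
  have "a ^ k = cis (real k * (pi / real k))" unfolding a_def by (simp only: Complex.DeMoivre)
  also have "\<dots> = -1" using assms by simp
  finally have "a ^ k = -1" .
  then have "zz (R u) ^ k = - (zz u ^ k)" for u unfolding zR power_mult_distrib by simp
  moreover have "R u $ 3 = u $ 3" for u by (simp add: R_def)
  ultimately show "(LINT u|surface. poly p (u $ 3) * Re (zz u ^ k)) = 0"
    "(LINT u|surface. poly p (u $ 3) * Im (zz u ^ k)) = 0"
    using surface_rotation[OF R, of "\<lambda>u. poly p (u $ 3) * Re (zz u ^ k)"]
      surface_rotation[OF R, of "\<lambda>u. poly p (u $ 3) * Im (zz u ^ k)"]
    by (simp_all add: continuous_intros)
qed

lemma surface_total: "measure surface S2 = 4 * pi"
  by (simp add: measure_def emeasure_surface)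

lemma surface_cong: "(\<And>u. u \<in> S2 \<Longrightarrow> f u = g u) \<Longrightarrow> (LINT u|surface. f u :: real) = (LINT u|surface. g u)"
  by (rule Bochner_Integration.integral_cong) auto

lemma height_moment_odd: "odd n \<Longrightarrow> (LINT u|surface. (u $ 3) ^ n) = 0"
proof -
  assume n: "odd n"
  define R :: "real^3 \<Rightarrow> real^3" where "R u = vector [u $ 1, u $ 2, - u $ 3]" for u
  have "orthogonal_transformation R"
    by (intro vector3_orthogonal linearI) (auto simp: R_def vec_eq_iff forall_3)
  from surface_rotation[OF this, of "\<lambda>u. (u $ 3) ^ n"] n show ?thesis
    by (simp add: R_def continuous_intros)
qed

lemma coeff_one_plus_square_power:
  "coeff ([:1, 0, 1:] ^ j :: real poly) 0 = 1" "coeff ([:1, 0, 1:] ^ j :: real poly) 2 = real j"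
proof -
  have "coeff ([:1, 0, 1:] ^ j :: real poly) 0 = 1 \<and> coeff ([:1, 0, 1:] ^ j :: real poly) 2 = real j"
    by (induction j) (auto simp: coeff_pCons numeral_2_eq_2 split: nat.splits)
  then show "coeff ([:1, 0, 1:] ^ j :: real poly) 0 = 1" "coeff ([:1, 0, 1:] ^ j :: real poly) 2 = real j" by auto
qed

text \<open>Rotating in the plane of the first and third coordinates by the angle with tangent \<open>t\<close> shows that
the integral of \<open>(t * x + z) ^ n\<close> is \<open>(1 + t\<^sup>2) ^ (n / 2)\<close> times the integral of \<open>z ^ n\<close>. Comparing
coefficients of \<open>t\<^sup>2\<close> expresses the moment of \<open>x\<^sup>2 * z ^ (n - 2)\<close> by that of \<open>z ^ n\<close>; since
\<open>x\<^sup>2 + y\<^sup>2 + z\<^sup>2 = 1\<close> on the sphere, this is a recursion for the even moments.\<close>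

lemma height_moment_even: "(LINT u|surface. (u $ 3) ^ (2 * j)) = 4 * pi / (2 * real j + 1)"
proof (induction j)
  case 0
  then show ?case using surface_total by simp
next
  case (Suc i)
  define n where "n = 2 * Suc i"
  define b where "b k = (LINT u|surface. (u $ 1) ^ k * (u $ 3) ^ (n - k))" for k
  define a where "a = (LINT u|surface. (u $ 3) ^ n)"
  have id: "(\<Sum>k\<le>n. real (n choose k) * b k * t ^ k) = a * (1 + t\<^sup>2) ^ Suc i" for t
  proof -
    define s where "s = sqrt (1 + t\<^sup>2)"
    have s: "s\<^sup>2 = 1 + t\<^sup>2" "s \<noteq> 0" unfolding s_def by (auto simp: add_nonneg_eq_0_iff)
    define R :: "real^3 \<Rightarrow> real^3" where "R u = vector [(u $ 1 - t * u $ 3) / s, u $ 2, (t * u $ 1 + u $ 3) / s]" for u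
    have "linear R" by (rule linearI) (auto simp: R_def vec_eq_iff forall_3 algebra_simps diff_divide_distrib add_divide_distrib)
    moreover have "((u $ 1 - t * u $ 3) / s)\<^sup>2 + ((t * u $ 1 + u $ 3) / s)\<^sup>2 = (u $ 1)\<^sup>2 + (u $ 3)\<^sup>2" for u :: "real^3"
    proof -
      have "(u $ 1 - t * u $ 3)\<^sup>2 + (t * u $ 1 + u $ 3)\<^sup>2 = s\<^sup>2 * ((u $ 1)\<^sup>2 + (u $ 3)\<^sup>2)"
        unfolding s(1) by (simp add: power2_eq_square algebra_simps)
      then show ?thesis using s(2) by (simp add: power_divide add_divide_distrib[symmetric])
    qed
    ultimately have R: "orthogonal_transformation R"
      by (intro vector3_orthogonal) (auto simp: R_def algebra_simps)
    have "a = (LINT u|surface. ((t * u $ 1 + u $ 3) / s) ^ n)"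
      unfolding a_def using surface_rotation[OF R, of "\<lambda>u. (u $ 3) ^ n"]
      by (simp add: R_def continuous_intros)
    also have "\<dots> = (LINT u|surface. (t * u $ 1 + u $ 3) ^ n) / s ^ n" by (simp add: power_divide)
    also have "(LINT u|surface. (t * u $ 1 + u $ 3) ^ n)
        = (LINT u|surface. (\<Sum>k\<le>n. real (n choose k) * t ^ k * ((u $ 1) ^ k * (u $ 3) ^ (n - k))))"
      unfolding binomial_ring by (simp add: power_mult_distrib algebra_simps)
    also have "\<dots> = (\<Sum>k\<le>n. real (n choose k) * b k * t ^ k)" unfolding b_def
      by (subst Bochner_Integration.integral_sum)
        (auto intro!: integrable_surface continuous_intros sum.cong simp: algebra_simps)
    finally have "(\<Sum>k\<le>n. real (n choose k) * b k * t ^ k) = a * s ^ n" using s(2) by simp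
    also have "s ^ n = (1 + t\<^sup>2) ^ Suc i" unfolding n_def power_mult s(1) ..
    finally show ?thesis .
  qed
  have "(\<Sum>k\<le>n. monom (real (n choose k) * b k) k) = smult a ([:1, 0, 1:] ^ Suc i)"
    by (rule poly_eq_poly_eq_iff[THEN iffD1])
      (auto simp: poly_sum poly_monom id poly_power power2_eq_square simp del: power_Suc)
  from arg_cong[OF this, of "\<lambda>p. coeff p 2"]
  moreover have "coeff (\<Sum>k\<le>n. monom (real (n choose k) * b k) k) 2 = real (n choose 2) * b 2"
  proof -
    have "2 \<le> n" by (simp add: n_def)
    then show ?thesis by (simp add: coeff_sum)
  qed
  ultimately have "real (n choose 2) * b 2 = a * (real i + 1)"
    unfolding coeff_smult coeff_one_plus_square_power by simp
  moreover have "real (n choose 2) = (real i + 1) * (2 * real i + 1)"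
    unfolding n_def choose_two by (simp add: algebra_simps)
  ultimately have 1: "(2 * real i + 1) * b 2 = a" by simp
  have "b 2 = (LINT u|surface. ((u $ 3) ^ (2 * i) - (u $ 3) ^ n) / 2 + poly (monom (1/2) (2 * i)) (u $ 3) * Re (zz u ^ 2))"
    unfolding b_def
  proof (rule surface_cong)
    fix u :: "real^3" assume "u \<in> S2"
    then have e: "(u $ 3)\<^sup>2 = 1 - (u $ 1)\<^sup>2 - (u $ 2)\<^sup>2" using norm3[of u] by simp
    have f1: "(u $ 3) ^ n = (u $ 3) ^ (2 * i) * (1 - (u $ 1)\<^sup>2 - (u $ 2)\<^sup>2)"
      unfolding e[symmetric] n_def by (simp add: power2_eq_square)
    have f2: "poly (monom (1/2) (2 * i)) (u $ 3) * Re (zz u ^ 2) = (u $ 3) ^ (2 * i) * ((u $ 1)\<^sup>2 - (u $ 2)\<^sup>2) / 2"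
      by (simp add: zz_def poly_monom power2_eq_square)
    have f3: "(h - h * (1 - x - y)) / 2 + h * (x - y) / 2 = x * h" for h x y :: real
      by (simp add: field_simps)
    show "(u $ 1)\<^sup>2 * (u $ 3) ^ (n - 2) = ((u $ 3) ^ (2 * i) - (u $ 3) ^ n) / 2 + poly (monom (1/2) (2 * i)) (u $ 3) * Re (zz u ^ 2)"
      unfolding f1 f2 f3 by (simp add: n_def)
  qed
  also have "\<dots> = (4 * pi / (2 * real i + 1) - a) / 2"
  proof -
    have "integrable surface (\<lambda>u. (u $ 3) ^ k)" for k
      by (intro integrable_surface continuous_intros)
    moreover have "integrable surface (\<lambda>u. poly (monom (1/2) (2 * i)) (u $ 3) * Re (zz u ^ 2))"
      by (intro integrable_surface continuous_intros)
    ultimately show ?thesis unfolding a_def Suc.IH[symmetric] by (simp add: integral_azimuthal)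
  qed
  finally have "a * (2 * real i + 3) = 4 * pi" using 1 by (simp add: field_simps)
  then show ?case unfolding a_def n_def by (simp add: field_simps)
qed

lemma poly_functional_ext:
  fixes A B :: "real poly \<Rightarrow> real"
  assumes "\<And>p q. A (p + q) = A p + A q" "\<And>c p. A (smult c p) = c * A p"
    and "\<And>p q. B (p + q) = B p + B q" "\<And>c p. B (smult c p) = c * B p"
    and m: "\<And>n. A (monom 1 n) = B (monom 1 n)"
  shows "A p = B p"
proof -
  have 0: "A 0 = 0" "B 0 = 0" using assms(2)[of 0 0] assms(4)[of 0 0] by auto
  have "A (\<Sum>i\<in>I. monom (c i) i) = B (\<Sum>i\<in>I. monom (c i) i)" if "finite I" for c and I :: "nat set"
    using that
  proof (induction I)
    case (insert i I)
    have "monom (c i) i = smult (c i) (monom 1 i)" by (simp add: smult_monom)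
    then show ?case using insert.IH unfolding sum.insert[OF insert.hyps] assms(1,3)
      by (simp add: assms(2,4) m)
  qed (simp add: 0)
  from this[of "{..degree p}" "coeff p"] show ?thesis by (simp add: poly_as_sum_of_monoms)
qed

text \<open>Archimedes' hat-box theorem in the form needed here: the height is uniformly distributed. Both sides are
linear in \<open>F\<close>, so the moments suffice.\<close>

lemma integral_height: "(LINT u|surface. poly (pderiv F) (u $ 3)) = 2 * pi * (poly F 1 - poly F (-1))"
proof (rule poly_functional_ext[of "\<lambda>F. LINT u|surface. poly (pderiv F) (u $ 3)"])
  fix n :: nat
  show "(LINT u|surface. poly (pderiv (monom 1 n)) (u $ 3)) = 2 * pi * (poly (monom 1 n) 1 - poly (monom 1 n) (-1))"
  proof (cases "even n")
    case True
    then show ?thesis using height_moment_odd[of "n - 1"] by (cases "n = 0") (auto simp: pderiv_monom poly_monom)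
  next
    case False
    then obtain j where "n = 2 * j + 1" by (elim oddE)
    then show ?thesis using height_moment_even[of j] by (simp add: pderiv_monom poly_monom) (simp add: field_simps)
  qed
next
  fix p q
  show "(LINT u|surface. poly (pderiv (p + q)) (u $ 3)) = (LINT u|surface. poly (pderiv p) (u $ 3)) + (LINT u|surface. poly (pderiv q) (u $ 3))"
    unfolding pderiv_add poly_add by (intro Bochner_Integration.integral_add integrable_surface continuous_intros)
qed (simp_all add: pderiv_smult algebra_simps)

text \<open>The inner products of associated Legendre functions of the same order \<open>k\<close>.\<close>

definition legI :: "nat \<Rightarrow> nat \<Rightarrow> nat \<Rightarrow> real" where
  "legI k l l' = (LINT u|surface. (1 - (u $ 3)\<^sup>2) ^ k * poly (Q l k) (u $ 3) * poly (Q l' k) (u $ 3))"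

text \<open>Integration by parts: \<open>w ^ Suc k * Q l (Suc k) * Q l' k\<close> vanishes at both poles, and the differential
equation computes its derivative.\<close>

lemma legI_Suc: "legI (Suc k) l l' = (real l - real k) * (real l + real k + 1) * legI k l l'"
proof -
  define w :: "real poly" where "w = [:1, 0, -1:]"
  have w: "poly w t = 1 - t\<^sup>2" "pderiv w = [:0, -2:]" for t by (auto simp: w_def power2_eq_square pderiv_pCons)
  define F where "F = w ^ Suc k * Q l (Suc k) * Q l' k"
  have "poly (pderiv F) t = (1 - t\<^sup>2) ^ Suc k * poly (Q l (Suc k)) t * poly (Q l' (Suc k)) t
      - (real l - real k) * (real l + real k + 1) * ((1 - t\<^sup>2) ^ k * poly (Q l k) t * poly (Q l' k) t)" for t
  proof -
    have "poly (pderiv F) t = (1 - t\<^sup>2) ^ Suc k * poly (Q l (Suc k)) t * poly (Q l' (Suc k)) t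
       + (1 - t\<^sup>2) ^ k * poly (Q l' k) t * ((1 - t\<^sup>2) * poly (Q l (Suc (Suc k))) t - 2 * (real k + 1) * t * poly (Q l (Suc k)) t)"
      unfolding F_def by (simp add: pderiv_mult pderiv_power_Suc pderiv_Q w poly_power del: power_Suc)
        (simp add: algebra_simps w)
    then show ?thesis unfolding legendre_ode by (simp add: algebra_simps)
  qed
  then have "(LINT u|surface. poly (pderiv F) (u $ 3)) = legI (Suc k) l l' - (real l - real k) * (real l + real k + 1) * legI k l l'"
    unfolding legI_def by (simp only:) (subst Bochner_Integration.integral_diff,
      auto intro!: integrable_surface continuous_intros simp del: power_Suc)
  moreover have "(LINT u|surface. poly (pderiv F) (u $ 3)) = 0"
    unfolding integral_height by (simp add: F_def w)
  ultimately show ?thesis by simp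
qed

lemma legI_sym: "legI k l l' = legI k l' l"
  by (simp add: legI_def mult.commute mult.left_commute)

lemma legI_eq: "k \<le> l \<Longrightarrow> legI k l l' = fact (l + k) / fact (l - k) * legI 0 l l'"
proof (induction k)
  case (Suc k)
  define a b where "a = real l - real k" and "b = real l + real k + 1"
  have "l - k = Suc (l - Suc k)" using Suc by simp
  then have f1: "fact (l - k) = a * fact (l - Suc k)" using Suc by (simp add: of_nat_diff a_def)
  have f2: "fact (l + Suc k) = b * fact (l + k)" by (simp add: b_def)
  have "a \<noteq> 0" using Suc by (simp add: a_def)
  then show ?case using Suc unfolding legI_Suc f1 f2 a_def[symmetric] b_def[symmetric] by (simp add: field_simps)
qed simp

text \<open>Symmetry together with \<open>legI_Suc\<close> forces \<open>legI k l l'\<close> to vanish for distinct degrees, because the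
eigenvalues differ.\<close>

lemma legI_0: "legI 0 l l' = (if l = l' then 4 * pi / (2 * real l + 1) else 0)"
proof (cases "l = l'")
  case False
  have "real l * (real l + 1) * legI 0 l l' = real l' * (real l' + 1) * legI 0 l l'"
    using legI_Suc[of 0 l l'] legI_Suc[of 0 l' l] by (simp add: legI_sym[of _ l' l])
  then have "((real l - real l') * (real l + real l' + 1)) * legI 0 l l' = 0" by (simp add: algebra_simps)
  moreover have "(real l - real l') * (real l + real l' + 1) \<noteq> 0" using False
    by (metis add_nonneg_pos eq_iff_diff_eq_0 mult_eq_0_iff of_nat_0_le_iff of_nat_add of_nat_eq_iff order_less_irrefl zero_less_one)
  ultimately show ?thesis using False by (metis mult_eq_0_iff)
next
  case True
  define c :: "nat \<Rightarrow> real" where "c k = 2 * fact (l - k) / fact (l + k)" for k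
  define g where "g k u = (1 - (u $ 3)\<^sup>2) ^ k * poly (Q l k) (u $ 3) * poly (Q l k) (u $ 3)" for k and u :: "real^3"
  have g: "integrable surface (g k)" for k
    unfolding g_def[abs_def] by (intro integrable_surface continuous_intros)
  have gI: "integral\<^sup>L surface (g k) = legI k l l" for k by (simp add: g_def[abs_def] legI_def)
  have "g 0 u + (\<Sum>k=1..l. c k * g k u) = 1" for u
    using legendre_addition[of l "u $ 3"] by (simp add: g_def c_def power2_eq_square mult.assoc)
  then have "4 * pi = (LINT u|surface. g 0 u + (\<Sum>k=1..l. c k * g k u))" using surface_total by simp
  also have "\<dots> = legI 0 l l + (\<Sum>k=1..l. c k * legI k l l)"
    by (simp add: g gI)
  also have "\<dots> = legI 0 l l + (\<Sum>k=1..l. 2 * legI 0 l l)"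
    by (intro arg_cong2[where f="(+)"] sum.cong refl, subst legI_eq) (auto simp: c_def)
  finally have "(2 * real l + 1) * legI 0 l l = 4 * pi" by (simp add: algebra_simps)
  then show ?thesis using True by (simp add: field_simps)
qed

section \<open>Spherical harmonics: orthonormality, addition theorem, completeness\<close>

text \<open>The azimuthal factor of the spherical harmonic of order \<open>m\<close>.\<close>

definition az :: "int \<Rightarrow> real^3 \<Rightarrow> real" where
  "az m u = (if m = 0 then 1 else if m > 0 then sqrt 2 * Re (zz u ^ nat \<bar>m\<bar>) else sqrt 2 * Im (zz u ^ nat \<bar>m\<bar>))"

text \<open>The normalising constant of a spherical harmonic.\<close>

definition nrm :: "nat \<Rightarrow> nat \<Rightarrow> real" where
  "nrm l k = sqrt ((2 * real l + 1) / (4 * pi) * fact (l - k) / fact (l + k))"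

lemma sph_harm_eq: "sph_harm l m u = nrm l (nat \<bar>m\<bar>) * poly (Q l (nat \<bar>m\<bar>)) (u $ 3) * az m u"
  unfolding sph_harm_def Let_def az_def nrm_def Q_def zz_def by simp

lemma continuous_az [continuous_intros]: "continuous_on A (az m)"
  unfolding az_def[abs_def] by (cases "m = 0"; cases "m > 0") (auto intro!: continuous_intros)

lemma continuous_sph_harm [continuous_intros]: "continuous_on A (sph_harm l m)"
  unfolding sph_harm_eq[abs_def] by (intro continuous_intros)

lemma sum_int_symmetric:
  fixes f :: "int \<Rightarrow> 'a::comm_monoid_add"
  shows "(\<Sum>m\<in>{-int l..int l}. f m) = f 0 + (\<Sum>k=1..l. f (int k) + f (- int k))"
proof (induction l)
  case (Suc l)
  have "{-int (Suc l)..int (Suc l)} = insert (int (Suc l)) (insert (- int (Suc l)) {-int l..int l})" by auto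
  then have "(\<Sum>m\<in>{-int (Suc l)..int (Suc l)}. f m) = f (int (Suc l)) + (f (- int (Suc l)) + (\<Sum>m\<in>{-int l..int l}. f m))"
    by (simp del: of_nat_Suc)
  then show ?case unfolding Suc sum.cl_ivl_Suc by (simp add: ac_simps del: of_nat_Suc)
qed simp

text \<open>The azimuthal factors of orders \<open>m\<close> and \<open>-m\<close> have squares adding up to \<open>2 * (1 - z\<^sup>2) ^ m\<close>, which reduces
the sum to \<open>legendre_addition\<close>.\<close>

lemma addition_theorem:
  assumes "u \<in> S2" shows "(\<Sum>m\<in>{-int l..int l}. (sph_harm l m u)\<^sup>2) = (2 * real l + 1) / (4 * pi)"
proof -
  have n: "(nrm l k)\<^sup>2 = (2 * real l + 1) / (4 * pi) * (fact (l - k) / fact (l + k))" for k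
    by (simp add: nrm_def)
  have "(sph_harm l (int k) u)\<^sup>2 + (sph_harm l (- int k) u)\<^sup>2
      = (2 * real l + 1) / (4 * pi) * (2 * fact (l - k) / fact (l + k) * (1 - (u $ 3)\<^sup>2) ^ k * poly (Q l k) (u $ 3) ^ 2)"
    if "k \<in> {1..l}" for k
  proof -
    have "(Re (zz u ^ k))\<^sup>2 + (Im (zz u ^ k))\<^sup>2 = ((cmod (zz u))\<^sup>2) ^ k"
      unfolding cmod_power2[symmetric] norm_power by (simp add: power_mult[symmetric] mult.commute)
    also have "\<dots> = (1 - (u $ 3)\<^sup>2) ^ k" unfolding cmod_power2 zz_sphere[OF assms] ..
    finally have "2 * (Re (zz u ^ k))\<^sup>2 + 2 * (Im (zz u ^ k))\<^sup>2 = 2 * (1 - (u $ 3)\<^sup>2) ^ k" by linarith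
    then have "(az (int k) u)\<^sup>2 + (az (- int k) u)\<^sup>2 = 2 * (1 - (u $ 3)\<^sup>2) ^ k"
      using that by (simp add: az_def power_mult_distrib)
    moreover have "(sph_harm l (int k) u)\<^sup>2 + (sph_harm l (- int k) u)\<^sup>2
       = (nrm l k)\<^sup>2 * poly (Q l k) (u $ 3) ^ 2 * ((az (int k) u)\<^sup>2 + (az (- int k) u)\<^sup>2)"
      by (simp add: sph_harm_eq power_mult_distrib algebra_simps)
    ultimately show ?thesis by (simp add: n)
  qed
  then have "(\<Sum>m\<in>{-int l..int l}. (sph_harm l m u)\<^sup>2) = (2 * real l + 1) / (4 * pi) *
     (poly (Q l 0) (u $ 3) ^ 2 + (\<Sum>k=1..l. 2 * fact (l - k) / fact (l + k) * (1 - (u $ 3)\<^sup>2) ^ k * poly (Q l k) (u $ 3) ^ 2))"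
    unfolding sum_int_symmetric distrib_left sum_distrib_left
    by (intro arg_cong2[where f="(+)"] sum.cong refl) (auto simp: sph_harm_eq az_def power_mult_distrib n)
  then show ?thesis unfolding legendre_addition by simp
qed

text \<open>Product-to-sum formulas for \<open>z ^ a\<close>, with \<open>w\<close> in place of \<open>\<bar>z\<bar>\<^sup>2\<close>. They show that the products of
harmonics of different order integrate to zero, and that the span of the harmonics is an algebra.\<close>

lemma power_products:
  fixes z :: complex
  assumes w: "(Re z)\<^sup>2 + (Im z)\<^sup>2 = w"
  shows "Re (z ^ (b + d)) * Re (z ^ b) = (Re (z ^ (b + d + b)) + w ^ b * Re (z ^ d)) / 2"
    "Im (z ^ (b + d)) * Im (z ^ b) = (w ^ b * Re (z ^ d) - Re (z ^ (b + d + b))) / 2"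
    "Im (z ^ (b + d)) * Re (z ^ b) = (Im (z ^ (b + d + b)) + w ^ b * Im (z ^ d)) / 2"
    "Re (z ^ (b + d)) * Im (z ^ b) = (Im (z ^ (b + d + b)) - w ^ b * Im (z ^ d)) / 2"
proof -
  have "z * cnj z = of_real w" unfolding complex_mult_cnj w ..
  then have "(z * cnj z) ^ b = of_real (w ^ b)" by simp
  then have "z ^ (b + d) * cnj (z ^ b) = of_real (w ^ b) * z ^ d"
    by (simp add: power_mult_distrib power_add mult_ac)
  then have m: "Re (z ^ (b + d) * cnj (z ^ b)) = w ^ b * Re (z ^ d)" "Im (z ^ (b + d) * cnj (z ^ b)) = w ^ b * Im (z ^ d)"
    by (simp_all only: Re_complex_of_real Im_complex_of_real times_complex.sel mult_zero_left diff_zero add_0_right)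
  have p: "z ^ (b + d + b) = z ^ (b + d) * z ^ b" by (simp add: power_add)
  show "Re (z ^ (b + d)) * Re (z ^ b) = (Re (z ^ (b + d + b)) + w ^ b * Re (z ^ d)) / 2"
    "Im (z ^ (b + d)) * Im (z ^ b) = (w ^ b * Re (z ^ d) - Re (z ^ (b + d + b))) / 2"
    "Im (z ^ (b + d)) * Re (z ^ b) = (Im (z ^ (b + d + b)) + w ^ b * Im (z ^ d)) / 2"
    "Re (z ^ (b + d)) * Im (z ^ b) = (Im (z ^ (b + d + b)) - w ^ b * Im (z ^ d)) / 2"
    unfolding m[symmetric] p times_complex.sel cnj.sel by (simp_all add: field_simps)
qed

text \<open>The flag selects the real part. Unlike \<open>az\<close>, the functions carry no normalisation and their
order is a natural number, which suits the product formulas.\<close>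

definition trig :: "bool \<Rightarrow> nat \<Rightarrow> real^3 \<Rightarrow> real" where
  "trig c k u = (if c then Re (zz u ^ k) else Im (zz u ^ k))"

lemma continuous_trig [continuous_intros]: "continuous_on A (trig c k)"
  unfolding trig_def[abs_def] by (cases c) (auto intro!: continuous_intros)

lemma trig_product:
  fixes c c' :: bool
  assumes "b \<le> a"
  obtains \<sigma> \<tau> where "\<sigma> \<in> {1, -1 :: real}" "\<tau> \<in> {1, -1 :: real}" "c = c' \<Longrightarrow> \<tau> = 1"
    "\<And>u. u \<in> S2 \<Longrightarrow> trig c a u * trig c' b u =
      (\<sigma> * trig (c = c') (a + b) u + \<tau> * ((1 - (u $ 3)\<^sup>2) ^ b * trig (c = c') (a - b) u)) / 2"
proof -
  define d where "d = a - b"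
  have a: "a = b + d" using assms by (simp add: d_def)
  note P = power_products[OF zz_sphere, of _ b d]
  show thesis
  proof (cases c; cases c')
    assume "c" "c'" then show thesis
      by (intro that[of 1 1]) (simp_all add: trig_def a P)
  next
    assume "c" "\<not> c'" then show thesis
      by (intro that[of 1 "-1"]) (simp_all add: trig_def a P)
  next
    assume "\<not> c" "c'" then show thesis
      by (intro that[of 1 1]) (simp_all add: trig_def a P)
  next
    assume "\<not> c" "\<not> c'" then show thesis
      by (intro that[of "-1" 1]) (simp_all add: trig_def a P)
  qed
qed

lemma integral_trig: "1 \<le> k \<Longrightarrow> (LINT u|surface. poly p (u $ 3) * trig c k u) = 0"
  using integral_azimuthal by (cases c) (auto simp: trig_def)

lemma integral_trig_product:
  assumes "b \<le> a" "1 \<le> a"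
  shows "(LINT u|surface. poly p (u $ 3) * (trig c a u * trig c' b u)) =
    (if a = b \<and> c = c' then (LINT u|surface. poly p (u $ 3) * (1 - (u $ 3)\<^sup>2) ^ a) / 2 else 0)"
proof -
  obtain \<sigma> \<tau> where \<tau>: "c = c' \<Longrightarrow> \<tau> = 1"
    and e: "\<And>u. u \<in> S2 \<Longrightarrow> trig c a u * trig c' b u =
      (\<sigma> * trig (c = c') (a + b) u + \<tau> * ((1 - (u $ 3)\<^sup>2) ^ b * trig (c = c') (a - b) u)) / 2"
    by (rule trig_product[OF assms(1), of c c']) blast
  define w :: "real poly" where "w = [:1, 0, -1:]"
  have w: "poly w t = 1 - t\<^sup>2" for t by (auto simp: w_def power2_eq_square)
  have "(LINT u|surface. poly p (u $ 3) * (trig c a u * trig c' b u)) =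
     (LINT u|surface. \<sigma> / 2 * (poly p (u $ 3) * trig (c = c') (a + b) u) + \<tau> / 2 * (poly (p * w ^ b) (u $ 3) * trig (c = c') (a - b) u))"
    by (rule surface_cong) (simp add: e w poly_power field_simps)
  also have "\<dots> = \<sigma> / 2 * (LINT u|surface. poly p (u $ 3) * trig (c = c') (a + b) u)
     + \<tau> / 2 * (LINT u|surface. poly (p * w ^ b) (u $ 3) * trig (c = c') (a - b) u)"
    by (subst Bochner_Integration.integral_add) (auto intro!: integrable_surface continuous_intros)
  also have "(LINT u|surface. poly p (u $ 3) * trig (c = c') (a + b) u) = 0"
    using assms by (intro integral_trig) auto
  also have "\<tau> / 2 * (LINT u|surface. poly (p * w ^ b) (u $ 3) * trig (c = c') (a - b) u)
    = (if a = b \<and> c = c' then (LINT u|surface. poly p (u $ 3) * (1 - (u $ 3)\<^sup>2) ^ a) / 2 else 0)"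
  proof (cases "a = b")
    case True
    then show ?thesis using \<tau> by (simp add: trig_def w poly_power)
  next
    case False
    then show ?thesis using assms integral_trig[of "a - b" "p * w ^ b" "c = c'"] by simp
  qed
  finally show ?thesis by simp
qed

lemma az_trig: "az m u = (if m = 0 then 1 else sqrt 2) * trig (0 \<le> m) (nat \<bar>m\<bar>) u"
  by (auto simp: az_def trig_def)

lemma integral_az:
  "(LINT u|surface. poly p (u $ 3) * (az m u * az m' u)) =
     (if m = m' then (LINT u|surface. poly p (u $ 3) * (1 - (u $ 3)\<^sup>2) ^ nat \<bar>m\<bar>) else 0)"
proof -
  have *: "(LINT u|surface. poly p (u $ 3) * (az m u * az m' u)) =
     (if m = m' then (LINT u|surface. poly p (u $ 3) * (1 - (u $ 3)\<^sup>2) ^ nat \<bar>m\<bar>) else 0)" if le: "\<bar>m'\<bar> \<le> \<bar>m\<bar>" for m m'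
  proof (cases "m = 0")
    case True
    then show ?thesis using le by (simp add: az_def)
  next
    case False
    have "poly p (u $ 3) * (az m u * az m' u) = (if m' = 0 then sqrt 2 else 2) *
       (poly p (u $ 3) * (trig (0 \<le> m) (nat \<bar>m\<bar>) u * trig (0 \<le> m') (nat \<bar>m'\<bar>) u))" for u
      unfolding az_trig using False by (auto simp: mult_ac)
    then have "(LINT u|surface. poly p (u $ 3) * (az m u * az m' u)) = (if m' = 0 then sqrt 2 else 2) *
       (LINT u|surface. poly p (u $ 3) * (trig (0 \<le> m) (nat \<bar>m\<bar>) u * trig (0 \<le> m') (nat \<bar>m'\<bar>) u))"
      by (simp only: integral_mult_right_zero)
    moreover have "nat \<bar>m\<bar> = nat \<bar>m'\<bar> \<and> (0 \<le> m) = (0 \<le> m') \<longleftrightarrow> m = m'" by auto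
    ultimately show ?thesis using False le by (simp add: integral_trig_product)
  qed
  show ?thesis
  proof (cases "\<bar>m'\<bar> \<le> \<bar>m\<bar>")
    case True then show ?thesis by (rule *)
  next
    case False
    then show ?thesis using *[of m m'] by (auto simp: mult.commute[of "az m _"])
  qed
qed

lemma sph_harm_orthonormal:
  assumes "\<bar>m\<bar> \<le> int l" "\<bar>m'\<bar> \<le> int l'"
  shows "L2_inner surface (sph_harm l m) (sph_harm l' m') = (if l = l' \<and> m = m' then 1 else 0)"
proof -
  define k where "k = nat \<bar>m\<bar>"
  have k: "k \<le> l" using assms by (simp add: k_def)
  have "L2_inner surface (sph_harm l m) (sph_harm l' m') = nrm l k * nrm l' (nat \<bar>m'\<bar>) *
     (LINT u|surface. poly (Q l k * Q l' (nat \<bar>m'\<bar>)) (u $ 3) * (az m u * az m' u))"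
    unfolding L2_inner_def sph_harm_eq k_def[symmetric]
    by (simp add: mult_ac flip: Bochner_Integration.integral_mult_right_zero)
  also have "\<dots> = (if m = m' then nrm l k * nrm l' k * legI k l l' else 0)"
    unfolding integral_az legI_def k_def by (simp add: mult_ac)
  also have "\<dots> = (if l = l' \<and> m = m' then (nrm l k)\<^sup>2 * (fact (l + k) / fact (l - k) * (4 * pi / (2 * real l + 1))) else 0)"
    using k by (subst legI_eq[OF k]) (simp add: legI_0 power2_eq_square)
  also have "(nrm l k)\<^sup>2 * (fact (l + k) / fact (l - k) * (4 * pi / (2 * real l + 1))) = 1"
  proof -
    have "2 * real l + 1 \<noteq> 0" by linarith
    then show ?thesis by (simp add: nrm_def)
  qed
  finally show ?thesis .
qed

text \<open>The linear span of all \<open>poly p z * trig c k\<close>, with no relation required between \<open>k\<close> and the degree of \<open>p\<close>.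
It is closed under products and contains the coordinates, so it contains every polynomial.\<close>

inductive harm_span :: "(real^3 \<Rightarrow> real) \<Rightarrow> bool" where
  base: "harm_span (\<lambda>u. poly p (u $ 3) * trig c k u)"
| add: "harm_span f \<Longrightarrow> harm_span g \<Longrightarrow> harm_span (\<lambda>u. f u + g u)"

lemma harm_span_cont: "harm_span f \<Longrightarrow> continuous_on A f"
  by (induction rule: harm_span.induct) (auto intro!: continuous_intros)

lemma harm_span_mult_base:
  "\<exists>h. harm_span h \<and> (\<forall>u\<in>S2. h u = (poly p (u $ 3) * trig c a u) * (poly q (u $ 3) * trig c' b u))"
proof -
  have *: "\<exists>h. harm_span h \<and> (\<forall>u\<in>S2. h u = (poly p (u $ 3) * trig c a u) * (poly q (u $ 3) * trig c' b u))"
    if le: "b \<le> a" for p q a b c c'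
  proof -
    obtain \<sigma> \<tau> where e: "\<And>u. u \<in> S2 \<Longrightarrow> trig c a u * trig c' b u =
      (\<sigma> * trig (c = c') (a + b) u + \<tau> * ((1 - (u $ 3)\<^sup>2) ^ b * trig (c = c') (a - b) u)) / 2"
      by (rule trig_product[OF le, of c c']) blast
    define w :: "real poly" where "w = [:1, 0, -1:]"
    have w: "poly w t = 1 - t\<^sup>2" for t by (auto simp: w_def power2_eq_square)
    let ?h = "\<lambda>u. poly (smult (\<sigma> / 2) (p * q)) (u $ 3) * trig (c = c') (a + b) u
       + poly (smult (\<tau> / 2) (p * q * w ^ b)) (u $ 3) * trig (c = c') (a - b) u"
    have "?h u = (poly p (u $ 3) * trig c a u) * (poly q (u $ 3) * trig c' b u)" if "u \<in> S2" for u
    proof -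
      have "(poly p (u $ 3) * trig c a u) * (poly q (u $ 3) * trig c' b u) = poly p (u $ 3) * poly q (u $ 3) * (trig c a u * trig c' b u)"
        by (simp add: mult_ac)
      then show ?thesis unfolding e[OF that] by (simp add: w poly_power field_simps)
    qed
    moreover have "harm_span ?h" by (intro harm_span.intros)
    ultimately show ?thesis by blast
  qed
  show ?thesis
  proof (cases "b \<le> a")
    case False
    then show ?thesis using *[of a b q c' p c] by (auto simp: mult.commute)
  qed (rule *)
qed

lemma harm_span_mult:
  assumes "harm_span f" "harm_span g"
  shows "\<exists>h. harm_span h \<and> (\<forall>u\<in>S2. h u = f u * g u)"
  using assms
proof (induction f rule: harm_span.induct)
  case (base p c a)
  from base show ?case
  proof (induction g rule: harm_span.induct)
    case (base q c' b)
    show ?case by (rule harm_span_mult_base)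
  next
    case (add g g')
    then obtain h h' where "harm_span h" "harm_span h'" "\<forall>u\<in>S2. h u = (poly p (u $ 3) * trig c a u) * g u"
      "\<forall>u\<in>S2. h' u = (poly p (u $ 3) * trig c a u) * g' u" by blast
    then show ?case by (intro exI[of _ "\<lambda>u. h u + h' u"]) (auto intro: harm_span.intros simp: distrib_left)
  qed
next
  case (add f f')
  then obtain h h' where "harm_span h" "harm_span h'" "\<forall>u\<in>S2. h u = f u * g u" "\<forall>u\<in>S2. h' u = f' u * g u" by blast
  then show ?case by (intro exI[of _ "\<lambda>u. h u + h' u"]) (auto intro: harm_span.intros simp: distrib_right)
qed

lemma polynomial_harm_span:
  assumes "real_polynomial_function (f :: real^3 \<Rightarrow> real)"
  shows "\<exists>h. harm_span h \<and> (\<forall>u\<in>S2. h u = f u)"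
  using assms
proof (induction rule: real_polynomial_function.induct)
  case (linear f)
  interpret bounded_linear f by fact
  define v where "v i = f (axis i 1)" for i
  have "f u = v 1 * u $ 1 + v 2 * u $ 2 + v 3 * u $ 3" for u
  proof -
    have "u = (u $ 1) *\<^sub>R axis 1 1 + (u $ 2) *\<^sub>R axis 2 1 + (u $ 3) *\<^sub>R axis 3 1"
      by (simp add: vec_eq_iff forall_3 axis_def)
    then have "f u = f ((u $ 1) *\<^sub>R axis 1 1 + (u $ 2) *\<^sub>R axis 2 1 + (u $ 3) *\<^sub>R axis 3 1)" by simp
    then show ?thesis unfolding add scaleR v_def by simp
  qed
  then have "(\<lambda>u. poly [:v 1:] (u $ 3) * trig True 1 u + (poly [:v 2:] (u $ 3) * trig False 1 u + poly [:0, v 3:] (u $ 3) * trig True 0 u)) = f"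
    by (auto simp: trig_def zz_def)
  moreover have "harm_span (\<lambda>u. poly [:v 1:] (u $ 3) * trig True 1 u + (poly [:v 2:] (u $ 3) * trig False 1 u + poly [:0, v 3:] (u $ 3) * trig True 0 u))"
    by (intro harm_span.intros)
  ultimately show ?case by metis
next
  case (const c)
  have "(\<lambda>u. poly [:c:] (u $ 3) * trig True 0 u) = (\<lambda>u. c)" by (auto simp: trig_def)
  then show ?case by (metis harm_span.base)
next
  case (add f g)
  then obtain h h' where "harm_span h" "harm_span h'" "\<forall>u\<in>S2. h u = f u" "\<forall>u\<in>S2. h' u = g u" by blast
  then show ?case by (intro exI[of _ "\<lambda>u. h u + h' u"]) (auto intro: harm_span.intros)
next
  case (mult f g)
  then obtain h h' where h: "harm_span h" "harm_span h'" "\<forall>u\<in>S2. h u = f u" "\<forall>u\<in>S2. h' u = g u" by blast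
  then show ?case using harm_span_mult[OF h(1,2)] by metis
qed

text \<open>A continuous function orthogonal to all harmonics is orthogonal to each \<open>poly p z * trig c k\<close>, because the
polynomials \<open>Q (k + j) k\<close> have degree \<open>j\<close> and form a basis. It is therefore orthogonal to all polynomials;
these are uniformly dense by the Stone-Weierstrass theorem, so it is orthogonal to itself.\<close>

lemma sph_harm_complete:
  assumes f: "continuous_on S2 f"
    and 0: "\<And>l m. \<bar>m\<bar> \<le> int l \<Longrightarrow> L2_inner surface f (sph_harm l m) = 0"
    and u: "u \<in> S2"
  shows "f u = 0"
proof -
  have int: "integrable surface (\<lambda>u. f u * g u)" if "continuous_on S2 g" for g
    using f that by (intro integrable_surface continuous_intros)
  have orth_Q: "(LINT u|surface. f u * (poly (Q l k) (u $ 3) * trig c k u)) = 0" if "k \<le> l" "c \<or> 0 < k" for l k c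
  proof -
    define m where "m = (if c then int k else - int k)"
    have m: "nat \<bar>m\<bar> = k" "\<bar>m\<bar> \<le> int l" "c = (0 \<le> m)" using that by (auto simp: m_def)
    have "0 = nrm l k * (if m = 0 then 1 else sqrt 2) * (LINT u|surface. f u * (poly (Q l k) (u $ 3) * trig c k u))"
      using 0[OF m(2)] unfolding L2_inner_def sph_harm_eq az_trig m(1) m(3)[symmetric]
      by (simp add: mult_ac flip: Bochner_Integration.integral_mult_right_zero)
    moreover have "nrm l k \<noteq> 0" by (auto simp: nrm_def add_nonneg_eq_0_iff)
    ultimately show ?thesis by (auto split: if_splits)
  qed
  have orth_base: "(LINT u|surface. f u * (poly p (u $ 3) * trig c k u)) = 0" for p c k
  proof (cases "c \<or> 0 < k")
    case False
    then show ?thesis by (simp add: trig_def)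
  next
    case True
    show ?thesis
    proof (induction "degree p" arbitrary: p rule: less_induct)
      case less
      define q where "q = Q (k + degree p) k"
      define s where "s = lead_coeff p / lead_coeff q"
      have dq: "degree q = degree p" "q \<noteq> 0" by (auto simp: q_def degree_Q Q_nz)
      define p' where "p' = p - smult s q"
      have p: "p = p' + smult s q" by (simp add: p'_def)
      have "(LINT u|surface. f u * (poly p' (u $ 3) * trig c k u)) = 0"
      proof (cases "degree p = 0")
        case True
        have "p' = 0" using dq True unfolding p'_def s_def
          by (auto elim!: degree_eq_zeroE simp: )
        then show ?thesis by simp
      next
        case False
        have "coeff q (degree p) \<noteq> 0" using dq by (metis leading_coeff_0_iff)
        then have "coeff p' (degree p) = 0" using dq by (simp add: p'_def s_def)
        moreover have "degree p' \<le> degree p" unfolding p'_def using dq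
          by (intro degree_diff_le) (auto intro: order_trans[OF degree_smult_le])
        ultimately have "degree p' < degree p" using False
          by (metis degree_0 le_neq_implies_less leading_coeff_0_iff not_gr_zero)
        then show ?thesis by (rule less)
      qed
      moreover have "(LINT u|surface. f u * (poly q (u $ 3) * trig c k u)) = 0"
        unfolding q_def by (rule orth_Q) (use True in auto)
      moreover have "(LINT u|surface. f u * (poly p (u $ 3) * trig c k u)) =
         (LINT u|surface. f u * (poly p' (u $ 3) * trig c k u) + s * (f u * (poly q (u $ 3) * trig c k u)))"
        by (subst p) (simp add: algebra_simps)
      moreover have "\<dots> = (LINT u|surface. f u * (poly p' (u $ 3) * trig c k u)) + s * (LINT u|surface. f u * (poly q (u $ 3) * trig c k u))"
        by (subst Bochner_Integration.integral_add) (auto intro!: int continuous_intros)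
      ultimately show ?case by simp
    qed
  qed
  have orth: "(LINT u|surface. f u * h u) = 0" if "harm_span h" for h
    using that
  proof induction
    case (add g h)
    then show ?case by (simp add: distrib_left int harm_span_cont)
  qed (rule orth_base)
  have bound: "(LINT u|surface. (f u)\<^sup>2) \<le> \<epsilon> * (LINT u|surface. \<bar>f u\<bar>)" if "0 < \<epsilon>" for \<epsilon>
  proof -
    obtain g where g: "real_polynomial_function g" "\<And>u. u \<in> S2 \<Longrightarrow> \<bar>f u - g u\<bar> < \<epsilon>"
      using Stone_Weierstrass_real_polynomial_function[OF compact_sphere f \<open>0 < \<epsilon>\<close>] by metis
    obtain h where h: "harm_span h" "\<And>u. u \<in> S2 \<Longrightarrow> h u = g u" using polynomial_harm_span[OF g(1)] by blast
    have "(LINT u|surface. (f u)\<^sup>2) = (LINT u|surface. f u * f u) - (LINT u|surface. f u * h u)"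
      by (simp add: orth[OF h(1)] power2_eq_square)
    also have "\<dots> = (LINT u|surface. f u * f u - f u * h u)"
      by (subst Bochner_Integration.integral_diff) (auto intro!: int f harm_span_cont h)
    also have "\<dots> \<le> (LINT u|surface. \<epsilon> * \<bar>f u\<bar>)"
    proof (rule integral_mono)
      show "integrable surface (\<lambda>u. f u * f u - f u * h u)"
        by (intro Bochner_Integration.integrable_diff int f harm_span_cont h)
      show "integrable surface (\<lambda>u. \<epsilon> * \<bar>f u\<bar>)" using f by (intro integrable_surface continuous_intros)
      fix u assume "u \<in> space surface"
      then have "\<bar>f u - h u\<bar> \<le> \<epsilon>" using g(2)[of u] h(2)[of u] by simp
      then have "\<bar>f u\<bar> * \<bar>f u - h u\<bar> \<le> \<bar>f u\<bar> * \<epsilon>" by (rule mult_left_mono) simp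
      then have "\<bar>f u * (f u - h u)\<bar> \<le> \<epsilon> * \<bar>f u\<bar>" by (simp add: abs_mult mult.commute)
      then show "f u * f u - f u * h u \<le> \<epsilon> * \<bar>f u\<bar>" by (simp add: algebra_simps)
    qed
    finally show ?thesis by simp
  qed
  have "(LINT u|surface. (f u)\<^sup>2) \<le> 0"
  proof (rule field_le_epsilon)
    fix \<delta> :: real assume "0 < \<delta>"
    define A where "A = (LINT u|surface. \<bar>f u\<bar>)"
    have A: "0 \<le> A" by (simp add: A_def)
    have "\<delta> / (A + 1) * A \<le> \<delta>" using A \<open>0 < \<delta>\<close> by (simp add: field_simps)
    moreover have "0 < \<delta> / (A + 1)" using A \<open>0 < \<delta>\<close> by simp
    ultimately show "(LINT u|surface. (f u)\<^sup>2) \<le> 0 + \<delta>" using bound[of "\<delta> / (A + 1)"] by (simp add: A_def)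
  qed
  moreover have "0 \<le> (LINT u|surface. (f u)\<^sup>2)" by simp
  ultimately show ?thesis by (intro surface_positive[OF f _ u]) linarith
qed

section \<open>Enumerating the spherical harmonics and their tensor products\<close>

definition harm_index :: "(nat \<times> int) set" where "harm_index = (SIGMA l:UNIV. {-int l..int l})"

text \<open>The harmonics are numbered by natural numbers in an arbitrary order; sums of non-negative terms do not depend on it.\<close>

definition idx :: "nat \<Rightarrow> nat \<times> int" where "idx = from_nat_into harm_index"

definition harmonic :: "nat \<Rightarrow> real^3 \<Rightarrow> real" where "harmonic k = sph_harm (fst (idx k)) (snd (idx k))"

definition deg :: "nat \<Rightarrow> nat" where "deg k = fst (idx k)"

lemma bij_idx: "bij_betw idx UNIV harm_index"
proof -
  have "infinite harm_index"
  proof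
    assume "finite harm_index"
    then have "finite ((\<lambda>l. (l, 0 :: int)) -` harm_index)" by (rule finite_vimageI) (simp add: inj_on_def)
    moreover have "(\<lambda>l. (l, 0 :: int)) -` harm_index = UNIV" by (auto simp: harm_index_def)
    ultimately show False by simp
  qed
  then show ?thesis unfolding idx_def by (intro bij_betw_from_nat_into) auto
qed

lemma idx_harm: "\<bar>snd (idx k)\<bar> \<le> int (fst (idx k))"
proof -
  have "idx k \<in> harm_index" using bij_idx by (auto simp: bij_betw_def)
  then show ?thesis by (cases "idx k") (auto simp: harm_index_def)
qed

lemma idx_inj: "idx j = idx k \<longleftrightarrow> j = k"
  using bij_idx by (auto simp: bij_betw_def inj_on_def)

lemma idx_surj: assumes "\<bar>m\<bar> \<le> int l" obtains k where "idx k = (l, m)"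
proof -
  have "(l, m) \<in> range idx" using bij_idx assms by (auto simp: bij_betw_def harm_index_def)
  then show ?thesis using that by fastforce
qed

lemma suminf_idx:
  fixes F :: "nat \<times> int \<Rightarrow> ennreal"
  shows "(\<Sum>k. F (idx k)) = (\<Sum>l. \<Sum>m\<in>{-int l..int l}. F (l, m))"
proof -
  have "(\<Sum>k. F (idx k)) = (\<integral>\<^sup>+k. F (idx k) \<partial>count_space UNIV)" by (rule nn_integral_count_space_nat[symmetric])
  also have "\<dots> = (\<integral>\<^sup>+x. F x \<partial>count_space harm_index)" by (rule nn_integral_bij_count_space[OF bij_idx])
  also have "\<dots> = (\<integral>\<^sup>+x. F x * indicator harm_index x \<partial>count_space UNIV)"
    by (rule nn_integral_count_space_indicator) simp
  also have "\<dots> = (\<integral>\<^sup>+l. \<integral>\<^sup>+m. F (l, m) * indicator harm_index (l, m) \<partial>count_space UNIV \<partial>count_space UNIV)"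
    by (rule nn_integral_fst_count_space[symmetric])
  also have "\<dots> = (\<integral>\<^sup>+l. (\<Sum>m\<in>{-int l..int l}. F (l, m)) \<partial>count_space UNIV)"
  proof (rule nn_integral_cong)
    fix l :: nat
    have "(\<integral>\<^sup>+m. F (l, m) * indicator harm_index (l, m) \<partial>count_space UNIV)
      = (\<integral>\<^sup>+m. F (l, m) * indicator {-int l..int l} m \<partial>count_space UNIV)"
      by (intro nn_integral_cong) (auto simp: harm_index_def indicator_def)
    also have "\<dots> = (\<integral>\<^sup>+m. F (l, m) \<partial>count_space {-int l..int l})"
      by (rule nn_integral_count_space_indicator[symmetric]) simp
    also have "\<dots> = (\<Sum>m\<in>{-int l..int l}. F (l, m))" by (rule nn_integral_count_space_finite) simp
    finally show "(\<integral>\<^sup>+m. F (l, m) * indicator harm_index (l, m) \<partial>count_space UNIV) = (\<Sum>m\<in>{-int l..int l}. F (l, m))" .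
  qed
  also have "\<dots> = (\<Sum>l. \<Sum>m\<in>{-int l..int l}. F (l, m))" by (rule nn_integral_count_space_nat)
  finally show ?thesis .
qed

text \<open>Pairs of harmonics are numbered by the standard pairing of natural numbers.\<close>

definition fst2 :: "nat \<Rightarrow> nat" where "fst2 k = fst (prod_decode k)"
definition snd2 :: "nat \<Rightarrow> nat" where "snd2 k = snd (prod_decode k)"

lemma suminf_pair: "(\<Sum>k. F (fst2 k) (snd2 k) :: ennreal) = (\<Sum>a. \<Sum>b. F a b)"
  using suminf_ennreal_2dimen[of "\<lambda>a. \<Sum>b. F a b" "\<lambda>(a, b). F a b"]
  by (simp add: case_prod_unfold fst2_def snd2_def)

lemma suminf_idx2:
  fixes F :: "nat \<times> int \<Rightarrow> nat \<times> int \<Rightarrow> ennreal"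
  shows "(\<Sum>k. F (idx (fst2 k)) (idx (snd2 k))) =
    (\<Sum>l. \<Sum>l'. \<Sum>m\<in>{-int l..int l}. \<Sum>m'\<in>{-int l'..int l'}. F (l, m) (l', m'))"
proof -
  have "(\<Sum>k. F (idx (fst2 k)) (idx (snd2 k))) = (\<Sum>a. \<Sum>b. F (idx a) (idx b))"
    by (rule suminf_pair)
  also have "\<dots> = (\<Sum>l. \<Sum>m\<in>{-int l..int l}. \<Sum>b. F (l, m) (idx b))" by (rule suminf_idx)
  also have "\<dots> = (\<Sum>l. \<Sum>m\<in>{-int l..int l}. \<Sum>l'. \<Sum>m'\<in>{-int l'..int l'}. F (l, m) (l', m'))"
    by (simp only: suminf_idx)
  also have "\<dots> = (\<Sum>l. \<Sum>l'. \<Sum>m\<in>{-int l..int l}. \<Sum>m'\<in>{-int l'..int l'}. F (l, m) (l', m'))"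
    by (intro suminf_cong suminf_sum[symmetric]) simp
  finally show ?thesis .
qed

lemma inj_pair: "fst2 j = fst2 k \<and> snd2 j = snd2 k \<longleftrightarrow> j = k"
  unfolding fst2_def snd2_def by (metis prod_eq_iff prod_decode_inverse)

lemma surj_pair: obtains k where "fst2 k = a" "snd2 k = b"
  using that[of "prod_encode (a, b)"] by (simp add: fst2_def snd2_def)

lemma continuous_harmonic [continuous_intros]: "continuous_on A (harmonic k)"
  unfolding harmonic_def by (rule continuous_sph_harm)

lemma meas_surface: "continuous_on S2 (f :: real^3 \<Rightarrow> real) \<Longrightarrow> f \<in> borel_measurable surface"
  using borel_measurable_continuous_on_restrict by (simp cong: measurable_cong_sets add: sets_surface)

interpretation sph: orthonormal_system surface S2 harmonic
proof (rule orthonormal_system.intro)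
  show "finite_measure surface" by (rule finite_surface)
  show "space surface = S2" by (rule space_surface)
  show "compact S2" by (rule compact_sphere)
  show "continuous_on S2 (harmonic k)" for k by (rule continuous_harmonic)
  show "f \<in> borel_measurable surface" if "continuous_on S2 f" for f :: "real^3 \<Rightarrow> real"
    using that by (rule meas_surface)
  show "L2_inner surface (harmonic j) (harmonic k) = (if j = k then 1 else 0)" for j k
    unfolding harmonic_def using sph_harm_orthonormal[OF idx_harm idx_harm, of j k] idx_inj[of j k]
    by (simp add: prod_eq_iff)
  fix f and x :: "real^3" assume f: "continuous_on S2 f" and 0: "\<And>k. L2_inner surface f (harmonic k) = 0" and x: "x \<in> S2"
  show "f x = 0"
  proof (rule sph_harm_complete[OF f _ x])
    fix l m assume "\<bar>m\<bar> \<le> int l"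
    then obtain k where "idx k = (l, m)" using idx_surj by blast
    then show "L2_inner surface f (sph_harm l m) = 0" using 0[of k] by (simp add: harmonic_def)
  qed
qed

interpretation surf: finite_measure surface by (rule finite_surface)
interpretation surf2: pair_sigma_finite surface surface ..
interpretation fsurf2: finite_measure surface2
  by (rule finite_measure_pair_measure[OF finite_surface finite_surface])

lemma space_surface2: "space surface2 = S2 \<times> S2" by (simp add: space_pair_measure)

lemma meas_surface2:
  assumes "continuous_on (S2 \<times> S2) (f :: _ \<Rightarrow> real)" shows "f \<in> borel_measurable surface2"
proof -
  have i: "(\<lambda>x. x) \<in> surface \<rightarrow>\<^sub>M borel"
    by (rule measurable_cong_sets[OF sets_surface refl, THEN equalityD2, THEN subsetD])
      (rule measurable_restrict_space1, simp)
  have "(\<lambda>x. (fst x, snd x)) \<in> surface2 \<rightarrow>\<^sub>M borel \<Otimes>\<^sub>M borel"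
    by (intro measurable_Pair measurable_compose[OF measurable_fst i] measurable_compose[OF measurable_snd i])
  then have "(\<lambda>x. x) \<in> surface2 \<rightarrow>\<^sub>M borel" by (simp add: borel_prod)
  then have "(\<lambda>x. x) \<in> surface2 \<rightarrow>\<^sub>M restrict_space borel (S2 \<times> S2)"
    by (intro measurable_restrict_space2) (auto simp: space_surface2)
  from measurable_compose[OF this borel_measurable_continuous_on_restrict[OF assms]] show ?thesis by simp
qed

lemma integrable_surface2:
  assumes "continuous_on (S2 \<times> S2) (f :: _ \<Rightarrow> real)" shows "integrable surface2 f"
proof -
  have "bounded (f ` (S2 \<times> S2))"
    by (rule compact_imp_bounded[OF compact_continuous_image[OF assms compact_Times[OF compact_sphere compact_sphere]]])
  then obtain C where "\<forall>x\<in>S2 \<times> S2. \<bar>f x\<bar> \<le> C" unfolding bounded_iff by auto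
  then show ?thesis
    by (intro fsurf2.integrable_const_bound[of _ C] AE_I2 meas_surface2 assms) (auto simp: space_surface2 simp del: mem_sphere_0)
qed

lemma integral_surface2:
  assumes "continuous_on (S2 \<times> S2) (f :: _ \<Rightarrow> real)"
  shows "(LINT x|surface2. f x) = (LINT u|surface. LINT v|surface. f (u, v))"
  using surf2.integral_fst[of "\<lambda>u v. f (u, v)"] integrable_surface2[OF assms] by simp

lemma continuous_slice: "continuous_on (S2 \<times> S2) f \<Longrightarrow> u \<in> S2 \<Longrightarrow> continuous_on S2 (\<lambda>v. f (u, v))"
  by (rule continuous_on_compose2[of _ f]) (auto intro!: continuous_intros)

lemma continuous_tensor [continuous_intros]:
  "continuous_on A f \<Longrightarrow> continuous_on B g \<Longrightarrow> continuous_on (A \<times> B) (tensor f g)"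
proof -
  assume f: "continuous_on A f" and g: "continuous_on B g"
  have "continuous_on (A \<times> B) (\<lambda>x. f (fst x))"
    by (rule continuous_on_compose2[OF f continuous_on_fst[OF continuous_on_id]]) auto
  moreover have "continuous_on (A \<times> B) (\<lambda>x. g (snd x))"
    by (rule continuous_on_compose2[OF g continuous_on_snd[OF continuous_on_id]]) auto
  ultimately show ?thesis unfolding tensor_def case_prod_unfold by (rule continuous_on_mult)
qed

lemma inner_tensor:
  assumes "continuous_on S2 f" "continuous_on S2 g" "continuous_on S2 f'" "continuous_on S2 g'"
  shows "L2_inner surface2 (tensor f g) (tensor f' g') = L2_inner surface f f' * L2_inner surface g g'"
proof -
  have "L2_inner surface2 (tensor f g) (tensor f' g') = (LINT u|surface. LINT v|surface. (f u * f' u) * (g v * g' v))"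
  proof -
    have c: "continuous_on (S2 \<times> S2) (\<lambda>x. tensor f g x * tensor f' g' x)"
      by (intro continuous_on_mult continuous_tensor assms)
    show ?thesis unfolding L2_inner_def integral_surface2[OF c]
      by (intro Bochner_Integration.integral_cong refl) (simp only: tensor_def case_prod_conv mult_ac)
  qed
  then show ?thesis unfolding L2_inner_def by simp
qed

definition harmonic2 :: "nat \<Rightarrow> (real^3) \<times> (real^3) \<Rightarrow> real" where
  "harmonic2 k = tensor (harmonic (fst2 k)) (harmonic (snd2 k))"

lemma continuous_param_integral:
  assumes h: "continuous_on (S2 \<times> S2) (h :: _ \<Rightarrow> real)"
  shows "continuous_on S2 (\<lambda>u. LINT v|surface. h (u, v))"
  unfolding continuous_on_sequentially comp_def
proof (intro allI impI ballI)
  fix x a assume a: "a \<in> S2" and x: "(\<forall>n. x n \<in> S2) \<and> x \<longlonglongrightarrow> a"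
  have "bounded (h ` (S2 \<times> S2))"
    by (rule compact_imp_bounded[OF compact_continuous_image[OF h compact_Times[OF compact_sphere compact_sphere]]])
  then obtain C where C: "\<forall>x\<in>S2 \<times> S2. \<bar>h x\<bar> \<le> C" unfolding bounded_iff by auto
  show "(\<lambda>n. LINT v|surface. h (x n, v)) \<longlonglongrightarrow> (LINT v|surface. h (a, v))"
  proof (rule integral_dominated_convergence[where w = "\<lambda>_. C"])
    show "(\<lambda>v. h (a, v)) \<in> borel_measurable surface" by (intro meas_surface continuous_slice h a)
    show "(\<lambda>v. h (x n, v)) \<in> borel_measurable surface" for n using x by (intro meas_surface continuous_slice h) auto
    show "AE v in surface. (\<lambda>n. h (x n, v)) \<longlonglongrightarrow> h (a, v)"
    proof (rule AE_I2)
      fix v assume "v \<in> space surface"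
      then have v: "v \<in> S2" by simp
      have "continuous_on S2 (\<lambda>u. h (u, v))"
        by (rule continuous_on_compose2[OF h]) (use v in \<open>auto intro!: continuous_intros\<close>)
      then show "(\<lambda>n. h (x n, v)) \<longlonglongrightarrow> h (a, v)" using x a unfolding continuous_on_sequentially comp_def by blast
    qed
    show "AE v in surface. norm (h (x n, v)) \<le> C" for n
      using C x by (intro AE_I2) (simp del: mem_sphere_0)
  qed simp
qed

interpretation sph2: orthonormal_system surface2 "S2 \<times> S2" harmonic2
proof (rule orthonormal_system.intro)
  show "finite_measure surface2" by (rule fsurf2.finite_measure_axioms)
  show "space surface2 = S2 \<times> S2" by (rule space_surface2)
  show "compact (S2 \<times> S2)" by (rule compact_Times[OF compact_sphere compact_sphere])
  show "continuous_on (S2 \<times> S2) (harmonic2 k)" for k unfolding harmonic2_def by (intro continuous_intros)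
  show "f \<in> borel_measurable surface2" if "continuous_on (S2 \<times> S2) f" for f :: "_ \<Rightarrow> real"
    using that by (rule meas_surface2)
  show "L2_inner surface2 (harmonic2 j) (harmonic2 k) = (if j = k then 1 else 0)" for j k
    unfolding harmonic2_def by (subst inner_tensor) (use inj_pair[of j k] in \<open>auto intro!: continuous_intros simp: sph.orth\<close>)
  fix f x assume f: "continuous_on (S2 \<times> S2) f" and 0: "\<And>k. L2_inner surface2 f (harmonic2 k) = 0"
    and x: "x \<in> S2 \<times> (S2 :: (real^3) set)"
  have cY: "continuous_on (S2 \<times> S2) (\<lambda>x. f x * harmonic b (snd x))" for b
    by (intro continuous_intros f continuous_on_compose2[OF continuous_harmonic[of UNIV]]) auto
  have z: "(LINT v|surface. f (u, v) * harmonic b v) = 0" if u: "u \<in> S2" for b u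
  proof (rule sph.complete[OF _ _ u])
    show "continuous_on S2 (\<lambda>u. LINT v|surface. f (u, v) * harmonic b v)"
      using continuous_param_integral[OF cY] by simp
    fix a
    obtain k where k: "fst2 k = a" "snd2 k = b" by (rule surj_pair)
    have "continuous_on (S2 \<times> S2) (\<lambda>x. f x * harmonic2 k x)"
      unfolding harmonic2_def by (intro continuous_intros f)
    from integral_surface2[OF this] 0[of k]
    show "L2_inner surface (\<lambda>u. LINT v|surface. f (u, v) * harmonic b v) (harmonic a) = 0"
      unfolding L2_inner_def harmonic2_def tensor_def k
      by (simp add: mult_ac flip: Bochner_Integration.integral_mult_right_zero)
  qed
  obtain u v where uv: "x = (u, v)" "u \<in> S2" "v \<in> S2" using x by auto
  have "f (u, v) = 0"
    by (rule sph.complete[OF continuous_slice[OF f uv(2)] _ uv(3)]) (use z[OF uv(2)] in \<open>simp add: L2_inner_def\<close>)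
  then show "f x = 0" using uv by simp
qed

lemma sobolev_normsq_idx:
  "sobolev_normsq s f = (\<Sum>k. ennreal (sobolev_weight s (deg k) * (sph.coef f k)\<^sup>2))"
proof -
  have w: "0 \<le> sobolev_weight s l" for l by (simp add: sobolev_weight_def)
  show ?thesis
    unfolding sobolev_normsq_def deg_def harmonic_def sum_distrib_left
      suminf_idx[of "\<lambda>x. ennreal (sobolev_weight s (fst x) * (L2_inner surface f (sph_harm (fst x) (snd x)))\<^sup>2)"]
    using w by (simp add: sum_ennreal)
qed

lemma sobolev2_normsq_idx:
  "sobolev2_normsq s g = (\<Sum>k. ennreal (sobolev_weight s (deg (fst2 k)) * sobolev_weight s (deg (snd2 k)) * (sph2.coef g k)\<^sup>2))"
proof -
  have w: "0 \<le> sobolev_weight s l" for l by (simp add: sobolev_weight_def)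
  show ?thesis
    unfolding sobolev2_normsq_def deg_def harmonic2_def harmonic_def sum_distrib_left
      suminf_idx2[of "\<lambda>x y. ennreal (sobolev_weight s (fst x) * sobolev_weight s (fst y) * (L2_inner surface2 g (tensor (sph_harm (fst x) (snd x)) (sph_harm (fst y) (snd y))))\<^sup>2)"]
    using w by (simp add: sum_ennreal sum_nonneg)
qed

text \<open>The terms of equal degree are summed by the addition theorem; the result does not depend on the point.\<close>

lemma kernel_sum:
  assumes "u \<in> S2" "\<And>l. 0 \<le> g l"
  shows "(\<Sum>k. ennreal ((harmonic k u)\<^sup>2 * g (deg k))) = (\<Sum>l. ennreal ((2 * real l + 1) / (4 * pi) * g l))"
proof -
  have "(\<Sum>k. ennreal ((harmonic k u)\<^sup>2 * g (deg k))) = (\<Sum>l. \<Sum>m\<in>{-int l..int l}. ennreal ((sph_harm l m u)\<^sup>2 * g l))"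
    using suminf_idx[of "\<lambda>x. ennreal ((sph_harm (fst x) (snd x) u)\<^sup>2 * g (fst x))"] by (simp add: harmonic_def deg_def)
  also have "\<dots> = (\<Sum>l. ennreal ((\<Sum>m\<in>{-int l..int l}. (sph_harm l m u)\<^sup>2) * g l))"
    using assms(2) by (simp add: sum_ennreal sum_distrib_right)
  finally show ?thesis unfolding addition_theorem[OF assms(1)] .
qed

lemma kernel_sum2:
  assumes "u \<in> S2" "v \<in> S2" "\<And>l l'. 0 \<le> g l l'"
  shows "(\<Sum>k. ennreal ((harmonic2 k (u, v))\<^sup>2 * g (deg (fst2 k)) (deg (snd2 k)))) =
    (\<Sum>l. \<Sum>l'. ennreal ((2 * real l + 1) / (4 * pi) * ((2 * real l' + 1) / (4 * pi)) * g l l'))"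
proof -
  have "(\<Sum>k. ennreal ((harmonic2 k (u, v))\<^sup>2 * g (deg (fst2 k)) (deg (snd2 k)))) =
     (\<Sum>l. \<Sum>l'. \<Sum>m\<in>{-int l..int l}. \<Sum>m'\<in>{-int l'..int l'}. ennreal ((sph_harm l m u)\<^sup>2 * (sph_harm l' m' v)\<^sup>2 * g l l'))"
    using suminf_idx2[of "\<lambda>x y. ennreal ((sph_harm (fst x) (snd x) u)\<^sup>2 * (sph_harm (fst y) (snd y) v)\<^sup>2 * g (fst x) (fst y))"]
    by (simp add: harmonic2_def harmonic_def deg_def tensor_def power_mult_distrib)
  also have "\<dots> = (\<Sum>l. \<Sum>l'. ennreal ((\<Sum>m\<in>{-int l..int l}. (sph_harm l m u)\<^sup>2) * (\<Sum>m'\<in>{-int l'..int l'}. (sph_harm l' m' v)\<^sup>2) * g l l'))"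
  proof (intro suminf_cong)
    fix l l'
    have "(\<Sum>m\<in>{-int l..int l}. \<Sum>m'\<in>{-int l'..int l'}. ennreal ((sph_harm l m u)\<^sup>2 * (sph_harm l' m' v)\<^sup>2 * g l l'))
      = ennreal (\<Sum>m\<in>{-int l..int l}. \<Sum>m'\<in>{-int l'..int l'}. (sph_harm l m u)\<^sup>2 * (sph_harm l' m' v)\<^sup>2 * g l l')"
      using assms(3) by (simp add: sum_ennreal sum_nonneg)
    also have "(\<Sum>m\<in>{-int l..int l}. \<Sum>m'\<in>{-int l'..int l'}. (sph_harm l m u)\<^sup>2 * (sph_harm l' m' v)\<^sup>2 * g l l')
      = (\<Sum>m\<in>{-int l..int l}. (sph_harm l m u)\<^sup>2) * (\<Sum>m'\<in>{-int l'..int l'}. (sph_harm l' m' v)\<^sup>2) * g l l'"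
      unfolding sum_product unfolding sum_distrib_right ..
    finally show "(\<Sum>m\<in>{-int l..int l}. \<Sum>m'\<in>{-int l'..int l'}. ennreal ((sph_harm l m u)\<^sup>2 * (sph_harm l' m' v)\<^sup>2 * g l l'))
      = ennreal ((\<Sum>m\<in>{-int l..int l}. (sph_harm l m u)\<^sup>2) * (\<Sum>m'\<in>{-int l'..int l'}. (sph_harm l' m' v)\<^sup>2) * g l l')" .
  qed
  finally show ?thesis unfolding addition_theorem[OF assms(1)] addition_theorem[OF assms(2)] .
qed

section \<open>Sobolev spaces and multiplier operators on the sphere\<close>

lemma summable_degrees:
  assumes "1 < s" "0 < c" and \<omega>: "\<And>l. c * (1 + real l) powr (2 * s) \<le> \<omega> l"
  shows "summable (\<lambda>l. (2 * real l + 1) / (4 * pi) / \<omega> l)"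
proof (rule summable_comparison_test')
  have "summable (\<lambda>l. real (Suc l) powr (1 - 2 * s))"
    using summable_Suc_iff[of "\<lambda>l. real l powr (1 - 2 * s)"] summable_real_powr_iff[of "1 - 2 * s"] assms(1) by simp
  then show "summable (\<lambda>l. 2 / (4 * pi * c) * real (Suc l) powr (1 - 2 * s))" by (rule summable_mult)
  fix l :: nat
  define x where "x = 1 + real l"
  have x: "0 < x" "1 \<le> x" by (auto simp: x_def)
  have w: "0 < c * x powr (2 * s)" "c * x powr (2 * s) \<le> \<omega> l" using \<omega>[of l] x assms(2) by (auto simp: x_def)
  have "norm ((2 * real l + 1) / (4 * pi) / \<omega> l) = (2 * real l + 1) / (4 * pi) / \<omega> l" using w by simp
  also have "\<dots> \<le> (2 * x) / (4 * pi) / (c * x powr (2 * s))"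
    using w x by (intro frac_le divide_right_mono) (auto simp: x_def)
  also have "\<dots> = 2 / (4 * pi * c) * (x / x powr (2 * s))" by simp
  also have "x / x powr (2 * s) = x powr (1 - 2 * s)" using x by (simp add: powr_diff)
  finally show "norm ((2 * real l + 1) / (4 * pi) / \<omega> l) \<le> 2 / (4 * pi * c) * real (Suc l) powr (1 - 2 * s)"
    by (simp add: x_def add.commute)
qed

lemma growth_lower:
  assumes "1 < s" "0 < c" and \<omega>: "\<And>l. c * (1 + real l) powr (2 * s) \<le> \<omega> l"
  shows "c \<le> \<omega> l" "0 < \<omega> l"
proof -
  have "1 \<le> (1 + real l) powr (2 * s)" using assms(1) by (intro ge_one_powr_ge_zero) auto
  then have "c * 1 \<le> c * (1 + real l) powr (2 * s)" using assms(2) by (intro mult_left_mono) auto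
  then show "c \<le> \<omega> l" using \<omega>[of l] by linarith
  then show "0 < \<omega> l" using assms(2) by linarith
qed

text \<open>By the addition theorem the kernel on the diagonal is a series of order \<open>(\<Sum>l. (2 * l + 1) / (1 + l) powr (2 * s))\<close>,
which converges for \<open>s > 1\<close>; the kernel of the tensor product is the square of it.\<close>

lemma sphere_kernel:
  assumes g: "1 < s" "0 < c" and \<omega>: "\<And>l. c * (1 + real l) powr (2 * s) \<le> \<omega> l"
  shows "\<exists>B. kernel_space surface S2 harmonic (\<lambda>k. \<omega> (deg k)) c B \<and>
    kernel_space surface2 (S2 \<times> S2) harmonic2 (\<lambda>k. \<omega> (deg (fst2 k)) * \<omega> (deg (snd2 k))) (c\<^sup>2) (B\<^sup>2)"
proof -
  note lo = growth_lower[OF g \<omega>]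
  have i0: "0 \<le> 1 / \<omega> l" for l using lo(2)[of l] by simp
  define a where "a l = (2 * real l + 1) / (4 * pi) / \<omega> l" for l
  have a: "0 \<le> a l" "summable a" for l
    using lo(2)[of l] summable_degrees[OF g \<omega>] by (auto simp: a_def[abs_def])
  define B where "B = suminf a"
  have B: "0 \<le> B" "(\<Sum>l. ennreal (a l)) = ennreal B"
    unfolding B_def using a by (auto intro: suminf_nonneg simp: ennreal_suminf_of_summable)
  have "kernel_space surface S2 harmonic (\<lambda>k. \<omega> (deg k)) c B"
  proof (rule kernel_space.intro[OF sph.orthonormal_system_axioms kernel_space_axioms.intro])
    fix u :: "real^3" assume u: "u \<in> S2"
    show "(\<Sum>k. ennreal ((harmonic k u)\<^sup>2 / \<omega> (deg k))) \<le> ennreal B"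
      using kernel_sum[OF u, of "\<lambda>l. 1 / \<omega> l", OF i0] B(2)[unfolded a_def] by simp
  qed (use lo g B in auto)
  moreover have "kernel_space surface2 (S2 \<times> S2) harmonic2 (\<lambda>k. \<omega> (deg (fst2 k)) * \<omega> (deg (snd2 k))) (c\<^sup>2) (B\<^sup>2)"
  proof (rule kernel_space.intro[OF sph2.orthonormal_system_axioms kernel_space_axioms.intro])
    fix x assume "x \<in> S2 \<times> (S2 :: (real^3) set)"
    then obtain u v where uv: "x = (u, v)" "u \<in> S2" "v \<in> S2" by auto
    have "(\<Sum>k. ennreal ((harmonic2 k x)\<^sup>2 / (\<omega> (deg (fst2 k)) * \<omega> (deg (snd2 k))))) = (\<Sum>l. \<Sum>l'. ennreal (a l * a l'))"
      using kernel_sum2[OF uv(2,3), of "\<lambda>l l'. 1 / \<omega> l * (1 / \<omega> l')", OF mult_nonneg_nonneg[OF i0 i0]] uv(1) by (simp add: a_def mult_ac)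
    also have "\<dots> = (\<Sum>l. \<Sum>l'. ennreal (a l) * ennreal (a l'))" using a by (simp add: ennreal_mult)
    also have "\<dots> = ennreal B * ennreal B"
      unfolding ennreal_suminf_cmult B(2) ennreal_suminf_multc ..
    also have "\<dots> = ennreal (B\<^sup>2)" using B by (simp add: ennreal_mult power2_eq_square)
    finally show "(\<Sum>k. ennreal ((harmonic2 k x)\<^sup>2 / (\<omega> (deg (fst2 k)) * \<omega> (deg (snd2 k))))) \<le> ennreal (B\<^sup>2)" by simp
  next
    fix k show "c\<^sup>2 \<le> \<omega> (deg (fst2 k)) * \<omega> (deg (snd2 k))"
      unfolding power2_eq_square using lo g by (intro mult_mono) (auto simp: less_imp_le)
  qed (use g in auto)
  ultimately show ?thesis by blast
qed

lemma sobolev_weight_bounds: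
  assumes "0 \<le> s"
  shows "(1/2) powr s * (1 + real l) powr (2 * s) \<le> sobolev_weight s l"
    "sobolev_weight s l \<le> (1 + real l) powr (2 * s)"
proof -
  have x: "(1 + real l) powr (2 * s) = ((1 + real l)\<^sup>2) powr s"
    unfolding powr_powr[symmetric] by (simp add: powr_numeral)
  have b: "(1 + real l)\<^sup>2 / 2 \<le> 1 + real l * (real l + 1)" "1 + real l * (real l + 1) \<le> (1 + real l)\<^sup>2"
    using zero_le_square[of "real l"] by (simp_all add: power2_eq_square algebra_simps)
  have "(1/2) powr s * (1 + real l) powr (2 * s) = ((1 + real l)\<^sup>2 / 2) powr s"
    unfolding x by (simp add: powr_divide)
  also have "\<dots> \<le> (1 + real l * (real l + 1)) powr s"
    using assms b by (intro powr_mono2) auto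
  finally show "(1/2) powr s * (1 + real l) powr (2 * s) \<le> sobolev_weight s l" by (simp add: sobolev_weight_def)
  show "sobolev_weight s l \<le> (1 + real l) powr (2 * s)"
    unfolding x sobolev_weight_def using assms b by (intro powr_mono2) auto
qed

lemma ennreal_suminf_finite_iff:
  "(\<And>k. 0 \<le> f k) \<Longrightarrow> (\<Sum>k. ennreal (f k)) < \<infinity> \<longleftrightarrow> summable f"
  using ennreal_suminf_of_summable[of f] summable_suminf_not_top[of f]
  by (metis ennreal_less_top infinity_ennreal_def less_irrefl)

lemma L2_cont:
  "continuous_on S2 f \<Longrightarrow> f \<in> L2 surface"
  "continuous_on (S2 \<times> S2) g \<Longrightarrow> g \<in> L2 surface2"
  unfolding L2_def
  by (auto intro!: meas_surface meas_surface2 integrable_surface integrable_surface2 continuous_on_power)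

lemma sobolev_iff:
  "f \<in> sobolev s \<longleftrightarrow> continuous_on S2 f \<and> (\<forall>u. u \<notin> S2 \<longrightarrow> f u = 0) \<and>
     summable (\<lambda>k. sobolev_weight s (deg k) * (sph.coef f k)\<^sup>2)"
  unfolding sobolev_def mem_Collect_eq sobolev_normsq_idx
  by (subst ennreal_suminf_finite_iff) (auto simp: sobolev_weight_def L2_cont)

lemma sobolev2_iff:
  "f \<in> sobolev2 s \<longleftrightarrow> continuous_on (S2 \<times> S2) f \<and> (\<forall>u. u \<notin> S2 \<times> S2 \<longrightarrow> f u = 0) \<and>
     summable (\<lambda>k. sobolev_weight s (deg (fst2 k)) * sobolev_weight s (deg (snd2 k)) * (sph2.coef f k)\<^sup>2)"
  unfolding sobolev2_def mem_Collect_eq sobolev2_normsq_idx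
  by (subst ennreal_suminf_finite_iff) (auto simp: sobolev_weight_def L2_cont)

lemma summable_weight_mono:
  fixes a b c :: "nat \<Rightarrow> real"
  assumes "\<And>k. 0 \<le> a k" "\<And>k. a k \<le> C * b k" "summable (\<lambda>k. b k * (c k)\<^sup>2)"
  shows "summable (\<lambda>k. a k * (c k)\<^sup>2)"
proof (rule summable_comparison_test'[OF summable_mult[OF assms(3), of C]])
  fix k show "norm (a k * (c k)\<^sup>2) \<le> C * (b k * (c k)\<^sup>2)"
    using assms(1)[of k] mult_right_mono[OF assms(2)[of k] zero_le_power2[of "c k"]] by (simp add: mult.assoc)
qed

text \<open>All eigenvalue sequences of the same growth define the same space. The Sobolev spaces are therefore the kernel
spaces of the penalties.\<close>

lemma sobolev_eq_Hs:
  assumes s: "1 < s" and c: "0 < c" "0 < C" "\<And>l. c * (1 + real l) powr (2 * s) \<le> \<omega> l"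
    and C: "\<And>l. \<omega> l \<le> C * (1 + real l) powr (2 * s)"
  shows "sobolev s = kernel_space.Hs surface S2 harmonic (\<lambda>k. \<omega> (deg k))"
    "sobolev2 s = kernel_space.Hs surface2 (S2 \<times> S2) harmonic2 (\<lambda>k. \<omega> (deg (fst2 k)) * \<omega> (deg (snd2 k)))"
proof -
  obtain B where k1: "kernel_space surface S2 harmonic (\<lambda>k. \<omega> (deg k)) c B"
    and k2: "kernel_space surface2 (S2 \<times> S2) harmonic2 (\<lambda>k. \<omega> (deg (fst2 k)) * \<omega> (deg (snd2 k))) (c\<^sup>2) (B\<^sup>2)"
    using sphere_kernel[OF s c(1,3)] by blast
  define C' where "C' = C / (1/2) powr s"
  have C'0: "0 \<le> C'" using c by (simp add: C'_def)
  define c' where "c' = 1 / c"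
  have up: "\<omega> l \<le> C' * sobolev_weight s l" for l
  proof -
    have "C' * sobolev_weight s l \<ge> C' * ((1/2) powr s * (1 + real l) powr (2 * s))"
      using sobolev_weight_bounds(1)[of s l] s C'0 by (intro mult_left_mono) auto
    then show ?thesis using C[of l] by (simp add: C'_def)
  qed
  have lo: "sobolev_weight s l \<le> c' * \<omega> l" for l
  proof -
    have "sobolev_weight s l \<le> (1 + real l) powr (2 * s)" using sobolev_weight_bounds(2)[of s l] s by auto
    also have "\<dots> \<le> c' * \<omega> l" using c(1) c(3)[of l] by (simp add: c'_def field_simps)
    finally show ?thesis .
  qed
  have w0: "0 \<le> sobolev_weight s l" "0 \<le> \<omega> l" for l
    using growth_lower(2)[OF s c(1,3), of l] by (auto simp: sobolev_weight_def)
  have up2: "\<omega> l * \<omega> l' \<le> C'\<^sup>2 * (sobolev_weight s l * sobolev_weight s l')" for l l'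
    using mult_mono[OF up[of l] up[of l']] w0 C'0 by (simp add: power2_eq_square mult_ac)
  have lo2: "sobolev_weight s l * sobolev_weight s l' \<le> c'\<^sup>2 * (\<omega> l * \<omega> l')" for l l'
    using mult_mono[OF lo[of l] lo[of l']] w0 c by (simp add: power2_eq_square mult_ac c'_def)
  have e1: "summable (\<lambda>k. sobolev_weight s (deg k) * (c k)\<^sup>2) = summable (\<lambda>k. \<omega> (deg k) * (c k)\<^sup>2)" for c
    by (rule iffI) (erule summable_weight_mono[rotated 2], rule w0, rule up lo)+
  have e2: "summable (\<lambda>k. sobolev_weight s (deg (fst2 k)) * sobolev_weight s (deg (snd2 k)) * (c k)\<^sup>2)
     = summable (\<lambda>k. \<omega> (deg (fst2 k)) * \<omega> (deg (snd2 k)) * (c k)\<^sup>2)" for c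
    by (rule iffI) (erule summable_weight_mono[rotated 2], intro mult_nonneg_nonneg w0, rule up2 lo2)+
  show "sobolev s = kernel_space.Hs surface S2 harmonic (\<lambda>k. \<omega> (deg k))"
    unfolding kernel_space.Hs_def[OF k1] set_eq_iff sobolev_iff mem_Collect_eq e1 by simp
  show "sobolev2 s = kernel_space.Hs surface2 (S2 \<times> S2) harmonic2 (\<lambda>k. \<omega> (deg (fst2 k)) * \<omega> (deg (snd2 k)))"
    unfolding kernel_space.Hs_def[OF k2] set_eq_iff sobolev2_iff mem_Collect_eq e2 by simp
qed

lemma L2_add:
  assumes "f \<in> L2 M" "g \<in> L2 M"
  shows "integrable M (\<lambda>x. f x * g x)" "(\<lambda>x. a * f x + b * g x) \<in> L2 M"
proof -
  have [measurable]: "f \<in> borel_measurable M" "g \<in> borel_measurable M" using assms by (auto simp: L2_def)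
  have i: "integrable M (\<lambda>x. (f x)\<^sup>2)" "integrable M (\<lambda>x. (g x)\<^sup>2)" using assms by (auto simp: L2_def)
  show p: "integrable M (\<lambda>x. f x * g x)"
  proof (rule Bochner_Integration.integrable_bound[OF Bochner_Integration.integrable_add[OF i]])
    have "\<bar>u * v\<bar> \<le> u\<^sup>2 + v\<^sup>2" for u v :: real
      using sum_squares_bound[of "\<bar>u\<bar>" "\<bar>v\<bar>"] mult_nonneg_nonneg[of "\<bar>u\<bar>" "\<bar>v\<bar>"]
      unfolding abs_mult power2_abs by linarith
    then show "AE x in M. norm (f x * g x) \<le> norm ((f x)\<^sup>2 + (g x)\<^sup>2)" by auto
  qed simp
  have "(\<lambda>x. (a * f x + b * g x)\<^sup>2) = (\<lambda>x. a\<^sup>2 * (f x)\<^sup>2 + (b\<^sup>2 * (g x)\<^sup>2 + 2 * a * b * (f x * g x)))"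
    by (auto simp: power2_eq_square algebra_simps)
  then show "(\<lambda>x. a * f x + b * g x) \<in> L2 M" using i p by (simp add: L2_def)
qed

lemma L2_diff: "f \<in> L2 M \<Longrightarrow> g \<in> L2 M \<Longrightarrow> (\<lambda>x. f x - g x) \<in> L2 M"
  using L2_add(2)[of f M g 1 "-1"] by simp

text \<open>The convexity inequality with a free parameter takes the place of the triangle inequality for square norms.\<close>

lemma L2_normsq_split:
  assumes f: "f \<in> L2 M" and g: "g \<in> L2 M" and t: "0 < t"
  shows "L2_normsq M f \<le> (1 + t) * L2_normsq M g + (1 + 1 / t) * L2_normsq M (\<lambda>x. f x - g x)"
proof -
  have "x\<^sup>2 \<le> (1 + t) * y\<^sup>2 + (1 + 1 / t) * (x - y)\<^sup>2" for x y :: real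
  proof -
    define s where "s = sqrt t"
    have s: "s \<noteq> 0" "t = s\<^sup>2" using t by (auto simp: s_def)
    have "(1 + t) * y\<^sup>2 + (1 + 1 / t) * (x - y)\<^sup>2 - x\<^sup>2 = (s * y - (x - y) / s)\<^sup>2"
      unfolding s(2) using s(1) by (simp add: power2_eq_square field_simps)
    then show ?thesis using zero_le_power2[of "s * y - (x - y) / s"] by linarith
  qed
  then have "(LINT x|M. (f x)\<^sup>2) \<le> (LINT x|M. (1 + t) * (g x)\<^sup>2 + (1 + 1 / t) * (f x - g x)\<^sup>2)"
    using f g L2_diff[OF f g] by (intro integral_mono) (auto simp: L2_def)
  also have "\<dots> = (1 + t) * (LINT x|M. (g x)\<^sup>2) + (1 + 1 / t) * (LINT x|M. (f x - g x)\<^sup>2)"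
    using g L2_diff[OF f g] by (simp add: L2_def)
  finally show ?thesis by (simp add: L2_normsq_def L2_inner_def power2_eq_square)
qed

lemma L2_normsq_sub_commute: "L2_normsq M (\<lambda>x. f x - g x) = L2_normsq M (\<lambda>x. g x - f x)"
  by (simp add: L2_normsq_def L2_inner_def algebra_simps)

lemma L2_normsq_limit:
  assumes F: "F \<in> L2 M" and S: "\<And>N. S N \<in> L2 M"
    and lim: "(\<lambda>N. L2_normsq M (\<lambda>x. F x - S N x)) \<longlonglongrightarrow> 0" and a: "(\<lambda>N. L2_normsq M (S N)) \<longlonglongrightarrow> a"
  shows "L2_normsq M F = a"
proof -
  have 1: "L2_normsq M F \<le> (1 + t) * a" if "0 < t" for t
  proof (rule LIMSEQ_le_const)
    show "(\<lambda>N. (1 + t) * L2_normsq M (S N) + (1 + 1 / t) * L2_normsq M (\<lambda>x. F x - S N x)) \<longlonglongrightarrow> (1 + t) * a"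
      using tendsto_add[OF tendsto_mult_left[OF a, of "1 + t"] tendsto_mult_left[OF lim, of "1 + 1 / t"]] by simp
  qed (use L2_normsq_split[OF F S that] in auto)
  have 2: "a \<le> (1 + t) * L2_normsq M F" if "0 < t" for t
  proof (rule LIMSEQ_le[OF a])
    show "(\<lambda>N. (1 + t) * L2_normsq M F + (1 + 1 / t) * L2_normsq M (\<lambda>x. F x - S N x)) \<longlonglongrightarrow> (1 + t) * L2_normsq M F"
      using tendsto_add[OF tendsto_const tendsto_mult_left[OF lim, of "1 + 1 / t"]] by simp
  qed (use L2_normsq_split[OF S F that] in \<open>auto simp: L2_normsq_sub_commute[of _ _ F]\<close>)
  have lim1: "((\<lambda>t. (1 + t) * b) \<longlongrightarrow> b) (at_right 0)" for b :: real
    by (auto intro!: tendsto_eq_intros)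
  have "L2_normsq M F \<le> a"
    by (rule tendsto_lowerbound[OF lim1]) (auto intro!: eventually_at_rightI[of 0 1] 1)
  moreover have "a \<le> L2_normsq M F"
    by (rule tendsto_lowerbound[OF lim1]) (auto intro!: eventually_at_rightI[of 0 1] 2)
  ultimately show ?thesis by simp
qed

lemma sum_exhaust:
  fixes f :: "nat \<Rightarrow> real"
  assumes f: "\<And>k. 0 \<le> f k" "summable f" and K: "\<And>N. finite (K N)" "\<And>k. \<forall>\<^sub>F N in sequentially. k \<in> K N"
  shows "(\<lambda>N. sum f (K N)) \<longlonglongrightarrow> suminf f"
proof (rule order_tendstoI)
  fix a assume "a < suminf f"
  then have "\<forall>\<^sub>F n in sequentially. a < (\<Sum>k<n. f k)"
    by (rule order_tendstoD(1)[OF summable_LIMSEQ[OF f(2)]])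
  then obtain n where n: "a < (\<Sum>k<n. f k)" by (auto simp: eventually_sequentially)
  have "\<forall>\<^sub>F N in sequentially. \<forall>k\<in>{..<n}. k \<in> K N" using K(2) by (intro eventually_ball_finite) auto
  then show "\<forall>\<^sub>F N in sequentially. a < sum f (K N)"
  proof eventually_elim
    case (elim N)
    then have "(\<Sum>k<n. f k) \<le> sum f (K N)" using f K by (intro sum_mono2) auto
    then show ?case using n by linarith
  qed
next
  fix a assume "suminf f < a"
  moreover have "sum f (K N) \<le> suminf f" for N using f K by (intro sum_le_suminf) auto
  ultimately show "\<forall>\<^sub>F N in sequentially. sum f (K N) < a" by (intro always_eventually allI) (blast intro: le_less_trans)
qed

lemma sum_degree_le:
  fixes F :: "nat \<times> int \<Rightarrow> real"
  shows "(\<Sum>l\<le>N. \<Sum>m\<in>{-int l..int l}. F (l, m)) = (\<Sum>k | deg k \<le> N. F (idx k))" "finite {k. deg k \<le> N}"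
proof -
  have b: "bij_betw idx {k. deg k \<le> N} (SIGMA l:{..N}. {-int l..int l})"
    unfolding bij_betw_def
  proof
    show "inj_on idx {k. deg k \<le> N}" by (simp add: inj_on_def idx_inj)
    show "idx ` {k. deg k \<le> N} = (SIGMA l:{..N}. {-int l..int l})"
    proof (intro equalityI subsetI)
      fix x assume "x \<in> idx ` {k. deg k \<le> N}"
      then obtain k where "x = idx k" "deg k \<le> N" by auto
      then show "x \<in> (SIGMA l:{..N}. {-int l..int l})" using idx_harm[of k] by (cases "idx k") (auto simp: deg_def)
    next
      fix x assume x: "x \<in> (SIGMA l:{..N}. {-int l..int l})"
      then obtain l m where lm: "x = (l, m)" "l \<le> N" "\<bar>m\<bar> \<le> int l" by auto
      obtain k where "idx k = (l, m)" using idx_surj[OF lm(3)] .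
      then show "x \<in> idx ` {k. deg k \<le> N}" using lm by (intro image_eqI[of _ _ k]) (auto simp: deg_def)
    qed
  qed
  then show "finite {k. deg k \<le> N}" by (subst bij_betw_finite[OF b]) auto
  show "(\<Sum>l\<le>N. \<Sum>m\<in>{-int l..int l}. F (l, m)) = (\<Sum>k | deg k \<le> N. F (idx k))"
    unfolding sum.reindex_bij_betw[OF b] by (simp add: sum.Sigma)
qed

text \<open>The defining property of an admissible operator for the enumerated harmonics, with the symbol \<open>d\<close> made explicit.\<close>

definition multiplier_operator ::
  "real \<Rightarrow> (nat \<Rightarrow> real) \<Rightarrow> ((real^3 \<Rightarrow> real) \<Rightarrow> (real^3 \<Rightarrow> real)) \<Rightarrow> bool" where
  "multiplier_operator p d T \<longleftrightarrow> (\<forall>f\<in>sobolev p. T f \<in> L2 surface \<and>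
     (\<lambda>N. L2_normsq surface (\<lambda>u. T f u - (\<Sum>k | deg k \<le> N. d (deg k) * sph.coef f k * harmonic k u))) \<longlonglongrightarrow> 0)"

lemma admissible_multiplier:
  assumes "admissible_operator p T"
  obtains d C1 C2 where "0 < C1" "0 < C2" "\<And>l. C1 * (1 + real l) powr p \<le> \<bar>d l\<bar>" "\<And>l. \<bar>d l\<bar> \<le> C2 * (1 + real l) powr p"
    "multiplier_operator p d T"
proof -
  obtain d C1 C2 where d: "0 < C1" "0 < C2" "\<And>l. C1 * (1 + real l) powr p \<le> \<bar>d l\<bar>" "\<And>l. \<bar>d l\<bar> \<le> C2 * (1 + real l) powr p"
    and T: "\<forall>f\<in>sobolev p. T f \<in> L2 surface \<and>
           (\<lambda>N. L2_normsq surface (\<lambda>u. T f u -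
                  (\<Sum>l\<le>N. d l * (\<Sum>m\<in>{-int l..int l}.
                      L2_inner surface f (sph_harm l m) * sph_harm l m u)))) \<longlonglongrightarrow> 0"
    using assms unfolding admissible_operator_def by blast
  have "(\<Sum>l\<le>N. d l * (\<Sum>m\<in>{-int l..int l}. L2_inner surface f (sph_harm l m) * sph_harm l m u))
      = (\<Sum>k | deg k \<le> N. d (deg k) * sph.coef f k * harmonic k u)" for N f u
    unfolding sum_distrib_left
    using sum_degree_le(1)[of "\<lambda>(l, m). d l * (L2_inner surface f (sph_harm l m) * sph_harm l m u)" N]
    by (simp add: case_prod_unfold harmonic_def deg_def mult.assoc)
  then have "multiplier_operator p d T" using T unfolding multiplier_operator_def by simp
  with d that show ?thesis by blast
qed

lemma multiplier_normsq:
  assumes T: "multiplier_operator p d T" and f: "f \<in> sobolev p"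
    and s: "summable (\<lambda>k. (d (deg k))\<^sup>2 * (sph.coef f k)\<^sup>2)"
  shows "L2_normsq surface (T f) = (\<Sum>k. (d (deg k))\<^sup>2 * (sph.coef f k)\<^sup>2)"
proof -
  define S where "S N u = (\<Sum>k | deg k \<le> N. d (deg k) * sph.coef f k * harmonic k u)" for N u
  have cS: "continuous_on S2 (S N)" for N
    unfolding S_def[abs_def] by (intro continuous_intros)
  have "L2_normsq surface (S N) = (\<Sum>k | deg k \<le> N. (d (deg k))\<^sup>2 * (sph.coef f k)\<^sup>2)" for N
  proof -
    have c: "L2_inner surface (S N) (harmonic j) = (if deg j \<le> N then d (deg j) * sph.coef f j else 0)" for j
      unfolding S_def[abs_def] using sum_degree_le(2)[of N]
      by (subst sph.inner_sum) (auto intro!: continuous_intros simp: sph.orth if_distrib cong: if_cong)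
    have "L2_normsq surface (S N) = (\<Sum>k | deg k \<le> N. (d (deg k) * sph.coef f k) * L2_inner surface (harmonic k) (S N))"
      unfolding L2_normsq_def by (subst (1) S_def[abs_def]) (rule sph.inner_sum[OF cS])
    also have "\<dots> = (\<Sum>k | deg k \<le> N. (d (deg k))\<^sup>2 * (sph.coef f k)\<^sup>2)"
      by (rule sum.cong) (auto simp: L2_inner_def[of _ "harmonic _"] mult.commute[of "harmonic _ _"] c[unfolded L2_inner_def[of _ "S N"]] power2_eq_square)
    finally show ?thesis .
  qed
  moreover have "(\<lambda>N. \<Sum>k | deg k \<le> N. (d (deg k))\<^sup>2 * (sph.coef f k)\<^sup>2) \<longlonglongrightarrow> (\<Sum>k. (d (deg k))\<^sup>2 * (sph.coef f k)\<^sup>2)"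
    by (rule sum_exhaust) (auto intro: s sum_degree_le eventually_ge_at_top)
  ultimately show ?thesis
    using T f by (intro L2_normsq_limit[of _ _ S]) (auto simp: multiplier_operator_def S_def[symmetric] intro: L2_cont(1)[OF cS])
qed

lemma L2_normsq_0_AE: "f \<in> L2 M \<Longrightarrow> L2_normsq M f = 0 \<Longrightarrow> AE x in M. f x = 0"
  using integral_nonneg_eq_0_iff_AE[of M "\<lambda>x. (f x)\<^sup>2"] by (simp add: L2_def L2_normsq_def L2_inner_def power2_eq_square)

text \<open>Elements of the Sobolev spaces vanish off the sphere, so the harmonics have to be cut off.\<close>

definition harmonic0 :: "nat \<Rightarrow> real^3 \<Rightarrow> real" where "harmonic0 k u = (if u \<in> S2 then harmonic k u else 0)"
definition harmonic02 :: "nat \<Rightarrow> (real^3) \<times> (real^3) \<Rightarrow> real" where "harmonic02 k = tensor (harmonic0 (fst2 k)) (harmonic0 (snd2 k))"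

lemma harmonic0_sobolev: "harmonic0 k \<in> sobolev s" and coef_harmonic0: "sph.coef (harmonic0 k) j = (if k = j then 1 else 0)"
proof -
  show c: "sph.coef (harmonic0 k) j = (if k = j then 1 else 0)" for j
    using sph.inner_cong[of "harmonic0 k" "harmonic k"] by (simp add: harmonic0_def sph.orth)
  have "summable (\<lambda>j. sobolev_weight s (deg j) * (sph.coef (harmonic0 k) j)\<^sup>2)"
    by (rule summable_finite[of "{k}"]) (auto simp: c)
  moreover have "continuous_on S2 (harmonic0 k)" by (rule continuous_on_eq[OF continuous_harmonic]) (simp add: harmonic0_def)
  ultimately show "harmonic0 k \<in> sobolev s" by (simp add: sobolev_iff harmonic0_def)
qed

lemma harmonic02_eq: "harmonic02 k x = (if x \<in> S2 \<times> S2 then harmonic2 k x else 0)"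
  by (cases x) (auto simp: harmonic02_def harmonic2_def harmonic0_def tensor_def)

lemma multiplier_harmonic0:
  assumes "multiplier_operator p d T"
  shows "AE u in surface. T (harmonic0 k) u = d (deg k) * harmonic k u"
proof -
  have T: "T (harmonic0 k) \<in> L2 surface" 
    "(\<lambda>N. L2_normsq surface (\<lambda>u. T (harmonic0 k) u - (\<Sum>j | deg j \<le> N. d (deg j) * sph.coef (harmonic0 k) j * harmonic j u))) \<longlonglongrightarrow> 0"
    using assms harmonic0_sobolev by (auto simp: multiplier_operator_def)
  have "(\<Sum>j | deg j \<le> N. d (deg j) * sph.coef (harmonic0 k) j * harmonic j u) = d (deg k) * harmonic k u" if "deg k \<le> N" for N u
    using sum_degree_le(2)[of N] that by (simp add: coef_harmonic0 if_distrib if_distribR cong: if_cong)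
  then have "\<forall>\<^sub>F N in sequentially. L2_normsq surface (\<lambda>u. T (harmonic0 k) u - (\<Sum>j | deg j \<le> N. d (deg j) * sph.coef (harmonic0 k) j * harmonic j u))
     = L2_normsq surface (\<lambda>u. T (harmonic0 k) u - d (deg k) * harmonic k u)"
    by (intro eventually_sequentiallyI[of "deg k"]) simp
  then have "(\<lambda>N. L2_normsq surface (\<lambda>u. T (harmonic0 k) u - (\<Sum>j | deg j \<le> N. d (deg j) * sph.coef (harmonic0 k) j * harmonic j u)))
     \<longlonglongrightarrow> L2_normsq surface (\<lambda>u. T (harmonic0 k) u - d (deg k) * harmonic k u)" by (rule tendsto_eventually)
  then have "L2_normsq surface (\<lambda>u. T (harmonic0 k) u - d (deg k) * harmonic k u) = 0" using T(2) LIMSEQ_unique by blast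
  moreover have "(\<lambda>u. T (harmonic0 k) u - d (deg k) * harmonic k u) \<in> L2 surface"
    by (intro L2_diff T L2_cont continuous_intros)
  ultimately show ?thesis using L2_normsq_0_AE by fastforce
qed

section \<open>Tensor multipliers and the Borel structure of the Sobolev space\<close>

lemma multiplier_harmonic02:
  assumes T: "multiplier_operator p d T" and T2: "tensor_square_operator p T T2"
  shows "AE x in surface2. T2 (harmonic02 k) x = d (deg (fst2 k)) * d (deg (snd2 k)) * harmonic2 k x"
proof -
  let ?a = "fst2 k" and ?b = "snd2 k"
  have [measurable]: "T (harmonic0 j) \<in> borel_measurable surface" for j
    using T harmonic0_sobolev by (auto simp: multiplier_operator_def L2_def)
  have [measurable]: "harmonic j \<in> borel_measurable surface" for j by (intro meas_surface continuous_harmonic)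
  have "AE x in surface2. tensor (T (harmonic0 ?a)) (T (harmonic0 ?b)) x = d (deg ?a) * d (deg ?b) * harmonic2 k x"
  proof (rule surf2.AE_pair_measure)
    show "{x \<in> space surface2. tensor (T (harmonic0 ?a)) (T (harmonic0 ?b)) x = d (deg ?a) * d (deg ?b) * harmonic2 k x} \<in> sets surface2"
      unfolding tensor_def harmonic2_def by measurable
    show "AE u in surface. AE v in surface. tensor (T (harmonic0 ?a)) (T (harmonic0 ?b)) (u, v) = d (deg ?a) * d (deg ?b) * harmonic2 k (u, v)"
      using multiplier_harmonic0[OF T, of ?a]
    proof eventually_elim
      case (elim u)
      show ?case using multiplier_harmonic0[OF T, of ?b] by eventually_elim (simp add: elim tensor_def harmonic2_def)
    qed
  qed
  moreover have "AE x in surface2. T2 (harmonic02 k) x = tensor (T (harmonic0 ?a)) (T (harmonic0 ?b)) x"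
    using T2 harmonic0_sobolev unfolding tensor_square_operator_def harmonic02_def by blast
  ultimately show ?thesis by eventually_elim simp
qed

lemma harmonic02_sum_sobolev:
  "(\<lambda>x. \<Sum>k<N. c k * harmonic02 k x) \<in> sobolev2 s"
  "sph2.coef (\<lambda>x. \<Sum>k<N. c k * harmonic02 k x) j = (if j < N then c j else 0)"
proof -
  have eq: "(\<Sum>k<N. c k * harmonic02 k x) = (\<Sum>k<N. c k * harmonic2 k x)" if "x \<in> S2 \<times> S2" for x
    using that by (simp add: harmonic02_eq)
  have c: "sph2.coef (\<lambda>x. \<Sum>k<N. c k * harmonic02 k x) j = (if j < N then c j else 0)" for j
    using sph2.inner_cong[OF eq] sph2.inner_sum[OF sph2.cont_e, of c "{..<N}" j]
    by (simp add: sph2.orth if_distrib cong: if_cong)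
  then show "sph2.coef (\<lambda>x. \<Sum>k<N. c k * harmonic02 k x) j = (if j < N then c j else 0)" .
  have "continuous_on (S2 \<times> S2) (\<lambda>x. \<Sum>k<N. c k * harmonic02 k x)"
    by (rule continuous_on_eq[of _ "\<lambda>x. \<Sum>k<N. c k * harmonic2 k x"])
      (intro continuous_intros sph2.cont_e, rule eq[symmetric])
  moreover have "summable (\<lambda>k. sobolev_weight s (deg (fst2 k)) * sobolev_weight s (deg (snd2 k)) * (sph2.coef (\<lambda>x. \<Sum>k<N. c k * harmonic02 k x) k)\<^sup>2)"
    by (rule summable_finite[of "{..<N}"]) (auto simp: c)
  ultimately show "(\<lambda>x. \<Sum>k<N. c k * harmonic02 k x) \<in> sobolev2 s"
    unfolding sobolev2_iff by (auto simp: harmonic02_eq)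
qed

lemma harmonic02_sobolev: "harmonic02 k \<in> sobolev2 s"
proof -
  have "(\<lambda>x. \<Sum>j<Suc k. (if j = k then 1 else 0) * harmonic02 j x) = harmonic02 k" by (auto simp: if_distribR cong: if_cong)
  then show ?thesis using harmonic02_sum_sobolev(1)[where N = "Suc k" and c = "\<lambda>j. if j = k then 1 else 0"] by metis
qed

lemma multiplier_harmonic02_sum:
  assumes T: "multiplier_operator p d T" and T2: "tensor_square_operator p T T2"
  shows "AE x in surface2. T2 (\<lambda>x. \<Sum>k<N. c k * harmonic02 k x) x = (\<Sum>k<N. c k * d (deg (fst2 k)) * d (deg (snd2 k)) * harmonic2 k x)"
proof -
  have lin: "AE x in surface2. T2 (\<lambda>y. a * g y + b * h y) x = a * T2 g x + b * T2 h x"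
    if "g \<in> sobolev2 p" "h \<in> sobolev2 p" for a b g h
    using T2 that unfolding tensor_square_operator_def by blast
  show ?thesis
  proof (induction N)
    case 0
    show ?case using lin[OF harmonic02_sobolev harmonic02_sobolev, of 0 0 0 0] by simp
  next
    case (Suc N)
    have "AE x in surface2. T2 (\<lambda>x. 1 * (\<Sum>k<N. c k * harmonic02 k x) + c N * harmonic02 N x) x =
       1 * T2 (\<lambda>x. \<Sum>k<N. c k * harmonic02 k x) x + c N * T2 (harmonic02 N) x"
      by (rule lin[OF harmonic02_sum_sobolev(1) harmonic02_sobolev])
    then show ?case using Suc multiplier_harmonic02[OF T T2, of N] by eventually_elim simp
  qed
qed

lemma L2_normsq_AE:
  "f \<in> L2 M \<Longrightarrow> g \<in> L2 M \<Longrightarrow> AE x in M. f x = g x \<Longrightarrow> L2_normsq M f = L2_normsq M g"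
  unfolding L2_normsq_def L2_inner_def by (rule integral_cong_AE) (auto simp: L2_def)

text \<open>On finite sums of product harmonics the operator is determined, up to null sets, by linearity and by its values
on tensors. Continuity extends the formula: \<open>g\<close> minus its \<open>N\<close>-th partial sum tends to zero in the Sobolev
norm, hence its image tends to zero in \<open>L\<^sup>2\<close>.\<close>

lemma tensor_multiplier_normsq:
  assumes T: "multiplier_operator p d T" and T2: "tensor_square_operator p T T2" and g: "g \<in> sobolev2 p"
    and s: "summable (\<lambda>k. (d (deg (fst2 k)))\<^sup>2 * (d (deg (snd2 k)))\<^sup>2 * (sph2.coef g k)\<^sup>2)"
  shows "L2_normsq surface2 (T2 g) = (\<Sum>k. (d (deg (fst2 k)))\<^sup>2 * (d (deg (snd2 k)))\<^sup>2 * (sph2.coef g k)\<^sup>2)"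
proof -
  define c where "c k = sph2.coef g k" for k
  define w where "w k = sobolev_weight p (deg (fst2 k)) * sobolev_weight p (deg (snd2 k))" for k
  define D where "D k = d (deg (fst2 k)) * d (deg (snd2 k))" for k
  define G where "G N x = (\<Sum>k<N. c k * harmonic02 k x)" for N x
  have G: "G N \<in> sobolev2 p" "sph2.coef (G N) j = (if j < N then c j else 0)" for N j
    unfolding G_def[abs_def] by (rule harmonic02_sum_sobolev)+
  have T2L: "T2 h \<in> L2 surface2" if "h \<in> sobolev2 p" for h
    using T2 that unfolding tensor_square_operator_def by blast
  obtain B where B: "0 \<le> B" "\<And>h. h \<in> sobolev2 p \<Longrightarrow> ennreal (L2_normsq surface2 (T2 h)) \<le> ennreal B * sobolev2_normsq p h"
    using T2 unfolding tensor_square_operator_def by blast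
  have w0: "0 \<le> w k" for k by (simp add: w_def sobolev_weight_def)
  have sw: "summable (\<lambda>k. w k * (c k)\<^sup>2)" using g unfolding sobolev2_iff w_def c_def by simp
  have cg: "continuous_on (S2 \<times> S2) g" "continuous_on (S2 \<times> S2) (G N)" for N
    using g G(1) unfolding sobolev2_iff by auto
  define R where "R N = (\<lambda>x. 1 * g x + (-1) * G N x)" for N
  have cR: "sph2.coef (R N) j = (if j < N then 0 else c j)" for N j
    unfolding R_def sph2.inner_lin[OF cg sph2.cont_e] G(2) by (simp add: c_def)
  have "summable (\<lambda>k. w k * (sph2.coef (R N) k)\<^sup>2)" for N
    by (rule summable_comparison_test'[OF sw]) (use w0 in \<open>auto simp: cR\<close>)
  note sR = this
  have RH: "R N \<in> sobolev2 p" for N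
    using sR[of N] g G(1)[of N] cg unfolding sobolev2_iff w_def
    by (auto simp: R_def intro!: continuous_intros)
  have tail: "L2_normsq surface2 (T2 (R N)) \<le> B * (\<Sum>k. w (k + N) * (c (k + N))\<^sup>2)" for N
  proof -
    have "(\<Sum>k. w k * (sph2.coef (R N) k)\<^sup>2) = (\<Sum>k. w (k + N) * (c (k + N))\<^sup>2) + (\<Sum>k<N. w k * (sph2.coef (R N) k)\<^sup>2)"
      using suminf_split_initial_segment[OF sR[of N], of N] by (simp add: cR)
    then have *: "(\<Sum>k. w k * (sph2.coef (R N) k)\<^sup>2) = (\<Sum>k. w (k + N) * (c (k + N))\<^sup>2)" by (simp add: cR)
    have "ennreal (L2_normsq surface2 (T2 (R N))) \<le> ennreal B * sobolev2_normsq p (R N)" by (rule B(2)[OF RH])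
    also have "sobolev2_normsq p (R N) = ennreal (\<Sum>k. w k * (sph2.coef (R N) k)\<^sup>2)"
      unfolding sobolev2_normsq_idx w_def[symmetric] using w0 by (intro ennreal_suminf_of_summable sR) auto
    finally have "ennreal (L2_normsq surface2 (T2 (R N))) \<le> ennreal (B * (\<Sum>k. w (k + N) * (c (k + N))\<^sup>2))"
      unfolding * using B(1) by (simp add: ennreal_mult')
    moreover have "0 \<le> B * (\<Sum>k. w (k + N) * (c (k + N))\<^sup>2)"
      using B(1) w0 summable_ignore_initial_segment[OF sw, of N] by (intro mult_nonneg_nonneg suminf_nonneg) auto
    ultimately show ?thesis by (simp add: ennreal_le_iff)
  qed
  have eq: "L2_normsq surface2 (\<lambda>x. T2 g x - T2 (G N) x) = L2_normsq surface2 (T2 (R N))" for N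
  proof (rule L2_normsq_AE[OF L2_diff[OF T2L[OF g] T2L[OF G(1)]] T2L[OF RH]])
    have "AE x in surface2. T2 (R N) x = 1 * T2 g x + (-1) * T2 (G N) x"
      using T2 g G(1) unfolding tensor_square_operator_def R_def by blast
    then show "AE x in surface2. T2 g x - T2 (G N) x = T2 (R N) x" by eventually_elim simp
  qed
  have lim: "(\<lambda>N. L2_normsq surface2 (\<lambda>x. T2 g x - T2 (G N) x)) \<longlonglongrightarrow> 0"
  proof (rule tendsto_sandwich[OF _ _ tendsto_const])
    show "(\<lambda>N. B * (\<Sum>k. w (k + N) * (c (k + N))\<^sup>2)) \<longlonglongrightarrow> 0"
      using tendsto_mult_right_zero[OF suminf_exist_split2[OF sw], of B] by simp
    show "\<forall>\<^sub>F N in sequentially. 0 \<le> L2_normsq surface2 (\<lambda>x. T2 g x - T2 (G N) x)"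
      by (simp add: L2_normsq_def L2_inner_def)
  qed (use tail in \<open>auto simp: eq\<close>)
  have "L2_normsq surface2 (T2 (G N)) = (\<Sum>k<N. (D k)\<^sup>2 * (c k)\<^sup>2)" for N
  proof -
    have cS: "continuous_on (S2 \<times> S2) (\<lambda>x. \<Sum>k<N. (c k * D k) * harmonic2 k x)"
      by (intro continuous_intros sph2.cont_e)
    have "AE x in surface2. T2 (G N) x = (\<Sum>k<N. (c k * D k) * harmonic2 k x)"
      using multiplier_harmonic02_sum[OF T T2, of c N] unfolding G_def[abs_def] D_def by (simp add: mult.assoc)
    then have "L2_normsq surface2 (T2 (G N)) = L2_normsq surface2 (\<lambda>x. \<Sum>k<N. (c k * D k) * harmonic2 k x)"
      by (intro L2_normsq_AE T2L G L2_cont cS)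
    also have "\<dots> = (\<Sum>k<N. (c k * D k) * L2_inner surface2 (\<lambda>x. \<Sum>k<N. (c k * D k) * harmonic2 k x) (harmonic2 k))"
      unfolding L2_normsq_def sph2.inner_sum[OF cS] by (simp only: L2_inner_def mult.commute[of "harmonic2 _ _"])
    also have "\<dots> = (\<Sum>k<N. (D k)\<^sup>2 * (c k)\<^sup>2)"
      by (intro sum.cong refl, subst sph2.inner_sum[OF sph2.cont_e])
        (simp add: sph2.orth if_distrib power2_eq_square cong: if_cong)
    finally show ?thesis .
  qed
  moreover have "(\<lambda>N. \<Sum>k<N. (D k)\<^sup>2 * (c k)\<^sup>2) \<longlonglongrightarrow> (\<Sum>k. (D k)\<^sup>2 * (c k)\<^sup>2)"
    using s unfolding D_def c_def by (intro summable_LIMSEQ) (simp add: power_mult_distrib)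
  ultimately have "L2_normsq surface2 (T2 g) = (\<Sum>k. (D k)\<^sup>2 * (c k)\<^sup>2)"
    by (intro L2_normsq_limit[OF T2L[OF g] T2L[OF G(1)] lim]) simp
  then show ?thesis unfolding D_def c_def by (simp add: power_mult_distrib)
qed

lemma (in kernel_space) J_triangle:
  assumes f: "f \<in> Hs" and g: "g \<in> Hs"
  shows "sqrt (J (\<lambda>x. f x + g x)) \<le> sqrt (J f) + sqrt (J g)"
proof -
  note sf = HsD(3)[OF f] note sg = HsD(3)[OF g]
  have b: "(\<rho> k * coef g k)\<^sup>2 / \<rho> k = \<rho> k * (coef g k)\<^sup>2" for k
    using \<rho>_pos[of k] by (simp add: power2_eq_square)
  have sb: "summable (\<lambda>k. (\<rho> k * coef g k)\<^sup>2 / \<rho> k)" unfolding b by (rule sg)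
  note cs = suminf_Cauchy_Schwarz[OF \<rho>_pos sf sb]
  define X where "X = (\<Sum>k. coef f k * (\<rho> k * coef g k))"
  have "X\<^sup>2 \<le> J f * J g" using cs(2) unfolding X_def b J_def .
  then have "\<bar>X\<bar> \<le> sqrt (J f * J g)" by (metis real_sqrt_abs real_sqrt_le_mono)
  then have X: "X \<le> sqrt (J f) * sqrt (J g)" by (simp add: real_sqrt_mult)
  have "J (\<lambda>x. f x + g x) = (\<Sum>k. \<rho> k * (coef f k)\<^sup>2 + (2 * (coef f k * (\<rho> k * coef g k)) + \<rho> k * (coef g k)\<^sup>2))"
    unfolding J_def using Hs_lin(2)[OF f g, of 1 1]
    by (intro suminf_cong) (simp add: power2_eq_square algebra_simps)
  also have "\<dots> = J f + (2 * X + J g)"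
    unfolding J_def X_def using sf sg summable_rabs_cancel[OF cs(1)]
    by (simp add: suminf_add[symmetric] suminf_mult summable_mult summable_add)
  also have "\<dots> \<le> (sqrt (J f) + sqrt (J g))\<^sup>2"
    using X J_nonneg[OF f] J_nonneg[OF g] by (simp add: power2_sum)
  finally show ?thesis using J_nonneg[OF f] J_nonneg[OF g] by (intro real_le_lsqrt) auto
qed

text \<open>The space of the curves, as a kernel space whose eigenvalues are the Sobolev weights.\<close>

locale sobolev_space =
  fixes q :: real assumes q: "1 < q"
begin

lemma space_kernel: "\<exists>B. kernel_space surface S2 harmonic (\<lambda>k. sobolev_weight q (deg k)) ((1/2) powr q) B"
  using sphere_kernel[OF q, of "(1/2) powr q" "sobolev_weight q"] sobolev_weight_bounds(1)[of q] q by auto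

definition B where "B = (SOME B. kernel_space surface S2 harmonic (\<lambda>k. sobolev_weight q (deg k)) ((1/2) powr q) B)"

sublocale K: kernel_space surface S2 harmonic "\<lambda>k. sobolev_weight q (deg k)" "(1/2) powr q" B
  unfolding B_def by (rule someI_ex[OF space_kernel])

lemma sobolev_Hs: "sobolev q = K.Hs"
  unfolding K.Hs_def set_eq_iff sobolev_iff by simp

lemma normsq_J: "f \<in> sobolev q \<Longrightarrow> sobolev_normsq q f = ennreal (K.J f)"
  unfolding sobolev_normsq_idx K.J_def sobolev_Hs
  by (intro ennreal_suminf_of_summable) (auto simp: K.HsD(3) less_imp_le[OF K.\<rho>_pos])

lemma dist_J: "f \<in> sobolev q \<Longrightarrow> g \<in> sobolev q \<Longrightarrow> sobolev_dist q f g = sqrt (K.J (\<lambda>u. f u - g u))"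
  unfolding sobolev_dist_def by (subst normsq_J) (auto simp: sobolev_Hs K.Hs_diff K.J_nonneg)

lemma coef_lipschitz:
  assumes f: "f \<in> sobolev q" and g: "g \<in> sobolev q"
  shows "\<bar>sph.coef f k - sph.coef g k\<bar> \<le> sqrt (1 / (1/2) powr q) * sobolev_dist q f g"
proof -
  have d: "(\<lambda>u. f u - g u) \<in> K.Hs" using f g by (auto simp: sobolev_Hs K.Hs_diff)
  have "(1/2) powr q * (sph.coef f k - sph.coef g k)\<^sup>2 \<le> sobolev_weight q (deg k) * (sph.coef f k - sph.coef g k)\<^sup>2"
    by (rule mult_right_mono[OF K.\<rho>0(2)]) simp
  also have "\<dots> \<le> K.J (\<lambda>u. f u - g u)"
    using sum_le_suminf[OF K.HsD(3)[OF d], of "{k}"] K.\<rho>_pos f g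
    by (auto simp: K.J_def K.Hs_diff sobolev_Hs less_imp_le)
  finally have "(sph.coef f k - sph.coef g k)\<^sup>2 \<le> 1 / (1/2) powr q * K.J (\<lambda>u. f u - g u)" by (simp add: field_simps)
  then have "\<bar>sph.coef f k - sph.coef g k\<bar> \<le> sqrt (1 / (1/2) powr q * K.J (\<lambda>u. f u - g u))"
    by (rule real_le_rsqrt[of "\<bar>_\<bar>", simplified])
  then show ?thesis unfolding dist_J[OF f g] by (simp add: real_sqrt_mult real_sqrt_divide)
qed

text \<open>Needed because the topology generating the Borel sets is the one of an abstract metric space.\<close>

lemma metric: "Metric_space (sobolev q) (sobolev_dist q)"
proof
  show "0 \<le> sobolev_dist q x y" for x y by (simp add: sobolev_dist_def)
  show "sobolev_dist q x y = sobolev_dist q y x" for x y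
  proof -
    have "sph.coef (\<lambda>u. x u - y u) k = - sph.coef (\<lambda>u. y u - x u) k" for k
      unfolding L2_inner_def by (simp add: algebra_simps flip: Bochner_Integration.integral_minus)
    then show ?thesis unfolding sobolev_dist_def sobolev_normsq_idx by simp
  qed
  fix x y assume x: "x \<in> sobolev q" and y: "y \<in> sobolev q"
  show "sobolev_dist q x y = 0 \<longleftrightarrow> x = y"
  proof
    assume "sobolev_dist q x y = 0"
    then have e: "sph.coef x k = sph.coef y k" for k using coef_lipschitz[OF x y, of k] by simp
    have "x u = y u" if "u \<in> S2" for u
      unfolding K.expansion[OF x[unfolded sobolev_Hs] that] K.expansion[OF y[unfolded sobolev_Hs] that] e ..
    moreover have "x u = y u" if "u \<notin> S2" for u using that x y unfolding sobolev_Hs by (simp add: K.HsD(2))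
    ultimately show "x = y" by blast
  qed (simp add: sobolev_dist_def sobolev_normsq_idx L2_inner_def)
  fix z assume z: "z \<in> sobolev q"
  show "sobolev_dist q x z \<le> sobolev_dist q x y + sobolev_dist q y z"
    using K.J_triangle[of "\<lambda>u. x u - y u" "\<lambda>u. y u - z u"] x y z
    by (simp add: dist_J sobolev_Hs K.Hs_diff)
qed

lemma space_borel: "space (sobolev_borel q) = sobolev q"
  and sets_borel: "openin (Metric_space.mtopology (sobolev q) (sobolev_dist q)) A \<Longrightarrow> A \<in> sets (sobolev_borel q)"
proof -
  interpret Metric_space "sobolev q" "sobolev_dist q" by (rule metric)
  have s: "{A. openin mtopology A} \<subseteq> Pow (sobolev q)" using openin_subset[of mtopology] by auto
  show "space (sobolev_borel q) = sobolev q" unfolding sobolev_borel_def by (rule space_measure_of[OF s])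
  show "openin mtopology A \<Longrightarrow> A \<in> sets (sobolev_borel q)"
    unfolding sobolev_borel_def sets_measure_of[OF s] by auto
qed

text \<open>The coefficients are Lipschitz functions on the Sobolev space.\<close>

lemma coef_measurable: "(\<lambda>f. sph.coef f k) \<in> borel_measurable (sobolev_borel q)"
proof (rule borel_measurable_iff_greater[THEN iffD2, rule_format])
  fix a
  interpret Metric_space "sobolev q" "sobolev_dist q" by (rule metric)
  define C where "C = sqrt (1 / (1/2) powr q)"
  have C: "0 < C" by (simp add: C_def)
  have "openin mtopology {f \<in> sobolev q. a < sph.coef f k}"
    unfolding openin_mtopology
  proof (intro conjI allI impI)
    fix f assume "f \<in> {f \<in> sobolev q. a < sph.coef f k}"
    then have f: "f \<in> sobolev q" "a < sph.coef f k" by auto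
    have "mball f ((sph.coef f k - a) / C) \<subseteq> {f \<in> sobolev q. a < sph.coef f k}"
    proof
      fix g assume "g \<in> mball f ((sph.coef f k - a) / C)"
      then have g: "g \<in> sobolev q" "C * sobolev_dist q f g < sph.coef f k - a" using C by (auto simp: field_simps)
      then show "g \<in> {f \<in> sobolev q. a < sph.coef f k}" using coef_lipschitz[OF f(1) g(1), of k] unfolding C_def by auto
    qed
    then show "\<exists>r>0. mball f r \<subseteq> {f \<in> sobolev q. a < sph.coef f k}" using f(2) C
      by (intro exI[of _ "(sph.coef f k - a) / C"]) simp
  qed auto
  then show "{f \<in> space (sobolev_borel q). a < sph.coef f k} \<in> sets (sobolev_borel q)"
    unfolding space_borel by (rule sets_borel)
qed

text \<open>Evaluation is jointly measurable as the pointwise limit of the partial sums of the expansion.\<close>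

lemma eval_measurable: "(\<lambda>x. fst x (snd x)) \<in> borel_measurable (sobolev_borel q \<Otimes>\<^sub>M surface)"
proof (rule borel_measurable_LIMSEQ_real)
  note [measurable] = coef_measurable meas_surface[OF continuous_harmonic]
  show "(\<lambda>x. \<Sum>k<n. sph.coef (fst x) k * harmonic k (snd x)) \<in> borel_measurable (sobolev_borel q \<Otimes>\<^sub>M surface)" for n
    by measurable
  fix x assume "x \<in> space (sobolev_borel q \<Otimes>\<^sub>M surface)"
  then show "(\<lambda>n. \<Sum>k<n. sph.coef (fst x) k * harmonic k (snd x)) \<longlonglongrightarrow> fst x (snd x)"
    using K.expansion_sums[of "fst x" "snd x"] by (auto simp: space_pair_measure space_borel sobolev_Hs sums_def)
qed

lemma eval_bound: "f \<in> sobolev q \<Longrightarrow> u \<in> S2 \<Longrightarrow> ennreal ((f u)\<^sup>2) \<le> ennreal B * sobolev_normsq q f"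
  using K.point_bound[of f u] K.B by (simp add: normsq_J sobolev_Hs ennreal_mult'[symmetric] K.J_nonneg ennreal_leI)

lemma coef_sum_le: "(\<Sum>k. ennreal ((sph.coef f k)\<^sup>2)) \<le> sobolev_normsq q f"
  unfolding sobolev_normsq_idx
proof (intro suminf_le ennreal_leI)
  fix k
  have "1 \<le> sobolev_weight q (deg k)" unfolding sobolev_weight_def using q by (intro ge_one_powr_ge_zero) auto
  from mult_right_mono[OF this, of "(sph.coef f k)\<^sup>2"]
  show "(sph.coef f k)\<^sup>2 \<le> sobolev_weight q (deg k) * (sph.coef f k)\<^sup>2" by simp
qed auto

end

section \<open>Markov's inequality, product laws and variances of weighted sums\<close>

lemma markov_ennreal:
  assumes F: "F \<in> borel_measurable M" and int: "(\<integral>\<^sup>+z. F z \<partial>M) \<le> ennreal C" and V: "0 < V"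
  shows "emeasure M {z \<in> space M. ennreal V < F z} \<le> ennreal (C / V)"
proof -
  let ?E = "{z \<in> space M. ennreal V < F z}"
  have E: "?E \<in> sets M" using F by measurable
  have "emeasure M ?E = (\<integral>\<^sup>+z. indicator ?E z \<partial>M)" using E by simp
  also have "\<dots> \<le> (\<integral>\<^sup>+z. ennreal (1 / V) * F z \<partial>M)"
  proof (rule nn_integral_mono)
    fix z
    have "1 = ennreal (1 / V) * ennreal V" using V by (simp add: ennreal_mult'[symmetric])
    moreover have "ennreal (1 / V) * ennreal V \<le> ennreal (1 / V) * F z" if "z \<in> ?E"
      using that by (intro mult_left_mono) auto
    ultimately show "indicator ?E z \<le> ennreal (1 / V) * F z"
      by (simp add: indicator_def)
  qed
  also have "\<dots> = ennreal (1 / V) * (\<integral>\<^sup>+z. F z \<partial>M)" by (rule nn_integral_cmult[OF F])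
  also have "\<dots> \<le> ennreal (1 / V) * ennreal C" by (intro mult_left_mono int) auto
  also have "\<dots> = ennreal (C / V)" using V by (simp add: ennreal_mult'[symmetric])
  finally show ?thesis .
qed

text \<open>Independence of blocks of coordinates, formulated through the sets of coordinates on which the functions
depend: factors depending on complementary sets integrate to the product of the integrals.\<close>

lemma PiM_block_integral:
  fixes f g :: "('i \<Rightarrow> 'a) \<Rightarrow> real"
  assumes N: "prob_space N" and I: "finite I" "A \<subseteq> I"
    and int: "integrable (PiM I (\<lambda>_. N)) f" "integrable (PiM I (\<lambda>_. N)) g" "integrable (PiM I (\<lambda>_. N)) (\<lambda>x. f x * g x)"
    and f: "\<And>x y. (\<And>i. i \<in> A \<Longrightarrow> x i = y i) \<Longrightarrow> f x = f y"
    and g: "\<And>x y. (\<And>i. i \<in> I - A \<Longrightarrow> x i = y i) \<Longrightarrow> g x = g y"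
  shows "(LINT x|PiM I (\<lambda>_. N). f x * g x) = (LINT x|PiM I (\<lambda>_. N). f x) * (LINT x|PiM I (\<lambda>_. N). g x)"
proof -
  interpret N: prob_space N by fact
  interpret product_prob_space "\<lambda>_. N" UNIV by unfold_locales
  define M1 where "M1 = PiM A (\<lambda>_. N)"
  define M2 where "M2 = PiM (I - A) (\<lambda>_. N)"
  interpret M1: prob_space M1 unfolding M1_def by (intro prob_space_PiM N)
  interpret M2: prob_space M2 unfolding M2_def by (intro prob_space_PiM N)
  have IA: "A \<union> (I - A) = I" "A \<inter> (I - A) = {}" "finite A" "finite (I - A)"
    using I finite_subset by auto
  have fold: "(LINT x|PiM I (\<lambda>_. N). h x) = (LINT x|M1. LINT y|M2. h (merge A (I - A) (x, y)))"
    if "integrable (PiM I (\<lambda>_. N)) h" for h :: "_ \<Rightarrow> real"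
    using product_integral_fold[OF IA(2-4), of h] that unfolding IA(1) M1_def M2_def by simp
  have fm: "f (merge A (I - A) (x, y)) = f x" and gm: "g (merge A (I - A) (x, y)) = g y" for x y
    by (auto intro!: f g simp: merge_def)
  show ?thesis unfolding fold[OF int(1)] fold[OF int(2)] fold[OF int(3)] fm gm
    by (simp add: M1.prob_space M2.prob_space)
qed

lemma pair_block_integral:
  fixes f g :: "('i \<Rightarrow> 'a) \<times> ('i \<Rightarrow> 'b) \<Rightarrow> real"
  assumes N: "prob_space N" "prob_space N'" and I: "finite I" "A \<subseteq> I"
    and int: "integrable (PiM I (\<lambda>_. N) \<Otimes>\<^sub>M PiM I (\<lambda>_. N')) f" "integrable (PiM I (\<lambda>_. N) \<Otimes>\<^sub>M PiM I (\<lambda>_. N')) g"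
      "integrable (PiM I (\<lambda>_. N) \<Otimes>\<^sub>M PiM I (\<lambda>_. N')) (\<lambda>x. f x * g x)"
    and f: "\<And>x y x' y'. (\<And>i. i \<in> A \<Longrightarrow> x i = x' i) \<Longrightarrow> (\<And>i. i \<in> A \<Longrightarrow> y i = y' i) \<Longrightarrow> f (x, y) = f (x', y')"
    and g: "\<And>x y x' y'. (\<And>i. i \<in> I - A \<Longrightarrow> x i = x' i) \<Longrightarrow> (\<And>i. i \<in> I - A \<Longrightarrow> y i = y' i) \<Longrightarrow> g (x, y) = g (x', y')"
  shows "(LINT x|(PiM I (\<lambda>_. N) \<Otimes>\<^sub>M PiM I (\<lambda>_. N')). f x * g x) =
    (LINT x|(PiM I (\<lambda>_. N) \<Otimes>\<^sub>M PiM I (\<lambda>_. N')). f x) * (LINT x|(PiM I (\<lambda>_. N) \<Otimes>\<^sub>M PiM I (\<lambda>_. N')). g x)"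
proof -
  define M1 where "M1 = PiM I (\<lambda>_. N)"
  define M2 where "M2 = PiM I (\<lambda>_. N')"
  interpret M1: prob_space M1 unfolding M1_def by (intro prob_space_PiM N)
  interpret M2: prob_space M2 unfolding M2_def by (intro prob_space_PiM N)
  interpret pair_sigma_finite M1 M2 ..
  note int = int[folded M1_def M2_def]
  define F where "F x = (LINT y|M2. f (x, y))" for x
  define G where "G x = (LINT y|M2. g (x, y))" for x
  have FG: "AE x in M1. (LINT y|M2. f (x, y) * g (x, y)) = F x * G x"
    using AE_integrable_fst'[OF int(1)] AE_integrable_fst'[OF int(2)] AE_integrable_fst'[OF int(3)]
  proof eventually_elim
    case (elim x)
    then show ?case unfolding F_def G_def M2_def
      by (intro PiM_block_integral[OF N(2) I]) (auto intro: f g)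
  qed
  have iF: "integrable M1 F" "integrable M1 G" unfolding F_def G_def by (intro integrable_fst' int)+
  have iFG: "integrable M1 (\<lambda>x. LINT y|M2. f (x, y) * g (x, y))" using integrable_fst'[OF int(3)] by simp
  have iFG': "integrable M1 (\<lambda>x. F x * G x)"
    by (rule integrable_cong_AE_imp[OF iFG _ FG]) (use iF in auto)
  have "(LINT x|(M1 \<Otimes>\<^sub>M M2). f x * g x) = (LINT x|M1. LINT y|M2. f (x, y) * g (x, y))"
    using integral_fst'[OF int(3)] by simp
  also have "\<dots> = (LINT x|M1. F x * G x)"
    by (rule integral_cong_AE[OF _ _ FG]) (use iFG iFG' in auto)
  also have "\<dots> = (LINT x|M1. F x) * (LINT x|M1. G x)"
    using iF iFG' unfolding M1_def
  proof (intro PiM_block_integral[OF N(1) I])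
    show "F x = F y" if "\<And>i. i \<in> A \<Longrightarrow> x i = y i" for x y
      unfolding F_def by (intro Bochner_Integration.integral_cong refl f that)
    show "G x = G y" if "\<And>i. i \<in> I - A \<Longrightarrow> x i = y i" for x y
      unfolding G_def by (intro Bochner_Integration.integral_cong refl g that)
  qed
  also have "(LINT x|M1. F x) = (LINT x|(M1 \<Otimes>\<^sub>M M2). f x)" unfolding F_def by (rule integral_fst'[OF int(1)])
  also have "(LINT x|M1. G x) = (LINT x|(M1 \<Otimes>\<^sub>M M2). g x)" unfolding G_def by (rule integral_fst'[OF int(2)])
  finally show ?thesis unfolding M1_def M2_def .
qed

text \<open>The relation \<open>D\<close> stands for uncorrelated pairs. Off \<open>D\<close> a product is bounded by half the sum of the squares, so only
second moments remain, weighted by the mass of the indices correlated with the given one.\<close>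

lemma variance_weighted_sum:
  fixes \<zeta> :: "'i \<Rightarrow> 'b \<Rightarrow> real" and w :: "'i \<Rightarrow> real"
  assumes N: "prob_space N" and I: "finite I" and w: "\<And>a. a \<in> I \<Longrightarrow> 0 \<le> w a"
    and \<zeta>: "\<And>a. a \<in> I \<Longrightarrow> \<zeta> a \<in> L2 N"
    and sym: "\<And>a b. D a b \<Longrightarrow> D b a"
    and D: "\<And>a b. a \<in> I \<Longrightarrow> b \<in> I \<Longrightarrow> D a b \<Longrightarrow> (LINT z|N. \<zeta> a z * \<zeta> b z) = (LINT z|N. \<zeta> a z) * (LINT z|N. \<zeta> b z)"
  shows "(LINT z|N. (\<Sum>a\<in>I. w a * \<zeta> a z)\<^sup>2) \<le>
     (\<Sum>a\<in>I. w a * (LINT z|N. \<zeta> a z))\<^sup>2 + (\<Sum>a\<in>I. w a * (\<Sum>b | b \<in> I \<and> \<not> D a b. w b) * (LINT z|N. (\<zeta> a z)\<^sup>2))"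
    and "(LINT z|N. ((\<Sum>a\<in>I. w a * \<zeta> a z) - (\<Sum>a\<in>I. w a * (LINT z|N. \<zeta> a z)))\<^sup>2) \<le>
     (\<Sum>a\<in>I. w a * (\<Sum>b | b \<in> I \<and> \<not> D a b. w b) * (LINT z|N. (\<zeta> a z)\<^sup>2))"
    and "integrable N (\<lambda>z. (\<Sum>a\<in>I. w a * \<zeta> a z)\<^sup>2)"
proof -
  interpret N: prob_space N by fact
  define m where "m a = (LINT z|N. \<zeta> a z)" for a
  define \<xi> where "\<xi> a z = \<zeta> a z - m a" for a z
  have cL: "(\<lambda>_. c) \<in> L2 N" for c :: real by (simp add: L2_def)
  have i1: "integrable N (\<zeta> a)" if "a \<in> I" for a
    using L2_add(1)[OF \<zeta>[OF that] cL[of 1]] by simp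
  have i2: "integrable N (\<lambda>z. (\<zeta> a z)\<^sup>2)" if "a \<in> I" for a using \<zeta>[OF that] by (simp add: L2_def)
  have i11: "integrable N (\<lambda>z. \<zeta> a z * \<zeta> b z)" if "a \<in> I" "b \<in> I" for a b using L2_add(1)[OF \<zeta> \<zeta>] that by blast
  have xL: "\<xi> a \<in> L2 N" if "a \<in> I" for a
    unfolding \<xi>_def[abs_def] by (rule L2_diff[OF \<zeta>[OF that] cL])
  have ix: "integrable N (\<lambda>z. \<xi> a z * \<xi> b z)" if "a \<in> I" "b \<in> I" for a b using L2_add(1)[OF xL xL] that by blast
  have cov: "(LINT z|N. \<xi> a z * \<xi> b z) = (LINT z|N. \<zeta> a z * \<zeta> b z) - m a * m b" if "a \<in> I" "b \<in> I" for a b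
  proof -
    have "(LINT z|N. \<xi> a z * \<xi> b z) = (LINT z|N. \<zeta> a z * \<zeta> b z - m b * \<zeta> a z - m a * \<zeta> b z + m a * m b)"
      by (rule Bochner_Integration.integral_cong) (auto simp: \<xi>_def algebra_simps)
    also have "\<dots> = (LINT z|N. \<zeta> a z * \<zeta> b z) - m b * m a - m a * m b + m a * m b"
      using that by (simp add: i1 i11 m_def N.prob_space)
    finally show ?thesis by simp
  qed
  define v where "v a = (LINT z|N. (\<xi> a z)\<^sup>2)" for a
  have v: "v a \<le> (LINT z|N. (\<zeta> a z)\<^sup>2)" if "a \<in> I" for a
    using cov[OF that that] unfolding v_def power2_eq_square by simp
  have covD: "(LINT z|N. \<xi> a z * \<xi> b z) \<le> (if D a b then 0 else (v a + v b) / 2)" if "a \<in> I" "b \<in> I" for a b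
  proof (cases "D a b")
    case True
    then show ?thesis using cov[OF that] D[OF that True] by (simp add: m_def)
  next
    case False
    have "(LINT z|N. \<xi> a z * \<xi> b z) \<le> (LINT z|N. ((\<xi> a z)\<^sup>2 + (\<xi> b z)\<^sup>2) / 2)"
    proof (rule integral_mono[OF ix[OF that]])
      show "integrable N (\<lambda>z. ((\<xi> a z)\<^sup>2 + (\<xi> b z)\<^sup>2) / 2)" using xL that by (simp add: L2_def)
      show "\<xi> a z * \<xi> b z \<le> ((\<xi> a z)\<^sup>2 + (\<xi> b z)\<^sup>2) / 2" for z using sum_squares_bound[of "\<xi> a z" "\<xi> b z"] by simp
    qed
    also have "\<dots> = (v a + v b) / 2" unfolding v_def using xL that by (simp add: L2_def)
    finally show ?thesis using False by simp
  qed
  define W where "W = (\<Sum>a\<in>I. w a * (\<Sum>b | b \<in> I \<and> \<not> D a b. w b) * (LINT z|N. (\<zeta> a z)\<^sup>2))"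
  define Z where "Z z = (\<Sum>a\<in>I. w a * \<xi> a z)" for z
  define m0 where "m0 = (\<Sum>a\<in>I. w a * m a)"
  have Zm: "(\<Sum>a\<in>I. w a * \<zeta> a z) = Z z + m0" for z
    by (simp add: Z_def m0_def \<xi>_def algebra_simps sum_subtractf)
  have Z2: "(Z z)\<^sup>2 = (\<Sum>a\<in>I. \<Sum>b\<in>I. w a * w b * (\<xi> a z * \<xi> b z))" for z
    unfolding Z_def power2_eq_square sum_product by (simp add: mult_ac)
  have iZ2: "integrable N (\<lambda>z. (Z z)\<^sup>2)" unfolding Z2
    by (intro Bochner_Integration.integrable_sum integrable_mult_right ix)
  have iZ: "integrable N Z" unfolding Z_def[abs_def] \<xi>_def[abs_def]
    by (intro Bochner_Integration.integrable_sum integrable_mult_right Bochner_Integration.integrable_diff i1) auto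
  have Z0: "(LINT z|N. Z z) = 0"
    unfolding Z_def \<xi>_def by (subst Bochner_Integration.integral_sum) (auto simp: i1 m_def N.prob_space)
  have var: "(LINT z|N. (Z z)\<^sup>2) \<le> W"
  proof -
    have "(LINT z|N. (Z z)\<^sup>2) = (\<Sum>a\<in>I. \<Sum>b\<in>I. w a * w b * (LINT z|N. \<xi> a z * \<xi> b z))"
      unfolding Z2 by (simp add: Bochner_Integration.integral_sum Bochner_Integration.integrable_sum ix)
    also have "\<dots> \<le> (\<Sum>a\<in>I. \<Sum>b\<in>I. w a * w b * (if D a b then 0 else (v a + v b) / 2))"
      using w covD by (intro sum_mono mult_left_mono) auto
    also have "\<dots> = (\<Sum>a\<in>I. \<Sum>b\<in>I. (if D a b then 0 else w a * w b * v a) / 2) + (\<Sum>a\<in>I. \<Sum>b\<in>I. (if D a b then 0 else w a * w b * v b) / 2)"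
      unfolding sum.distrib[symmetric] by (intro sum.cong refl) (auto simp: field_simps)
    also have "(\<Sum>a\<in>I. \<Sum>b\<in>I. (if D a b then 0 else w a * w b * v b) / 2) = (\<Sum>b\<in>I. \<Sum>a\<in>I. (if D a b then 0 else w a * w b * v b) / 2)"
      by (rule sum.swap)
    also have "\<dots> = (\<Sum>a\<in>I. \<Sum>b\<in>I. (if D a b then 0 else w a * w b * v a) / 2)"
    proof -
      have "D a b = D b a" for a b using sym by blast
      then show ?thesis by (intro sum.cong refl) (simp add: mult.commute)
    qed
    also have "(\<Sum>a\<in>I. \<Sum>b\<in>I. (if D a b then 0 else w a * w b * v a) / 2) + (\<Sum>a\<in>I. \<Sum>b\<in>I. (if D a b then 0 else w a * w b * v a) / 2)
       = (\<Sum>a\<in>I. \<Sum>b\<in>I. (if D a b then 0 else w a * w b * v a))"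
      by (simp add: sum_divide_distrib[symmetric])
    also have "\<dots> = (\<Sum>a\<in>I. w a * (\<Sum>b | b \<in> I \<and> \<not> D a b. w b) * v a)"
    proof (rule sum.cong[OF refl])
      fix a assume "a \<in> I"
      have "(\<Sum>b\<in>I. (if D a b then 0 else w a * w b * v a)) = (\<Sum>b | b \<in> I \<and> \<not> D a b. w a * w b * v a)"
        unfolding sum.inter_filter[OF I] by (intro sum.cong) auto
      then show "(\<Sum>b\<in>I. (if D a b then 0 else w a * w b * v a)) = w a * (\<Sum>b | b \<in> I \<and> \<not> D a b. w b) * v a"
        by (simp add: sum_distrib_left sum_distrib_right)
    qed
    also have "\<dots> \<le> W" unfolding W_def using w v
      by (intro sum_mono mult_left_mono mult_nonneg_nonneg sum_nonneg) auto
    finally show ?thesis .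
  qed
  have sq: "(\<Sum>a\<in>I. w a * \<zeta> a z)\<^sup>2 = (Z z)\<^sup>2 + 2 * m0 * Z z + m0\<^sup>2" for z
    unfolding Zm by (simp add: power2_eq_square algebra_simps)
  show "integrable N (\<lambda>z. (\<Sum>a\<in>I. w a * \<zeta> a z)\<^sup>2)" unfolding sq using iZ2 iZ by simp
  have "(LINT z|N. (\<Sum>a\<in>I. w a * \<zeta> a z)\<^sup>2) = (LINT z|N. (Z z)\<^sup>2) + m0\<^sup>2"
    unfolding sq using iZ2 iZ by (simp add: Z0 N.prob_space)
  then show "(LINT z|N. (\<Sum>a\<in>I. w a * \<zeta> a z)\<^sup>2) \<le>
     (\<Sum>a\<in>I. w a * (LINT z|N. \<zeta> a z))\<^sup>2 + (\<Sum>a\<in>I. w a * (\<Sum>b | b \<in> I \<and> \<not> D a b. w b) * (LINT z|N. (\<zeta> a z)\<^sup>2))"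
    using var unfolding W_def m0_def m_def by simp
  show "(LINT z|N. ((\<Sum>a\<in>I. w a * \<zeta> a z) - (\<Sum>a\<in>I. w a * (LINT z|N. \<zeta> a z)))\<^sup>2) \<le>
     (\<Sum>a\<in>I. w a * (\<Sum>b | b \<in> I \<and> \<not> D a b. w b) * (LINT z|N. (\<zeta> a z)\<^sup>2))"
    using var unfolding Zm m_def[symmetric] m0_def[symmetric] W_def by simp
qed

section \<open>A probabilistic risk bound for regression designs\<close>

text \<open>The common structure of the two regressions. The design has points \<open>x a\<close> and responses \<open>y a\<close>; \<open>MX\<close> carries
the curves and \<open>MY\<close> the locations and errors. The relation \<open>D\<close> marks the pairs of indices that are independent
given the curves, and \<open>\<kappa>\<close> bounds the mass of the remaining pairs. \<open>\<Phi> k\<close> is the conditional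
expectation, given the curves, of the \<open>k\<close>-th empirical residual coefficient.\<close>

locale regression_design = kernel_space M S e \<rho> \<rho>0 B
  for M :: "'x::topological_space measure" and S e \<rho> \<rho>0 B +
  fixes MX :: "'a measure" and MY :: "'b measure" and I :: "'i set" and w :: "'i \<Rightarrow> real"
    and D :: "'i \<Rightarrow> 'i \<Rightarrow> bool" and x :: "'i \<Rightarrow> 'b \<Rightarrow> 'x" and y :: "'i \<Rightarrow> 'a \<Rightarrow> 'b \<Rightarrow> real"
    and f0 :: "'x \<Rightarrow> real" and \<Phi> :: "nat \<Rightarrow> 'a \<Rightarrow> real" and q \<kappa> Cy C\<Phi> :: real
  assumes MX: "prob_space MX" and MY: "prob_space MY" and I: "finite I" and w: "\<And>a. a \<in> I \<Longrightarrow> 0 \<le> w a"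
    and D_sym: "\<And>a b. D a b \<Longrightarrow> D b a"
    and x_meas: "\<And>a. a \<in> I \<Longrightarrow> x a \<in> MY \<rightarrow>\<^sub>M M"
    and law: "\<And>a (h :: 'x \<Rightarrow> real). a \<in> I \<Longrightarrow> continuous_on S h \<Longrightarrow> (LINT Y|MY. h (x a Y)) = (LINT z|M. h z) / q"
    and indep_x: "\<And>a b (h :: 'x \<Rightarrow> real). a \<in> I \<Longrightarrow> b \<in> I \<Longrightarrow> D a b \<Longrightarrow> continuous_on S h \<Longrightarrow>
      (LINT Y|MY. h (x a Y) * h (x b Y)) = (LINT Y|MY. h (x a Y)) * (LINT Y|MY. h (x b Y))"
    and q: "0 < q" and total: "sum w I = q"
    and \<kappa>: "0 \<le> \<kappa>" and overlap: "(\<Sum>a\<in>I. w a * (\<Sum>b | b \<in> I \<and> \<not> D a b. w b)) \<le> \<kappa>"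
    and f0: "f0 \<in> Hs"
    and y_meas: "\<And>a. a \<in> I \<Longrightarrow> (\<lambda>z. y a (fst z) (snd z)) \<in> borel_measurable (MX \<Otimes>\<^sub>M MY)"
    and y_sq: "\<And>a X. a \<in> I \<Longrightarrow> X \<in> space MX \<Longrightarrow> integrable MY (\<lambda>Y. (y a X Y)\<^sup>2)"
    and indep_y: "\<And>a b X k. a \<in> I \<Longrightarrow> b \<in> I \<Longrightarrow> D a b \<Longrightarrow> X \<in> space MX \<Longrightarrow>
      (LINT Y|MY. ((y a X Y - f0 (x a Y)) * e k (x a Y)) * ((y b X Y - f0 (x b Y)) * e k (x b Y))) =
      (LINT Y|MY. (y a X Y - f0 (x a Y)) * e k (x a Y)) * (LINT Y|MY. (y b X Y - f0 (x b Y)) * e k (x b Y))"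
    and \<Phi>_meas: "\<And>k. \<Phi> k \<in> borel_measurable MX"
    and cond_mean: "\<And>X k. X \<in> space MX \<Longrightarrow> (\<Sum>a\<in>I. w a * (LINT Y|MY. (y a X Y - f0 (x a Y)) * e k (x a Y))) = \<Phi> k X"
    and C\<Phi>: "0 \<le> C\<Phi>" and \<Phi>_bound: "(\<Sum>k. \<integral>\<^sup>+X. ennreal ((\<Phi> k X)\<^sup>2) \<partial>MX) \<le> ennreal C\<Phi>"
    and Cy: "0 \<le> Cy" and y_bound: "\<And>a. a \<in> I \<Longrightarrow>
      (\<integral>\<^sup>+z. ennreal ((y a (fst z) (snd z) - f0 (x a (snd z)))\<^sup>2) \<partial>(MX \<Otimes>\<^sub>M MY)) \<le> ennreal Cy"
begin

sublocale MX: prob_space MX by (rule MX)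
sublocale MY: prob_space MY by (rule MY)

abbreviation \<Omega> where "\<Omega> \<equiv> MX \<Otimes>\<^sub>M MY"

text \<open>The quantity bounded by \<open>V\<close> in the oracle inequality.\<close>

definition noise :: "real \<Rightarrow> 'a \<times> 'b \<Rightarrow> ennreal" where
  "noise \<eta> z = (\<Sum>k. ennreal ((\<Sum>a\<in>I. w a * ((y a (fst z) (snd z) - f0 (x a (snd z))) * e k (x a (snd z))))\<^sup>2 / (1 + \<eta> * \<rho> k)))"

text \<open>The squared weighted Hilbert-Schmidt distance of the empirical Gram matrix from the identity.\<close>

definition gram_error :: "real \<Rightarrow> 'a \<times> 'b \<Rightarrow> ennreal" where
  "gram_error \<eta> z = (\<Sum>k. \<Sum>j. ennreal (((\<Sum>a\<in>I. w a * (e k (x a (snd z)) * e j (x a (snd z)))) - (if k = j then 1 else 0))\<^sup>2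
     / ((1 + \<eta> * \<rho> k) * (1 + \<eta> * \<rho> j))))"

lemma x_S: "a \<in> I \<Longrightarrow> Y \<in> space MY \<Longrightarrow> x a Y \<in> S"
  using x_meas[of a] measurable_space space_M by metis

lemma cont_meas: "a \<in> I \<Longrightarrow> continuous_on S h \<Longrightarrow> (\<lambda>Y. h (x a Y) :: real) \<in> borel_measurable MY"
  using measurable_compose[OF x_meas meas] .

lemma cont_bounded_L2:
  assumes a: "a \<in> I" and h: "continuous_on S h" and g: "g \<in> L2 MY"
  shows "(\<lambda>Y. g Y * h (x a Y)) \<in> L2 MY"
proof -
  obtain C where C: "0 \<le> C" "\<And>z. z \<in> S \<Longrightarrow> \<bar>h z\<bar> \<le> C" using bounded_cont[OF h] by blast
  have [measurable]: "g \<in> borel_measurable MY" "(\<lambda>Y. h (x a Y)) \<in> borel_measurable MY"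
    using g cont_meas[OF a h] by (auto simp: L2_def)
  have "integrable MY (\<lambda>Y. (g Y * h (x a Y))\<^sup>2)"
  proof (rule Bochner_Integration.integrable_bound)
    show "integrable MY (\<lambda>Y. C\<^sup>2 * (g Y)\<^sup>2)" using g by (simp add: L2_def)
    show "AE Y in MY. norm ((g Y * h (x a Y))\<^sup>2) \<le> norm (C\<^sup>2 * (g Y)\<^sup>2)"
    proof (rule AE_I2)
      fix Y assume "Y \<in> space MY"
      then have "\<bar>h (x a Y)\<bar> \<le> \<bar>C\<bar>" using C x_S[OF a] by fastforce
      then have "(h (x a Y))\<^sup>2 \<le> C\<^sup>2" by (rule abs_le_square_iff[THEN iffD1])
      from mult_right_mono[OF this, of "(g Y)\<^sup>2"]
      show "norm ((g Y * h (x a Y))\<^sup>2) \<le> norm (C\<^sup>2 * (g Y)\<^sup>2)" by (simp add: power_mult_distrib mult.commute)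
    qed
  qed simp
  then show ?thesis by (simp add: L2_def)
qed

lemma one_L2: "(\<lambda>_. 1) \<in> L2 MY" by (simp add: L2_def)

lemma cont_L2: "a \<in> I \<Longrightarrow> continuous_on S h \<Longrightarrow> (\<lambda>Y. h (x a Y)) \<in> L2 MY"
  using cont_bounded_L2[OF _ _ one_L2] by simp

lemma y_meas1: "a \<in> I \<Longrightarrow> X \<in> space MX \<Longrightarrow> y a X \<in> borel_measurable MY"
  using measurable_compose[OF measurable_Pair1' y_meas[of a]] by simp

lemma resid_L2:
  assumes a: "a \<in> I" and X: "X \<in> space MX"
  shows "(\<lambda>Y. (y a X Y - f0 (x a Y)) * e k (x a Y)) \<in> L2 MY"
proof (rule cont_bounded_L2[OF a cont_e L2_diff[OF _ cont_L2[OF a HsD(1)[OF f0]]]])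
  show "y a X \<in> L2 MY" using y_meas1[OF a X] y_sq[OF a X] by (simp add: L2_def)
qed

lemma meas_resid: "a \<in> I \<Longrightarrow> (\<lambda>z. (y a (fst z) (snd z) - f0 (x a (snd z))) * e k (x a (snd z))) \<in> borel_measurable \<Omega>"
  and meas_resid': "a \<in> I \<Longrightarrow> (\<lambda>z. (y a (fst z) (snd z) - f0 (x a (snd z)))) \<in> borel_measurable \<Omega>"
  and meas_ex: "a \<in> I \<Longrightarrow> (\<lambda>z. e k (x a (snd z))) \<in> borel_measurable \<Omega>"
proof -
  assume a: "a \<in> I"
  note [measurable] = y_meas[OF a] measurable_compose[OF measurable_snd cont_meas[OF a HsD(1)[OF f0]]]
    measurable_compose[OF measurable_snd cont_meas[OF a cont_e]]
  show "(\<lambda>z. (y a (fst z) (snd z) - f0 (x a (snd z))) * e k (x a (snd z))) \<in> borel_measurable \<Omega>" by measurable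
  show "(\<lambda>z. (y a (fst z) (snd z) - f0 (x a (snd z)))) \<in> borel_measurable \<Omega>" by measurable
  show "(\<lambda>z. e k (x a (snd z))) \<in> borel_measurable \<Omega>" by measurable
qed

lemma meas_noise [measurable]: "noise \<eta> \<in> borel_measurable \<Omega>"
proof -
  note [measurable] = meas_resid
  show ?thesis unfolding noise_def[abs_def] by measurable
qed

lemma meas_gram [measurable]: "gram_error \<eta> \<in> borel_measurable \<Omega>"
proof -
  note [measurable] = meas_ex
  show ?thesis unfolding gram_error_def[abs_def] by measurable
qed

definition W :: "'i \<Rightarrow> real" where "W a = w a * (\<Sum>b | b \<in> I \<and> \<not> D a b. w b)"

lemma W_nonneg: "a \<in> I \<Longrightarrow> 0 \<le> W a"
  unfolding W_def by (intro mult_nonneg_nonneg sum_nonneg w) auto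

lemma W_sum: "(\<Sum>a\<in>I. ennreal (W a) * ennreal C) \<le> ennreal (\<kappa> * C)" if "0 \<le> C"
proof -
  have "(\<Sum>a\<in>I. ennreal (W a) * ennreal C) = ennreal (sum W I) * ennreal C"
    using W_nonneg by (simp add: sum_distrib_right[symmetric] sum_ennreal)
  also have "\<dots> \<le> ennreal \<kappa> * ennreal C"
    using overlap by (intro mult_right_mono ennreal_leI) (auto simp: W_def)
  finally show ?thesis using \<kappa> that by (simp add: ennreal_mult)
qed

context
  fixes \<eta> G :: real
  assumes \<eta>: "0 < \<eta>" and G: "0 \<le> G" and dim: "\<And>z. z \<in> S \<Longrightarrow> (\<Sum>k. ennreal ((e k z)\<^sup>2 / (1 + \<eta> * \<rho> k))) \<le> ennreal G"
begin

lemma A_ge_1: "1 \<le> 1 + \<eta> * \<rho> k" using \<eta> \<rho>_pos[of k] by simp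

text \<open>Given the curves, the second moment of a coefficient is its squared mean \<open>(\<Phi> k)\<^sup>2\<close> plus the contribution of
dependent pairs. Summing the latter over \<open>k\<close> with the weights \<open>1 / (1 + \<eta> * \<rho> k)\<close> under the integral produces the
effective dimension \<open>G\<close>, while the conditional means are summed with weights at most 1.\<close>

lemma noise_expectation: "(\<integral>\<^sup>+z. noise \<eta> z \<partial>\<Omega>) \<le> ennreal (\<kappa> * (G * Cy) + C\<Phi>)"
proof -
  define r where "r a z = y a (fst z) (snd z) - f0 (x a (snd z))" for a z
  define \<epsilon> where "\<epsilon> k z = (\<Sum>a\<in>I. w a * (r a z * e k (x a (snd z))))" for k z
  have [measurable]: "\<And>a. a \<in> I \<Longrightarrow> r a \<in> borel_measurable \<Omega>" "\<And>a k. a \<in> I \<Longrightarrow> (\<lambda>z. e k (x a (snd z))) \<in> borel_measurable \<Omega>"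
    unfolding r_def[abs_def] using meas_resid' meas_ex by auto
  have [measurable]: "\<epsilon> k \<in> borel_measurable \<Omega>" for k unfolding \<epsilon>_def[abs_def] by measurable
  note [measurable] = \<Phi>_meas
  have per_k: "(\<integral>\<^sup>+z. ennreal ((\<epsilon> k z)\<^sup>2) \<partial>\<Omega>) \<le>
      (\<Sum>a\<in>I. ennreal (W a) * (\<integral>\<^sup>+z. ennreal ((r a z * e k (x a (snd z)))\<^sup>2) \<partial>\<Omega>)) + (\<integral>\<^sup>+X. ennreal ((\<Phi> k X)\<^sup>2) \<partial>MX)" for k
  proof -
    have "(\<integral>\<^sup>+z. ennreal ((\<epsilon> k z)\<^sup>2) \<partial>\<Omega>) = (\<integral>\<^sup>+X. \<integral>\<^sup>+Y. ennreal ((\<epsilon> k (X, Y))\<^sup>2) \<partial>MY \<partial>MX)"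
      by (rule MY.nn_integral_fst[symmetric]) measurable
    also have "\<dots> \<le> (\<integral>\<^sup>+X. (\<Sum>a\<in>I. ennreal (W a) * (\<integral>\<^sup>+Y. ennreal ((r a (X, Y) * e k (x a Y))\<^sup>2) \<partial>MY)) + ennreal ((\<Phi> k X)\<^sup>2) \<partial>MX)"
    proof (rule nn_integral_mono)
      fix X assume X: "X \<in> space MX"
      note v = variance_weighted_sum[where N = MY and I = I and w = w and \<zeta> = "\<lambda>a Y. (y a X Y - f0 (x a Y)) * e k (x a Y)" and D = D, OF MY I w resid_L2[OF _ X] D_sym indep_y[OF _ _ _ X]]
      have sq: "integrable MY (\<lambda>Y. ((y a X Y - f0 (x a Y)) * e k (x a Y))\<^sup>2)" if "a \<in> I" for a
        using resid_L2[OF that X] by (simp add: L2_def)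
      have "(\<integral>\<^sup>+Y. ennreal ((\<epsilon> k (X, Y))\<^sup>2) \<partial>MY) = ennreal (LINT Y|MY. (\<Sum>a\<in>I. w a * ((y a X Y - f0 (x a Y)) * e k (x a Y)))\<^sup>2)"
        unfolding \<epsilon>_def r_def fst_conv snd_conv by (rule nn_integral_eq_integral) (use v(3) in auto)
      also have "\<dots> \<le> ennreal ((\<Phi> k X)\<^sup>2 + (\<Sum>a\<in>I. W a * (LINT Y|MY. ((y a X Y - f0 (x a Y)) * e k (x a Y))\<^sup>2)))"
        using v(1) unfolding cond_mean[OF X] W_def by (intro ennreal_leI) auto
      also have "\<dots> = ennreal ((\<Phi> k X)\<^sup>2) + (\<Sum>a\<in>I. ennreal (W a) * (\<integral>\<^sup>+Y. ennreal ((r a (X, Y) * e k (x a Y))\<^sup>2) \<partial>MY))"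
        using W_nonneg by (subst ennreal_plus)
          (auto intro!: sum_nonneg mult_nonneg_nonneg sum.cong simp: sum_ennreal[symmetric] ennreal_mult r_def nn_integral_eq_integral[OF sq])
      finally show "(\<integral>\<^sup>+Y. ennreal ((\<epsilon> k (X, Y))\<^sup>2) \<partial>MY) \<le>
          (\<Sum>a\<in>I. ennreal (W a) * (\<integral>\<^sup>+Y. ennreal ((r a (X, Y) * e k (x a Y))\<^sup>2) \<partial>MY)) + ennreal ((\<Phi> k X)\<^sup>2)" by (simp add: add.commute)
    qed
    also have "\<dots> = (\<Sum>a\<in>I. ennreal (W a) * (\<integral>\<^sup>+X. \<integral>\<^sup>+Y. ennreal ((r a (X, Y) * e k (x a Y))\<^sup>2) \<partial>MY \<partial>MX)) + (\<integral>\<^sup>+X. ennreal ((\<Phi> k X)\<^sup>2) \<partial>MX)"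
    proof -
      have m: "(\<lambda>X. \<integral>\<^sup>+Y. ennreal ((r a (X, Y) * e k (x a Y))\<^sup>2) \<partial>MY) \<in> borel_measurable MX" if a[measurable]: "a \<in> I" for a
        using MY.borel_measurable_nn_integral_fst[of "\<lambda>z. ennreal ((r a z * e k (x a (snd z)))\<^sup>2)" MX] by simp
      show ?thesis using m by (subst nn_integral_add) (auto simp: nn_integral_sum nn_integral_cmult)
    qed
    also have "(\<Sum>a\<in>I. ennreal (W a) * (\<integral>\<^sup>+X. \<integral>\<^sup>+Y. ennreal ((r a (X, Y) * e k (x a Y))\<^sup>2) \<partial>MY \<partial>MX))
       = (\<Sum>a\<in>I. ennreal (W a) * (\<integral>\<^sup>+z. ennreal ((r a z * e k (x a (snd z)))\<^sup>2) \<partial>\<Omega>))"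
    proof (intro sum.cong refl arg_cong[where f = "\<lambda>c. _ * c"])
      fix a assume [measurable]: "a \<in> I"
      show "(\<integral>\<^sup>+X. \<integral>\<^sup>+Y. ennreal ((r a (X, Y) * e k (x a Y))\<^sup>2) \<partial>MY \<partial>MX) = (\<integral>\<^sup>+z. ennreal ((r a z * e k (x a (snd z)))\<^sup>2) \<partial>\<Omega>)"
        using MY.nn_integral_fst[of "\<lambda>z. ennreal ((r a z * e k (x a (snd z)))\<^sup>2)" MX] by simp
    qed
    finally show ?thesis .
  qed
  have iA: "0 \<le> 1 / (1 + \<eta> * \<rho> k)" "1 / (1 + \<eta> * \<rho> k) \<le> 1" for k using A_ge_1[of k] by auto
  have "(\<integral>\<^sup>+z. noise \<eta> z \<partial>\<Omega>) = (\<integral>\<^sup>+z. (\<Sum>k. ennreal (1 / (1 + \<eta> * \<rho> k)) * ennreal ((\<epsilon> k z)\<^sup>2)) \<partial>\<Omega>)"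
    unfolding noise_def \<epsilon>_def r_def using iA by (simp add: ennreal_mult'[symmetric])
  also have "\<dots> = (\<Sum>k. ennreal (1 / (1 + \<eta> * \<rho> k)) * (\<integral>\<^sup>+z. ennreal ((\<epsilon> k z)\<^sup>2) \<partial>\<Omega>))"
    by (subst nn_integral_suminf) (auto simp: nn_integral_cmult)
  also have "\<dots> \<le> (\<Sum>k. (\<Sum>a\<in>I. ennreal (W a) * (ennreal (1 / (1 + \<eta> * \<rho> k)) * (\<integral>\<^sup>+z. ennreal ((r a z * e k (x a (snd z)))\<^sup>2) \<partial>\<Omega>))) + (\<integral>\<^sup>+X. ennreal ((\<Phi> k X)\<^sup>2) \<partial>MX))"
  proof (intro suminf_le allI)
    fix k
    have "ennreal (1 / (1 + \<eta> * \<rho> k)) * (\<integral>\<^sup>+z. ennreal ((\<epsilon> k z)\<^sup>2) \<partial>\<Omega>) \<le>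
      ennreal (1 / (1 + \<eta> * \<rho> k)) * (\<Sum>a\<in>I. ennreal (W a) * (\<integral>\<^sup>+z. ennreal ((r a z * e k (x a (snd z)))\<^sup>2) \<partial>\<Omega>))
       + ennreal (1 / (1 + \<eta> * \<rho> k)) * (\<integral>\<^sup>+X. ennreal ((\<Phi> k X)\<^sup>2) \<partial>MX)"
      unfolding distrib_left[symmetric] by (intro mult_left_mono per_k) simp
    also have "ennreal (1 / (1 + \<eta> * \<rho> k)) * (\<integral>\<^sup>+X. ennreal ((\<Phi> k X)\<^sup>2) \<partial>MX) \<le> 1 * (\<integral>\<^sup>+X. ennreal ((\<Phi> k X)\<^sup>2) \<partial>MX)"
      using iA(2)[of k] by (intro mult_right_mono) (auto simp: ennreal_le_1)
    finally show "ennreal (1 / (1 + \<eta> * \<rho> k)) * (\<integral>\<^sup>+z. ennreal ((\<epsilon> k z)\<^sup>2) \<partial>\<Omega>) \<le>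
      (\<Sum>a\<in>I. ennreal (W a) * (ennreal (1 / (1 + \<eta> * \<rho> k)) * (\<integral>\<^sup>+z. ennreal ((r a z * e k (x a (snd z)))\<^sup>2) \<partial>\<Omega>))) + (\<integral>\<^sup>+X. ennreal ((\<Phi> k X)\<^sup>2) \<partial>MX)"
      by (simp add: sum_distrib_left mult.left_commute add_left_mono)
  qed auto
  also have "\<dots> = (\<Sum>a\<in>I. ennreal (W a) * (\<Sum>k. ennreal (1 / (1 + \<eta> * \<rho> k)) * (\<integral>\<^sup>+z. ennreal ((r a z * e k (x a (snd z)))\<^sup>2) \<partial>\<Omega>))) + (\<Sum>k. \<integral>\<^sup>+X. ennreal ((\<Phi> k X)\<^sup>2) \<partial>MX)"
    by (simp add: suminf_add[symmetric] suminf_sum ennreal_suminf_cmult)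
  also have "\<dots> \<le> (\<Sum>a\<in>I. ennreal (W a) * ennreal (G * Cy)) + ennreal C\<Phi>"
  proof (intro add_mono \<Phi>_bound sum_mono mult_left_mono)
    fix a assume a[measurable]: "a \<in> I"
    have "(\<Sum>k. ennreal (1 / (1 + \<eta> * \<rho> k)) * (\<integral>\<^sup>+z. ennreal ((r a z * e k (x a (snd z)))\<^sup>2) \<partial>\<Omega>))
      = (\<integral>\<^sup>+z. (\<Sum>k. ennreal (1 / (1 + \<eta> * \<rho> k)) * ennreal ((r a z * e k (x a (snd z)))\<^sup>2)) \<partial>\<Omega>)"
      by (subst nn_integral_suminf) (auto simp: nn_integral_cmult)
    also have "\<dots> \<le> (\<integral>\<^sup>+z. ennreal G * ennreal ((r a z)\<^sup>2) \<partial>\<Omega>)"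
    proof (rule nn_integral_mono)
      fix z assume "z \<in> space \<Omega>"
      then have xS: "x a (snd z) \<in> S" using x_S[OF a] by (auto simp: space_pair_measure)
      have "(\<Sum>k. ennreal (1 / (1 + \<eta> * \<rho> k)) * ennreal ((r a z * e k (x a (snd z)))\<^sup>2))
        = (\<Sum>k. ennreal ((e k (x a (snd z)))\<^sup>2 / (1 + \<eta> * \<rho> k)) * ennreal ((r a z)\<^sup>2))"
        using iA by (intro suminf_cong) (simp add: ennreal_mult'[symmetric] power_mult_distrib mult.commute)
      also have "\<dots> = (\<Sum>k. ennreal ((e k (x a (snd z)))\<^sup>2 / (1 + \<eta> * \<rho> k))) * ennreal ((r a z)\<^sup>2)" by (rule ennreal_suminf_multc)
      also have "\<dots> \<le> ennreal G * ennreal ((r a z)\<^sup>2)" by (intro mult_right_mono dim xS) simp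
      finally show "(\<Sum>k. ennreal (1 / (1 + \<eta> * \<rho> k)) * ennreal ((r a z * e k (x a (snd z)))\<^sup>2)) \<le> ennreal G * ennreal ((r a z)\<^sup>2)" .
    qed
    also have "\<dots> = ennreal G * (\<integral>\<^sup>+z. ennreal ((r a z)\<^sup>2) \<partial>\<Omega>)" by (rule nn_integral_cmult) measurable
    also have "\<dots> \<le> ennreal G * ennreal Cy" unfolding r_def by (intro mult_left_mono y_bound a) simp
    also have "\<dots> = ennreal (G * Cy)" using G Cy by (simp add: ennreal_mult)
    finally show "(\<Sum>k. ennreal (1 / (1 + \<eta> * \<rho> k)) * (\<integral>\<^sup>+z. ennreal ((r a z * e k (x a (snd z)))\<^sup>2) \<partial>\<Omega>)) \<le> ennreal (G * Cy)" .
  qed auto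
  also have "\<dots> \<le> ennreal (\<kappa> * (G * Cy)) + ennreal C\<Phi>" using G Cy by (intro add_right_mono W_sum) auto
  also have "\<dots> = ennreal (\<kappa> * (G * Cy) + C\<Phi>)" using \<kappa> G Cy C\<Phi> by (simp add: ennreal_plus)
  finally show ?thesis .
qed

text \<open>The entries of the Gram matrix are unbiased, so only dependent pairs contribute; the double sum over \<open>k\<close> and
\<open>j\<close> is the product of two effective dimensions.\<close>

lemma gram_expectation: "(\<integral>\<^sup>+z. gram_error \<eta> z \<partial>\<Omega>) \<le> ennreal (\<kappa> * G\<^sup>2)"
proof -
  define t where "t k j Y = (\<Sum>a\<in>I. w a * (e k (x a Y) * e j (x a Y))) - (if k = j then 1 else 0)" for k j Y
  have [measurable]: "\<And>a k. a \<in> I \<Longrightarrow> (\<lambda>Y. e k (x a Y)) \<in> borel_measurable MY" by (intro cont_meas cont_e)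
  have [measurable]: "t k j \<in> borel_measurable MY" for k j unfolding t_def[abs_def] by measurable
  define A where "A k = 1 + \<eta> * \<rho> k" for k
  have iA: "0 < A k" "0 \<le> 1 / A k" for k using A_ge_1[of k] by (auto simp: A_def)
  have per_kj: "(\<integral>\<^sup>+Y. ennreal ((t k j Y)\<^sup>2) \<partial>MY) \<le> (\<Sum>a\<in>I. ennreal (W a) * (\<integral>\<^sup>+Y. ennreal ((e k (x a Y))\<^sup>2 * (e j (x a Y))\<^sup>2) \<partial>MY))" for k j
  proof -
    have c: "continuous_on S (\<lambda>z. e k z * e j z)" by (intro continuous_intros cont_e)
    note v = variance_weighted_sum[where N = MY and I = I and w = w and \<zeta> = "\<lambda>a Y. e k (x a Y) * e j (x a Y)" and D = D, OF MY I w cont_L2[OF _ c] D_sym indep_x[OF _ _ _ c]]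
    have sq: "integrable MY (\<lambda>Y. (e k (x a Y) * e j (x a Y))\<^sup>2)" if "a \<in> I" for a
      using cont_L2[OF that c] by (simp add: L2_def)
    have "(\<Sum>a\<in>I. w a * (LINT Y|MY. e k (x a Y) * e j (x a Y))) = (\<Sum>a\<in>I. w a * (L2_inner M (e k) (e j) / q))"
      by (intro sum.cong refl) (simp add: law[OF _ c] L2_inner_def)
    also have "\<dots> = (if k = j then 1 else 0)" using q unfolding sum_distrib_right[symmetric] total orth by simp
    finally have m: "(\<Sum>a\<in>I. w a * (LINT Y|MY. e k (x a Y) * e j (x a Y))) = (if k = j then 1 else 0)" .
    have it: "integrable MY (\<lambda>Y. (t k j Y)\<^sup>2)"
    proof -
      have "(\<lambda>Y. \<Sum>a\<in>I. w a * (e k (x a Y) * e j (x a Y))) \<in> L2 MY" using v(3) by (simp add: L2_def)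
      from L2_diff[OF this, of "\<lambda>_. if k = j then 1 else 0"] show ?thesis unfolding t_def by (simp add: L2_def)
    qed
    have "(\<integral>\<^sup>+Y. ennreal ((t k j Y)\<^sup>2) \<partial>MY) = ennreal (LINT Y|MY. (t k j Y)\<^sup>2)"
      by (rule nn_integral_eq_integral[OF it]) simp
    also have "\<dots> \<le> ennreal (\<Sum>a\<in>I. W a * (LINT Y|MY. (e k (x a Y) * e j (x a Y))\<^sup>2))"
      using v(2) unfolding m W_def t_def by (intro ennreal_leI) auto
    also have "\<dots> = (\<Sum>a\<in>I. ennreal (W a) * (\<integral>\<^sup>+Y. ennreal ((e k (x a Y) * e j (x a Y))\<^sup>2) \<partial>MY))"
      using W_nonneg by (auto intro!: sum.cong simp: sum_ennreal[symmetric] ennreal_mult nn_integral_eq_integral[OF sq])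
    finally show ?thesis by (simp add: power_mult_distrib)
  qed
  have "(\<integral>\<^sup>+z. gram_error \<eta> z \<partial>\<Omega>) = (\<integral>\<^sup>+X. \<integral>\<^sup>+Y. gram_error \<eta> (X, Y) \<partial>MY \<partial>MX)"
    by (rule MY.nn_integral_fst[symmetric]) measurable
  also have "\<dots> = (\<integral>\<^sup>+Y. (\<Sum>k. \<Sum>j. ennreal (1 / A k) * (ennreal (1 / A j) * ennreal ((t k j Y)\<^sup>2))) \<partial>MY)"
  proof -
    have "gram_error \<eta> (X, Y) = (\<Sum>k. \<Sum>j. ennreal (1 / A k) * (ennreal (1 / A j) * ennreal ((t k j Y)\<^sup>2)))" for X Y
      unfolding gram_error_def t_def A_def[symmetric] snd_conv using iA(2)
      by (intro suminf_cong) (simp add: ennreal_mult'[symmetric] field_simps)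
    then show ?thesis by (simp add: MX.emeasure_space_1)
  qed
  also have "\<dots> = (\<Sum>k. \<Sum>j. ennreal (1 / A k) * (ennreal (1 / A j) * (\<integral>\<^sup>+Y. ennreal ((t k j Y)\<^sup>2) \<partial>MY)))"
    by (simp add: nn_integral_suminf nn_integral_cmult)
  also have "\<dots> \<le> (\<Sum>k. \<Sum>j. ennreal (1 / A k) * (ennreal (1 / A j) * (\<Sum>a\<in>I. ennreal (W a) * (\<integral>\<^sup>+Y. ennreal ((e k (x a Y))\<^sup>2 * (e j (x a Y))\<^sup>2) \<partial>MY))))"
    by (intro suminf_le allI mult_left_mono per_kj) auto
  also have "\<dots> = (\<Sum>a\<in>I. ennreal (W a) * (\<Sum>k. \<Sum>j. ennreal (1 / A k) * (ennreal (1 / A j) * (\<integral>\<^sup>+Y. ennreal ((e k (x a Y))\<^sup>2 * (e j (x a Y))\<^sup>2) \<partial>MY))))"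
  proof -
    define X where "X a k j = ennreal (1 / A k) * (ennreal (1 / A j) * (\<integral>\<^sup>+Y. ennreal ((e k (x a Y))\<^sup>2 * (e j (x a Y))\<^sup>2) \<partial>MY))" for a k j
    have "(\<Sum>k. \<Sum>j. ennreal (1 / A k) * (ennreal (1 / A j) * (\<Sum>a\<in>I. ennreal (W a) * (\<integral>\<^sup>+Y. ennreal ((e k (x a Y))\<^sup>2 * (e j (x a Y))\<^sup>2) \<partial>MY))))
       = (\<Sum>k. \<Sum>j. \<Sum>a\<in>I. ennreal (W a) * X a k j)"
      unfolding X_def sum_distrib_left by (intro suminf_cong sum.cong refl) (simp only: ac_simps)
    also have "\<dots> = (\<Sum>a\<in>I. \<Sum>k. \<Sum>j. ennreal (W a) * X a k j)" by (simp add: suminf_sum)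
    also have "\<dots> = (\<Sum>a\<in>I. ennreal (W a) * (\<Sum>k. \<Sum>j. X a k j))" by (simp only: ennreal_suminf_cmult)
    finally show ?thesis unfolding X_def .
  qed
  also have "\<dots> \<le> (\<Sum>a\<in>I. ennreal (W a) * ennreal (G\<^sup>2))"
  proof (intro sum_mono mult_left_mono)
    fix a assume a[measurable]: "a \<in> I"
    have "(\<Sum>k. \<Sum>j. ennreal (1 / A k) * (ennreal (1 / A j) * (\<integral>\<^sup>+Y. ennreal ((e k (x a Y))\<^sup>2 * (e j (x a Y))\<^sup>2) \<partial>MY)))
      = (\<integral>\<^sup>+Y. (\<Sum>k. \<Sum>j. ennreal (1 / A k) * (ennreal (1 / A j) * ennreal ((e k (x a Y))\<^sup>2 * (e j (x a Y))\<^sup>2))) \<partial>MY)"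
      by (simp add: nn_integral_suminf nn_integral_cmult)
    also have "\<dots> \<le> (\<integral>\<^sup>+Y. ennreal (G\<^sup>2) \<partial>MY)"
    proof (rule nn_integral_mono)
      fix Y assume "Y \<in> space MY"
      then have xS: "x a Y \<in> S" using x_S[OF a] by auto
      define g where "g k = (e k (x a Y))\<^sup>2 / A k" for k
      have "(\<Sum>k. \<Sum>j. ennreal (1 / A k) * (ennreal (1 / A j) * ennreal ((e k (x a Y))\<^sup>2 * (e j (x a Y))\<^sup>2)))
        = (\<Sum>k. \<Sum>j. ennreal (g k) * ennreal (g j))"
        using iA by (intro suminf_cong) (simp add: ennreal_mult'[symmetric] g_def field_simps)
      also have "\<dots> = (\<Sum>k. ennreal (g k)) * (\<Sum>j. ennreal (g j))" by (simp add: ennreal_suminf_cmult ennreal_suminf_multc)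
      also have "\<dots> \<le> ennreal G * ennreal G" unfolding g_def A_def by (intro mult_mono dim xS) auto
      also have "\<dots> = ennreal (G\<^sup>2)" using G by (simp add: ennreal_mult power2_eq_square)
      finally show "(\<Sum>k. \<Sum>j. ennreal (1 / A k) * (ennreal (1 / A j) * ennreal ((e k (x a Y))\<^sup>2 * (e j (x a Y))\<^sup>2))) \<le> ennreal (G\<^sup>2)" .
    qed
    also have "\<dots> = ennreal (G\<^sup>2)" by (simp add: MY.emeasure_space_1)
    finally show "(\<Sum>k. \<Sum>j. ennreal (1 / A k) * (ennreal (1 / A j) * (\<integral>\<^sup>+Y. ennreal ((e k (x a Y))\<^sup>2 * (e j (x a Y))\<^sup>2) \<partial>MY))) \<le> ennreal (G\<^sup>2)" .
  qed simp
  also have "\<dots> \<le> ennreal (\<kappa> * G\<^sup>2)" by (rule W_sum) simp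
  finally show ?thesis .
qed

text \<open>Markov's inequality for the noise at level \<open>V\<close> and for the Gram error at level \<open>1 / 16\<close>. The exceptional set does not
involve the fitted function, so the conclusion holds simultaneously for all functions that do no worse than \<open>f0\<close>,
in particular for a minimiser chosen depending on the data.\<close>

lemma risk_bound:
  assumes V: "0 < V"
  shows "\<exists>E\<in>sets \<Omega>. emeasure \<Omega> E \<le> ennreal ((\<kappa> * (G * Cy) + C\<Phi>) / V + 16 * (\<kappa> * G\<^sup>2)) \<and>
    (\<forall>z\<in>space \<Omega> - E. \<forall>g\<in>Hs. (\<Sum>a\<in>I. w a * (y a (fst z) (snd z) - g (x a (snd z)))\<^sup>2) + \<eta> * J g \<le>
         (\<Sum>a\<in>I. w a * (y a (fst z) (snd z) - f0 (x a (snd z)))\<^sup>2) + \<eta> * J f0 \<longrightarrow>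
      L2_normsq M (\<lambda>u. g u - f0 u) \<le> 64 * V + 16 * \<eta> * J f0)"
proof -
  define E1 where "E1 = {z \<in> space \<Omega>. ennreal V < noise \<eta> z}"
  define E2 where "E2 = {z \<in> space \<Omega>. ennreal (1 / 16) < gram_error \<eta> z}"
  have E1: "E1 \<in> sets \<Omega>" and E2: "E2 \<in> sets \<Omega>" unfolding E1_def E2_def by measurable
  then have E12: "E1 \<union> E2 \<in> sets \<Omega>" by auto
  have "emeasure \<Omega> (E1 \<union> E2) \<le> emeasure \<Omega> E1 + emeasure \<Omega> E2" by (rule emeasure_subadditive[OF E1 E2])
  also have "\<dots> \<le> ennreal ((\<kappa> * (G * Cy) + C\<Phi>) / V) + ennreal (\<kappa> * G\<^sup>2 / (1 / 16))"
    unfolding E1_def E2_def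
    by (intro add_mono markov_ennreal noise_expectation gram_expectation V meas_noise meas_gram) auto
  also have "\<dots> = ennreal ((\<kappa> * (G * Cy) + C\<Phi>) / V + 16 * (\<kappa> * G\<^sup>2))"
    using V \<kappa> G Cy C\<Phi> by (subst ennreal_plus[symmetric]) (auto simp: mult.commute)
  finally have prob: "emeasure \<Omega> (E1 \<union> E2) \<le> ennreal ((\<kappa> * (G * Cy) + C\<Phi>) / V + 16 * (\<kappa> * G\<^sup>2))" .
  have good: "L2_normsq M (\<lambda>u. g u - f0 u) \<le> 64 * V + 16 * \<eta> * J f0"
    if z: "z \<in> space \<Omega> - (E1 \<union> E2)" and g: "g \<in> Hs"
      and min: "(\<Sum>a\<in>I. w a * (y a (fst z) (snd z) - g (x a (snd z)))\<^sup>2) + \<eta> * J g \<le>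
         (\<Sum>a\<in>I. w a * (y a (fst z) (snd z) - f0 (x a (snd z)))\<^sup>2) + \<eta> * J f0" for z g
  proof -
  have "snd z \<in> space MY" using z by (auto simp: space_pair_measure)
  then have xS: "x a (snd z) \<in> S" if "a \<in> I" for a using x_S[OF that] by simp
  show ?thesis
  proof (rule oracle_inequality[OF I w xS \<eta> f0 g min _ less_imp_le[OF V]])
    show "(\<Sum>k. ennreal ((\<Sum>a\<in>I. w a * ((y a (fst z) (snd z) - f0 (x a (snd z))) * e k (x a (snd z))))\<^sup>2 / (1 + \<eta> * \<rho> k))) \<le> ennreal V"
      using z unfolding E1_def noise_def by (auto simp: not_less)
    show "(\<Sum>k. \<Sum>j. ennreal (((\<Sum>a\<in>I. w a * (e k (x a (snd z)) * e j (x a (snd z)))) - (if k = j then 1 else 0))\<^sup>2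
     / ((1 + \<eta> * \<rho> k) * (1 + \<eta> * \<rho> j)))) \<le> ennreal (1 / 16)"
      using z unfolding E2_def gram_error_def by (auto simp: not_less)
  qed
  qed
  show ?thesis by (intro bexI[OF _ E12] conjI[OF prob] ballI impI good)
qed

end

end

section \<open>The sampling model\<close>

lemma L2_of_fourth:
  assumes "finite_measure M" "f \<in> borel_measurable M" "integrable M (\<lambda>x. (f x) ^ 4 :: real)"
  shows "f \<in> L2 M"
proof -
  interpret finite_measure M by fact
  have "integrable M (\<lambda>x. (f x)\<^sup>2)"
  proof (rule Bochner_Integration.integrable_bound)
    show "integrable M (\<lambda>x. 1 + (f x) ^ 4)" using assms by simp
    have "a\<^sup>2 \<le> 1 + a ^ 4" for a :: real
    proof -
      have "(a\<^sup>2 - 1)\<^sup>2 = a ^ 4 - 2 * a\<^sup>2 + 1" by (simp add: power2_diff)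
      then show ?thesis using zero_le_power2[of "a\<^sup>2 - 1"] zero_le_power2[of a] by linarith
    qed
    then show "AE x in M. norm ((f x)\<^sup>2) \<le> norm (1 + (f x) ^ 4)" by (auto simp: abs_of_nonneg)
  qed (use assms in simp)
  then show ?thesis using assms by (simp add: L2_def)
qed

lemma product_L2_of_fourth:
  assumes "f \<in> borel_measurable M" "integrable M (\<lambda>x. (f x) ^ 4 :: real)"
    "g \<in> borel_measurable M" "integrable M (\<lambda>x. (g x) ^ 4 :: real)"
  shows "(\<lambda>x. f x * g x) \<in> L2 M"
proof -
  have [measurable]: "f \<in> borel_measurable M" "g \<in> borel_measurable M" by fact+
  have "integrable M (\<lambda>x. (f x * g x)\<^sup>2)"
  proof (rule Bochner_Integration.integrable_bound[OF Bochner_Integration.integrable_add[OF assms(2,4)]])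
    have "(a * b)\<^sup>2 \<le> a ^ 4 + b ^ 4" for a b :: real
    proof -
      have "0 \<le> a\<^sup>2 * b\<^sup>2" by simp
      moreover have "2 * (a\<^sup>2 * b\<^sup>2) \<le> a ^ 4 + b ^ 4" using sum_squares_bound[of "a\<^sup>2" "b\<^sup>2"] by simp
      ultimately show ?thesis unfolding power_mult_distrib by linarith
    qed
    then show "AE x in M. norm ((f x * g x)\<^sup>2) \<le> norm ((f x) ^ 4 + (g x) ^ 4)" by (auto simp: abs_of_nonneg)
  qed simp
  then show ?thesis by (simp add: L2_def)
qed

lemma prob_unif_sphere: "prob_space unif_sphere"
  unfolding unif_sphere_def by (rule prob_space_uniform_measure) (auto simp: emeasure_surface)

lemma sets_unif_sphere [measurable_cong, simp]: "sets unif_sphere = sets surface"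
  by (simp add: unif_sphere_def)

lemma space_unif_sphere [simp]: "space unif_sphere = S2"
  using sets_eq_imp_space_eq[OF sets_unif_sphere] by simp

lemma unif_sphere_density: "unif_sphere = density surface (\<lambda>_. ennreal (1 / (4 * pi)))"
proof (rule measure_eqI)
  fix A assume "A \<in> sets unif_sphere"
  then have A: "A \<in> sets surface" by simp
  have S: "S2 \<in> sets surface" using sets.top[of surface] by simp
  have "A \<subseteq> S2" using sets.sets_into_space[OF A] by simp
  then have "emeasure unif_sphere A = emeasure surface A / ennreal (4 * pi)"
    unfolding unif_sphere_def using A S by (simp add: emeasure_uniform_measure emeasure_surface Int_absorb1)
  also have "\<dots> = ennreal (1 / (4 * pi)) * emeasure surface A"
    by (simp add: divide_ennreal_def inverse_ennreal mult.commute inverse_eq_divide)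
  finally show "emeasure unif_sphere A = emeasure (density surface (\<lambda>_. ennreal (1 / (4 * pi)))) A"
    using A by (simp add: emeasure_density_const)
qed simp

lemma integral_unif_sphere:
  assumes "continuous_on S2 (h :: _ \<Rightarrow> real)" shows "(LINT u|unif_sphere. h u) = (LINT u|surface. h u) / (4 * pi)"
  unfolding unif_sphere_density by (subst integral_density) (auto intro: meas_surface assms)

lemma integral_unif_sphere2:
  assumes h: "continuous_on (S2 \<times> S2) (h :: _ \<Rightarrow> real)"
  shows "(LINT x|(unif_sphere \<Otimes>\<^sub>M unif_sphere). h x) = (LINT x|surface2. h x) / (4 * pi)\<^sup>2"
proof -
  interpret U: prob_space unif_sphere by (rule prob_unif_sphere)
  interpret UU: pair_sigma_finite unif_sphere unif_sphere ..
  interpret UUp: pair_prob_space unif_sphere unif_sphere ..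
  have m: "h \<in> borel_measurable (unif_sphere \<Otimes>\<^sub>M unif_sphere)"
    using meas_surface2[OF h] by (simp cong: measurable_cong_sets sets_pair_measure_cong)
  have "bounded (h ` (S2 \<times> S2))"
    by (rule compact_imp_bounded[OF compact_continuous_image[OF h compact_Times[OF compact_sphere compact_sphere]]])
  then obtain C where C: "\<forall>x\<in>S2 \<times> S2. \<bar>h x\<bar> \<le> C" unfolding bounded_iff by auto
  have "integrable (unif_sphere \<Otimes>\<^sub>M unif_sphere) h"
    by (rule UUp.integrable_const_bound[of _ C, OF AE_I2 m]) (use C in \<open>auto simp: space_pair_measure simp del: mem_sphere_0\<close>)
  then have "(LINT x|(unif_sphere \<Otimes>\<^sub>M unif_sphere). h x) = (LINT u|unif_sphere. LINT v|unif_sphere. h (u, v))"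
    using UU.integral_fst'[of h] by simp
  also have "\<dots> = (LINT u|unif_sphere. (LINT v|surface. h (u, v)) / (4 * pi))"
    by (intro Bochner_Integration.integral_cong refl integral_unif_sphere continuous_slice h) simp
  also have "\<dots> = (LINT u|surface. LINT v|surface. h (u, v)) / (4 * pi)\<^sup>2"
    by (simp add: integral_unif_sphere continuous_param_integral h power2_eq_square)
  finally show ?thesis unfolding integral_surface2[OF h] .
qed

locale sampling = sobolev_space q for q +
  fixes P :: "(real^3 \<Rightarrow> real) measure" and \<nu> :: "real measure" and n :: nat and r :: "nat \<Rightarrow> nat" and L :: real
  assumes P: "prob_space P" "sets P = sets (sobolev_borel q)"
    and \<nu>: "prob_space \<nu>" "sets \<nu> = sets borel" "integrable \<nu> (\<lambda>x. x ^ 4)" "(LINT x|\<nu>. x) = 0"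
    and n: "0 < n" and r: "\<And>i. i < n \<Longrightarrow> 2 \<le> r i"
    and L: "0 \<le> L" "(\<integral>\<^sup>+f. (sobolev_normsq q f)\<^sup>2 \<partial>P) \<le> ennreal L"
begin

sublocale P: prob_space P by (rule P)
sublocale \<nu>: prob_space \<nu> by (rule \<nu>)

abbreviation Ob where "Ob \<equiv> obs_index n r"
definition MX where "MX = PiM {..<n} (\<lambda>_. P)"
definition MU where "MU = PiM Ob (\<lambda>_. unif_sphere)"
definition ME where "ME = PiM Ob (\<lambda>_. \<nu>)"
abbreviation MY where "MY \<equiv> MU \<Otimes>\<^sub>M ME"

lemma sample_space_eq: "sample_space n r P \<nu> = MX \<Otimes>\<^sub>M MY"
  by (simp add: sample_space_def MX_def MU_def ME_def)

sublocale MX: prob_space MX unfolding MX_def by (intro prob_space_PiM P)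
sublocale MU: prob_space MU unfolding MU_def by (intro prob_space_PiM prob_unif_sphere)
sublocale ME: prob_space ME unfolding ME_def by (intro prob_space_PiM \<nu>)
sublocale MYp: pair_prob_space MU ME ..

lemma finite_O: "finite Ob" by (simp add: obs_index_def)

lemma space_P: "space P = sobolev q" using sets_eq_imp_space_eq[OF P(2)] by (simp add: space_borel)

lemma space_MX: "X \<in> space MX \<Longrightarrow> i < n \<Longrightarrow> X i \<in> sobolev q"
  by (auto simp: MX_def space_PiM space_P)

lemma sobolev_cont: "f \<in> sobolev q \<Longrightarrow> continuous_on S2 f" by (simp add: sobolev_iff)

lemma loc_meas: "a \<in> Ob \<Longrightarrow> (\<lambda>Y. fst Y a) \<in> MY \<rightarrow>\<^sub>M surface"
proof -
  assume a: "a \<in> Ob"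
  have "(\<lambda>U. U a) \<in> MU \<rightarrow>\<^sub>M unif_sphere" unfolding MU_def by (rule measurable_component_singleton[OF a])
  then have "(\<lambda>U. U a) \<in> MU \<rightarrow>\<^sub>M surface" by (simp cong: measurable_cong_sets)
  then show ?thesis by (rule measurable_compose[OF measurable_fst])
qed

lemma err_meas: "a \<in> Ob \<Longrightarrow> (\<lambda>Y. snd Y a) \<in> borel_measurable MY"
proof -
  assume a: "a \<in> Ob"
  have "(\<lambda>E. E a) \<in> ME \<rightarrow>\<^sub>M \<nu>" unfolding ME_def by (rule measurable_component_singleton[OF a])
  then have "(\<lambda>E. E a) \<in> borel_measurable ME" using \<nu>(2) by (simp cong: measurable_cong_sets)
  then show ?thesis by (rule measurable_compose[OF measurable_snd])
qed

lemma curve_meas: "i < n \<Longrightarrow> (\<lambda>X. X i) \<in> MX \<rightarrow>\<^sub>M sobolev_borel q"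
proof -
  assume i: "i < n"
  have "(\<lambda>X. X i) \<in> MX \<rightarrow>\<^sub>M P" unfolding MX_def by (rule measurable_component_singleton) (simp add: i)
  then show ?thesis by (simp add: P(2) cong: measurable_cong_sets)
qed

text \<open>The observation, separated into the curves \<open>X\<close> and the locations and errors \<open>Y\<close>.\<close>

definition obs :: "(nat \<Rightarrow> real^3 \<Rightarrow> real) \<Rightarrow> (nat \<times> nat \<Rightarrow> real^3) \<times> (nat \<times> nat \<Rightarrow> real) \<Rightarrow> nat \<times> nat \<Rightarrow> real" where
  "obs X Y a = X (fst a) (fst Y a) + snd Y a"

lemma O_fst: "a \<in> Ob \<Longrightarrow> fst a < n" by (auto simp: obs_index_def)

lemma obs_meas: "a \<in> Ob \<Longrightarrow> (\<lambda>z. obs (fst z) (snd z) a) \<in> borel_measurable (MX \<Otimes>\<^sub>M MY)"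
proof -
  assume a: "a \<in> Ob"
  have "(\<lambda>z. (fst z (fst a), fst (snd z) a)) \<in> MX \<Otimes>\<^sub>M MY \<rightarrow>\<^sub>M sobolev_borel q \<Otimes>\<^sub>M surface"
    by (intro measurable_Pair measurable_compose[OF measurable_fst curve_meas[OF O_fst[OF a]]]
        measurable_compose[OF measurable_snd loc_meas[OF a]])
  from measurable_compose[OF this eval_measurable] show ?thesis
    unfolding obs_def fst_conv snd_conv
    by (rule borel_measurable_add) (rule measurable_compose[OF measurable_snd err_meas[OF a]])
qed

lemma cont_loc_meas: "a \<in> Ob \<Longrightarrow> continuous_on S2 h \<Longrightarrow> (\<lambda>Y. h (fst Y a) :: real) \<in> borel_measurable MY"
  by (rule measurable_compose[OF loc_meas meas_surface])

lemma loc_S2: "a \<in> Ob \<Longrightarrow> Y \<in> space MY \<Longrightarrow> fst Y a \<in> S2"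
  using measurable_space[OF loc_meas] by simp

lemma integral_loc:
  assumes a: "a \<in> Ob" and h: "continuous_on S2 (h :: _ \<Rightarrow> real)"
  shows "(LINT Y|MY. h (fst Y a)) = (LINT u|surface. h u) / (4 * pi)" "integrable MY (\<lambda>Y. h (fst Y a))"
proof -
  obtain C where C: "\<And>z. z \<in> S2 \<Longrightarrow> \<bar>h z\<bar> \<le> C" using sph.bounded_cont[OF h] by blast
  show i: "integrable MY (\<lambda>Y. h (fst Y a))"
    by (rule MYp.integrable_const_bound[of _ C, OF AE_I2 cont_loc_meas[OF a h]]) (use C loc_S2[OF a] in auto)
  have "(LINT Y|MY. h (fst Y a)) = (LINT U|MU. h (U a))"
    using MYp.integral_fst'[OF i] by (simp add: ME.prob_space)
  also have "\<dots> = (LINT u|distr MU unif_sphere (\<lambda>U. U a). h u)"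
    unfolding MU_def using meas_surface[OF h] a by (subst integral_distr) (auto intro: measurable_component_singleton cong: measurable_cong_sets)
  also have "distr MU unif_sphere (\<lambda>U. U a) = unif_sphere"
    unfolding MU_def by (rule distr_PiM_component) (auto simp: prob_unif_sphere a)
  finally show "(LINT Y|MY. h (fst Y a)) = (LINT u|surface. h u) / (4 * pi)" by (simp add: integral_unif_sphere[OF h])
qed

lemma loc2_meas: "a \<in> Ob \<Longrightarrow> b \<in> Ob \<Longrightarrow> (\<lambda>Y. (fst Y a, fst Y b)) \<in> MY \<rightarrow>\<^sub>M surface2"
  by (intro measurable_Pair loc_meas)

lemma integral_loc2:
  assumes a: "a \<in> Ob" "b \<in> Ob" "a \<noteq> b" and h: "continuous_on (S2 \<times> S2) (h :: _ \<Rightarrow> real)"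
  shows "(LINT Y|MY. h (fst Y a, fst Y b)) = (LINT x|surface2. h x) / (4 * pi)\<^sup>2" "integrable MY (\<lambda>Y. h (fst Y a, fst Y b))"
proof -
  obtain C where C: "\<And>z. z \<in> S2 \<times> S2 \<Longrightarrow> \<bar>h z\<bar> \<le> C" using sph2.bounded_cont[OF h] by blast
  show i: "integrable MY (\<lambda>Y. h (fst Y a, fst Y b))"
    by (rule MYp.integrable_const_bound[of _ C, OF AE_I2 measurable_compose[OF loc2_meas[OF a(1,2)] meas_surface2[OF h]]])
      (use C loc_S2[OF a(1)] loc_S2[OF a(2)] in \<open>auto simp del: mem_sphere_0\<close>)
  interpret U: prob_space unif_sphere by (rule prob_unif_sphere)
  interpret PU: product_prob_space "\<lambda>_. unif_sphere" Ob by unfold_locales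
  have m[measurable]: "(\<lambda>U. (U a, U b)) \<in> MU \<rightarrow>\<^sub>M unif_sphere \<Otimes>\<^sub>M unif_sphere"
    unfolding MU_def by (intro measurable_Pair measurable_component_singleton a)
  have d: "unif_sphere \<Otimes>\<^sub>M unif_sphere = distr MU (unif_sphere \<Otimes>\<^sub>M unif_sphere) (\<lambda>U. (U a, U b))"
  proof (rule pair_measure_eqI)
    fix A B assume A: "A \<in> sets unif_sphere" and B: "B \<in> sets unif_sphere"
    have "emeasure (distr MU (unif_sphere \<Otimes>\<^sub>M unif_sphere) (\<lambda>U. (U a, U b))) (A \<times> B) =
      emeasure MU {U \<in> space MU. \<forall>c\<in>{a, b}. U c \<in> (if c = a then A else B)}"
      using A B a(3) by (subst emeasure_distr[OF m]) (auto intro!: arg_cong[where f = "emeasure MU"])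
    also have "\<dots> = (\<Prod>c\<in>{a, b}. emeasure unif_sphere (if c = a then A else B))"
      unfolding MU_def by (rule PU.emeasure_PiM_Collect) (use a A B in auto)
    finally show "emeasure unif_sphere A * emeasure unif_sphere B =
       emeasure (distr MU (unif_sphere \<Otimes>\<^sub>M unif_sphere) (\<lambda>U. (U a, U b))) (A \<times> B)" using a(3) by simp
  qed (auto intro: U.sigma_finite_measure_axioms)
  have mh: "h \<in> borel_measurable (unif_sphere \<Otimes>\<^sub>M unif_sphere)"
    using meas_surface2[OF h] by (simp cong: measurable_cong_sets sets_pair_measure_cong)
  have "(LINT Y|MY. h (fst Y a, fst Y b)) = (LINT U|MU. h (U a, U b))"
    using MYp.integral_fst'[OF i] by (simp add: ME.prob_space)
  also have "\<dots> = (LINT x|distr MU (unif_sphere \<Otimes>\<^sub>M unif_sphere) (\<lambda>U. (U a, U b)). h x)"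
    by (rule integral_distr[OF m mh, symmetric])
  also have "\<dots> = (LINT x|surface2. h x) / (4 * pi)\<^sup>2" unfolding d[symmetric] by (rule integral_unif_sphere2[OF h])
  finally show "(LINT Y|MY. h (fst Y a, fst Y b)) = (LINT x|surface2. h x) / (4 * pi)\<^sup>2" .
qed

lemma integral_err:
  assumes a: "a \<in> Ob" and h: "h \<in> borel_measurable borel" "integrable \<nu> (h :: real \<Rightarrow> real)"
  shows "(LINT E|ME. h (E a)) = (LINT x|\<nu>. h x)" "integrable MY (\<lambda>Y. h (snd Y a))" "integrable ME (\<lambda>E. h (E a))"
proof -
  have m: "(\<lambda>E. E a) \<in> ME \<rightarrow>\<^sub>M \<nu>" unfolding ME_def by (rule measurable_component_singleton[OF a])
  have d: "distr ME \<nu> (\<lambda>E. E a) = \<nu>" unfolding ME_def by (rule distr_PiM_component) (auto simp: \<nu> a)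
  have mh: "h \<in> borel_measurable \<nu>" using h(1) \<nu>(2) by (simp cong: measurable_cong_sets)
  show "(LINT E|ME. h (E a)) = (LINT x|\<nu>. h x)" using integral_distr[OF m mh] d by simp
  show i: "integrable ME (\<lambda>E. h (E a))" using integrable_distr_eq[OF m mh] h(2) d by simp
  show "integrable MY (\<lambda>Y. h (snd Y a))"
    by (intro MYp.Fubini_integrable) (use i measurable_compose[OF err_meas[OF a] h(1)] in auto)
qed

definition m4 where "m4 = (LINT x|\<nu>. x ^ 4)"
lemma m4: "0 \<le> m4" by (simp add: m4_def)

lemma fourth_sum: "((a::real) + b) ^ 4 \<le> 8 * a ^ 4 + 8 * b ^ 4"
proof -
  have s: "(x + y)\<^sup>2 \<le> 2 * x\<^sup>2 + 2 * y\<^sup>2" for x y :: real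
    using sum_squares_bound[of x y] by (simp add: power2_sum)
  have "(a + b) ^ 4 = ((a + b)\<^sup>2)\<^sup>2" by simp
  also have "\<dots> \<le> (2 * a\<^sup>2 + 2 * b\<^sup>2)\<^sup>2" by (rule power_mono[OF s]) simp
  also have "\<dots> \<le> 2 * (2 * a\<^sup>2)\<^sup>2 + 2 * (2 * b\<^sup>2)\<^sup>2" by (rule s)
  finally show ?thesis by (simp add: power_mult_distrib)
qed

lemma obs_meas1: "a \<in> Ob \<Longrightarrow> X \<in> space MX \<Longrightarrow> (\<lambda>Y. obs X Y a) \<in> borel_measurable MY"
  using measurable_compose[OF measurable_Pair1' obs_meas[of a]] by simp

lemma obs_fourth:
  assumes a: "a \<in> Ob" and X: "X \<in> space MX"
  shows "integrable MY (\<lambda>Y. (obs X Y a) ^ 4)"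
proof (rule Bochner_Integration.integrable_bound)
  have c: "continuous_on S2 (\<lambda>u. (X (fst a) u) ^ 4)"
    by (intro continuous_intros sobolev_cont space_MX[OF X] O_fst a)
  show "integrable MY (\<lambda>Y. 8 * (X (fst a) (fst Y a)) ^ 4 + 8 * (snd Y a) ^ 4)"
    using integral_loc(2)[OF a c] integral_err(2)[OF a, of "\<lambda>x. x ^ 4"] \<nu>(3) by auto
  show "AE Y in MY. norm ((obs X Y a) ^ 4) \<le> norm (8 * (X (fst a) (fst Y a)) ^ 4 + 8 * (snd Y a) ^ 4)"
    unfolding obs_def using fourth_sum by (intro AE_I2) (auto simp: abs_of_nonneg intro: order_trans[OF _ abs_ge_self])
qed (use obs_meas1[OF a X] in simp)

lemma obs_L2: "a \<in> Ob \<Longrightarrow> X \<in> space MX \<Longrightarrow> (\<lambda>Y. obs X Y a) \<in> L2 MY"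
  by (rule L2_of_fourth[OF _ obs_meas1 obs_fourth]) (auto intro: MYp.finite_measure_axioms)

text \<open>Conditionally on the curves, functions of disjoint sets of observations are uncorrelated.\<close>

lemma block:
  assumes A: "A \<subseteq> Ob" and fg: "f \<in> L2 MY" "g \<in> L2 MY"
    and f: "\<And>x y x' y'. (\<And>i. i \<in> A \<Longrightarrow> x i = x' i) \<Longrightarrow> (\<And>i. i \<in> A \<Longrightarrow> y i = y' i) \<Longrightarrow> f (x, y) = f (x', y')"
    and g: "\<And>x y x' y'. (\<And>i. i \<in> Ob - A \<Longrightarrow> x i = x' i) \<Longrightarrow> (\<And>i. i \<in> Ob - A \<Longrightarrow> y i = y' i) \<Longrightarrow> g (x, y) = g (x', y')"
  shows "(LINT Y|MY. f Y * g Y) = (LINT Y|MY. f Y) * (LINT Y|MY. g Y)"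
proof -
  have one: "(\<lambda>_. 1) \<in> L2 MY" by (simp add: L2_def)
  have "integrable MY f" "integrable MY g" "integrable MY (\<lambda>Y. f Y * g Y)"
    using L2_add(1)[OF fg(1) one] L2_add(1)[OF fg(2) one] L2_add(1)[OF fg] by auto
  then show ?thesis unfolding MU_def ME_def
    by (intro pair_block_integral[OF prob_unif_sphere \<nu>(1) finite_O A]) (auto intro: f g)
qed

lemma obs_linear:
  assumes a: "a \<in> Ob" and X: "X \<in> space MX" and h: "continuous_on S2 h"
  shows "(LINT Y|MY. obs X Y a * h (fst Y a)) = (LINT u|surface. X (fst a) u * h u) / (4 * pi)"
proof -
  have cX: "continuous_on S2 (X (fst a))" by (intro sobolev_cont space_MX[OF X] O_fst a)
  have c: "continuous_on S2 (\<lambda>u. X (fst a) u * h u)" by (intro continuous_intros cX h)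
  have fE: "(\<lambda>Y. snd Y a) \<in> L2 MY"
    by (rule L2_of_fourth[OF MYp.finite_measure_axioms err_meas[OF a]]) (use integral_err(2)[OF a, of "\<lambda>x. x ^ 4"] \<nu>(3) in auto)
  have fh: "(\<lambda>Y. h (fst Y a)) \<in> L2 MY"
    using integral_loc(2)[OF a, of "\<lambda>u. (h u)\<^sup>2"] h cont_loc_meas[OF a h] by (auto simp: L2_def intro!: continuous_intros)
  have i: "integrable MY (\<lambda>Y. h (fst Y a) * snd Y a)" by (rule L2_add(1)[OF fh fE])
  have i1: "integrable \<nu> (\<lambda>x. x)"
  proof -
    have "(\<lambda>x. x) \<in> borel_measurable \<nu>" using \<nu>(2) by (simp cong: measurable_cong_sets)
    from L2_add(1)[OF L2_of_fourth[OF \<nu>.finite_measure_axioms this \<nu>(3)], of "\<lambda>_. 1"] show ?thesis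
      by (simp add: L2_def)
  qed
  have "(LINT Y|MY. h (fst Y a) * snd Y a) = (LINT U|MU. LINT E|ME. h (U a) * E a)"
    using MYp.integral_fst'[OF i] unfolding fst_conv snd_conv by (rule sym)
  also have "\<dots> = 0"
    unfolding integral_mult_right_zero integral_err(1)[OF a measurable_ident[unfolded id_def] i1] \<nu>(4) by simp
  finally have z: "(LINT Y|MY. h (fst Y a) * snd Y a) = 0" .
  have "(LINT Y|MY. obs X Y a * h (fst Y a)) = (LINT Y|MY. X (fst a) (fst Y a) * h (fst Y a) + h (fst Y a) * snd Y a)"
    by (simp add: obs_def algebra_simps)
  also have "\<dots> = (LINT Y|MY. X (fst a) (fst Y a) * h (fst Y a)) + 0"
    using integral_loc(2)[OF a c] i z by simp
  finally show ?thesis using integral_loc(1)[OF a c] by simp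
qed

lemma eval_fourth: "u \<in> S2 \<Longrightarrow> f \<in> sobolev q \<Longrightarrow> ennreal ((f u) ^ 4) \<le> ennreal (B\<^sup>2) * (sobolev_normsq q f)\<^sup>2"
proof -
  assume "u \<in> S2" "f \<in> sobolev q"
  from power_mono[OF eval_bound[OF this(2,1)], of 2]
  show ?thesis using K.B by (simp add: ennreal_power power_mult_distrib power_mult[symmetric])
qed

text \<open>Point evaluation is bounded by the Sobolev norm, so the fourth moment of a curve at a point is controlled by the
fourth moment of its norm.\<close>

lemma obs_fourth_expectation:
  assumes a: "a \<in> Ob"
  shows "(\<integral>\<^sup>+z. ennreal ((obs (fst z) (snd z) a) ^ 4) \<partial>(MX \<Otimes>\<^sub>M MY)) \<le> ennreal (8 * (B\<^sup>2 * L) + 8 * m4)"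
proof -
  note [measurable] = obs_meas[OF a]
  have i: "fst a < n" by (rule O_fst[OF a])
  have "(\<integral>\<^sup>+z. ennreal ((obs (fst z) (snd z) a) ^ 4) \<partial>(MX \<Otimes>\<^sub>M MY)) =
     (\<integral>\<^sup>+X. \<integral>\<^sup>+Y. ennreal ((obs X Y a) ^ 4) \<partial>MY \<partial>MX)"
    using MYp.nn_integral_fst[of "\<lambda>z. ennreal ((obs (fst z) (snd z) a) ^ 4)" MX] by simp
  also have "\<dots> \<le> (\<integral>\<^sup>+X. ennreal (8 * B\<^sup>2) * (sobolev_normsq q (X (fst a)))\<^sup>2 + ennreal (8 * m4) \<partial>MX)"
  proof (rule nn_integral_mono)
    fix X assume X: "X \<in> space MX"
    have XS: "X (fst a) \<in> sobolev q" by (rule space_MX[OF X i])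
    have me: "(\<lambda>Y. ennreal (8 * (snd Y a) ^ 4)) \<in> borel_measurable MY" using err_meas[OF a] by measurable
    have "(\<integral>\<^sup>+Y. ennreal ((obs X Y a) ^ 4) \<partial>MY) \<le> (\<integral>\<^sup>+Y. ennreal (8 * B\<^sup>2) * (sobolev_normsq q (X (fst a)))\<^sup>2 + ennreal (8 * (snd Y a) ^ 4) \<partial>MY)"
    proof (rule nn_integral_mono)
      fix Y assume Y: "Y \<in> space MY"
      have "ennreal ((obs X Y a) ^ 4) \<le> ennreal (8 * (X (fst a) (fst Y a)) ^ 4 + 8 * (snd Y a) ^ 4)"
        unfolding obs_def by (intro ennreal_leI fourth_sum)
      also have "\<dots> = ennreal 8 * ennreal ((X (fst a) (fst Y a)) ^ 4) + ennreal (8 * (snd Y a) ^ 4)"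
        by (simp add: ennreal_plus ennreal_mult)
      also have "\<dots> \<le> ennreal 8 * (ennreal (B\<^sup>2) * (sobolev_normsq q (X (fst a)))\<^sup>2) + ennreal (8 * (snd Y a) ^ 4)"
        by (intro add_mono mult_left_mono eval_fourth XS loc_S2[OF a Y]) auto
      finally show "ennreal ((obs X Y a) ^ 4) \<le> ennreal (8 * B\<^sup>2) * (sobolev_normsq q (X (fst a)))\<^sup>2 + ennreal (8 * (snd Y a) ^ 4)"
        by (simp add: ennreal_mult mult.assoc)
    qed
    also have "\<dots> = ennreal (8 * B\<^sup>2) * (sobolev_normsq q (X (fst a)))\<^sup>2 + (\<integral>\<^sup>+Y. ennreal (8 * (snd Y a) ^ 4) \<partial>MY)"
      using me by (subst nn_integral_add) (auto simp: MYp.emeasure_space_1)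
    also have "(\<integral>\<^sup>+Y. ennreal (8 * (snd Y a) ^ 4) \<partial>MY) = ennreal (8 * m4)"
    proof -
      note e = integral_err[OF a, of "\<lambda>x. 8 * x ^ 4"]
      have "(\<integral>\<^sup>+Y. ennreal (8 * (snd Y a) ^ 4) \<partial>MY) = (\<integral>\<^sup>+U. \<integral>\<^sup>+E. ennreal (8 * (E a) ^ 4) \<partial>ME \<partial>MU)"
        using ME.nn_integral_fst[OF me] by simp
      also have "\<dots> = ennreal (LINT E|ME. 8 * (E a) ^ 4)"
        using e(3) \<nu>(3) by (simp add: nn_integral_eq_integral MU.emeasure_space_1)
      also have "\<dots> = ennreal (8 * m4)" unfolding m4_def using e(1) \<nu>(3) by simp
      finally show ?thesis .
    qed
    finally show "(\<integral>\<^sup>+Y. ennreal ((obs X Y a) ^ 4) \<partial>MY) \<le> ennreal (8 * B\<^sup>2) * (sobolev_normsq q (X (fst a)))\<^sup>2 + ennreal (8 * m4)" .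
  qed
  also have "\<dots> = ennreal (8 * B\<^sup>2) * (\<integral>\<^sup>+X. (sobolev_normsq q (X (fst a)))\<^sup>2 \<partial>MX) + ennreal (8 * m4)"
  proof -
    note [measurable] = coef_measurable
    have "sobolev_normsq q \<in> borel_measurable (sobolev_borel q)"
      unfolding sobolev_normsq_idx[abs_def] by measurable
    from measurable_compose[OF curve_meas[OF i] this]
    show ?thesis by (subst nn_integral_add) (auto simp: nn_integral_cmult MX.emeasure_space_1)
  qed
  also have "(\<integral>\<^sup>+X. (sobolev_normsq q (X (fst a)))\<^sup>2 \<partial>MX) = (\<integral>\<^sup>+f. (sobolev_normsq q f)\<^sup>2 \<partial>P)"
  proof -
    note [measurable] = coef_measurable
    have m: "(\<lambda>f. (sobolev_normsq q f)\<^sup>2) \<in> borel_measurable P"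
      unfolding sobolev_normsq_idx[abs_def] using P(2) by measurable
    have mc: "(\<lambda>X. X (fst a)) \<in> MX \<rightarrow>\<^sub>M P" using curve_meas[OF i] by (simp add: P(2) cong: measurable_cong_sets)
    have "distr MX P (\<lambda>X. X (fst a)) = P" unfolding MX_def by (rule distr_PiM_component) (auto simp: P i)
    moreover have "(\<integral>\<^sup>+f. (sobolev_normsq q f)\<^sup>2 \<partial>distr MX P (\<lambda>X. X (fst a))) = (\<integral>\<^sup>+X. (sobolev_normsq q (X (fst a)))\<^sup>2 \<partial>MX)"
      by (rule nn_integral_distr[OF mc]) (simp add: m)
    ultimately show ?thesis by simp
  qed
  also have "ennreal (8 * B\<^sup>2) * (\<integral>\<^sup>+f. (sobolev_normsq q f)\<^sup>2 \<partial>P) + ennreal (8 * m4) \<le> ennreal (8 * B\<^sup>2) * ennreal L + ennreal (8 * m4)"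
    by (intro add_mono mult_left_mono L) auto
  also have "\<dots> = ennreal (8 * (B\<^sup>2 * L) + 8 * m4)" 
  proof -
    have "ennreal (8 * B\<^sup>2) * ennreal L = ennreal (8 * B\<^sup>2 * L)"
      by (rule ennreal_mult[symmetric]) (use L in auto)
    moreover have "ennreal (8 * B\<^sup>2 * L) + ennreal (8 * m4) = ennreal (8 * B\<^sup>2 * L + 8 * m4)"
      by (rule ennreal_plus[symmetric]) (use L m4 in auto)
    ultimately show ?thesis by (simp only: mult.assoc)
  qed
  finally show ?thesis .
qed

end

section \<open>The design for the mean\<close>

context sampling
begin

lemma coef_meas_P: "(\<lambda>f. sph.coef f k) \<in> borel_measurable P"
  using coef_measurable P(2) by (simp cong: measurable_cong_sets)

lemma normsq_meas_P: "sobolev_normsq q \<in> borel_measurable P"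
proof -
  note [measurable] = coef_meas_P
  show ?thesis unfolding sobolev_normsq_idx[abs_def] by measurable
qed

lemma eval_fourth_integrable:
  assumes N: "finite_measure N" and \<pi>: "\<pi> \<in> N \<rightarrow>\<^sub>M surface"
  shows "(\<lambda>z. fst z (\<pi> (snd z))) \<in> borel_measurable (P \<Otimes>\<^sub>M N)"
    "integrable (P \<Otimes>\<^sub>M N) (\<lambda>z. (fst z (\<pi> (snd z))) ^ 4)"
proof -
  interpret N: finite_measure N by fact
  have "(\<lambda>z. (fst z, \<pi> (snd z))) \<in> P \<Otimes>\<^sub>M N \<rightarrow>\<^sub>M sobolev_borel q \<Otimes>\<^sub>M surface"
  proof (rule measurable_Pair)
    show "fst \<in> P \<Otimes>\<^sub>M N \<rightarrow>\<^sub>M sobolev_borel q"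
      using measurable_fst[of P N] P(2) by (simp cong: measurable_cong_sets)
    show "(\<lambda>x. \<pi> (snd x)) \<in> P \<Otimes>\<^sub>M N \<rightarrow>\<^sub>M surface" by (rule measurable_compose[OF measurable_snd \<pi>])
  qed
  from measurable_compose[OF this eval_measurable]
  show m: "(\<lambda>z. fst z (\<pi> (snd z))) \<in> borel_measurable (P \<Otimes>\<^sub>M N)" by simp
  have "(\<integral>\<^sup>+z. ennreal (norm ((fst z (\<pi> (snd z))) ^ 4)) \<partial>(P \<Otimes>\<^sub>M N)) = (\<integral>\<^sup>+f. \<integral>\<^sup>+y. ennreal ((f (\<pi> y)) ^ 4) \<partial>N \<partial>P)"
    using N.nn_integral_fst[of "\<lambda>z. ennreal (norm ((fst z (\<pi> (snd z))) ^ 4))" P] m by (simp add: abs_of_nonneg)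
  also have "\<dots> \<le> (\<integral>\<^sup>+f. (ennreal (B\<^sup>2) * (sobolev_normsq q f)\<^sup>2) * emeasure N (space N) \<partial>P)"
  proof (rule nn_integral_mono)
    fix f assume "f \<in> space P"
    then have f: "f \<in> sobolev q" by (simp add: space_P)
    have "(\<integral>\<^sup>+y. ennreal ((f (\<pi> y)) ^ 4) \<partial>N) \<le> (\<integral>\<^sup>+y. ennreal (B\<^sup>2) * (sobolev_normsq q f)\<^sup>2 \<partial>N)"
      using measurable_space[OF \<pi>] by (intro nn_integral_mono eval_fourth f) simp
    then show "(\<integral>\<^sup>+y. ennreal ((f (\<pi> y)) ^ 4) \<partial>N) \<le> (ennreal (B\<^sup>2) * (sobolev_normsq q f)\<^sup>2) * emeasure N (space N)" by simp
  qed
  also have "\<dots> = ennreal (B\<^sup>2) * (\<integral>\<^sup>+f. (sobolev_normsq q f)\<^sup>2 \<partial>P) * emeasure N (space N)"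
    using normsq_meas_P by (simp add: nn_integral_multc nn_integral_cmult)
  also have "\<dots> \<le> ennreal (B\<^sup>2) * ennreal L * emeasure N (space N)"
    by (intro mult_right_mono mult_left_mono L) auto
  also have "\<dots> < \<infinity>" using N.emeasure_finite[of "space N"] by (simp add: ennreal_mult_eq_top_iff less_top[symmetric])
  finally show "integrable (P \<Otimes>\<^sub>M N) (\<lambda>z. (fst z (\<pi> (snd z))) ^ 4)" using m by (simp add: integrable_iff_bounded)
qed

text \<open>Fubini's theorem, justified by the fourth-moment bound on point evaluations.\<close>

lemma mean_coef: "sph.coef (mean_fun P) k = (LINT f|P. sph.coef f k)"
proof -
  interpret PS: pair_sigma_finite P surface ..
  interpret PSf: finite_measure "P \<Otimes>\<^sub>M surface" by (rule finite_measure_pair_measure) (auto intro: P.finite_measure_axioms finite_surface)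
  note e = eval_fourth_integrable[OF finite_surface measurable_ident[unfolded id_def]]
  have L2e: "(\<lambda>z. fst z (snd z)) \<in> L2 (P \<Otimes>\<^sub>M surface)" by (rule L2_of_fourth[OF PSf.finite_measure_axioms e])
  obtain C where C: "\<And>z. z \<in> S2 \<Longrightarrow> \<bar>harmonic k z\<bar> \<le> C" using sph.bounded_cont[OF continuous_harmonic] by blast
  have mh: "(\<lambda>z. harmonic k (snd z)) \<in> borel_measurable (P \<Otimes>\<^sub>M surface)"
    by (rule measurable_compose[OF measurable_snd meas_surface[OF continuous_harmonic]])
  have "integrable (P \<Otimes>\<^sub>M surface) (\<lambda>z. (harmonic k (snd z))\<^sup>2)"
  proof (rule PSf.integrable_const_bound[of _ "C\<^sup>2"])
    show "AE z in P \<Otimes>\<^sub>M surface. norm ((harmonic k (snd z))\<^sup>2) \<le> C\<^sup>2"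
      using power_mono[OF C, of _ 2] by (intro AE_I2) (auto simp: space_pair_measure)
  qed (use mh in simp)
  then have "(\<lambda>z. harmonic k (snd z)) \<in> L2 (P \<Otimes>\<^sub>M surface)" using mh by (simp add: L2_def)
  from L2_add(1)[OF L2e this] have i: "integrable (P \<Otimes>\<^sub>M surface) (\<lambda>(f, u). f u * harmonic k u)" by (simp add: case_prod_unfold)
  have "sph.coef (mean_fun P) k = (LINT u|surface. LINT f|P. f u * harmonic k u)"
    unfolding L2_inner_def mean_fun_def by simp
  also have "\<dots> = (LINT f|P. LINT u|surface. f u * harmonic k u)" by (rule PS.Fubini_integral[OF i])
  finally show ?thesis unfolding L2_inner_def .
qed

text \<open>Fubini's theorem as for the mean, with the product of two evaluations.\<close>

lemma second_moment_coef:
  "sph2.coef (second_moment_fun P) k = (LINT f|P. sph.coef f (fst2 k) * sph.coef f (snd2 k))"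
proof -
  interpret PS: pair_sigma_finite P surface2 ..
  interpret PSf: finite_measure "P \<Otimes>\<^sub>M surface2" by (rule finite_measure_pair_measure) (auto intro: P.finite_measure_axioms fsurf2.finite_measure_axioms)
  note e1 = eval_fourth_integrable[OF fsurf2.finite_measure_axioms measurable_fst]
  note e2 = eval_fourth_integrable[OF fsurf2.finite_measure_axioms measurable_snd]
  have L2e: "(\<lambda>z. fst z (fst (snd z)) * fst z (snd (snd z))) \<in> L2 (P \<Otimes>\<^sub>M surface2)" by (rule product_L2_of_fourth[OF e1 e2])
  have ch: "continuous_on (S2 \<times> S2) (harmonic2 k)" by (rule sph2.cont_e)
  obtain C where C: "\<And>z. z \<in> S2 \<times> S2 \<Longrightarrow> \<bar>harmonic2 k z\<bar> \<le> C" using sph2.bounded_cont[OF ch] by blast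
  have mh: "(\<lambda>z. harmonic2 k (snd z)) \<in> borel_measurable (P \<Otimes>\<^sub>M surface2)"
    by (rule measurable_compose[OF measurable_snd meas_surface2[OF ch]])
  have "integrable (P \<Otimes>\<^sub>M surface2) (\<lambda>z. (harmonic2 k (snd z))\<^sup>2)"
  proof (rule PSf.integrable_const_bound[of _ "C\<^sup>2"])
    show "AE z in P \<Otimes>\<^sub>M surface2. norm ((harmonic2 k (snd z))\<^sup>2) \<le> C\<^sup>2"
      using power_mono[OF C, of _ 2] by (intro AE_I2) (auto simp: space_pair_measure)
  qed (use mh in simp)
  then have "(\<lambda>z. harmonic2 k (snd z)) \<in> L2 (P \<Otimes>\<^sub>M surface2)" using mh by (simp add: L2_def)
  from L2_add(1)[OF L2e this]
  have i: "integrable (P \<Otimes>\<^sub>M surface2) (\<lambda>(f, x). f (fst x) * f (snd x) * harmonic2 k x)" by (simp add: case_prod_unfold)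
  have "sph2.coef (second_moment_fun P) k = (LINT x|surface2. LINT f|P. f (fst x) * f (snd x) * harmonic2 k x)"
    unfolding L2_inner_def second_moment_fun_def case_prod_unfold by simp
  also have "\<dots> = (LINT f|P. LINT x|surface2. f (fst x) * f (snd x) * harmonic2 k x)" by (rule PS.Fubini_integral[OF i])
  also have "\<dots> = (LINT f|P. sph.coef f (fst2 k) * sph.coef f (snd2 k))"
  proof (rule Bochner_Integration.integral_cong[OF refl])
    fix f assume "f \<in> space P"
    then have f: "continuous_on S2 f" by (simp add: space_P sobolev_cont)
    show "(LINT x|surface2. f (fst x) * f (snd x) * harmonic2 k x) = sph.coef f (fst2 k) * sph.coef f (snd2 k)"
      using inner_tensor[OF f f continuous_harmonic continuous_harmonic, of "fst2 k" "snd2 k"]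
      unfolding harmonic2_def L2_inner_def[of surface2] by (simp add: tensor_def case_prod_unfold)
  qed
  finally show ?thesis .
qed

lemma coef_sq_le: "ennreal ((sph.coef f k)\<^sup>2) \<le> sobolev_normsq q f"
  using order_trans[OF sum_le_suminf[of "\<lambda>k. ennreal ((sph.coef f k)\<^sup>2)" "{k}"] coef_sum_le[of f]] by simp

lemma coef_fourth: "integrable P (\<lambda>f. (sph.coef f k) ^ 4)"
proof -
  have "(\<integral>\<^sup>+f. ennreal (norm ((sph.coef f k) ^ 4)) \<partial>P) \<le> (\<integral>\<^sup>+f. (sobolev_normsq q f)\<^sup>2 \<partial>P)"
  proof (rule nn_integral_mono)
    fix f
    show "ennreal (norm ((sph.coef f k) ^ 4)) \<le> (sobolev_normsq q f)\<^sup>2"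
      using power_mono[OF coef_sq_le[of f k], of 2] by (simp add: ennreal_power power_mult[symmetric] abs_of_nonneg)
  qed
  also have "\<dots> < \<infinity>" using L(2) by (simp add: le_less_trans[OF _ ennreal_less_top])
  finally show ?thesis using coef_meas_P by (simp add: integrable_iff_bounded)
qed

lemma coef_L2: "(\<lambda>f. sph.coef f k) \<in> L2 P"
  by (rule L2_of_fourth[OF P.finite_measure_axioms coef_meas_P coef_fourth])

lemma coef2_L2: "(\<lambda>f. sph.coef f j * sph.coef f k) \<in> L2 P"
  by (rule product_L2_of_fourth[OF coef_meas_P coef_fourth coef_meas_P coef_fourth])

lemma coef_sum_bound: "(\<Sum>k. ennreal (LINT f|P. (sph.coef f k)\<^sup>2)) \<le> ennreal (1 + L)"
proof -
  have "(\<Sum>k. ennreal (LINT f|P. (sph.coef f k)\<^sup>2)) = (\<Sum>k. \<integral>\<^sup>+f. ennreal ((sph.coef f k)\<^sup>2) \<partial>P)"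
    using coef_L2 by (intro suminf_cong nn_integral_eq_integral[symmetric]) (auto simp: L2_def)
  also have "\<dots> = (\<integral>\<^sup>+f. (\<Sum>k. ennreal ((sph.coef f k)\<^sup>2)) \<partial>P)"
    using coef_meas_P by (intro nn_integral_suminf[symmetric]) simp
  also have "\<dots> \<le> (\<integral>\<^sup>+f. 1 + (sobolev_normsq q f)\<^sup>2 \<partial>P)"
  proof (rule nn_integral_mono)
    fix f
    have "x \<le> 1 + x\<^sup>2" for x :: ennreal
    proof (cases "x \<le> 1")
      case True then show ?thesis by (simp add: add_increasing2)
    next
      case False
      then have "1 * x \<le> x * x" by (intro mult_right_mono) auto
      then show ?thesis by (simp add: power2_eq_square add_increasing)
    qed
    then show "(\<Sum>k. ennreal ((sph.coef f k)\<^sup>2)) \<le> 1 + (sobolev_normsq q f)\<^sup>2" using coef_sum_le order_trans by blast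
  qed
  also have "\<dots> = 1 + (\<integral>\<^sup>+f. (sobolev_normsq q f)\<^sup>2 \<partial>P)"
    using normsq_meas_P by (subst nn_integral_add) (auto simp: P.emeasure_space_1)
  also have "\<dots> \<le> 1 + ennreal L" by (intro add_left_mono L)
  also have "\<dots> = ennreal (1 + L)" using L(1) by (simp add: ennreal_plus)
  finally show ?thesis .
qed

lemma coef2_sum_bound: "(\<Sum>k. ennreal (LINT f|P. (sph.coef f (fst2 k) * sph.coef f (snd2 k))\<^sup>2)) \<le> ennreal (1 + L)"
proof -
  note [measurable] = coef_meas_P
  have "(\<Sum>k. ennreal (LINT f|P. (sph.coef f (fst2 k) * sph.coef f (snd2 k))\<^sup>2)) = (\<Sum>k. \<integral>\<^sup>+f. ennreal ((sph.coef f (fst2 k) * sph.coef f (snd2 k))\<^sup>2) \<partial>P)"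
    using coef2_L2 by (intro suminf_cong nn_integral_eq_integral[symmetric]) (auto simp: L2_def)
  also have "\<dots> = (\<integral>\<^sup>+f. (\<Sum>k. ennreal ((sph.coef f (fst2 k) * sph.coef f (snd2 k))\<^sup>2)) \<partial>P)"
    by (intro nn_integral_suminf[symmetric]) simp
  also have "\<dots> \<le> (\<integral>\<^sup>+f. (sobolev_normsq q f)\<^sup>2 \<partial>P)"
  proof (rule nn_integral_mono)
    fix f
    have "(\<Sum>k. ennreal ((sph.coef f (fst2 k) * sph.coef f (snd2 k))\<^sup>2)) = (\<Sum>a. \<Sum>b. ennreal ((sph.coef f a)\<^sup>2) * ennreal ((sph.coef f b)\<^sup>2))"
      using suminf_pair[of "\<lambda>a b. ennreal ((sph.coef f a)\<^sup>2) * ennreal ((sph.coef f b)\<^sup>2)"]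
      by (simp add: ennreal_mult power_mult_distrib)
    also have "\<dots> = (\<Sum>a. ennreal ((sph.coef f a)\<^sup>2)) * (\<Sum>b. ennreal ((sph.coef f b)\<^sup>2))"
      by (simp only: ennreal_suminf_cmult ennreal_suminf_multc)
    also have "\<dots> \<le> sobolev_normsq q f * sobolev_normsq q f" by (intro mult_mono coef_sum_le) auto
    finally show "(\<Sum>k. ennreal ((sph.coef f (fst2 k) * sph.coef f (snd2 k))\<^sup>2)) \<le> (sobolev_normsq q f)\<^sup>2"
      by (simp add: power2_eq_square)
  qed
  also have "\<dots> \<le> ennreal (1 + L)" using L by (simp add: order_trans[OF L(2)] ennreal_leI)
  finally show ?thesis .
qed

text \<open>The variance of an average of \<open>n\<close> independent curves; this is the origin of the term \<open>1 / n\<close>.\<close>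

lemma curve_average:
  assumes g: "g \<in> L2 P"
  shows "(\<integral>\<^sup>+X. ennreal (((\<Sum>i<n. g (X i) - (LINT f|P. g f)) / real n)\<^sup>2) \<partial>MX) \<le> ennreal (1 / real n) * ennreal (LINT f|P. (g f)\<^sup>2)"
    "(\<lambda>X. (\<Sum>i<n. g (X i) - (LINT f|P. g f)) / real n) \<in> borel_measurable MX"
proof -
  define m where "m = (LINT f|P. g f)"
  have gm: "g \<in> borel_measurable P" and g2: "integrable P (\<lambda>f. (g f)\<^sup>2)" using g by (auto simp: L2_def)
  have mc: "(\<lambda>X. X i) \<in> MX \<rightarrow>\<^sub>M P" if "i < n" for i unfolding MX_def using that by (intro measurable_component_singleton) simp
  have d: "distr MX P (\<lambda>X. X i) = P" if "i < n" for i
    unfolding MX_def by (rule distr_PiM_component) (auto simp: P that)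
  have int: "(LINT X|MX. h (X i)) = (LINT f|P. h f)" "integrable P h \<Longrightarrow> integrable MX (\<lambda>X. h (X i))"
    if "i < n" "h \<in> borel_measurable P" for i and h :: "_ \<Rightarrow> real"
    using integral_distr[OF mc that(2)] integrable_distr_eq[OF mc that(2)] d that(1) by auto
  have gX: "(\<lambda>X. g (X i)) \<in> L2 MX" if "i < n" for i
    using int(2)[OF that, of "\<lambda>f. (g f)\<^sup>2"] measurable_compose[OF mc[OF that] gm] gm g2 by (simp add: L2_def)
  have gm'[measurable]: "i < n \<Longrightarrow> (\<lambda>X. g (X i)) \<in> borel_measurable MX" for i using measurable_compose[OF mc gm] .
  show mm: "(\<lambda>X. (\<Sum>i<n. g (X i) - (LINT f|P. g f)) / real n) \<in> borel_measurable MX" by measurable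
  have one: "(\<lambda>_. 1) \<in> L2 MX" by (simp add: L2_def)
  have ind: "(LINT X|MX. g (X i) * g (X j)) = (LINT X|MX. g (X i)) * (LINT X|MX. g (X j))"
    if ij: "i \<in> {..<n}" "j \<in> {..<n}" "i \<noteq> j" for i j
  proof -
    have "integrable MX (\<lambda>X. g (X i))" "integrable MX (\<lambda>X. g (X j))" "integrable MX (\<lambda>X. g (X i) * g (X j))"
      using L2_add(1)[OF gX one] L2_add(1)[OF gX gX] ij by auto
    then show ?thesis unfolding MX_def
      by (intro PiM_block_integral[OF P(1), of _ "{i}"]) (use ij in auto)
  qed
  note v = variance_weighted_sum(2,3)[where N = MX and I = "{..<n}" and w = "\<lambda>_. 1 / real n" and \<zeta> = "\<lambda>i X. g (X i)" and D = "(\<noteq>)", OF MX.prob_space_axioms finite_lessThan _ gX _ ind]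
  have e: "(\<Sum>i<n. 1 / real n * g (X i)) - (\<Sum>i<n. 1 / real n * (LINT X|MX. g (X i))) = (\<Sum>i<n. g (X i) - m) / real n" for X
    using int(1)[OF _ gm] by (simp add: m_def sum_subtractf sum_distrib_left[symmetric] sum_divide_distrib[symmetric] diff_divide_distrib)
  have rhs: "(\<Sum>a<n. 1 / real n * (\<Sum>b | b \<in> {..<n} \<and> \<not> a \<noteq> b. 1 / real n) * (LINT X|MX. (g (X a))\<^sup>2)) = 1 / real n * (LINT f|P. (g f)\<^sup>2)"
  proof -
    have "{b. b \<in> {..<n} \<and> \<not> a \<noteq> b} = {a}" if "a < n" for a using that by auto
    then show ?thesis using int(1)[of _ "\<lambda>f. (g f)\<^sup>2"] gm n by simp
  qed
  have b: "(LINT X|MX. ((\<Sum>i<n. g (X i) - m) / real n)\<^sup>2) \<le> 1 / real n * (LINT f|P. (g f)\<^sup>2)"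
    using v(1) unfolding e rhs by auto
  have "(\<lambda>X. (\<Sum>i<n. 1 / real n * g (X i))) \<in> L2 MX" using v(2) by (auto simp: L2_def)
  from L2_diff[OF this, of "\<lambda>_. \<Sum>i<n. 1 / real n * (LINT X|MX. g (X i))"]
  have "integrable MX (\<lambda>X. ((\<Sum>i<n. g (X i) - m) / real n)\<^sup>2)" unfolding e by (simp add: L2_def)
  then have "(\<integral>\<^sup>+X. ennreal (((\<Sum>i<n. g (X i) - m) / real n)\<^sup>2) \<partial>MX) = ennreal (LINT X|MX. ((\<Sum>i<n. g (X i) - m) / real n)\<^sup>2)"
    by (rule nn_integral_eq_integral) simp
  also have "\<dots> \<le> ennreal (1 / real n * (LINT f|P. (g f)\<^sup>2))" by (rule ennreal_leI[OF b])
  also have "\<dots> = ennreal (1 / real n) * ennreal (LINT f|P. (g f)\<^sup>2)" by (rule ennreal_mult) auto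
  finally show "(\<integral>\<^sup>+X. ennreal (((\<Sum>i<n. g (X i) - (LINT f|P. g f)) / real n)\<^sup>2) \<partial>MX) \<le> ennreal (1 / real n) * ennreal (LINT f|P. (g f)\<^sup>2)"
    unfolding m_def .
qed

text \<open>The value \<open>1 / (n * r)\<close>, with \<open>r\<close> the harmonic mean, in the form in which it arises as a sum of squared weights.\<close>

definition R1 where "R1 = (\<Sum>i<n. 1 / real (r i)) / (real n)\<^sup>2"

lemma R1: "0 \<le> R1" by (simp add: R1_def sum_nonneg)

text \<open>Bounds the second moment of a residual \<open>y - f0\<close> when \<open>f0\<^sup>2 \<le> R\<close>. The first summand is the fourth-moment bound,
used with \<open>t\<^sup>2 \<le> 1 + t\<^sup>4\<close> so that one constant serves observations and their products.\<close>

definition Cy where "Cy R = 2 + 2 * (8 * (B\<^sup>2 * L) + 8 * m4) + 2 * R"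

lemma sum_obs: "(\<Sum>a\<in>Ob. F a) = (\<Sum>i<n. \<Sum>j<r i. F (i, j) :: real)"
  unfolding obs_index_def by (simp add: sum.Sigma)

lemma cont_L2_loc: "a \<in> Ob \<Longrightarrow> continuous_on S2 h \<Longrightarrow> (\<lambda>Y. h (fst Y a)) \<in> L2 MY"
  using integral_loc(2)[of a "\<lambda>u. (h u)\<^sup>2"] cont_loc_meas[of a h] by (auto simp: L2_def intro!: continuous_intros)

lemma cont_L2_loc2: "a \<in> Ob \<Longrightarrow> b \<in> Ob \<Longrightarrow> a \<noteq> b \<Longrightarrow> continuous_on (S2 \<times> S2) h \<Longrightarrow> (\<lambda>Y. h (fst Y a, fst Y b)) \<in> L2 MY"
  using integral_loc2(2)[of a b "\<lambda>u. (h u)\<^sup>2"] measurable_compose[OF loc2_meas[of a b] meas_surface2[of h]]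
  by (auto simp: L2_def intro!: continuous_on_power)

lemma bounded_mult_L2:
  assumes "g \<in> L2 MY" "h \<in> borel_measurable MY" "\<And>Y. Y \<in> space MY \<Longrightarrow> \<bar>h Y\<bar> \<le> C"
  shows "(\<lambda>Y. g Y * h Y) \<in> L2 MY"
proof -
  have [measurable]: "g \<in> borel_measurable MY" "h \<in> borel_measurable MY" using assms by (auto simp: L2_def)
  have "integrable MY (\<lambda>Y. (g Y * h Y)\<^sup>2)"
  proof (rule Bochner_Integration.integrable_bound)
    show "integrable MY (\<lambda>Y. C\<^sup>2 * (g Y)\<^sup>2)" using assms by (simp add: L2_def)
    show "AE Y in MY. norm ((g Y * h Y)\<^sup>2) \<le> norm (C\<^sup>2 * (g Y)\<^sup>2)"
    proof (rule AE_I2)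
      fix Y assume "Y \<in> space MY"
      then have "\<bar>h Y\<bar> \<le> \<bar>C\<bar>" using assms(3) by fastforce
      then have "(h Y)\<^sup>2 \<le> C\<^sup>2" by (rule abs_le_square_iff[THEN iffD1])
      from mult_right_mono[OF this, of "(g Y)\<^sup>2"]
      show "norm ((g Y * h Y)\<^sup>2) \<le> norm (C\<^sup>2 * (g Y)\<^sup>2)" by (simp add: power_mult_distrib mult.commute)
    qed
  qed simp
  then show ?thesis by (simp add: L2_def)
qed

text \<open>Distinct observations are conditionally independent, so every index is dependent only on itself and
the overlap is the sum of the squared weights.\<close>

lemma mean_design:
  assumes K: "kernel_space surface S2 harmonic \<rho> \<rho>0 Bp"
    and \<mu>: "mean_fun P \<in> kernel_space.Hs surface S2 harmonic \<rho>"
    and R: "0 \<le> R" "\<And>u. u \<in> S2 \<Longrightarrow> (mean_fun P u)\<^sup>2 \<le> R"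
  shows "regression_design surface S2 harmonic \<rho> \<rho>0 Bp MX MY Ob (\<lambda>a. 4 * pi / (real n * real (r (fst a)))) (\<noteq>)
    (\<lambda>a Y. fst Y a) (\<lambda>a X Y. obs X Y a) (mean_fun P)
    (\<lambda>k X. (\<Sum>i<n. sph.coef (X i) k - (LINT f|P. sph.coef f k)) / real n) (4 * pi) ((4 * pi)\<^sup>2 * R1) (Cy R) ((1 + L) / real n)"
proof -
  interpret Kp: kernel_space surface S2 harmonic \<rho> \<rho>0 Bp by (rule K)
  have cm: "continuous_on S2 (mean_fun P)" by (rule Kp.HsD(1)[OF \<mu>])
  have r0: "0 < real (r i)" if "i < n" for i using r[OF that] by simp
  show ?thesis
  proof (rule regression_design.intro[OF K], rule regression_design_axioms.intro, goal_cases)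
    case (4 a) then show ?case by simp
  next
    case (6 a) then show ?case by (rule loc_meas)
  next
    case (7 a h) show ?case using integral_loc(1)[OF 7(1), of h] 7(2) by simp
  next
    case (8 a b h)
    then show ?case by (intro block[of "{a}" "\<lambda>Y. h (fst Y a)"] cont_L2_loc) auto
  next
    case 10
    show ?case unfolding sum_obs using r0 n by simp
  next
    case 12
    have "{b \<in> Ob. \<not> a \<noteq> b} = {a}" if "a \<in> Ob" for a using that by auto
    then have "(\<Sum>a\<in>Ob. 4 * pi / (real n * real (r (fst a))) * (\<Sum>b | b \<in> Ob \<and> \<not> a \<noteq> b. 4 * pi / (real n * real (r (fst b)))))
      = (\<Sum>a\<in>Ob. (4 * pi / (real n * real (r (fst a))))\<^sup>2)" by (simp add: power2_eq_square)
    also have "\<dots> = (\<Sum>i<n. (4 * pi)\<^sup>2 / (real n)\<^sup>2 * (1 / real (r i)))"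
      unfolding sum_obs using r0 by (intro sum.cong refl) (simp add: power2_eq_square field_simps)
    also have "\<dots> = (4 * pi)\<^sup>2 / (real n)\<^sup>2 * (\<Sum>i<n. 1 / real (r i))" by (rule sum_distrib_left[symmetric])
    finally show ?case by (simp add: R1_def)
  next
    case 13 then show ?case by (rule \<mu>)
  next
    case (14 a) then show ?case by (rule obs_meas)
  next
    case (15 a X) then show ?case using obs_L2 by (simp add: L2_def)
  next
    case (16 a b X k)
    have L: "(\<lambda>Y. (obs X Y c - mean_fun P (fst Y c)) * harmonic k (fst Y c)) \<in> L2 MY" if c: "c \<in> Ob" for c
    proof -
      obtain C where C: "\<And>z. z \<in> S2 \<Longrightarrow> \<bar>harmonic k z\<bar> \<le> C" using sph.bounded_cont[OF continuous_harmonic] by blast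
      show ?thesis
        by (rule bounded_mult_L2[of _ _ C]) (use 16 c C loc_S2[OF c] in \<open>auto intro!: L2_diff obs_L2 cont_L2_loc cm cont_loc_meas continuous_harmonic\<close>)
    qed
    show ?case
      by (rule block[of "{a}" "\<lambda>Y. (obs X Y a - mean_fun P (fst Y a)) * harmonic k (fst Y a)"])
        (use 16 L in \<open>auto simp: obs_def\<close>)
  next
    case (17 k) then show ?case by (rule curve_average(2)[OF coef_L2])
  next
    case (18 X k)
    have t: "(LINT Y|MY. (obs X Y a - mean_fun P (fst Y a)) * harmonic k (fst Y a)) = (sph.coef (X (fst a)) k - sph.coef (mean_fun P) k) / (4 * pi)"
      if a: "a \<in> Ob" for a
    proof -
      have c: "continuous_on S2 (\<lambda>u. mean_fun P u * harmonic k u)" by (intro continuous_intros cm)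
      have "(LINT Y|MY. (obs X Y a - mean_fun P (fst Y a)) * harmonic k (fst Y a)) =
        (LINT Y|MY. obs X Y a * harmonic k (fst Y a) - mean_fun P (fst Y a) * harmonic k (fst Y a))" by (simp add: left_diff_distrib)
      also have "\<dots> = (LINT Y|MY. obs X Y a * harmonic k (fst Y a)) - (LINT Y|MY. mean_fun P (fst Y a) * harmonic k (fst Y a))"
        using L2_add(1)[OF obs_L2[OF a 18] cont_L2_loc[OF a continuous_harmonic]] integral_loc(2)[OF a c] by simp
      finally show ?thesis using obs_linear[OF a 18 continuous_harmonic] integral_loc(1)[OF a c]
        by (simp add: L2_inner_def diff_divide_distrib)
    qed
    have "(\<Sum>a\<in>Ob. 4 * pi / (real n * real (r (fst a))) * (LINT Y|MY. (obs X Y a - mean_fun P (fst Y a)) * harmonic k (fst Y a)))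
      = (\<Sum>a\<in>Ob. 4 * pi / (real n * real (r (fst a))) * ((sph.coef (X (fst a)) k - sph.coef (mean_fun P) k) / (4 * pi)))"
      by (intro sum.cong refl) (simp add: t)
    also have "\<dots> = (\<Sum>i<n. (sph.coef (X i) k - sph.coef (mean_fun P) k) / real n)"
      unfolding sum_obs using r0 by (intro sum.cong refl) simp
    finally show ?case by (simp add: mean_coef sum_divide_distrib)
  next
    case 19 then show ?case using L(1) by simp
  next
    case 20
    have "(\<Sum>k. \<integral>\<^sup>+X. ennreal (((\<Sum>i<n. sph.coef (X i) k - (LINT f|P. sph.coef f k)) / real n)\<^sup>2) \<partial>MX)
      \<le> (\<Sum>k. ennreal (1 / real n) * ennreal (LINT f|P. (sph.coef f k)\<^sup>2))"
      by (intro suminf_le curve_average(1) coef_L2) auto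
    also have "\<dots> \<le> ennreal (1 / real n) * ennreal (1 + L)"
      unfolding ennreal_suminf_cmult by (intro mult_left_mono coef_sum_bound) simp
    also have "\<dots> = ennreal ((1 + L) / real n)"
      by (subst ennreal_mult[symmetric]) (use L(1) in auto)
    finally show ?case .
  next
    case 21 then show ?case using R L m4 by (simp add: Cy_def)
  next
    case (22 a)
    note [measurable] = obs_meas[OF 22]
    have "(\<integral>\<^sup>+z. ennreal ((obs (fst z) (snd z) a - mean_fun P (fst (snd z) a))\<^sup>2) \<partial>(MX \<Otimes>\<^sub>M MY))
      \<le> (\<integral>\<^sup>+z. ennreal (2 + 2 * R) + ennreal 2 * ennreal ((obs (fst z) (snd z) a) ^ 4) \<partial>(MX \<Otimes>\<^sub>M MY))"
    proof (rule nn_integral_mono)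
      fix z assume "z \<in> space (MX \<Otimes>\<^sub>M MY)"
      then have "snd z \<in> space MY" by (auto simp: space_pair_measure)
      then have Rz: "(mean_fun P (fst (snd z) a))\<^sup>2 \<le> R" by (intro R loc_S2[OF 22])
      have "(s - t)\<^sup>2 \<le> 2 + 2 * R + 2 * s ^ 4" if "t\<^sup>2 \<le> R" for s t :: real
      proof -
        have "(s\<^sup>2 - 1)\<^sup>2 = s ^ 4 - 2 * s\<^sup>2 + 1" by (simp add: power2_diff)
        moreover have "(s - t)\<^sup>2 + (s + t)\<^sup>2 = 2 * s\<^sup>2 + 2 * t\<^sup>2" by (simp add: power2_eq_square algebra_simps)
        ultimately show ?thesis using zero_le_power2[of "s\<^sup>2 - 1"] zero_le_power2[of "s + t"] zero_le_power2[of s] that by linarith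
      qed
      from ennreal_leI[OF this[OF Rz, of "obs (fst z) (snd z) a"]]
      have "ennreal ((obs (fst z) (snd z) a - mean_fun P (fst (snd z) a))\<^sup>2) \<le> ennreal (2 + 2 * R + 2 * (obs (fst z) (snd z) a) ^ 4)" .
      also have "\<dots> = ennreal (2 + 2 * R) + ennreal 2 * ennreal ((obs (fst z) (snd z) a) ^ 4)"
        by (subst ennreal_plus) (use R(1) in \<open>auto simp: ennreal_mult\<close>)
      finally show "ennreal ((obs (fst z) (snd z) a - mean_fun P (fst (snd z) a))\<^sup>2) \<le> ennreal (2 + 2 * R) + ennreal 2 * ennreal ((obs (fst z) (snd z) a) ^ 4)" .
    qed
    also have "\<dots> = ennreal (2 + 2 * R) + ennreal 2 * (\<integral>\<^sup>+z. ennreal ((obs (fst z) (snd z) a) ^ 4) \<partial>(MX \<Otimes>\<^sub>M MY))"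
    proof -
      interpret S: pair_prob_space MX MY ..
      show ?thesis by (subst nn_integral_add) (auto simp: nn_integral_cmult S.emeasure_space_1)
    qed
    also have "\<dots> \<le> ennreal (2 + 2 * R) + ennreal 2 * ennreal (8 * (B\<^sup>2 * L) + 8 * m4)"
      by (intro add_left_mono mult_left_mono obs_fourth_expectation 22) simp
    also have "\<dots> = ennreal (2 + 2 * R) + ennreal (2 * (8 * (B\<^sup>2 * L) + 8 * m4))"
      by (subst ennreal_mult[symmetric]) (use L m4 in auto)
    also have "\<dots> = ennreal (Cy R)"
      unfolding Cy_def by (subst ennreal_plus[symmetric]) (use R L m4 in auto)
    finally show ?case .
  qed (auto simp: MX.prob_space_axioms MYp.prob_space_axioms finite_O R1)
qed

end

section \<open>The design for the second moment\<close>

definition index_pairs :: "nat \<Rightarrow> (nat \<times> nat) set" where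
  "index_pairs m = {(j, k). j < m \<and> k < m \<and> j \<noteq> k}"

definition pt1 :: "nat \<times> nat \<times> nat \<Rightarrow> nat \<times> nat" where "pt1 a = (fst a, fst (snd a))"
definition pt2 :: "nat \<times> nat \<times> nat \<Rightarrow> nat \<times> nat" where "pt2 a = (fst a, snd (snd a))"

text \<open>Products of observations are conditionally independent when they share no observation.\<close>

definition disjoint_pairs :: "nat \<times> nat \<times> nat \<Rightarrow> nat \<times> nat \<times> nat \<Rightarrow> bool" where
  "disjoint_pairs a b \<longleftrightarrow> {pt1 a, pt2 a} \<inter> {pt1 b, pt2 b} = {}"

lemma finite_index_pairs: "finite (index_pairs m)"
  by (rule finite_subset[of _ "{..<m} \<times> {..<m}"]) (auto simp: index_pairs_def)

lemma card_index_pairs: "card (index_pairs m) = m * (m - 1)"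
proof -
  have "index_pairs m = (SIGMA j:{..<m}. {..<m} - {j})" by (auto simp: index_pairs_def)
  then show ?thesis by simp
qed

text \<open>At most \<open>4 * (m - 1)\<close> ordered pairs meet a given pair, out of \<open>m * (m - 1)\<close>; this gains the factor \<open>1 / m\<close>.\<close>

lemma card_meeting_pairs:
  assumes "j < m" "k < m"
  shows "card {(j', k'). (j', k') \<in> index_pairs m \<and> {j', k'} \<inter> {j, k} \<noteq> {}} \<le> 4 * (m - 1)"
proof -
  let ?A = "(\<lambda>t. (j, t)) ` ({..<m} - {j})" and ?B = "(\<lambda>t. (k, t)) ` ({..<m} - {k})"
  let ?C = "(\<lambda>t. (t, j)) ` ({..<m} - {j})" and ?E = "(\<lambda>t. (t, k)) ` ({..<m} - {k})"
  have c: "card ?A \<le> m - 1" "card ?B \<le> m - 1" "card ?C \<le> m - 1" "card ?E \<le> m - 1"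
    using assms by (auto intro!: order_trans[OF card_image_le])
  have "{(j', k'). (j', k') \<in> index_pairs m \<and> {j', k'} \<inter> {j, k} \<noteq> {}} \<subseteq> (?A \<union> ?B) \<union> (?C \<union> ?E)"
    by (auto simp: index_pairs_def image_iff)
  then have "card {(j', k'). (j', k') \<in> index_pairs m \<and> {j', k'} \<inter> {j, k} \<noteq> {}} \<le> card ((?A \<union> ?B) \<union> (?C \<union> ?E))"
    by (intro card_mono) auto
  also have "\<dots> \<le> (card ?A + card ?B) + (card ?C + card ?E)"
    by (intro order_trans[OF card_Un_le] add_mono card_Un_le)
  also have "\<dots> \<le> 4 * (m - 1)" using c by linarith
  finally show ?thesis .
qed

context sampling
begin

definition I2 where "I2 = (SIGMA i:{..<n}. index_pairs (r i))"
definition w2 :: "nat \<times> nat \<times> nat \<Rightarrow> real" where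
  "w2 a = (4 * pi)\<^sup>2 / (real n * (real (r (fst a)) * (real (r (fst a)) - 1)))"

lemma I2_pts: "a \<in> I2 \<Longrightarrow> pt1 a \<in> Ob" "a \<in> I2 \<Longrightarrow> pt2 a \<in> Ob" "a \<in> I2 \<Longrightarrow> pt1 a \<noteq> pt2 a" "a \<in> I2 \<Longrightarrow> fst a < n"
  by (auto simp: I2_def index_pairs_def pt1_def pt2_def obs_index_def)

lemma sum_I2: "(\<Sum>a\<in>I2. F a) = (\<Sum>i<n. \<Sum>jk\<in>index_pairs (r i). F (i, jk) :: real)"
  unfolding I2_def by (simp add: sum.Sigma finite_index_pairs)

lemma sum_w2:
  assumes "i < n" shows "(\<Sum>jk\<in>index_pairs (r i). w2 (i, jk) * c) = (4 * pi)\<^sup>2 / real n * c"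
proof -
  have r1: "1 < real (r i)" using r[OF assms] by simp
  have "real (card (index_pairs (r i))) = real (r i) * (real (r i) - 1)"
    using r1 by (simp add: card_index_pairs of_nat_diff)
  then show ?thesis using r1 n by (simp add: w2_def)
qed

lemma w2_nonneg: "a \<in> I2 \<Longrightarrow> 0 \<le> w2 a"
proof -
  assume "a \<in> I2"
  then have "1 < real (r (fst a))" using r[OF I2_pts(4)] by fastforce
  then show ?thesis unfolding w2_def by (intro divide_nonneg_nonneg mult_nonneg_nonneg) auto
qed

lemma overlap_w2:
  assumes a: "a \<in> I2"
  shows "(\<Sum>b | b \<in> I2 \<and> \<not> disjoint_pairs a b. w2 b) \<le> 4 * (4 * pi)\<^sup>2 / (real n * real (r (fst a)))"
proof -
  obtain i j k where ijk: "a = (i, j, k)" "i < n" "j < r i" "k < r i" using a by (auto simp: I2_def index_pairs_def)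
  define N where "N = {(j', k'). (j', k') \<in> index_pairs (r i) \<and> {j', k'} \<inter> {j, k} \<noteq> {}}"
  have fN: "finite N" unfolding N_def by (rule finite_subset[OF _ finite_index_pairs[of "r i"]]) auto
  have r1: "1 < real (r i)" using r[OF ijk(2)] by simp
  have "{b. b \<in> I2 \<and> \<not> disjoint_pairs a b} = Pair i ` N"
    unfolding N_def by (auto simp: disjoint_pairs_def pt1_def pt2_def ijk I2_def image_iff)
  then have "(\<Sum>b | b \<in> I2 \<and> \<not> disjoint_pairs a b. w2 b) = (\<Sum>jk\<in>N. w2 (i, jk))"
    by (simp add: sum.reindex inj_on_def)
  also have "\<dots> = real (card N) * ((4 * pi)\<^sup>2 / (real n * (real (r i) * (real (r i) - 1))))" by (simp add: w2_def)
  also have "\<dots> \<le> (4 * (real (r i) - 1)) * ((4 * pi)\<^sup>2 / (real n * (real (r i) * (real (r i) - 1))))"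
  proof (rule mult_right_mono)
    have "real (card N) \<le> real (4 * (r i - 1))" using card_meeting_pairs[OF ijk(3,4)] unfolding N_def by (rule of_nat_mono)
    then show "real (card N) \<le> 4 * (real (r i) - 1)" using r1 by (simp add: of_nat_diff)
  qed (use r1 in simp)
  also have "\<dots> = 4 * (4 * pi)\<^sup>2 / (real n * real (r (fst a)))" using r1 n by (simp add: ijk field_simps)
  finally show ?thesis .
qed

lemma obs2_L2:
  assumes "a \<in> I2" "X \<in> space MX" shows "(\<lambda>Y. obs X Y (pt1 a) * obs X Y (pt2 a)) \<in> L2 MY"
  using assms by (intro product_L2_of_fourth obs_meas1 obs_fourth I2_pts)

text \<open>The diagonal \<open>j = k\<close> is excluded, so the errors in a product of two observations are independent and centred,
and the product is conditionally unbiased for \<open>X u * X v\<close>.\<close>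

lemma second_moment_design:
  assumes K: "kernel_space surface2 (S2 \<times> S2) harmonic2 \<rho> \<rho>0 Bp"
    and R2: "second_moment_fun P \<in> kernel_space.Hs surface2 (S2 \<times> S2) harmonic2 \<rho>"
    and R: "0 \<le> R" "\<And>x. x \<in> S2 \<times> S2 \<Longrightarrow> (second_moment_fun P x)\<^sup>2 \<le> R"
  shows "regression_design surface2 (S2 \<times> S2) harmonic2 \<rho> \<rho>0 Bp MX MY I2 w2 disjoint_pairs
    (\<lambda>a Y. (fst Y (pt1 a), fst Y (pt2 a))) (\<lambda>a X Y. obs X Y (pt1 a) * obs X Y (pt2 a)) (second_moment_fun P)
    (\<lambda>k X. (\<Sum>i<n. sph.coef (X i) (fst2 k) * sph.coef (X i) (snd2 k) - (LINT f|P. sph.coef f (fst2 k) * sph.coef f (snd2 k))) / real n)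
    ((4 * pi)\<^sup>2) (4 * ((4 * pi)\<^sup>2)\<^sup>2 * R1) (Cy R) ((1 + L) / real n)"
proof -
  interpret Kp: kernel_space surface2 "S2 \<times> S2" harmonic2 \<rho> \<rho>0 Bp by (rule K)
  let ?R = "second_moment_fun P"
  have cm: "continuous_on (S2 \<times> S2) ?R" by (rule Kp.HsD(1)[OF R2])
  have r0: "0 < real (r i)" "1 < real (r i)" if "i < n" for i using r[OF that] by auto
  have ch: "continuous_on (S2 \<times> S2) (harmonic2 k)" for k by (rule sph2.cont_e)
  show ?thesis
  proof (rule regression_design.intro[OF K], rule regression_design_axioms.intro, goal_cases)
    case 1 show ?case by (rule MX.prob_space_axioms)
  next
    case 2 show ?case by (rule MYp.prob_space_axioms)
  next
    case 3 show ?case unfolding I2_def by (auto intro: finite_index_pairs)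
  next
    case (4 a) then show ?case by (rule w2_nonneg)
  next
    case (5 a b) then show ?case by (auto simp: disjoint_pairs_def)
  next
    case (6 a) then show ?case by (intro loc2_meas I2_pts)
  next
    case (7 a h) show ?case by (rule integral_loc2(1)[OF I2_pts(1-3)[OF 7(1)] 7(2)])
  next
    case (8 a b h)
    have "{pt1 a, pt2 a} \<subseteq> Ob" using I2_pts 8(1) by auto
    moreover have "pt1 b \<notin> {pt1 a, pt2 a}" "pt2 b \<notin> {pt1 a, pt2 a}" using 8(3) by (auto simp: disjoint_pairs_def)
    ultimately show ?case using I2_pts(1,2)[OF 8(2)]
      by (intro block[of "{pt1 a, pt2 a}" "\<lambda>Y. h (fst Y (pt1 a), fst Y (pt2 a))"] cont_L2_loc2 I2_pts 8) auto
  next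
    case 9 show ?case by simp
  next
    case 10
    have "sum w2 I2 = (\<Sum>i<n. (4 * pi)\<^sup>2 / real n * 1)" unfolding sum_I2 using sum_w2[of _ 1] by (intro sum.cong) auto
    then show ?case using n by simp
  next
    case 11 show ?case using R1 by simp
  next
    case 12
    have "(\<Sum>a\<in>I2. w2 a * (\<Sum>b | b \<in> I2 \<and> \<not> disjoint_pairs a b. w2 b)) \<le> (\<Sum>a\<in>I2. w2 a * (4 * (4 * pi)\<^sup>2 / (real n * real (r (fst a)))))"
      by (intro sum_mono mult_left_mono overlap_w2 w2_nonneg)
    also have "\<dots> = (\<Sum>i<n. (4 * pi)\<^sup>2 / real n * (4 * (4 * pi)\<^sup>2 / (real n * real (r i))))"
      unfolding sum_I2 fst_conv by (intro sum.cong refl sum_w2) simp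
    also have "\<dots> = (\<Sum>i<n. 4 * ((4 * pi)\<^sup>2)\<^sup>2 / (real n)\<^sup>2 * (1 / real (r i)))"
      by (intro sum.cong refl) (simp add: power2_eq_square)
    also have "\<dots> = 4 * ((4 * pi)\<^sup>2)\<^sup>2 / (real n)\<^sup>2 * (\<Sum>i<n. 1 / real (r i))" by (rule sum_distrib_left[symmetric])
    finally show ?case by (simp add: R1_def)
  next
    case 13 then show ?case by (rule R2)
  next
    case (14 a) then show ?case by (intro borel_measurable_times obs_meas I2_pts)
  next
    case (15 a X) then show ?case using obs2_L2[OF 15] by (simp add: L2_def)
  next
    case (16 a b X k)
    have L: "(\<lambda>Y. (obs X Y (pt1 c) * obs X Y (pt2 c) - ?R (fst Y (pt1 c), fst Y (pt2 c))) * harmonic2 k (fst Y (pt1 c), fst Y (pt2 c))) \<in> L2 MY"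
      if c: "c \<in> I2" for c
    proof -
      obtain C where C: "\<And>z. z \<in> S2 \<times> S2 \<Longrightarrow> \<bar>harmonic2 k z\<bar> \<le> C" using sph2.bounded_cont[OF ch] by blast
      show ?thesis
      proof (rule bounded_mult_L2[of _ _ C])
        show "(\<lambda>Y. obs X Y (pt1 c) * obs X Y (pt2 c) - ?R (fst Y (pt1 c), fst Y (pt2 c))) \<in> L2 MY"
          by (intro L2_diff obs2_L2 c 16 cont_L2_loc2 I2_pts cm)
        show "(\<lambda>Y. harmonic2 k (fst Y (pt1 c), fst Y (pt2 c))) \<in> borel_measurable MY"
          using cont_L2_loc2[OF I2_pts(1-3)[OF c] ch] by (simp add: L2_def)
        show "\<bar>harmonic2 k (fst Y (pt1 c), fst Y (pt2 c))\<bar> \<le> C" if "Y \<in> space MY" for Y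
          using loc_S2[OF I2_pts(1)[OF c] that] loc_S2[OF I2_pts(2)[OF c] that] by (intro C) simp
      qed
    qed
    have "{pt1 a, pt2 a} \<subseteq> Ob" using I2_pts 16(1) by auto
    moreover have "pt1 b \<notin> {pt1 a, pt2 a}" "pt2 b \<notin> {pt1 a, pt2 a}" using 16(3) by (auto simp: disjoint_pairs_def)
    ultimately show ?case using I2_pts(1,2)[OF 16(2)] L[OF 16(1)] L[OF 16(2)]
      by (intro block[of "{pt1 a, pt2 a}" "\<lambda>Y. (obs X Y (pt1 a) * obs X Y (pt2 a) - ?R (fst Y (pt1 a), fst Y (pt2 a))) * harmonic2 k (fst Y (pt1 a), fst Y (pt2 a))"])
        (auto simp: obs_def)
  next
    case (17 k) then show ?case by (rule curve_average(2)[OF coef2_L2])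
  next
    case (18 X k)
    let ?s = "fst2 k" and ?t = "snd2 k"
    have t: "(LINT Y|MY. (obs X Y (pt1 a) * obs X Y (pt2 a) - ?R (fst Y (pt1 a), fst Y (pt2 a))) * harmonic2 k (fst Y (pt1 a), fst Y (pt2 a)))
       = (sph.coef (X (fst a)) ?s * sph.coef (X (fst a)) ?t - sph2.coef ?R k) / (4 * pi)\<^sup>2"
      if a: "a \<in> I2" for a
    proof -
      note p = I2_pts[OF a]
      have c: "continuous_on (S2 \<times> S2) (\<lambda>x. ?R x * harmonic2 k x)" by (intro continuous_on_mult cm ch)
      have L: "(\<lambda>Y. obs X Y b * harmonic j (fst Y b)) \<in> L2 MY" if b: "b \<in> Ob" for b j
      proof -
        obtain C where C: "\<And>z. z \<in> S2 \<Longrightarrow> \<bar>harmonic j z\<bar> \<le> C" using sph.bounded_cont[OF continuous_harmonic] by blast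
        show ?thesis
          by (rule bounded_mult_L2[of _ _ C, OF obs_L2[OF b 18] cont_loc_meas[OF b continuous_harmonic]])
            (rule C[OF loc_S2[OF b]])
      qed
      have b: "(LINT Y|MY. (obs X Y (pt1 a) * harmonic ?s (fst Y (pt1 a))) * (obs X Y (pt2 a) * harmonic ?t (fst Y (pt2 a)))) =
         (LINT Y|MY. obs X Y (pt1 a) * harmonic ?s (fst Y (pt1 a))) * (LINT Y|MY. obs X Y (pt2 a) * harmonic ?t (fst Y (pt2 a)))"
        using p by (intro block[of "{pt1 a}" "\<lambda>Y. obs X Y (pt1 a) * harmonic ?s (fst Y (pt1 a))"] L) (auto simp: obs_def)
      have "(LINT Y|MY. (obs X Y (pt1 a) * obs X Y (pt2 a) - ?R (fst Y (pt1 a), fst Y (pt2 a))) * harmonic2 k (fst Y (pt1 a), fst Y (pt2 a))) =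
        (LINT Y|MY. (obs X Y (pt1 a) * harmonic ?s (fst Y (pt1 a))) * (obs X Y (pt2 a) * harmonic ?t (fst Y (pt2 a)))
           - ?R (fst Y (pt1 a), fst Y (pt2 a)) * harmonic2 k (fst Y (pt1 a), fst Y (pt2 a)))"
        by (intro Bochner_Integration.integral_cong refl) (simp add: harmonic2_def tensor_def algebra_simps)
      also have "\<dots> = (LINT Y|MY. (obs X Y (pt1 a) * harmonic ?s (fst Y (pt1 a))) * (obs X Y (pt2 a) * harmonic ?t (fst Y (pt2 a))))
          - (LINT Y|MY. ?R (fst Y (pt1 a), fst Y (pt2 a)) * harmonic2 k (fst Y (pt1 a), fst Y (pt2 a)))"
        using L2_add(1)[OF L[OF p(1)] L[OF p(2)]] integral_loc2(2)[OF p(1-3) c] by (rule Bochner_Integration.integral_diff)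
      finally show ?thesis
        unfolding b obs_linear[OF p(1) 18 continuous_harmonic] obs_linear[OF p(2) 18 continuous_harmonic] integral_loc2(1)[OF p(1-3) c]
        by (simp add: L2_inner_def diff_divide_distrib pt1_def pt2_def power2_eq_square)
    qed
    have "(\<Sum>a\<in>I2. w2 a * (LINT Y|MY. (obs X Y (pt1 a) * obs X Y (pt2 a) - ?R (fst Y (pt1 a), fst Y (pt2 a))) * harmonic2 k (fst Y (pt1 a), fst Y (pt2 a))))
      = (\<Sum>a\<in>I2. w2 a * ((sph.coef (X (fst a)) ?s * sph.coef (X (fst a)) ?t - sph2.coef ?R k) / (4 * pi)\<^sup>2))"
      by (intro sum.cong refl) (simp only: t)
    also have "\<dots> = (\<Sum>i<n. (4 * pi)\<^sup>2 / real n * ((sph.coef (X i) ?s * sph.coef (X i) ?t - sph2.coef ?R k) / (4 * pi)\<^sup>2))"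
      unfolding sum_I2 fst_conv by (intro sum.cong refl sum_w2) simp
    also have "\<dots> = (\<Sum>i<n. (sph.coef (X i) ?s * sph.coef (X i) ?t - sph2.coef ?R k) / real n)"
      by (intro sum.cong refl) simp
    finally show ?case by (simp add: second_moment_coef sum_divide_distrib)
  next
    case 19 then show ?case using L(1) by simp
  next
    case 20
    have "(\<Sum>k. \<integral>\<^sup>+X. ennreal (((\<Sum>i<n. sph.coef (X i) (fst2 k) * sph.coef (X i) (snd2 k) - (LINT f|P. sph.coef f (fst2 k) * sph.coef f (snd2 k))) / real n)\<^sup>2) \<partial>MX)
      \<le> (\<Sum>k. ennreal (1 / real n) * ennreal (LINT f|P. (sph.coef f (fst2 k) * sph.coef f (snd2 k))\<^sup>2))"
      by (intro suminf_le allI curve_average(1) coef2_L2) auto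
    also have "\<dots> \<le> ennreal (1 / real n) * ennreal (1 + L)"
      unfolding ennreal_suminf_cmult by (intro mult_left_mono coef2_sum_bound) simp
    also have "\<dots> = ennreal ((1 + L) / real n)"
      by (subst ennreal_mult[symmetric]) (use L(1) in auto)
    finally show ?case .
  next
    case 21 then show ?case using R L m4 by (simp add: Cy_def)
  next
    case (22 a)
    note p = I2_pts[OF 22]
    note [measurable] = obs_meas[OF p(1)] obs_meas[OF p(2)]
    let ?s = "\<lambda>z. obs (fst z) (snd z) (pt1 a)" and ?t = "\<lambda>z. obs (fst z) (snd z) (pt2 a)"
    have "(\<integral>\<^sup>+z. ennreal ((?s z * ?t z - ?R (fst (snd z) (pt1 a), fst (snd z) (pt2 a)))\<^sup>2) \<partial>(MX \<Otimes>\<^sub>M MY))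
      \<le> (\<integral>\<^sup>+z. ennreal (2 * R) + (ennreal ((?s z) ^ 4) + ennreal ((?t z) ^ 4)) \<partial>(MX \<Otimes>\<^sub>M MY))"
    proof (rule nn_integral_mono)
      fix z assume "z \<in> space (MX \<Otimes>\<^sub>M MY)"
      then have z: "snd z \<in> space MY" by (auto simp: space_pair_measure)
      have Rz: "(?R (fst (snd z) (pt1 a), fst (snd z) (pt2 a)))\<^sup>2 \<le> R"
        using loc_S2[OF p(1) z] loc_S2[OF p(2) z] by (intro R) simp
      have "(s * t - c)\<^sup>2 \<le> 2 * R + (s ^ 4 + t ^ 4)" if "c\<^sup>2 \<le> R" for s t c :: real
      proof -
        have "2 * (s * t)\<^sup>2 \<le> s ^ 4 + t ^ 4" using sum_squares_bound[of "s\<^sup>2" "t\<^sup>2"] by (simp add: power_mult_distrib)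
        moreover have "(s * t - c)\<^sup>2 + (s * t + c)\<^sup>2 = 2 * (s * t)\<^sup>2 + 2 * c\<^sup>2" by (simp add: power2_eq_square algebra_simps)
        ultimately show ?thesis using zero_le_power2[of "s * t + c"] that by linarith
      qed
      from this[OF Rz, of "?s z" "?t z"]
      show "ennreal ((?s z * ?t z - ?R (fst (snd z) (pt1 a), fst (snd z) (pt2 a)))\<^sup>2) \<le> ennreal (2 * R) + (ennreal ((?s z) ^ 4) + ennreal ((?t z) ^ 4))"
        using R(1) by (simp add: ennreal_plus[symmetric] ennreal_leI del: ennreal_plus)
    qed
    also have "\<dots> = ennreal (2 * R) + ((\<integral>\<^sup>+z. ennreal ((?s z) ^ 4) \<partial>(MX \<Otimes>\<^sub>M MY)) + (\<integral>\<^sup>+z. ennreal ((?t z) ^ 4) \<partial>(MX \<Otimes>\<^sub>M MY)))"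
    proof -
      interpret S: pair_prob_space MX MY ..
      show ?thesis by (simp add: nn_integral_add S.emeasure_space_1)
    qed
    also have "\<dots> \<le> ennreal (2 * R) + (ennreal (8 * (B\<^sup>2 * L) + 8 * m4) + ennreal (8 * (B\<^sup>2 * L) + 8 * m4))"
      by (intro add_left_mono add_mono obs_fourth_expectation p)
    also have "\<dots> = ennreal (2 * R + ((8 * (B\<^sup>2 * L) + 8 * m4) + (8 * (B\<^sup>2 * L) + 8 * m4)))"
    proof -
      have x: "0 \<le> 8 * (B\<^sup>2 * L) + 8 * m4" using L m4 by simp
      show ?thesis using x R(1) by (simp only: ennreal_plus mult_nonneg_nonneg add_nonneg_nonneg zero_le_numeral)
    qed
    also have "\<dots> \<le> ennreal (Cy R)" unfolding Cy_def by (intro ennreal_leI) simp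
    finally show ?case .
  qed
qed

end

section \<open>The effective dimension\<close>

text \<open>Comparison with an integral in discrete form: \<open>H\<close> plays the part of the tail integral.\<close>

lemma telescoping_ennreal:
  fixes f H :: "nat \<Rightarrow> real"
  assumes "\<And>l. 0 \<le> f l" "\<And>l. 0 \<le> H l" "\<And>l. f l \<le> H l - H (Suc l)"
  shows "(\<Sum>l. ennreal (f l)) \<le> ennreal (H 0)"
proof -
  have "(\<Sum>l<n. f l) \<le> H 0 - H n" for n
  proof (induction n)
    case (Suc n)
    then show ?case using assms(3)[of n] by simp
  qed simp
  then have "(\<Sum>l<n. ennreal (f l)) \<le> ennreal (H 0)" for n
    using assms(1,2) by (simp add: sum_ennreal) (meson diff_le_eq ennreal_leI le_add_same_cancel1 order_trans)
  then show ?thesis unfolding suminf_eq_SUP by (intro SUP_least)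
qed

lemma sum_cauchy_kernel:
  assumes s: "0 < s"
  shows "(\<Sum>l. ennreal ((1 + real l) / (s + (1 + real l)\<^sup>2)\<^sup>2)) \<le> ennreal (1 / (2 * s))"
proof -
  define H where "H l = 1 / (2 * (s + real l * (real l + 1)))" for l :: nat
  have "(\<Sum>l. ennreal ((1 + real l) / (s + (1 + real l)\<^sup>2)\<^sup>2)) \<le> ennreal (H 0)"
  proof (rule telescoping_ennreal)
    fix l
    define u where "u = 1 + real l"
    define a b where "a = s + u\<^sup>2 - u" and "b = s + u\<^sup>2 + u"
    have u: "1 \<le> u" by (simp add: u_def)
    have "u \<le> u\<^sup>2" using u by (simp add: power2_eq_square)
    then have ab: "0 < a" "0 < b" using s u by (auto simp: a_def b_def)
    have H: "H l = 1 / (2 * a)" "H (Suc l) = 1 / (2 * b)"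
      by (simp_all add: H_def a_def b_def u_def power2_eq_square algebra_simps)
    have "a * b \<le> (s + u\<^sup>2)\<^sup>2" unfolding a_def b_def by (simp add: power2_eq_square algebra_simps)
    moreover have "0 < (s + u\<^sup>2)\<^sup>2" using s by (intro zero_less_power add_pos_nonneg) auto
    ultimately have "u / (s + u\<^sup>2)\<^sup>2 \<le> u / (a * b)" using u ab by (intro divide_left_mono mult_pos_pos) auto
    also have "\<dots> = H l - H (Suc l)" unfolding H using ab by (simp add: field_simps) (simp add: a_def b_def)
    finally show "(1 + real l) / (s + (1 + real l)\<^sup>2)\<^sup>2 \<le> H l - H (Suc l)" by (simp add: u_def)
  qed (use s in \<open>auto simp: H_def\<close>)
  then show ?thesis by (simp add: H_def)
qed

lemma sum_cauchy_kernel_strong: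
  assumes s: "0 < s"
  shows "(\<Sum>l. ennreal ((1 + real l) / (s + (1 + real l)\<^sup>2)\<^sup>2)) \<le> ennreal (2 / (1 + s))"
proof -
  have "(\<Sum>l. ennreal ((1 + real l) / (s + (1 + real l)\<^sup>2)\<^sup>2)) \<le> (\<Sum>l. ennreal 4 * ennreal ((1 + real l) / ((1 + s) + (1 + real l)\<^sup>2)\<^sup>2))"
  proof (intro suminf_le allI)
    fix l
    define u where "u = 1 + real l"
    have u: "1 \<le> u" by (simp add: u_def)
    then have "1 \<le> u\<^sup>2" by simp
    then have "((1 + s) + u\<^sup>2) \<le> 2 * (s + u\<^sup>2)" using s by (simp add: algebra_simps)
    then have "((1 + s) + u\<^sup>2)\<^sup>2 \<le> (2 * (s + u\<^sup>2))\<^sup>2" using s by (intro power_mono) auto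
    then have le: "((1 + s) + u\<^sup>2)\<^sup>2 \<le> 4 * (s + u\<^sup>2)\<^sup>2" unfolding power_mult_distrib by simp
    have pos: "0 < (s + u\<^sup>2)\<^sup>2" "0 < ((1 + s) + u\<^sup>2)\<^sup>2" 
      by (intro zero_less_power add_pos_nonneg; use s in simp)+
    have "u / (s + u\<^sup>2)\<^sup>2 = 4 * u / (4 * (s + u\<^sup>2)\<^sup>2)" by simp
    also have "\<dots> \<le> 4 * u / ((1 + s) + u\<^sup>2)\<^sup>2" using le pos u by (intro divide_left_mono) auto
    finally have "ennreal (u / (s + u\<^sup>2)\<^sup>2) \<le> ennreal (4 * (u / ((1 + s) + u\<^sup>2)\<^sup>2))" by (intro ennreal_leI) simp
    also have "\<dots> = ennreal 4 * ennreal (u / ((1 + s) + u\<^sup>2)\<^sup>2)" using u by (intro ennreal_mult) auto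
    finally show "ennreal ((1 + real l) / (s + (1 + real l)\<^sup>2)\<^sup>2) \<le> ennreal 4 * ennreal ((1 + real l) / ((1 + s) + (1 + real l)\<^sup>2)\<^sup>2)"
      by (simp add: u_def)
  qed auto
  also have "\<dots> = ennreal 4 * (\<Sum>l. ennreal ((1 + real l) / ((1 + s) + (1 + real l)\<^sup>2)\<^sup>2))" by (rule ennreal_suminf_cmult)
  also have "\<dots> \<le> ennreal 4 * ennreal (1 / (2 * (1 + s)))" using s by (intro mult_left_mono sum_cauchy_kernel) auto
  also have "\<dots> = ennreal (4 * (1 / (2 * (1 + s))))" using s by (intro ennreal_mult[symmetric]) auto
  also have "4 * (1 / (2 * (1 + s))) = 2 / (1 + s)" using s by (simp add: field_simps)
  finally show ?thesis .
qed

text \<open>The logarithm arises here: the sum behaves like \<open>s powr (-1)\<close> times the harmonic sum up to \<open>sqrt s\<close>.\<close>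

lemma sum_hyperbola:
  assumes s: "0 < s"
  shows "(\<Sum>l. ennreal (1 / ((1 + real l) * ((1 + real l)\<^sup>2 + s)))) \<le> ennreal ((1 + ln (1 + s)) / s)"
proof -
  define h where "h l = ln (1 + s / (real l)\<^sup>2) / s" for l :: nat
  define H where "H l = (if l = 0 then (1 + ln (1 + s)) / s else h l)" for l :: nat
  have h0: "0 \<le> h l" for l unfolding h_def using s by (intro divide_nonneg_nonneg ln_ge_zero) auto
  have "(\<Sum>l. ennreal (1 / ((1 + real l) * ((1 + real l)\<^sup>2 + s)))) \<le> ennreal (H 0)"
  proof (rule telescoping_ennreal)
    fix l :: nat
    show "0 \<le> H l" using h0 s by (auto simp: H_def intro!: divide_nonneg_nonneg add_nonneg_nonneg ln_ge_zero)
    show "1 / ((1 + real l) * ((1 + real l)\<^sup>2 + s)) \<le> H l - H (Suc l)"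
    proof (cases "l = 0")
      case True
      have "1 / (1 + s) \<le> 1 / s" using s by (intro divide_left_mono) auto
      then show ?thesis using True by (simp add: H_def h_def add_divide_distrib)
    next
      case False
      define v where "v = real l"
      have v: "1 \<le> v" using False by (simp add: v_def)
      define a b where "a = 1 + s / v\<^sup>2" and "b = 1 + s / (1 + v)\<^sup>2"
      have ab: "0 < a" "0 < b" using s by (auto simp: a_def b_def intro!: add_pos_nonneg)
      have "ln (b / a) \<le> b / a - 1" using ab by (intro ln_le_minus_one) auto
      then have "1 - b / a \<le> ln a - ln b" using ab by (simp add: ln_div)
      moreover have "1 - b / a = s * (2 * v + 1) / ((1 + v)\<^sup>2 * (v\<^sup>2 + s))"
      proof -
        have nz: "v\<^sup>2 \<noteq> 0" "(1 + v)\<^sup>2 \<noteq> 0" "v\<^sup>2 + s \<noteq> 0" using v s by (auto simp: add_nonneg_eq_0_iff)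
        have "a = (v\<^sup>2 + s) / v\<^sup>2" using nz by (simp add: a_def field_simps)
        moreover have "b = ((1 + v)\<^sup>2 + s) / (1 + v)\<^sup>2" using nz by (simp add: b_def field_simps)
        ultimately have "b / a = ((1 + v)\<^sup>2 + s) * v\<^sup>2 / ((1 + v)\<^sup>2 * (v\<^sup>2 + s))" by simp
        then have "1 - b / a = ((1 + v)\<^sup>2 * (v\<^sup>2 + s) - ((1 + v)\<^sup>2 + s) * v\<^sup>2) / ((1 + v)\<^sup>2 * (v\<^sup>2 + s))"
          using nz by (simp add: diff_divide_distrib)
        also have "(1 + v)\<^sup>2 * (v\<^sup>2 + s) - ((1 + v)\<^sup>2 + s) * v\<^sup>2 = s * (2 * v + 1)"
          by (simp add: power2_eq_square algebra_simps)
        finally show ?thesis .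
      qed
      ultimately have d: "s * (2 * v + 1) / ((1 + v)\<^sup>2 * (v\<^sup>2 + s)) \<le> ln a - ln b" by simp
      have "1 / ((1 + v) * ((1 + v)\<^sup>2 + s)) \<le> 1 / ((1 + v) * (v\<^sup>2 + s))"
        using v s by (intro divide_left_mono mult_left_mono mult_pos_pos) (auto intro!: add_nonneg_pos power_mono)
      also have "\<dots> = (1 + v) / ((1 + v)\<^sup>2 * (v\<^sup>2 + s))" using v by (simp add: power2_eq_square)
      also have "\<dots> \<le> (2 * v + 1) / ((1 + v)\<^sup>2 * (v\<^sup>2 + s))" using v s by (intro divide_right_mono) auto
      also have "\<dots> = (s * (2 * v + 1) / ((1 + v)\<^sup>2 * (v\<^sup>2 + s))) / s" using s by simp
      also have "\<dots> \<le> (ln a - ln b) / s" using d s by (intro divide_right_mono) auto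
      also have "\<dots> = H l - H (Suc l)" using False by (simp add: H_def h_def a_def b_def v_def diff_divide_distrib)
      finally show ?thesis by (simp add: v_def)
    qed
  qed (use s in simp)
  then show ?thesis by (simp add: H_def)
qed

lemma filter_bound:
  fixes p x t b :: real
  assumes p: "2 \<le> p" and x: "0 < x" and t: "0 < t" and b: "(t / x) powr (2 * p) \<le> b"
  shows "1 / (1 + b) \<le> 4 * x ^ 4 / (x\<^sup>2 + t\<^sup>2)\<^sup>2"
proof (cases "t \<le> x")
  case True
  have "0 \<le> b" using b by (meson order_trans powr_ge_zero)
  then have "1 / (1 + b) \<le> 1" by simp
  also have "(x\<^sup>2 + t\<^sup>2)\<^sup>2 \<le> (2 * x\<^sup>2)\<^sup>2" using True t by (intro power_mono) (auto intro: power_mono)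
  then have "1 \<le> 4 * x ^ 4 / (x\<^sup>2 + t\<^sup>2)\<^sup>2" using x t by (subst le_divide_eq_1_pos) (auto simp: power_mult_distrib intro!: zero_less_power add_pos_pos)
  finally show ?thesis .
next
  case False
  have "(t / x) ^ 4 = (t / x) powr 4" by (rule powr_numeral[symmetric]) (use x t in simp)
  also have "\<dots> \<le> (t / x) powr (2 * p)" using False x p by (intro powr_mono) auto
  finally have tb: "(t / x) ^ 4 \<le> b" using b by linarith
  have tx: "0 < (t / x) ^ 4" using t x by simp
  have "0 < 1 + b" using tb tx by linarith
  then have "1 / (1 + b) \<le> 1 / (t / x) ^ 4" using tb tx
    by (intro divide_left_mono mult_pos_pos) linarith+
  also have "\<dots> = 4 * x ^ 4 / (2 * t\<^sup>2)\<^sup>2" using t x by (simp add: power_divide power_mult_distrib)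
  also have "\<dots> \<le> 4 * x ^ 4 / (x\<^sup>2 + t\<^sup>2)\<^sup>2"
  proof (intro divide_left_mono power_mono)
    show "x\<^sup>2 + t\<^sup>2 \<le> 2 * t\<^sup>2" using False x by (simp add: power_mono)
  qed (use t x in \<open>auto intro!: mult_pos_pos zero_less_power add_pos_pos\<close>)
  finally show ?thesis .
qed

text \<open>The effective dimension at scale \<open>s\<close>, up to a constant: the number of pairs of degrees below a hyperbola, weighted by multiplicity.\<close>

definition eff_dim :: "real \<Rightarrow> real" where "eff_dim s = s * (1 + ln (1 + s))"

lemma eff_dim_mono: "0 \<le> s \<Longrightarrow> s \<le> t \<Longrightarrow> eff_dim s \<le> eff_dim t"
  unfolding eff_dim_def by (intro mult_mono add_mono) (auto intro!: add_nonneg_nonneg)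

lemma scale_eq:
  fixes a p t :: real
  assumes "0 < a" "0 < p" "0 < t"
  shows "(t / (a powr (- 1 / (2 * p)))) powr (2 * p) = a * t powr (2 * p)"
proof -
  have "(t / (a powr (- 1 / (2 * p)))) powr (2 * p) = t powr (2 * p) / (a powr (- 1 / (2 * p))) powr (2 * p)"
    using assms by (simp add: powr_divide)
  also have "(a powr (- 1 / (2 * p))) powr (2 * p) = a powr (-1)" using assms by (simp add: powr_powr)
  also have "a powr (-1) = 1 / a" using assms by (simp add: powr_neg_one)
  finally show ?thesis using assms by simp
qed

lemma degree_weight_le: "(2 * real l + 1) / (4 * pi) \<le> (1 + real l) / 4"
proof -
  have "(1 + real l) * 2 \<le> (1 + real l) * pi" by (rule mult_left_mono[OF pi_ge_two]) simp
  moreover have "2 * real l + 1 \<le> (1 + real l) * 2" by simp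
  ultimately have "2 * real l + 1 \<le> (1 + real l) * pi" by (rule order_trans[rotated])
  then have "(2 * real l + 1) / (4 * pi) \<le> ((1 + real l) * pi) / (4 * pi)" by (rule divide_right_mono) simp
  then show ?thesis by simp
qed

text \<open>The spectral filter \<open>1 / (1 + t powr (2 * p))\<close> is dominated by the rational function of \<open>filter_bound\<close>, whose sum over the
degrees telescopes. The bound with the logarithm is used also here, so that both regressions share it.\<close>

lemma effective_dimension:
  assumes p: "2 \<le> p" and c: "0 < c" and \<omega>: "\<And>l. c * (1 + real l) powr (2 * p) \<le> \<omega> l" and \<eta>: "0 < \<eta>" and u: "u \<in> S2"
  shows "(\<Sum>k. ennreal ((harmonic k u)\<^sup>2 / (1 + \<eta> * \<omega> (deg k)))) \<le> ennreal (eff_dim (((\<eta> * c) powr (- 1 / (2 * p)))\<^sup>2))"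
proof -
  define x where "x = (\<eta> * c) powr (- 1 / (2 * p))"
  have a: "0 < \<eta> * c" using \<eta> c by simp
  have x: "0 < x" unfolding x_def using a \<eta> c by simp
  have \<omega>0: "0 \<le> \<omega> l" for l using growth_lower(2)[of p c \<omega> l] p c \<omega> by auto
  have g0: "0 \<le> 1 / (1 + \<eta> * \<omega> l)" for l using \<omega>0[of l] \<eta> by simp
  have b: "1 / (1 + \<eta> * \<omega> l) \<le> 4 * x ^ 4 / (x\<^sup>2 + (1 + real l)\<^sup>2)\<^sup>2" for l
  proof (rule filter_bound[OF p x])
    have "((1 + real l) / x) powr (2 * p) = (\<eta> * c) * (1 + real l) powr (2 * p)"
      unfolding x_def by (rule scale_eq[OF a]) (use p in auto)
    also have "\<dots> \<le> \<eta> * \<omega> l" using mult_left_mono[OF \<omega>[of l], of \<eta>] \<eta> by (simp add: mult.assoc)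
    finally show "((1 + real l) / x) powr (2 * p) \<le> \<eta> * \<omega> l" .
  qed simp
  have "(\<Sum>k. ennreal ((harmonic k u)\<^sup>2 / (1 + \<eta> * \<omega> (deg k)))) = (\<Sum>l. ennreal ((2 * real l + 1) / (4 * pi) * (1 / (1 + \<eta> * \<omega> l))))"
    using kernel_sum[OF u, of "\<lambda>l. 1 / (1 + \<eta> * \<omega> l)", OF g0] by simp
  also have "\<dots> \<le> (\<Sum>l. ennreal (2 * x ^ 4) * ennreal ((1 + real l) / (x\<^sup>2 + (1 + real l)\<^sup>2)\<^sup>2))"
  proof (intro suminf_le allI)
    fix l
    have "(2 * real l + 1) / (4 * pi) \<le> (1 + real l) / 2" by (rule order_trans[OF degree_weight_le]) simp
    then have "(2 * real l + 1) / (4 * pi) * (1 / (1 + \<eta> * \<omega> l)) \<le> (1 + real l) / 2 * (4 * x ^ 4 / (x\<^sup>2 + (1 + real l)\<^sup>2)\<^sup>2)"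
      using g0 b by (intro mult_mono) auto
    also have "\<dots> = (2 * x ^ 4) * ((1 + real l) / (x\<^sup>2 + (1 + real l)\<^sup>2)\<^sup>2)" by simp
    finally have "ennreal ((2 * real l + 1) / (4 * pi) * (1 / (1 + \<eta> * \<omega> l))) \<le> ennreal ((2 * x ^ 4) * ((1 + real l) / (x\<^sup>2 + (1 + real l)\<^sup>2)\<^sup>2))"
      by (rule ennreal_leI)
    also have "\<dots> = ennreal (2 * x ^ 4) * ennreal ((1 + real l) / (x\<^sup>2 + (1 + real l)\<^sup>2)\<^sup>2)" by (rule ennreal_mult) auto
    finally show "ennreal ((2 * real l + 1) / (4 * pi) * (1 / (1 + \<eta> * \<omega> l))) \<le> ennreal (2 * x ^ 4) * ennreal ((1 + real l) / (x\<^sup>2 + (1 + real l)\<^sup>2)\<^sup>2)" .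
  qed auto
  also have "\<dots> \<le> ennreal (2 * x ^ 4) * ennreal (1 / (2 * x\<^sup>2))"
    unfolding ennreal_suminf_cmult using x by (intro mult_left_mono sum_cauchy_kernel) auto
  also have "\<dots> = ennreal (2 * x ^ 4 * (1 / (2 * x\<^sup>2)))" by (rule ennreal_mult[symmetric]) auto
  also have "2 * x ^ 4 * (1 / (2 * x\<^sup>2)) = x\<^sup>2 * 1" using x by (simp add: power2_eq_square power4_eq_xxxx)
  also have "ennreal (x\<^sup>2 * 1) \<le> ennreal (eff_dim (x\<^sup>2))"
    unfolding eff_dim_def by (intro ennreal_leI mult_left_mono) auto
  finally show ?thesis unfolding x_def .
qed

text \<open>The penalty acts through the product \<open>(1 + l) * (1 + l')\<close>, so the dimension counts pairs below the
hyperbola where this product equals \<open>x\<close>. Summing over one degree with the Cauchy kernel leaves the sum of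
\<open>sum_hyperbola\<close> over the other.\<close>

lemma effective_dimension2:
  assumes p: "2 \<le> p" and c: "0 < c" and \<omega>: "\<And>l. c * (1 + real l) powr (2 * p) \<le> \<omega> l" and \<eta>: "0 < \<eta>" and z: "z \<in> S2 \<times> S2"
  shows "(\<Sum>k. ennreal ((harmonic2 k z)\<^sup>2 / (1 + \<eta> * (\<omega> (deg (fst2 k)) * \<omega> (deg (snd2 k)))))) \<le> ennreal (eff_dim (((\<eta> * c\<^sup>2) powr (- 1 / (2 * p)))\<^sup>2))"
proof -
  obtain u v where uv: "z = (u, v)" "u \<in> S2" "v \<in> S2" using z by auto
  define x where "x = (\<eta> * c\<^sup>2) powr (- 1 / (2 * p))"
  have a: "0 < \<eta> * c\<^sup>2" using \<eta> c by simp
  have x: "0 < x" unfolding x_def using a \<eta> c by simp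
  have \<omega>0: "0 \<le> \<omega> l" for l using growth_lower(2)[of p c \<omega> l] p c \<omega> by auto
  define g where "g l l' = 1 / (1 + \<eta> * (\<omega> l * \<omega> l'))" for l l'
  have g0: "0 \<le> g l l'" for l l' using \<omega>0[of l] \<omega>0[of l'] \<eta> by (simp add: g_def)
  have b: "g l l' \<le> 4 * x ^ 4 / (x\<^sup>2 + ((1 + real l) * (1 + real l'))\<^sup>2)\<^sup>2" for l l'
    unfolding g_def
  proof (rule filter_bound[OF p x])
    have "((1 + real l) * (1 + real l') / x) powr (2 * p) = (\<eta> * c\<^sup>2) * ((1 + real l) * (1 + real l')) powr (2 * p)"
      unfolding x_def by (rule scale_eq[OF a]) (use p in auto)
    also have "\<dots> = \<eta> * ((c * (1 + real l) powr (2 * p)) * (c * (1 + real l') powr (2 * p)))"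
      by (simp add: powr_mult power2_eq_square)
    also have "\<dots> \<le> \<eta> * (\<omega> l * \<omega> l')" using \<eta> c \<omega> \<omega>0 by (intro mult_left_mono mult_mono) auto
    finally show "((1 + real l) * (1 + real l') / x) powr (2 * p) \<le> \<eta> * (\<omega> l * \<omega> l')" .
  qed simp
  note w = degree_weight_le
  have "(\<Sum>k. ennreal ((harmonic2 k z)\<^sup>2 / (1 + \<eta> * (\<omega> (deg (fst2 k)) * \<omega> (deg (snd2 k)))))) =
    (\<Sum>l. \<Sum>l'. ennreal ((2 * real l + 1) / (4 * pi) * ((2 * real l' + 1) / (4 * pi)) * g l l'))"
    using kernel_sum2[OF uv(2,3), of g, OF g0] by (simp add: uv(1) g_def)
  also have "\<dots> \<le> (\<Sum>l. ennreal (x ^ 4 / 2) * ennreal (1 / ((1 + real l) * ((1 + real l)\<^sup>2 + x\<^sup>2))))"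
  proof (intro suminf_le allI)
    fix l
    define v where "v = 1 + real l"
    have v: "1 \<le> v" by (simp add: v_def)
    define s where "s = x\<^sup>2 / v\<^sup>2"
    have s: "0 < s" using x v by (simp add: s_def)
    have "(\<Sum>l'. ennreal ((2 * real l + 1) / (4 * pi) * ((2 * real l' + 1) / (4 * pi)) * g l l'))
      \<le> (\<Sum>l'. ennreal (x ^ 4 / 4 / v ^ 3) * ennreal ((1 + real l') / (s + (1 + real l')\<^sup>2)\<^sup>2))"
    proof (intro suminf_le allI)
      fix l'
      define t where "t = 1 + real l'"
      have t: "1 \<le> t" by (simp add: t_def)
      have "(2 * real l + 1) / (4 * pi) * ((2 * real l' + 1) / (4 * pi)) * g l l' \<le> v / 4 * (t / 4) * (4 * x ^ 4 / (x\<^sup>2 + (v * t)\<^sup>2)\<^sup>2)"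
        unfolding v_def t_def using w b g0 by (intro mult_mono) auto
      also have "x\<^sup>2 + (v * t)\<^sup>2 = v\<^sup>2 * (s + t\<^sup>2)" using v by (simp add: s_def power_mult_distrib field_simps)
      also have "v / 4 * (t / 4) * (4 * x ^ 4 / (v\<^sup>2 * (s + t\<^sup>2))\<^sup>2) = x ^ 4 / 4 / v ^ 3 * (t / (s + t\<^sup>2)\<^sup>2)"
        using v by (simp add: power_mult_distrib power2_eq_square power3_eq_cube mult_ac)
      finally have "ennreal ((2 * real l + 1) / (4 * pi) * ((2 * real l' + 1) / (4 * pi)) * g l l') \<le> ennreal (x ^ 4 / 4 / v ^ 3 * (t / (s + t\<^sup>2)\<^sup>2))"
        by (rule ennreal_leI)
      also have "\<dots> = ennreal (x ^ 4 / 4 / v ^ 3) * ennreal (t / (s + t\<^sup>2)\<^sup>2)" using v t by (intro ennreal_mult) auto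
      finally show "ennreal ((2 * real l + 1) / (4 * pi) * ((2 * real l' + 1) / (4 * pi)) * g l l') \<le> ennreal (x ^ 4 / 4 / v ^ 3) * ennreal ((1 + real l') / (s + (1 + real l')\<^sup>2)\<^sup>2)"
        by (simp add: t_def)
    qed auto
    also have "\<dots> \<le> ennreal (x ^ 4 / 4 / v ^ 3) * ennreal (2 / (1 + s))"
      unfolding ennreal_suminf_cmult by (intro mult_left_mono sum_cauchy_kernel_strong s) auto
    also have "\<dots> = ennreal (x ^ 4 / 4 / v ^ 3 * (2 / (1 + s)))" using v s by (intro ennreal_mult[symmetric]) auto
    also have "x ^ 4 / 4 / v ^ 3 * (2 / (1 + s)) = x ^ 4 / 2 * (1 / (v * (v\<^sup>2 + x\<^sup>2)))"
    proof -
      have "1 + s = (v\<^sup>2 + x\<^sup>2) / v\<^sup>2" using v by (simp add: s_def field_simps)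
      then have "2 / (1 + s) = 2 * v\<^sup>2 / (v\<^sup>2 + x\<^sup>2)" by simp
      have "v\<^sup>2 / v ^ 3 = 1 / v" using v by (simp add: power2_eq_square power3_eq_cube)
      have "x ^ 4 / 4 / v ^ 3 * (2 / (1 + s)) = x ^ 4 / 4 / v ^ 3 * (2 * v\<^sup>2 / (v\<^sup>2 + x\<^sup>2))"
        unfolding \<open>2 / (1 + s) = 2 * v\<^sup>2 / (v\<^sup>2 + x\<^sup>2)\<close> ..
      also have "\<dots> = x ^ 4 / 2 * (v\<^sup>2 / v ^ 3) * (1 / (v\<^sup>2 + x\<^sup>2))" by simp
      also have "\<dots> = x ^ 4 / 2 * (1 / (v * (v\<^sup>2 + x\<^sup>2)))"
        unfolding \<open>v\<^sup>2 / v ^ 3 = 1 / v\<close> by simp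
      finally show ?thesis .
    qed
    also have "ennreal (x ^ 4 / 2 * (1 / (v * (v\<^sup>2 + x\<^sup>2)))) = ennreal (x ^ 4 / 2) * ennreal (1 / (v * (v\<^sup>2 + x\<^sup>2)))"
      using v by (intro ennreal_mult) auto
    finally show "(\<Sum>l'. ennreal ((2 * real l + 1) / (4 * pi) * ((2 * real l' + 1) / (4 * pi)) * g l l')) \<le> ennreal (x ^ 4 / 2) * ennreal (1 / ((1 + real l) * ((1 + real l)\<^sup>2 + x\<^sup>2)))"
      by (simp add: v_def)
  qed auto
  also have "\<dots> \<le> ennreal (x ^ 4 / 2) * ennreal ((1 + ln (1 + x\<^sup>2)) / x\<^sup>2)"
    unfolding ennreal_suminf_cmult using x by (intro mult_left_mono sum_hyperbola) auto
  also have "\<dots> = ennreal (x ^ 4 / 2 * ((1 + ln (1 + x\<^sup>2)) / x\<^sup>2))"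
    using x by (intro ennreal_mult[symmetric]) (auto intro!: divide_nonneg_nonneg add_nonneg_nonneg ln_ge_zero)
  also have "x ^ 4 / 2 * ((1 + ln (1 + x\<^sup>2)) / x\<^sup>2) = eff_dim (x\<^sup>2) / 2"
    using x by (simp add: eff_dim_def power2_eq_square power4_eq_xxxx)
  also have "ennreal (eff_dim (x\<^sup>2) / 2) \<le> ennreal (eff_dim (x\<^sup>2))"
    by (intro ennreal_leI) (simp add: eff_dim_def ln_ge_zero)
  finally show ?thesis unfolding x_def .
qed

section \<open>From the two regressions to the covariance\<close>

lemma arg_min_attained:
  fixes F :: "'a \<Rightarrow> real"
  assumes "\<exists>g. Pr g \<and> (\<forall>h. Pr h \<longrightarrow> F g \<le> F h)"
  shows "Pr (arg_min F Pr)" "Pr h \<Longrightarrow> F (arg_min F Pr) \<le> F h"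
proof -
  have "\<exists>g. is_arg_min F Pr g" using assms by (auto simp: is_arg_min_def not_less)
  then have "is_arg_min F Pr (arg_min F Pr)" unfolding arg_min_def by (rule someI_ex)
  then show "Pr (arg_min F Pr)" "Pr h \<Longrightarrow> F (arg_min F Pr) \<le> F h" by (auto simp: is_arg_min_def not_less)
qed

lemma L2_normsq_add_le:
  assumes "f \<in> L2 M" "g \<in> L2 M"
  shows "L2_normsq M (\<lambda>x. f x + g x) \<le> 2 * L2_normsq M f + 2 * L2_normsq M g"
  using L2_normsq_split[OF _ assms(1), of "\<lambda>x. f x + g x" 1] L2_add(2)[OF assms, of 1 1] by simp

lemma tensor_normsq:
  "continuous_on S2 f \<Longrightarrow> continuous_on S2 g \<Longrightarrow> L2_normsq surface2 (tensor f g) = L2_normsq surface f * L2_normsq surface g"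
  unfolding L2_normsq_def by (rule inner_tensor)

lemma L2_normsq_nonneg: "0 \<le> L2_normsq M f"
  by (simp add: L2_normsq_def L2_inner_def)

text \<open>With \<open>d = f - m\<close>, \<open>f \<otimes> f - m \<otimes> m = d \<otimes> f + m \<otimes> d\<close>; tensor norms factor, and \<open>\<Delta> \<le> 1\<close> keeps \<open>f\<close> bounded.\<close>

lemma covariance_error:
  assumes f: "continuous_on S2 f" and m: "continuous_on S2 m"
    and s: "continuous_on (S2 \<times> S2) s" and c: "continuous_on (S2 \<times> S2) c"
    and \<delta>: "L2_normsq surface (\<lambda>u. f u - m u) \<le> \<Delta>" "\<Delta> \<le> 1"
    and \<delta>2: "L2_normsq surface2 (\<lambda>x. s x - c x) \<le> \<Delta>" and K: "L2_normsq surface m \<le> K"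
  shows "L2_normsq surface2 (\<lambda>y. (s y - tensor f f y) - (c y - tensor m m y)) \<le> (12 * K + 10) * \<Delta>"
proof -
  define d where "d = (\<lambda>u. f u - m u)"
  have d: "continuous_on S2 d" unfolding d_def by (intro continuous_intros f m)
  note n0 = L2_normsq_nonneg
  have \<Delta>0: "0 \<le> \<Delta>" using order_trans[OF n0 \<delta>(1)] .
  have K0: "0 \<le> K" using order_trans[OF n0 K] .
  have "L2_normsq surface f \<le> 2 * L2_normsq surface m + 2 * L2_normsq surface d"
    using L2_normsq_split[OF L2_cont(1)[OF f] L2_cont(1)[OF m], of 1] by (simp add: d_def)
  then have nf: "L2_normsq surface f \<le> 2 * K + 2" using K \<delta> by (simp add: d_def)
  have nd: "L2_normsq surface d \<le> \<Delta>" using \<delta>(1) by (simp add: d_def)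
  have Lt: "tensor d f \<in> L2 surface2" "tensor m d \<in> L2 surface2" "(\<lambda>x. s x - c x) \<in> L2 surface2"
    "(\<lambda>x. - tensor d f x + - tensor m d x) \<in> L2 surface2"
    by (intro L2_cont continuous_intros d f m s c)+
  have neg: "L2_normsq surface2 (\<lambda>x. - h x) = L2_normsq surface2 h" for h
    by (simp add: L2_normsq_def L2_inner_def)
  have "L2_normsq surface2 (\<lambda>y. (s y - tensor f f y) - (c y - tensor m m y)) = L2_normsq surface2 (\<lambda>y. (s y - c y) + (- tensor d f y + - tensor m d y))"
    by (intro arg_cong[where f = "L2_normsq surface2"] ext) (auto simp: tensor_def d_def algebra_simps)
  also have "\<dots> \<le> 2 * L2_normsq surface2 (\<lambda>y. s y - c y) + 2 * L2_normsq surface2 (\<lambda>y. - tensor d f y + - tensor m d y)"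
    by (rule L2_normsq_add_le[OF Lt(3,4)])
  also have "(\<lambda>y. - tensor d f y + - tensor m d y) = (\<lambda>y. - (tensor d f y + tensor m d y))" by auto
  also have "L2_normsq surface2 (\<lambda>y. - (tensor d f y + tensor m d y)) \<le> 2 * L2_normsq surface2 (tensor d f) + 2 * L2_normsq surface2 (tensor m d)"
    unfolding neg by (rule L2_normsq_add_le[OF Lt(1,2)])
  also have "2 * L2_normsq surface2 (tensor d f) + 2 * L2_normsq surface2 (tensor m d) \<le> 2 * (\<Delta> * (2 * K + 2)) + 2 * (K * \<Delta>)"
    unfolding tensor_normsq[OF d f] tensor_normsq[OF m d]
    using nd nf K K0 \<Delta>0 n0 by (intro add_mono mult_left_mono mult_mono) auto
  finally show ?thesis using \<delta>2 by (simp add: algebra_simps)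
qed

lemma normsq_real_bound:
  assumes "\<And>k. 0 \<le> f k" "(\<Sum>k. ennreal (f k)) \<le> ennreal K" "0 \<le> K" "\<And>k. 0 \<le> g k" "\<And>k. g k \<le> C * f k" "0 \<le> C"
  shows "summable g" "suminf g \<le> C * K"
proof -
  note s = summable_of_ennreal_bound[OF assms(1-3)]
  show sg: "summable g" by (rule summable_comparison_test'[OF summable_mult[OF s(1), of C]]) (use assms in simp)
  have "suminf g \<le> (\<Sum>k. C * f k)" by (rule suminf_le[OF assms(5) sg summable_mult[OF s(1)]])
  also have "\<dots> = C * suminf f" by (rule suminf_mult[OF s(1)])
  also have "\<dots> \<le> C * K" by (rule mult_left_mono[OF s(2) assms(6)])
  finally show "suminf g \<le> C * K" .
qed

text \<open>An admissible operator with its symbol and its tensor square; the penalties are then squared norms of kernel spaces.\<close>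

locale penalty =
  fixes p C1 C2 :: real and d :: "nat \<Rightarrow> real"
    and T :: "(real^3 \<Rightarrow> real) \<Rightarrow> (real^3 \<Rightarrow> real)"
    and T2 :: "((real^3) \<times> (real^3) \<Rightarrow> real) \<Rightarrow> ((real^3) \<times> (real^3) \<Rightarrow> real)"
  assumes p: "2 < p" and C: "0 < C1" "0 < C2"
    and d: "\<And>l. C1 * (1 + real l) powr p \<le> \<bar>d l\<bar>" "\<And>l. \<bar>d l\<bar> \<le> C2 * (1 + real l) powr p"
    and T: "multiplier_operator p d T" and T2: "tensor_square_operator p T T2"
begin

definition \<omega> where "\<omega> l = (d l)\<^sup>2"

lemma \<omega>_lower: "C1\<^sup>2 * (1 + real l) powr (2 * p) \<le> \<omega> l"
  and \<omega>_upper: "\<omega> l \<le> C2\<^sup>2 * (1 + real l) powr (2 * p)"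
proof -
  have e: "(x * (1 + real l) powr p)\<^sup>2 = x\<^sup>2 * (1 + real l) powr (2 * p)" for x
    by (simp add: power_mult_distrib power2_eq_square powr_add[symmetric])
  have a: "0 \<le> C1 * (1 + real l) powr p" using C by simp
  show "C1\<^sup>2 * (1 + real l) powr (2 * p) \<le> \<omega> l"
    using power_mono[OF d(1) a, of 2] unfolding e \<omega>_def by simp
  show "\<omega> l \<le> C2\<^sup>2 * (1 + real l) powr (2 * p)"
    using power_mono[OF d(2) abs_ge_zero, of l 2] unfolding e \<omega>_def by simp
qed

lemma kernels: "\<exists>Bp. kernel_space surface S2 harmonic (\<lambda>k. \<omega> (deg k)) (C1\<^sup>2) Bp \<and>
    kernel_space surface2 (S2 \<times> S2) harmonic2 (\<lambda>k. \<omega> (deg (fst2 k)) * \<omega> (deg (snd2 k))) ((C1\<^sup>2)\<^sup>2) (Bp\<^sup>2)"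
  by (rule sphere_kernel[of p "C1\<^sup>2" \<omega>]) (use p C \<omega>_lower in auto)

definition Bp where "Bp = (SOME Bp. kernel_space surface S2 harmonic (\<lambda>k. \<omega> (deg k)) (C1\<^sup>2) Bp \<and>
    kernel_space surface2 (S2 \<times> S2) harmonic2 (\<lambda>k. \<omega> (deg (fst2 k)) * \<omega> (deg (snd2 k))) ((C1\<^sup>2)\<^sup>2) (Bp\<^sup>2))"

lemma K1: "kernel_space surface S2 harmonic (\<lambda>k. \<omega> (deg k)) (C1\<^sup>2) Bp"
  and K2: "kernel_space surface2 (S2 \<times> S2) harmonic2 (\<lambda>k. \<omega> (deg (fst2 k)) * \<omega> (deg (snd2 k))) ((C1\<^sup>2)\<^sup>2) (Bp\<^sup>2)"
  using someI_ex[OF kernels] unfolding Bp_def by blast+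

sublocale k1: kernel_space surface S2 harmonic "\<lambda>k. \<omega> (deg k)" "C1\<^sup>2" Bp by (rule K1)
sublocale k2: kernel_space surface2 "S2 \<times> S2" harmonic2 "\<lambda>k. \<omega> (deg (fst2 k)) * \<omega> (deg (snd2 k))" "(C1\<^sup>2)\<^sup>2" "Bp\<^sup>2" by (rule K2)

lemma sobolev_Hs: "sobolev p = k1.Hs" "sobolev2 p = k2.Hs"
  using sobolev_eq_Hs[of p "C1\<^sup>2" "C2\<^sup>2" \<omega>] p C \<omega>_lower \<omega>_upper by auto

lemma penalty_J1: "g \<in> sobolev p \<Longrightarrow> L2_normsq surface (T g) = k1.J g"
  unfolding k1.J_def unfolding \<omega>_def
  by (rule multiplier_normsq[OF T]) (auto simp: sobolev_Hs dest: k1.HsD(3) simp flip: \<omega>_def)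

lemma penalty_J2: "g \<in> sobolev2 p \<Longrightarrow> L2_normsq surface2 (T2 g) = k2.J g"
  unfolding k2.J_def unfolding \<omega>_def
  by (rule tensor_multiplier_normsq[OF T T2]) (auto simp: sobolev_Hs dest: k2.HsD(3) simp flip: \<omega>_def)

text \<open>The ratio of the penalty to the Sobolev weight, which turns the Sobolev bounds of the class into bounds on the penalty.\<close>

definition Cw where "Cw = C2\<^sup>2 / (1/2) powr p"

lemma Cw: "0 < Cw" "\<omega> l \<le> Cw * sobolev_weight p l"
proof -
  show "0 < Cw" using C by (simp add: Cw_def)
  then have "Cw * ((1/2) powr p * (1 + real l) powr (2 * p)) \<le> Cw * sobolev_weight p l"
    using sobolev_weight_bounds(1)[of p l] p by (intro mult_left_mono) auto
  then show "\<omega> l \<le> Cw * sobolev_weight p l" using \<omega>_upper[of l] by (simp add: Cw_def)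
qed

lemma weight_ge_1: "1 \<le> sobolev_weight p l"
  unfolding sobolev_weight_def using p by (intro ge_one_powr_ge_zero) auto

lemma J1_bound:
  assumes "g \<in> sobolev p" "sobolev_normsq p g \<le> ennreal K" "0 \<le> K"
  shows "k1.J g \<le> Cw * K" "L2_normsq surface g \<le> K"
proof -
  have w0: "0 \<le> sobolev_weight p l" for l using weight_ge_1[of l] by linarith
  note b = normsq_real_bound[OF _ assms(2)[unfolded sobolev_normsq_idx] assms(3)]
  show "k1.J g \<le> Cw * K" unfolding k1.J_def
    by (rule b(2)) (use Cw w0 k1.\<rho>_pos mult_right_mono[OF Cw(2) zero_le_power2] in \<open>auto simp: less_imp_le mult.assoc\<close>)
  have "(\<Sum>k. (sph.coef g k)\<^sup>2) \<le> 1 * K"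
    by (rule b(2)) (use w0 mult_right_mono[OF weight_ge_1 zero_le_power2] in \<open>auto\<close>)
  then show "L2_normsq surface g \<le> K" using k1.parseval[of g] assms(1) by (simp add: sobolev_Hs sums_iff)
qed

lemma J2_bound:
  assumes "g \<in> sobolev2 p" "sobolev2_normsq p g \<le> ennreal K" "0 \<le> K"
  shows "k2.J g \<le> Cw\<^sup>2 * K"
proof -
  have w0: "0 \<le> sobolev_weight p l" for l using weight_ge_1[of l] by linarith
  have o0: "0 \<le> \<omega> l" for l by (simp add: \<omega>_def)
  have "\<omega> l * \<omega> l' \<le> Cw\<^sup>2 * (sobolev_weight p l * sobolev_weight p l')" for l l'
    using mult_mono[OF Cw(2)[of l] Cw(2)[of l']] o0 w0 Cw(1) by (simp add: power2_eq_square mult_ac)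
  from mult_right_mono[OF this zero_le_power2]
  show ?thesis unfolding k2.J_def
    by (intro normsq_real_bound(2)[OF _ assms(2)[unfolded sobolev2_normsq_idx] assms(3)]) (use w0 o0 in \<open>auto simp: mult.assoc\<close>)
qed

end

locale penalised_sampling = sampling q P \<nu> n r L + penalty p C1 C2 d T T2
  for q P \<nu> n r L p C1 C2 d T T2 +
  fixes K1b K2b \<eta> :: real
  assumes K: "0 \<le> K1b" "0 \<le> K2b" and \<eta>: "0 < \<eta>"
    and sm: "second_moment_fun P \<in> sobolev2 p" "sobolev2_normsq p (second_moment_fun P) \<le> ennreal K1b"
    and mean: "mean_fun P \<in> sobolev p" "sobolev_normsq p (mean_fun P) \<le> ennreal K2b"
begin

definition Rb where "Rb = Bp * (Cw * K2b) + Bp\<^sup>2 * (Cw\<^sup>2 * K1b)"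

lemma Rb: "0 \<le> Rb" "u \<in> S2 \<Longrightarrow> (mean_fun P u)\<^sup>2 \<le> Rb" "x \<in> S2 \<times> S2 \<Longrightarrow> (second_moment_fun P x)\<^sup>2 \<le> Rb"
proof -
  have a: "0 \<le> Bp * (Cw * K2b)" "0 \<le> Bp\<^sup>2 * (Cw\<^sup>2 * K1b)" using k1.B Cw(1) K by auto
  then show "0 \<le> Rb" by (simp add: Rb_def)
  show "(mean_fun P u)\<^sup>2 \<le> Rb" if "u \<in> S2"
    using k1.point_bound[of "mean_fun P" u] mult_left_mono[OF J1_bound(1)[OF mean K(2)] k1.B] mean(1) that a
    by (simp add: sobolev_Hs Rb_def)
  show "(second_moment_fun P x)\<^sup>2 \<le> Rb" if "x \<in> S2 \<times> S2"
    using k2.point_bound[of "second_moment_fun P" x] mult_left_mono[OF J2_bound[OF sm K(1)] k2.B] sm(1) that a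
    by (simp add: sobolev_Hs Rb_def)
qed

sublocale MD: regression_design surface S2 harmonic "\<lambda>k. \<omega> (deg k)" "C1\<^sup>2" Bp MX MY Ob
    "\<lambda>a. 4 * pi / (real n * real (r (fst a)))" "(\<noteq>)"
    "\<lambda>a Y. fst Y a" "\<lambda>a X Y. obs X Y a" "mean_fun P"
    "\<lambda>k X. (\<Sum>i<n. sph.coef (X i) k - (LINT f|P. sph.coef f k)) / real n" "4 * pi" "(4 * pi)\<^sup>2 * R1" "Cy Rb" "(1 + L) / real n"
  by (rule mean_design[OF K1 mean(1)[unfolded sobolev_Hs] Rb(1,2)])

sublocale SD: regression_design surface2 "S2 \<times> S2" harmonic2 "\<lambda>k. \<omega> (deg (fst2 k)) * \<omega> (deg (snd2 k))" "(C1\<^sup>2)\<^sup>2" "Bp\<^sup>2" MX MY I2 w2 disjoint_pairs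
    "\<lambda>a Y. (fst Y (pt1 a), fst Y (pt2 a))" "\<lambda>a X Y. obs X Y (pt1 a) * obs X Y (pt2 a)" "second_moment_fun P"
    "\<lambda>k X. (\<Sum>i<n. sph.coef (X i) (fst2 k) * sph.coef (X i) (snd2 k) - (LINT f|P. sph.coef f (fst2 k) * sph.coef f (snd2 k))) / real n"
    "(4 * pi)\<^sup>2" "4 * ((4 * pi)\<^sup>2)\<^sup>2 * R1" "Cy Rb" "(1 + L) / real n"
  by (rule second_moment_design[OF K2 sm(1)[unfolded sobolev_Hs] Rb(1,3)])

lemma mean_criterion:
  "4 * pi / real n * (\<Sum>i<n. 1 / real (r i) * (\<Sum>j<r i. (observation z i j - g (location z i j))\<^sup>2))
     = (\<Sum>a\<in>Ob. 4 * pi / (real n * real (r (fst a))) * (obs (fst z) (snd z) a - g (fst (snd z) a))\<^sup>2)"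
  unfolding sum_obs observation_def location_def obs_def case_prod_unfold
  by (simp add: sum_distrib_left mult.assoc)

lemma second_moment_criterion:
  "(4 * pi)\<^sup>2 / real n * (\<Sum>i<n. 1 / (real (r i) * (real (r i) - 1)) *
     (\<Sum>(j, k)\<in>{(j, k). j < r i \<and> k < r i \<and> j \<noteq> k}. (observation z i j * observation z i k - g (location z i j, location z i k))\<^sup>2))
     = (\<Sum>a\<in>I2. w2 a * (obs (fst z) (snd z) (pt1 a) * obs (fst z) (snd z) (pt2 a) - g (fst (snd z) (pt1 a), fst (snd z) (pt2 a)))\<^sup>2)"
  unfolding sum_I2 observation_def location_def obs_def case_prod_unfold index_pairs_def[symmetric] w2_def pt1_def pt2_def
  by (simp add: sum_distrib_left mult.assoc index_pairs_def case_prod_unfold)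

text \<open>The estimator is defined by a choice among minimisers, so its minimality has to be deduced from their existence.\<close>

lemma mean_estimator_minimises:
  assumes z: "z \<in> space (MX \<Otimes>\<^sub>M MY)"
  shows "mean_estimator p T \<eta> n r z \<in> k1.Hs"
    "h \<in> k1.Hs \<Longrightarrow> (\<Sum>a\<in>Ob. 4 * pi / (real n * real (r (fst a))) * (obs (fst z) (snd z) a - mean_estimator p T \<eta> n r z (fst (snd z) a))\<^sup>2) + \<eta> * k1.J (mean_estimator p T \<eta> n r z)
      \<le> (\<Sum>a\<in>Ob. 4 * pi / (real n * real (r (fst a))) * (obs (fst z) (snd z) a - h (fst (snd z) a))\<^sup>2) + \<eta> * k1.J h"
proof -
  let ?F = "\<lambda>g. 4 * pi / real n * (\<Sum>i<n. 1 / real (r i) * (\<Sum>j<r i. (observation z i j - g (location z i j))\<^sup>2)) + \<eta> * L2_normsq surface (T g)"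
  let ?G = "\<lambda>g. (\<Sum>a\<in>Ob. 4 * pi / (real n * real (r (fst a))) * (obs (fst z) (snd z) a - g (fst (snd z) a))\<^sup>2) + \<eta> * k1.J g"
  have FG: "?F g = ?G g" if "g \<in> k1.Hs" for g using penalty_J1[of g] that by (simp only: mean_criterion sobolev_Hs)
  have z2: "snd z \<in> space MY" using z by (auto simp: space_pair_measure)
  have "\<exists>g\<in>k1.Hs. \<forall>h\<in>k1.Hs. ?G g \<le> ?G h"
    by (rule k1.exists_minimiser) (rule MD.I MD.w \<eta> MD.x_S[OF _ z2] | assumption)+
  then obtain g where g: "g \<in> k1.Hs" and min: "\<forall>h\<in>k1.Hs. ?G g \<le> ?G h" by (rule bexE)
  have "?F g \<le> ?F h" if "h \<in> k1.Hs" for h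
    using min[rule_format, OF that] by (simp only: FG[OF g] FG[OF that])
  then have ex: "\<exists>g. g \<in> sobolev p \<and> (\<forall>h. h \<in> sobolev p \<longrightarrow> ?F g \<le> ?F h)"
    unfolding sobolev_Hs by (intro exI[of _ g] conjI g allI impI)
  note am = arg_min_attained[OF ex, folded mean_estimator_def]
  show h: "mean_estimator p T \<eta> n r z \<in> k1.Hs" using am(1) by (simp add: sobolev_Hs)
  show "?G (mean_estimator p T \<eta> n r z) \<le> ?G h" if "h \<in> k1.Hs"
    using am(2)[of h] that unfolding sobolev_Hs by (simp only: FG[OF h] FG[OF that] simp_thms)
qed

lemma second_moment_estimator_minimises:
  assumes z: "z \<in> space (MX \<Otimes>\<^sub>M MY)"
  shows "second_moment_estimator p T2 \<eta> n r z \<in> k2.Hs"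
    "h \<in> k2.Hs \<Longrightarrow> (\<Sum>a\<in>I2. w2 a * (obs (fst z) (snd z) (pt1 a) * obs (fst z) (snd z) (pt2 a) - second_moment_estimator p T2 \<eta> n r z (fst (snd z) (pt1 a), fst (snd z) (pt2 a)))\<^sup>2) + \<eta> * k2.J (second_moment_estimator p T2 \<eta> n r z)
      \<le> (\<Sum>a\<in>I2. w2 a * (obs (fst z) (snd z) (pt1 a) * obs (fst z) (snd z) (pt2 a) - h (fst (snd z) (pt1 a), fst (snd z) (pt2 a)))\<^sup>2) + \<eta> * k2.J h"
proof -
  let ?F = "\<lambda>g. (4 * pi)\<^sup>2 / real n * (\<Sum>i<n. 1 / (real (r i) * (real (r i) - 1)) *
     (\<Sum>(j, k)\<in>{(j, k). j < r i \<and> k < r i \<and> j \<noteq> k}. (observation z i j * observation z i k - g (location z i j, location z i k))\<^sup>2)) + \<eta> * L2_normsq surface2 (T2 g)"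
  let ?G = "\<lambda>g. (\<Sum>a\<in>I2. w2 a * (obs (fst z) (snd z) (pt1 a) * obs (fst z) (snd z) (pt2 a) - g (fst (snd z) (pt1 a), fst (snd z) (pt2 a)))\<^sup>2) + \<eta> * k2.J g"
  have FG: "?F g = ?G g" if "g \<in> k2.Hs" for g using penalty_J2[of g] that by (simp only: second_moment_criterion sobolev_Hs)
  have z2: "snd z \<in> space MY" using z by (auto simp: space_pair_measure)
  have "\<exists>g\<in>k2.Hs. \<forall>h\<in>k2.Hs. ?G g \<le> ?G h"
    by (rule k2.exists_minimiser) (rule SD.I SD.w \<eta> SD.x_S[OF _ z2] | assumption)+
  then obtain g where g: "g \<in> k2.Hs" and min: "\<forall>h\<in>k2.Hs. ?G g \<le> ?G h" by (rule bexE)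
  have "?F g \<le> ?F h" if "h \<in> k2.Hs" for h
    using min[rule_format, OF that] by (simp only: FG[OF g] FG[OF that])
  then have ex: "\<exists>g. g \<in> sobolev2 p \<and> (\<forall>h. h \<in> sobolev2 p \<longrightarrow> ?F g \<le> ?F h)"
    unfolding sobolev_Hs by (intro exI[of _ g] conjI g allI impI)
  note am = arg_min_attained[OF ex, folded second_moment_estimator_def]
  show h: "second_moment_estimator p T2 \<eta> n r z \<in> k2.Hs" using am(1) by (simp add: sobolev_Hs)
  show "?G (second_moment_estimator p T2 \<eta> n r z) \<le> ?G h" if "h \<in> k2.Hs"
    using am(2)[of h] that unfolding sobolev_Hs by (simp only: FG[OF h] FG[OF that] simp_thms)
qed

definition \<kappa>0 where "\<kappa>0 = 4 * ((4 * pi)\<^sup>2)\<^sup>2"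

text \<open>Off the union of the exceptional events of the two regressions, both errors are at most \<open>\<Delta>\<close>, and \<open>covariance_error\<close> applies.\<close>

lemma covariance_probability:
  assumes V: "0 < V" and G: "0 \<le> G" "eff_dim (((\<eta> * C1\<^sup>2) powr (- 1 / (2 * p)))\<^sup>2) \<le> G"
      "eff_dim (((\<eta> * (C1\<^sup>2)\<^sup>2) powr (- 1 / (2 * p)))\<^sup>2) \<le> G"
    and \<Delta>: "64 * V + 16 * \<eta> * (Cw * K2b + Cw\<^sup>2 * K1b) \<le> \<Delta>" "\<Delta> \<le> 1" and \<Delta>b: "(12 * K2b + 10) * \<Delta> \<le> b"
  shows "emeasure (sample_space n r P \<nu>) {z \<in> space (sample_space n r P \<nu>).
      L2_normsq surface2 (\<lambda>y. cov_estimator p T T2 \<eta> n r z y - cov_fun P y) > b}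
    \<le> ennreal (2 * ((\<kappa>0 * R1 * (G * Cy Rb) + (1 + L) / real n) / V + 16 * (\<kappa>0 * R1 * G\<^sup>2)))"
proof -
  have dim1: "(\<Sum>k. ennreal ((harmonic k u)\<^sup>2 / (1 + \<eta> * \<omega> (deg k)))) \<le> ennreal G" if "u \<in> S2" for u
    using effective_dimension[of p "C1\<^sup>2" \<omega>, OF _ _ \<omega>_lower \<eta> that] p C G(2) by (auto intro: order_trans ennreal_leI)
  have dim2: "(\<Sum>k. ennreal ((harmonic2 k u)\<^sup>2 / (1 + \<eta> * (\<omega> (deg (fst2 k)) * \<omega> (deg (snd2 k)))))) \<le> ennreal G" if "u \<in> S2 \<times> S2" for u
    using effective_dimension2[of p "C1\<^sup>2" \<omega>, OF _ _ \<omega>_lower \<eta> that] p C G(3) by (auto intro: order_trans ennreal_leI)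
  obtain E1 where E1: "E1 \<in> sets (MX \<Otimes>\<^sub>M MY)"
      "emeasure (MX \<Otimes>\<^sub>M MY) E1 \<le> ennreal (((4 * pi)\<^sup>2 * R1 * (G * Cy Rb) + (1 + L) / real n) / V + 16 * ((4 * pi)\<^sup>2 * R1 * G\<^sup>2))"
    and good1: "\<forall>z\<in>space (MX \<Otimes>\<^sub>M MY) - E1. \<forall>g\<in>k1.Hs. (\<Sum>a\<in>Ob. 4 * pi / (real n * real (r (fst a))) * (obs (fst z) (snd z) a - g (fst (snd z) a))\<^sup>2) + \<eta> * k1.J g \<le>
         (\<Sum>a\<in>Ob. 4 * pi / (real n * real (r (fst a))) * (obs (fst z) (snd z) a - mean_fun P (fst (snd z) a))\<^sup>2) + \<eta> * k1.J (mean_fun P) \<longrightarrow>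
      L2_normsq surface (\<lambda>u. g u - mean_fun P u) \<le> 64 * V + 16 * \<eta> * k1.J (mean_fun P)"
    by (rule MD.risk_bound[OF \<eta> G(1) dim1 V, THEN bexE], assumption, elim conjE, rule that)
  obtain E2 where E2: "E2 \<in> sets (MX \<Otimes>\<^sub>M MY)"
      "emeasure (MX \<Otimes>\<^sub>M MY) E2 \<le> ennreal ((4 * ((4 * pi)\<^sup>2)\<^sup>2 * R1 * (G * Cy Rb) + (1 + L) / real n) / V + 16 * (4 * ((4 * pi)\<^sup>2)\<^sup>2 * R1 * G\<^sup>2))"
    and good2: "\<forall>z\<in>space (MX \<Otimes>\<^sub>M MY) - E2. \<forall>g\<in>k2.Hs. (\<Sum>a\<in>I2. w2 a * (obs (fst z) (snd z) (pt1 a) * obs (fst z) (snd z) (pt2 a) - g (fst (snd z) (pt1 a), fst (snd z) (pt2 a)))\<^sup>2) + \<eta> * k2.J g \<le>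
         (\<Sum>a\<in>I2. w2 a * (obs (fst z) (snd z) (pt1 a) * obs (fst z) (snd z) (pt2 a) - second_moment_fun P (fst (snd z) (pt1 a), fst (snd z) (pt2 a)))\<^sup>2) + \<eta> * k2.J (second_moment_fun P) \<longrightarrow>
      L2_normsq surface2 (\<lambda>u. g u - second_moment_fun P u) \<le> 64 * V + 16 * \<eta> * k2.J (second_moment_fun P)"
    by (rule SD.risk_bound[OF \<eta> G(1) dim2 V, THEN bexE], assumption, elim conjE, rule that)
  have sub: "{z \<in> space (MX \<Otimes>\<^sub>M MY). L2_normsq surface2 (\<lambda>y. cov_estimator p T T2 \<eta> n r z y - cov_fun P y) > b} \<subseteq> E1 \<union> E2"
  proof (rule ccontr)
    assume "\<not> ?thesis"
    then obtain z where z: "z \<in> space (MX \<Otimes>\<^sub>M MY)" "z \<notin> E1" "z \<notin> E2"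
      and big: "b < L2_normsq surface2 (\<lambda>y. cov_estimator p T T2 \<eta> n r z y - cov_fun P y)" by auto
    let ?f = "mean_estimator p T \<eta> n r z" and ?s = "second_moment_estimator p T2 \<eta> n r z"
    have b1: "L2_normsq surface (\<lambda>u. ?f u - mean_fun P u) \<le> 64 * V + 16 * \<eta> * k1.J (mean_fun P)"
      by (rule good1[rule_format]) (use z MD.f0 mean_estimator_minimises[OF z(1)] in blast)+
    have b2: "L2_normsq surface2 (\<lambda>u. ?s u - second_moment_fun P u) \<le> 64 * V + 16 * \<eta> * k2.J (second_moment_fun P)"
      by (rule good2[rule_format]) (use z SD.f0 second_moment_estimator_minimises[OF z(1)] in blast)+
    have Kc: "0 \<le> Cw * K2b" "0 \<le> Cw\<^sup>2 * K1b" using Cw(1) K by auto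
    have "16 * \<eta> * k1.J (mean_fun P) \<le> 16 * \<eta> * (Cw * K2b + Cw\<^sup>2 * K1b)"
      "16 * \<eta> * k2.J (second_moment_fun P) \<le> 16 * \<eta> * (Cw * K2b + Cw\<^sup>2 * K1b)"
      using J1_bound(1)[OF mean K(2)] J2_bound[OF sm K(1)] Kc \<eta> by (auto intro!: mult_left_mono)
    then have d: "L2_normsq surface (\<lambda>u. ?f u - mean_fun P u) \<le> \<Delta>" "L2_normsq surface2 (\<lambda>u. ?s u - second_moment_fun P u) \<le> \<Delta>"
      using b1 b2 \<Delta>(1) by linarith+
    have "L2_normsq surface2 (\<lambda>y. cov_estimator p T T2 \<eta> n r z y - cov_fun P y) \<le> (12 * K2b + 10) * \<Delta>"
      unfolding cov_estimator_def cov_fun_def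
    proof (rule covariance_error[OF _ _ _ _ d(1) \<Delta>(2) d(2) J1_bound(2)[OF mean K(2)]])
      show "continuous_on S2 ?f" by (rule k1.HsD(1)[OF mean_estimator_minimises(1)[OF z(1)]])
      show "continuous_on (S2 \<times> S2) ?s" by (rule k2.HsD(1)[OF second_moment_estimator_minimises(1)[OF z(1)]])
      show "continuous_on S2 (mean_fun P)" by (rule k1.HsD(1)[OF MD.f0])
      show "continuous_on (S2 \<times> S2) (second_moment_fun P)" by (rule k2.HsD(1)[OF SD.f0])
    qed
    then show False using big \<Delta>b by linarith
  qed
  let ?x = "(\<kappa>0 * R1 * (G * Cy Rb) + (1 + L) / real n) / V + 16 * (\<kappa>0 * R1 * G\<^sup>2)"
  have x0: "0 \<le> ?x" using V G(1) R1 L(1) MD.Cy by (intro add_nonneg_nonneg divide_nonneg_nonneg mult_nonneg_nonneg) (auto simp: \<kappa>0_def)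
  have k: "(4 * pi)\<^sup>2 \<le> \<kappa>0"
  proof -
    have "1 \<le> 4 * pi" using pi_ge_two by linarith
    then have "1 \<le> (4 * pi)\<^sup>2" by (rule one_le_power)
    then have "(4 * pi)\<^sup>2 * 1 \<le> (4 * pi)\<^sup>2 * (4 * (4 * pi)\<^sup>2)" by (intro mult_left_mono) auto
    then show ?thesis by (simp add: \<kappa>0_def power2_eq_square)
  qed
  have "emeasure (MX \<Otimes>\<^sub>M MY) {z \<in> space (MX \<Otimes>\<^sub>M MY). L2_normsq surface2 (\<lambda>y. cov_estimator p T T2 \<eta> n r z y - cov_fun P y) > b}
      \<le> emeasure (MX \<Otimes>\<^sub>M MY) (E1 \<union> E2)" by (rule emeasure_mono[OF sub]) (use E1 E2 in auto)
  also have "\<dots> \<le> emeasure (MX \<Otimes>\<^sub>M MY) E1 + emeasure (MX \<Otimes>\<^sub>M MY) E2" by (rule emeasure_subadditive[OF E1(1) E2(1)])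
  also have "\<dots> \<le> ennreal ?x + ennreal ?x"
  proof (rule add_mono)
    show "emeasure (MX \<Otimes>\<^sub>M MY) E1 \<le> ennreal ?x"
      by (rule order_trans[OF E1(2)], intro ennreal_leI add_mono divide_right_mono mult_left_mono mult_right_mono k)
        (use R1 G(1) V MD.Cy in auto)
    show "emeasure (MX \<Otimes>\<^sub>M MY) E2 \<le> ennreal ?x" using E2(2) unfolding \<kappa>0_def .
  qed
  also have "\<dots> = ennreal (2 * ?x)" unfolding ennreal_plus[OF x0 x0, symmetric] by (simp only: mult_2)
  finally show ?thesis unfolding sample_space_eq .
qed

end

section \<open>Rates\<close>

lemma one_plus_ln_le_powr:
  fixes z c :: real
  assumes "1 \<le> z" "1 \<le> c" shows "1 + ln z \<le> c * z powr (1 / c)"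
proof -
  have "ln (z powr (1 / c)) \<le> z powr (1 / c) - 1" by (rule ln_le_minus_one) (use assms in simp)
  then have "c * (ln z / c) \<le> c * (z powr (1 / c) - 1)" using assms by (intro mult_left_mono) (auto simp: ln_powr)
  then show ?thesis using assms by (simp add: algebra_simps)
qed

text \<open>The factor lost when the effective dimension at scale \<open>x * z powr a\<close> is bounded by \<open>z powr a * (1 + ln z)\<close>.\<close>

definition dim_const :: "real \<Rightarrow> real" where "dim_const x = x * (1 + ln (1 + x))"

lemma dim_const_nonneg: "0 \<le> x \<Longrightarrow> 0 \<le> dim_const x" by (simp add: dim_const_def)

lemma eff_dim_powr:
  assumes z: "1 \<le> z" and a: "0 < a" "a \<le> 1" and x: "0 < x"
  shows "eff_dim (x * z powr a) \<le> dim_const x * (z powr a * (1 + ln z))"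
proof -
  have za: "1 \<le> z powr a" using z a by (intro ge_one_powr_ge_zero) auto
  have lz: "0 \<le> ln z" "0 \<le> ln (1 + x)" using z x by auto
  have "1 + x * z powr a \<le> (1 + x) * z powr a" using za by (simp add: algebra_simps)
  then have "ln (1 + x * z powr a) \<le> ln ((1 + x) * z powr a)" using x by (intro ln_mono) (auto simp: add_pos_nonneg)
  also have "\<dots> = ln (1 + x) + a * ln z" using x z by (subst ln_mult) (auto simp: ln_powr)
  also have "\<dots> \<le> ln (1 + x) + ln z" using mult_right_mono[OF a(2) lz(1)] by simp
  finally have "1 + ln (1 + x * z powr a) \<le> 1 + (ln (1 + x) + ln z)" by simp
  also have "\<dots> \<le> (1 + ln (1 + x)) * (1 + ln z)" using mult_nonneg_nonneg[OF lz] by (simp add: algebra_simps)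
  finally have "x * z powr a * (1 + ln (1 + x * z powr a)) \<le> x * z powr a * ((1 + ln (1 + x)) * (1 + ln z))"
    using x by (intro mult_left_mono) auto
  then show ?thesis by (simp add: eff_dim_def dim_const_def mult_ac)
qed

text \<open>The quantity \<open>z\<close> is \<open>n r / ln n\<close>. If \<open>z\<close> is polynomial in \<open>n\<close>, then \<open>ln z\<close> is of the order \<open>ln n\<close> and is cancelled by it. If
\<open>z\<close> is larger, the power of \<open>z\<close> is so small that the whole term is below \<open>1 / n\<close>. The two cases make the bound
uniform in the numbers of observations per curve.\<close>

lemma variance_rate:
  fixes z N b :: real
  assumes z: "1 \<le> z" and N: "0 < N" "1 \<le> ln N" and b: "2 / 3 \<le> b"
  shows "z powr (- b) * (1 + ln z) / ln N \<le> 4 * (z powr (- b) + 1 / N)"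
proof (cases "z \<le> N ^ 3")
  case True
  have "ln z \<le> ln (N ^ 3)" using True z N(1) by (intro ln_mono) auto
  then have "ln z \<le> 3 * ln N" using N(1) by (simp add: ln_realpow)
  then have "(1 + ln z) / ln N \<le> 4" using N(2) by (simp add: field_simps)
  then have "z powr (- b) * ((1 + ln z) / ln N) \<le> z powr (- b) * 4" by (intro mult_left_mono) auto
  also have "\<dots> \<le> 4 * (z powr (- b) + 1 / N)" using N(1) by (simp add: field_simps)
  finally show ?thesis by simp
next
  case False
  have l: "1 + ln z \<le> 3 * z powr (1 / 3)" using one_plus_ln_le_powr[OF z, of 3] by simp
  have l0: "0 \<le> 1 + ln z" using z by simp
  have "z powr (- b) * (1 + ln z) / ln N \<le> z powr (- b) * (1 + ln z) / 1"
    using N(2) l0 by (intro divide_left_mono mult_nonneg_nonneg) auto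
  also have "\<dots> \<le> z powr (- (2/3)) * (3 * z powr (1 / 3))"
    using z b l l0 by (simp only: div_by_1, intro mult_mono powr_mono) auto
  also have "\<dots> = 3 * (z powr (- (2/3)) * z powr (1/3))" by simp
  also have "z powr (- (2/3)) * z powr (1/3) = z powr (- (1/3))" by (simp add: powr_add[symmetric])
  also have "z powr (- (1/3)) \<le> (N ^ 3) powr (- (1/3))" using False N(1) by (intro powr_mono2') auto
  also have "(N ^ 3) powr (- (1/3)) = 1 / N"
    using N(1) powr_realpow[of N 3] by (simp add: powr_powr powr_minus_divide flip: powr_numeral)
  finally have "z powr (- b) * (1 + ln z) / ln N \<le> 3 * (1 / N)" by simp
  moreover have "0 \<le> 1 / N" "0 \<le> z powr (- b)" using N(1) by auto
  ultimately show ?thesis unfolding distrib_left by linarith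
qed

text \<open>As \<open>p > 2\<close>, the exponent \<open>a = 1 / (p + 1)\<close> is below \<open>1 / 3\<close>, so the Gram error vanishes polynomially in \<open>z\<close> and the squared
logarithm is absorbed.\<close>

lemma gram_rate:
  fixes z a :: real
  assumes z: "1 \<le> z" and a: "a \<le> 1 / 3"
  shows "z powr (2 * a - 1) * (1 + ln z)\<^sup>2 \<le> 144 * z powr (- (1 / 6))"
proof -
  have l: "1 + ln z \<le> 12 * z powr (1 / 12)" using one_plus_ln_le_powr[OF z, of 12] by simp
  have "(1 + ln z)\<^sup>2 \<le> (12 * z powr (1 / 12))\<^sup>2" using z by (intro power_mono[OF l]) simp
  also have "\<dots> = 144 * z powr (1 / 6)" by (simp add: power_mult_distrib power2_eq_square powr_add[symmetric])
  finally have "z powr (2 * a - 1) * (1 + ln z)\<^sup>2 \<le> z powr (- (1/3)) * (144 * z powr (1 / 6))"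
    using z a by (intro mult_mono powr_mono) auto
  also have "\<dots> = 144 * (z powr (- (1/3)) * z powr (1 / 6))" by simp
  also have "z powr (- (1/3)) * z powr (1 / 6) = z powr (- (1 / 6))" by (simp add: powr_add[symmetric])
  finally show ?thesis .
qed

lemma harmonic_mean_ge_2:
  assumes n: "0 < n" and r: "\<And>i. i < n \<Longrightarrow> 2 \<le> r i"
  shows "2 \<le> harmonic_mean n r" "(\<Sum>i<n. 1 / real (r i)) / (real n)\<^sup>2 = 1 / (real n * harmonic_mean n r)"
proof -
  let ?s = "\<Sum>i<n. 1 / real (r i)"
  have "?s \<le> (\<Sum>i<n. 1 / 2)" by (rule sum_mono) (use r in \<open>force simp: field_simps\<close>)
  then have s: "?s \<le> real n / 2" by simp
  have s0: "0 < ?s" using n r by (intro sum_pos) (force simp: lessThan_empty_iff)+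
  show "2 \<le> harmonic_mean n r" unfolding harmonic_mean_def using s s0 n by (simp add: field_simps)
  show "?s / (real n)\<^sup>2 = 1 / (real n * harmonic_mean n r)" unfolding harmonic_mean_def
    using s0 n by (simp add: field_simps power2_eq_square)
qed

definition dim_scale :: "real \<Rightarrow> real \<Rightarrow> real \<Rightarrow> real" where
  "dim_scale p c0 C1 = (c0 * C1\<^sup>2) powr (- 1 / p) + (c0 * (C1\<^sup>2)\<^sup>2) powr (- 1 / p)"

text \<open>The lower bound on \<open>\<eta>\<close> limits the effective dimension to a multiple of \<open>z powr (1 / (p + 1))\<close>.\<close>

lemma smoothing_scale:
  fixes p c0 c z \<eta> :: real
  assumes p: "0 < p" and c: "0 < c0" "0 < c" and z: "0 < z" and \<eta>: "c0 * z powr (- p / (p + 1)) \<le> \<eta>"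
  shows "((\<eta> * c) powr (- 1 / (2 * p)))\<^sup>2 \<le> (c0 * c) powr (- 1 / p) * z powr (1 / (p + 1))"
proof -
  have m: "0 < c0 * c * z powr (- p / (p + 1))" using c z by (intro mult_pos_pos) simp_all
  have le: "c0 * c * z powr (- p / (p + 1)) \<le> \<eta> * c" using mult_right_mono[OF \<eta>, of c] c by (simp add: mult_ac)
  have "((\<eta> * c) powr (- 1 / (2 * p)))\<^sup>2 = (\<eta> * c) powr (- 1 / p)"
    by (simp add: power2_eq_square powr_add[symmetric])
  also have "\<dots> \<le> (c0 * c * z powr (- p / (p + 1))) powr (- 1 / p)"
    using p m le by (intro powr_mono2') auto
  also have "\<dots> = (c0 * c) powr (- 1 / p) * z powr (1 / (p + 1))"
    using c p by (simp add: powr_mult powr_powr)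
  finally show ?thesis .
qed

context penalised_sampling
begin

definition noise_const where
  "noise_const c0 = 2 * (4 * \<kappa>0 * dim_const (dim_scale p c0 C1) * Cy Rb + 1 + L)"
definition gram_const where
  "gram_const c0 = 32 * \<kappa>0 * 144 * (dim_const (dim_scale p c0 C1))\<^sup>2"

text \<open>The noise level is \<open>V = \<tau> * rate\<close>: then the bias \<open>\<eta>\<close> and the noise are multiples of the rate, the probability of
large noise is at most a constant over \<open>\<tau>\<close>, and the Gram event adds a term that vanishes with \<open>n\<close>. The constants do not
involve the law of the process.\<close>

lemma covariance_rate:
  assumes ln_n: "1 \<le> ln (real n)" and c0: "0 < c0" and \<tau>: "0 < \<tau>"
    and \<eta>0: "c0 * (real n * harmonic_mean n r / ln (real n)) powr (- p / (p + 1)) \<le> \<eta>"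
    and \<eta>1: "\<eta> \<le> c1 * (real n * harmonic_mean n r / ln (real n)) powr (- p / (p + 1))"
    and \<Delta>: "(64 * \<tau> + 16 * c1 * (Cw * K2b + Cw\<^sup>2 * K1b)) * ((ln (real n) / real n) powr (2 / 3) + 1 / real n) \<le> 1"
    and D: "(12 * K2b + 10) * (64 * \<tau> + 16 * c1 * (Cw * K2b + Cw\<^sup>2 * K1b)) \<le> D"
  shows "emeasure (sample_space n r P \<nu>) {z \<in> space (sample_space n r P \<nu>).
      L2_normsq surface2 (\<lambda>y. cov_estimator p T T2 \<eta> n r z y - cov_fun P y)
        > D * ((ln (real n) / (real n * harmonic_mean n r)) powr (p / (p + 1)) + 1 / real n)}
    \<le> ennreal (noise_const c0 / \<tau> + gram_const c0 * (ln (real n) / real n) powr (1 / 6))"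
proof -
  define N where "N = real n"
  define z where "z = N * harmonic_mean n r / ln N"
  define b where "b = p / (p + 1)"
  define a where "a = 1 / (p + 1)"
  define x where "x = dim_scale p c0 C1"
  define c3 where "c3 = dim_const x"
  define rate where "rate = z powr (- b) + 1 / N"
  define M where "M = Cw * K2b + Cw\<^sup>2 * K1b"
  have "0 < real n" "0 < ln (real n)" using n ln_n by linarith+
  then have N0: "0 < N" "1 \<le> ln N" "0 < ln N" using ln_n unfolding N_def by blast+
  have hm: "2 \<le> harmonic_mean n r" "R1 = 1 / (real n * harmonic_mean n r)"
    using harmonic_mean_ge_2[of n r, OF n] r unfolding R1_def by blast+
  have R1': "R1 = 1 / (z * ln N)" unfolding hm(2) z_def N_def[symmetric] using N0 by auto
  have a: "0 < a" "a \<le> 1 / 3" "a \<le> 1" "2 / 3 \<le> b" and ab: "b = 1 - a"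
    using p by (auto simp: a_def b_def field_simps)
  have lN: "ln N < N" using N0 by (intro ln_less_self) auto
  have "N * 1 \<le> N * harmonic_mean n r" by (rule mult_left_mono) (use N0 hm(1) in linarith)+
  then have "N \<le> N * harmonic_mean n r" unfolding mult_1_right .
  then have zN: "N / ln N \<le> z" unfolding z_def by (rule divide_right_mono) (use N0 in linarith)
  have "1 \<le> N / ln N" using N0 lN by simp
  then have z: "1 \<le> z" using zN by linarith
  have z_inv: "z powr (- s) \<le> (ln N / N) powr s" if "0 \<le> s" for s
  proof -
    have "0 < N / ln N" using N0 by (intro divide_pos_pos)
    then have "z powr (- s) \<le> (N / ln N) powr (- s)" using zN that by (intro powr_mono2') linarith+
    also have "\<dots> = (ln N / N) powr s" using N0 by (simp add: powr_minus powr_divide)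
    finally show ?thesis .
  qed
  have rate_eq: "(ln (real n) / (real n * harmonic_mean n r)) powr (p / (p + 1)) + 1 / real n = rate"
    unfolding rate_def z_def b_def N_def using n hm(1) ln_n by (simp add: powr_minus powr_divide)
  have eb: "- p / (p + 1) = - b" by (simp add: b_def)
  have \<eta>0': "c0 * z powr (- b) \<le> \<eta>" and \<eta>1': "\<eta> \<le> c1 * z powr (- b)"
    using \<eta>0 \<eta>1 unfolding eb z_def N_def by auto
  have zb: "0 < z powr (- b)" using z by simp
  have rate0: "0 < rate" unfolding rate_def using zb N0 by (intro add_pos_pos) auto
  have c1: "0 < c1" using \<eta> \<eta>1' zb by (metis less_le_trans zero_less_mult_pos2)
  have M0: "0 \<le> M" unfolding M_def using Cw(1) K by auto
  have K2': "0 < 12 * K2b + 10" using K by linarith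
  have cc: "0 < C1\<^sup>2" "0 < (C1\<^sup>2)\<^sup>2" using C by auto
  have x0: "0 < x" unfolding x_def dim_scale_def using c0 cc by (intro add_pos_pos) (simp_all add: less_le)
  define G where "G = c3 * (z powr a * (1 + ln z))"
  have lz: "0 \<le> ln z" using z by simp
  have c30: "0 \<le> c3" unfolding c3_def using x0 by (intro dim_const_nonneg) simp
  have G0: "0 \<le> G" unfolding G_def using c30 lz by (intro mult_nonneg_nonneg) auto
  have dim: "eff_dim (((\<eta> * c) powr (- 1 / (2 * p)))\<^sup>2) \<le> G" if "0 < c" "(c0 * c) powr (- 1 / p) \<le> x" for c
  proof -
    have "((\<eta> * c) powr (- 1 / (2 * p)))\<^sup>2 \<le> (c0 * c) powr (- 1 / p) * z powr a" unfolding a_def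
      by (rule smoothing_scale[OF _ c0 that(1) _ \<eta>0'[folded eb]]) (use p z in linarith)+
    also have "\<dots> \<le> x * z powr a" using that by (intro mult_right_mono) auto
    finally have "eff_dim (((\<eta> * c) powr (- 1 / (2 * p)))\<^sup>2) \<le> eff_dim (x * z powr a)"
      by (intro eff_dim_mono) auto
    also have "\<dots> \<le> G" unfolding G_def c3_def by (rule eff_dim_powr[OF z a(1) a(3) x0])
    finally show ?thesis .
  qed
  have xge: "(c0 * C1\<^sup>2) powr (- 1 / p) \<le> x" "(c0 * (C1\<^sup>2)\<^sup>2) powr (- 1 / p) \<le> x" by (auto simp: x_def dim_scale_def)
  have RG: "R1 * G \<le> c3 * (4 * rate)"
  proof -
    have e: "z powr (- b) = z powr a / z" using z by (simp add: ab powr_diff)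
    have "R1 * G = c3 * (z powr (- b) * (1 + ln z) / ln N)" unfolding R1' G_def e by simp
    also have "\<dots> \<le> c3 * (4 * (z powr (- b) + 1 / N))" by (intro mult_left_mono variance_rate z N0 a(4) c30)
    finally show ?thesis by (simp add: rate_def)
  qed
  have RG2: "R1 * G\<^sup>2 \<le> c3\<^sup>2 * (144 * (ln N / N) powr (1 / 6))"
  proof -
    have e: "z powr (2 * a - 1) = z powr a * z powr a / z" using z by (simp add: powr_diff powr_add[symmetric])
    have "R1 * G\<^sup>2 = c3\<^sup>2 * (z powr (2 * a - 1) * (1 + ln z)\<^sup>2) / ln N"
      unfolding R1' G_def e by (simp add: power2_eq_square)
    also have "\<dots> \<le> c3\<^sup>2 * (z powr (2 * a - 1) * (1 + ln z)\<^sup>2) / 1" using N0 by (intro divide_left_mono) auto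
    also have "\<dots> \<le> c3\<^sup>2 * (144 * z powr (- (1 / 6)))"
      unfolding div_by_1 by (intro mult_left_mono gram_rate z a(2)) auto
    also have "\<dots> \<le> c3\<^sup>2 * (144 * (ln N / N) powr (1 / 6))" by (intro mult_left_mono z_inv) auto
    finally show ?thesis .
  qed
  have rate_le: "rate \<le> (ln N / N) powr (2 / 3) + 1 / N"
  proof -
    have "z powr (- b) \<le> z powr (- (2 / 3))" using z a(4) by (intro powr_mono) auto
    also have "\<dots> \<le> (ln N / N) powr (2 / 3)" by (rule z_inv) simp
    finally show ?thesis by (simp add: rate_def)
  qed
  have \<kappa>00: "0 \<le> \<kappa>0" by (simp add: \<kappa>0_def)
  have Q: "0 \<le> 64 * \<tau> + 16 * c1 * M" using \<tau> c1 M0 by (intro add_nonneg_nonneg mult_nonneg_nonneg) auto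
  have "emeasure (sample_space n r P \<nu>) {y \<in> space (sample_space n r P \<nu>).
      L2_normsq surface2 (\<lambda>u. cov_estimator p T T2 \<eta> n r y u - cov_fun P u) > D * rate}
    \<le> ennreal (2 * ((\<kappa>0 * R1 * (G * Cy Rb) + (1 + L) / real n) / (\<tau> * rate) + 16 * (\<kappa>0 * R1 * G\<^sup>2)))"
  proof (rule covariance_probability[where \<Delta> = "(64 * \<tau> + 16 * c1 * M) * rate"])
    show "0 < \<tau> * rate" using \<tau> rate0 by simp
    show "0 \<le> G" by (rule G0)
    show "eff_dim (((\<eta> * C1\<^sup>2) powr (- 1 / (2 * p)))\<^sup>2) \<le> G" by (rule dim[OF cc(1) xge(1)])
    show "eff_dim (((\<eta> * (C1\<^sup>2)\<^sup>2) powr (- 1 / (2 * p)))\<^sup>2) \<le> G" by (rule dim[OF cc(2) xge(2)])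
    have "c1 * z powr (- b) \<le> c1 * rate" using c1 N0 unfolding rate_def by (intro mult_left_mono) auto
    then have "\<eta> \<le> c1 * rate" using \<eta>1' by (rule order_trans[rotated])
    then have "16 * \<eta> * M \<le> 16 * (c1 * rate) * M" using M0 by (intro mult_right_mono) auto
    then show "64 * (\<tau> * rate) + 16 * \<eta> * (Cw * K2b + Cw\<^sup>2 * K1b) \<le> (64 * \<tau> + 16 * c1 * M) * rate"
      unfolding M_def[symmetric] by (simp add: algebra_simps)
    have "(64 * \<tau> + 16 * c1 * M) * rate \<le> (64 * \<tau> + 16 * c1 * M) * ((ln N / N) powr (2 / 3) + 1 / N)"
      by (intro mult_left_mono rate_le Q)
    also have "\<dots> \<le> 1" using \<Delta> unfolding M_def N_def .
    finally show "(64 * \<tau> + 16 * c1 * M) * rate \<le> 1" .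
    show "(12 * K2b + 10) * ((64 * \<tau> + 16 * c1 * M) * rate) \<le> D * rate"
      using mult_right_mono[OF D, of rate] rate0 unfolding M_def by (simp add: mult.assoc)
  qed
  also have "\<dots> \<le> ennreal (noise_const c0 / \<tau> + gram_const c0 * (ln N / N) powr (1 / 6))"
  proof (rule ennreal_leI)
    have nc: "noise_const c0 / 2 = 4 * \<kappa>0 * c3 * Cy Rb + 1 + L" by (simp add: noise_const_def c3_def x_def)
    have "\<kappa>0 * R1 * (G * Cy Rb) = \<kappa>0 * Cy Rb * (R1 * G)" by simp
    also have "\<dots> \<le> \<kappa>0 * Cy Rb * (c3 * (4 * rate))" using RG \<kappa>00 MD.Cy by (intro mult_left_mono) auto
    finally have 1: "\<kappa>0 * R1 * (G * Cy Rb) \<le> (4 * \<kappa>0 * c3 * Cy Rb) * rate" by (simp add: mult_ac)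
    have "1 / real n \<le> rate" unfolding rate_def N_def using zb by simp
    then have 2: "(1 + L) / real n \<le> (1 + L) * rate" using mult_left_mono[of "1 / real n" rate "1 + L"] L(1) by simp
    have "(\<kappa>0 * R1 * (G * Cy Rb) + (1 + L) / real n) / (\<tau> * rate) \<le> ((4 * \<kappa>0 * c3 * Cy Rb + 1 + L) * rate) / (\<tau> * rate)"
      using 1 2 \<tau> rate0 by (intro divide_right_mono) (auto simp: algebra_simps)
    also have "\<dots> = (noise_const c0 / 2) / \<tau>" unfolding nc using rate0 by simp
    finally have A: "(\<kappa>0 * R1 * (G * Cy Rb) + (1 + L) / real n) / (\<tau> * rate) \<le> (noise_const c0 / 2) / \<tau>" .
    have "\<kappa>0 * (R1 * G\<^sup>2) \<le> \<kappa>0 * (c3\<^sup>2 * (144 * (ln N / N) powr (1 / 6)))" by (rule mult_left_mono[OF RG2 \<kappa>00])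
    then have B: "32 * (\<kappa>0 * R1 * G\<^sup>2) \<le> gram_const c0 * (ln N / N) powr (1 / 6)"
      by (simp add: gram_const_def c3_def x_def mult_ac)
    show "2 * ((\<kappa>0 * R1 * (G * Cy Rb) + (1 + L) / real n) / (\<tau> * rate) + 16 * (\<kappa>0 * R1 * G\<^sup>2))
      \<le> noise_const c0 / \<tau> + gram_const c0 * (ln N / N) powr (1 / 6)"
      unfolding distrib_left using A B by linarith
  qed
  finally show ?thesis unfolding rate_eq N_def .
qed

end

section \<open>The convergence rate of the covariance estimator\<close>

lemma ln_ratio_tendsto_0:
  "(\<lambda>n. (ln (real n) / real n) powr (1 / 6)) \<longlonglongrightarrow> 0"
  "(\<lambda>n. (ln (real n) / real n) powr (2 / 3) + 1 / real n) \<longlonglongrightarrow> 0"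
  by real_asymp+

lemma limsup_SUP_le:
  fixes F :: "nat \<Rightarrow> 'a \<Rightarrow> ennreal" and f :: "nat \<Rightarrow> real"
  assumes "\<forall>\<^sub>F n in sequentially. \<forall>x\<in>A. F n x \<le> ennreal (f n)" "f \<longlonglongrightarrow> l"
  shows "limsup (\<lambda>n. SUP x\<in>A. F n x) \<le> ennreal l"
proof -
  have "limsup (\<lambda>n. SUP x\<in>A. F n x) \<le> limsup (\<lambda>n. ennreal (f n))"
    by (rule Limsup_mono, rule eventually_mono[OF assms(1)]) (auto intro: SUP_least)
  also have "\<dots> = ennreal l" by (rule lim_imp_Limsup[OF _ tendsto_ennrealI[OF assms(2)]]) simp
  finally show ?thesis .
qed

text \<open>For a given \<open>D\<close> the level \<open>\<tau>\<close> is chosen as large as \<open>covariance_rate\<close> permits. It grows linearly in \<open>D\<close>, while the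
limit superior is at most a constant over \<open>\<tau>\<close>.\<close>

theorem theorem19:
  fixes p q L K1 K2 \<sigma> :: real
    and T :: "(real^3 \<Rightarrow> real) \<Rightarrow> (real^3 \<Rightarrow> real)"
    and T2 :: "((real^3) \<times> (real^3) \<Rightarrow> real) \<Rightarrow> ((real^3) \<times> (real^3) \<Rightarrow> real)"
    and \<nu> :: "real measure"
    and r :: "nat \<Rightarrow> nat \<Rightarrow> nat"
    and \<eta> :: "nat \<Rightarrow> real"
  assumes "p > 2" and "1 < q" and "q \<le> p"
    and "L > 0" and "K1 > 0" and "K2 > 0"
    and "admissible_operator p T"
    and "tensor_square_operator p T T2"
    and "prob_space \<nu>" and "sets \<nu> = sets borel"
    and "integrable \<nu> (\<lambda>x. x ^ 4)"
    and "(LINT x|\<nu>. x) = 0"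
    and "\<sigma> > 0" and "(LINT x|\<nu>. x\<^sup>2) = \<sigma>\<^sup>2"
    and "\<And>n i. i < n \<Longrightarrow> r n i \<ge> 2"
    and "\<exists>c c'. 0 < c \<and> c \<le> c' \<and>
           (\<forall>\<^sub>F n in sequentially.
              c * (real n * harmonic_mean n (r n) / ln (real n)) powr (- p / (p + 1)) \<le> \<eta> n \<and>
              \<eta> n \<le> c' * (real n * harmonic_mean n (r n) / ln (real n)) powr (- p / (p + 1)))"
  shows "((\<lambda>D::real. limsup (\<lambda>n. SUP P\<in>Pi2 L K1 K2 p q.
            emeasure (sample_space n (r n) P \<nu>)
              {\<omega> \<in> space (sample_space n (r n) P \<nu>).
                 L2_normsq surface2 (\<lambda>y. cov_estimator p T T2 (\<eta> n) n (r n) \<omega> y - cov_fun P y)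
                 > D * ((ln (real n) / (real n * harmonic_mean n (r n))) powr (p / (p + 1))
                        + 1 / real n)}))
          \<longlongrightarrow> 0) at_top"
proof -
  obtain c c' where c: "0 < c" and ev: "\<forall>\<^sub>F n in sequentially.
      c * (real n * harmonic_mean n (r n) / ln (real n)) powr (- p / (p + 1)) \<le> \<eta> n \<and>
      \<eta> n \<le> c' * (real n * harmonic_mean n (r n) / ln (real n)) powr (- p / (p + 1))"
    using assms(16) by blast
  obtain d C1 C2 where C: "0 < C1" "0 < C2"
    and d: "\<And>l. C1 * (1 + real l) powr p \<le> \<bar>d l\<bar>" "\<And>l. \<bar>d l\<bar> \<le> C2 * (1 + real l) powr p"
    and T: "multiplier_operator p d T" by (rule admissible_multiplier[OF assms(7)]) (blast intro: that)
  interpret pen: penalty p C1 C2 d T T2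
    by unfold_locales (rule assms C d T)+
  define NC where "NC = penalised_sampling.noise_const q \<nu> L p C1 C2 d K1 K2 c"
  define GC where "GC = penalised_sampling.gram_const p C1 c"
  define M where "M = 16 * c' * (pen.Cw * K2 + pen.Cw\<^sup>2 * K1)"
  define A where "A = 12 * K2 + 10"
  define \<tau> where "\<tau> D = (D / A - M) / 64" for D
  have c_powr: "0 < c * x powr s" if "0 < x" for x s :: real using that c by simp
  have A: "0 < A" using assms(6) by (simp add: A_def)
  have \<tau>_eq: "64 * \<tau> D + M = D / A" for D
  proof -
    have "64 * ((x - M) / 64) + M = x" for x by (simp add: field_simps)
    then show ?thesis unfolding \<tau>_def .
  qed
  have \<tau>_pos: "0 < \<tau> D" if "A * M < D" for D
    using that A by (simp add: \<tau>_def field_simps)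
  define F where "F D n P = emeasure (sample_space n (r n) P \<nu>)
      {\<omega> \<in> space (sample_space n (r n) P \<nu>).
         L2_normsq surface2 (\<lambda>y. cov_estimator p T T2 (\<eta> n) n (r n) \<omega> y - cov_fun P y)
         > D * ((ln (real n) / (real n * harmonic_mean n (r n))) powr (p / (p + 1)) + 1 / real n)}" for D n P
  have upper: "limsup (\<lambda>n. SUP P\<in>Pi2 L K1 K2 p q. F D n P) \<le> ennreal (NC / \<tau> D)" if D: "A * M < D" for D
  proof (rule limsup_SUP_le)
    have "(\<lambda>n. NC / \<tau> D + GC * (ln (real n) / real n) powr (1 / 6)) \<longlonglongrightarrow> NC / \<tau> D + GC * 0"
      by (intro tendsto_intros ln_ratio_tendsto_0)
    then show "(\<lambda>n. NC / \<tau> D + GC * (ln (real n) / real n) powr (1 / 6)) \<longlonglongrightarrow> NC / \<tau> D" by simp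
    have "(\<lambda>n. (64 * \<tau> D + M) * ((ln (real n) / real n) powr (2 / 3) + 1 / real n)) \<longlonglongrightarrow> (64 * \<tau> D + M) * 0"
      by (intro tendsto_mult tendsto_const ln_ratio_tendsto_0)
    then have small: "\<forall>\<^sub>F n in sequentially. (64 * \<tau> D + M) * ((ln (real n) / real n) powr (2 / 3) + 1 / real n) < 1"
      by (rule order_tendstoD) simp
    have large: "\<forall>\<^sub>F n in sequentially. 1 \<le> ln (real n)" by real_asymp
    show "\<forall>\<^sub>F n in sequentially. \<forall>P\<in>Pi2 L K1 K2 p q. F D n P \<le> ennreal (NC / \<tau> D + GC * (ln (real n) / real n) powr (1 / 6))"
      using ev small large
    proof eventually_elim
      case (elim n)
      show ?case
      proof
        fix P assume P: "P \<in> Pi2 L K1 K2 p q"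
        have n: "0 < n" using elim(3) by (intro gr0I) simp
        have hm: "2 \<le> harmonic_mean n (r n)" by (rule harmonic_mean_ge_2(1)[OF n assms(15)])
        have "0 < real n * harmonic_mean n (r n) / ln (real n)"
          using n hm elim(3) by (intro divide_pos_pos mult_pos_pos) linarith+
        then have "0 < c * (real n * harmonic_mean n (r n) / ln (real n)) powr (- p / (p + 1))" by (rule c_powr)
        then have \<eta>: "0 < \<eta> n" using elim(1) by linarith
        have P': "prob_space P" "sets P = sets (sobolev_borel q)" "(\<integral>\<^sup>+x. (sobolev_normsq q x)\<^sup>2 \<partial>P) \<le> ennreal L"
          "second_moment_fun P \<in> sobolev2 p" "sobolev2_normsq p (second_moment_fun P) \<le> ennreal K1"
          "mean_fun P \<in> sobolev p" "sobolev_normsq p (mean_fun P) \<le> ennreal K2"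
          using P unfolding Pi2_def by blast+
        interpret penalised_sampling q P \<nu> n "r n" L p C1 C2 d T T2 K1 K2 "\<eta> n"
          by (rule penalised_sampling.intro sampling.intro sobolev_space.intro sampling_axioms.intro
              penalised_sampling_axioms.intro pen.penalty_axioms P' assms n \<eta> assms(4-6)[THEN less_imp_le] | assumption)+
        show "F D n P \<le> ennreal (NC / \<tau> D + GC * (ln (real n) / real n) powr (1 / 6))"
          unfolding F_def NC_def GC_def
        proof (rule covariance_rate[where ?c1.0 = c'])
          show "1 \<le> ln (real n)" by (rule elim(3))
          show "0 < c" by (rule c)
          show "0 < \<tau> D" by (rule \<tau>_pos[OF D])
          show "(64 * \<tau> D + 16 * c' * (pen.Cw * K2 + pen.Cw\<^sup>2 * K1)) * ((ln (real n) / real n) powr (2 / 3) + 1 / real n) \<le> 1"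
            using elim(2) unfolding M_def by (rule less_imp_le)
          show "(12 * K2 + 10) * (64 * \<tau> D + 16 * c' * (pen.Cw * K2 + pen.Cw\<^sup>2 * K1)) \<le> D"
            unfolding M_def[symmetric] A_def[symmetric] \<tau>_eq using A by simp
        qed (use elim(1) in auto)
      qed
    qed
  qed
  have "((\<lambda>D. NC / \<tau> D) \<longlongrightarrow> 0) at_top" unfolding \<tau>_def using A by real_asymp
  then have lim: "((\<lambda>D. ennreal (NC / \<tau> D)) \<longlongrightarrow> 0) at_top" using tendsto_ennrealI by fastforce
  have "((\<lambda>D. limsup (\<lambda>n. SUP P\<in>Pi2 L K1 K2 p q. F D n P)) \<longlongrightarrow> 0) at_top"
    by (rule tendsto_sandwich[OF _ _ tendsto_const lim])
      (auto intro: eventually_mono[OF eventually_gt_at_top[of "A * M"]] upper)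
  then show ?thesis unfolding F_def .
qed

end
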